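(* Let $\Bbbk$ be a perfect field, let $K$ be an $n$-dimensional topological local field over $\Bbbk$, and let $\boldsymbol{\sigma}$ and $\boldsymbol{\sigma}'$ be two systems of liftings for $K$. (1) There is equality $\mathrm{E}_{\boldsymbol{\sigma}}(K) = \mathrm{E}_{\boldsymbol{\sigma}'}(K)$ of these subrings of $\operatorname{End}_{\Bbbk}(K)$. (2) For any $i = 1, \ldots, n$ and $j = 1, 2$ there is equality $\mathrm{E}_{\boldsymbol{\sigma}}(K)_{i,j} = \mathrm{E}_{\boldsymbol{\sigma}'}(K)_{i,j}$ of these ideals of $\mathrm{E}_{\boldsymbol{\sigma}}(K)$.
   Context: **Semi-topological (ST) rings and modules.** $\Bbbk$ is a perfect field with the discrete topology. A $\Bbbk$-linear topology on a $\Bbbk$-module is a module topology in which $0$ has a basis of open neighborhoods consisting of $\Bbbk$-submodules. A commutative ST $\Bbbk$-ring is a commutative $\Bbbk$-ring $A$ with a $\Bbbk$-linear topology such that for every $a \in A$ the map $A \to A$, $b \mapsto ab$, is continuous; homomorphisms of ST $\Bbbk$-rings are the continuous $\Bbbk$-ring homomorphisms. A ST $A$-module is an $A$-module $M$ with a $\Bbbk$-linear topology such that for every $a \in A$ and $m \in M$ the maps $M \to M$, $m' \mapsto a m'$, and $A \to M$, $a' \mapsto a' m$, are continuous. The fine $A$-module topology on an $A$-module is the finest $\Bbbk$-linear topology making it a ST $A$-module (it exists). **Laurent series.** For a commutative ST $\Bbbk$-ring $A$: give $A[t]/(t^{i+1})$ the fine $A$-module topology, $A[[t]] = \lim_{\leftarrow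 i} A[t]/(t^{i+1})$ the inverse limit topology, and $A((t)) = A[[t]][t^{-1}]$ the fine $A[[t]]$-module topology. Recursively $A((t_1,\ldots,t_n)) := A((t_2,\ldots,t_n))((t_1))$. **Local fields.** An $n$-dimensional local field is a field $K$ with complete discrete valuation rings $\mathcal{O}_1(K),\ldots,\mathcal{O}_n(K)$ such that $K$ is the fraction field of $\mathcal{O}_1(K)$ and for $1\le i\le n-1$ the residue field of $\mathcal{O}_i(K)$ is the fraction field of $\mathcal{O}_{i+1}(K)$. Let $\boldsymbol{k}_i(K)$ be the residue field of $\mathcal{O}_i(K)$, and $\boldsymbol{k}_0(K):=K$. The ring of integers $\mathcal{O}(K) := \mathcal{O}_1(K)\times_{\boldsymbol{k}_1(K)}\mathcal{O}_2(K)\cdots\times_{\boldsymbol{k}_{n-1}(K)}\mathcal{O}_n(K)$ is a subring of $K$ ($\mathcal{O}(K)=K$ if $n=0$). For a finite field extension $\Bbbk'$ of $\Bbbk$ (discrete topology), the standard $n$-dimensional topological local field is $\Bbbk'((t_1,\ldots,t_n))$ with the iterated Laurent series topology (obtained from the discrete topology on $\Bbbk'$ by the recursion $\Bbbk'((t_1,\ldots,t_n)) = \Bbbk'((t_2,\ldots,t_n))((t_1))$, where $A((t))$ has the fine $A[[t]]$-module topology) and with $\mathcal{O}_i = \Bbbk'((t_{i+1},\ldots,t_n))[[t_i]]$. An $n$-dimensional topological local field (TLF) over $\Bbbk$ is an $n$-dimensional local field $K$ with a ring homomorphism $\Bbbk\to\mathcal{O}(K)$ such that $\Bbbk\to\boldsymbol{k}_n(K)$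 is finite, and a topology making $K$ a ST $\Bbbk$-ring, for which there exists a $\Bbbk$-ring isomorphism $\Bbbk'((t_1,\ldots,t_n)) \to K$, $\Bbbk' := \boldsymbol{k}_n(K)$, that is a homeomorphism and respects the valuation rings (it maps $\mathcal{O}_1$ onto $\mathcal{O}_1$, the induced map on residue fields maps $\mathcal{O}_2$ onto $\mathcal{O}_2$, etc.). Each $\mathcal{O}_i(K)\subset\boldsymbol{k}_{i-1}(K)$ has the subspace topology and each $\boldsymbol{k}_i(K)$ has the quotient topology from $\mathcal{O}_i(K)$; then $\boldsymbol{k}_i(K)$ is an $(n-i)$-dimensional TLF. **Systems of liftings.** A system of liftings for $K$ is a sequence $\boldsymbol{\sigma}=(\sigma_1,\ldots,\sigma_n)$, where each $\sigma_i:\boldsymbol{k}_i(K)\to\mathcal{O}_i(K)$ is a continuous $\Bbbk$-ring homomorphism splitting the canonical surjection $\mathcal{O}_i(K)\to\boldsymbol{k}_i(K)$ (the empty sequence if $n=0$). If $n \geq 1$, $\mathrm{d}_1(\boldsymbol{\sigma}) := (\sigma_2,\ldots,\sigma_n)$, a system of liftings for $\boldsymbol{k}_1(K)$. **Lattices.** "Finite module" means finitely generated. For $n \ge 1$ and a finite $K$-module $M$, an $\mathcal{O}_1(K)$-lattice in $M$ is a finite $\mathcal{O}_1(K)$-submodule $L$ with $M = K\cdot L$; $\operatorname{Lat}(M)$ is the set of lattices, and $\operatorname{Lat}(M_1,M_2):=\operatorname{Lat}(M_1)\times\operatorname{Lat}(M_2)$. For lattices $L\subset L'$, $L'/L$ has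 finite length over $\mathcal{O}_1(K)$, and $\operatorname{rest}_{\sigma_1}(L'/L)$ denotes it as a finite $\boldsymbol{k}_1(K)$-module via $\sigma_1$. For a $\Bbbk$-linear $\phi:M_1\to M_2$ and $(L_1,L_2),(L'_1,L'_2)\in\operatorname{Lat}(M_1,M_2)$, $(L'_1,L'_2)$ is a $\phi$-refinement of $(L_1,L_2)$, written $(L'_1,L'_2)\prec_\phi(L_1,L_2)$, if $L'_1\subset L_1$, $L_2\subset L'_2$, $\phi(L'_1)\subset L_2$ and $\phi(L_1)\subset L'_2$; then there is an induced $\bar\phi:L_1/L'_1\to L'_2/L_2$. **BT operators.** For finite $K$-modules $M_1,M_2$ define $\mathrm{E}^K_{\boldsymbol{\sigma}}(M_1,M_2)\subset\operatorname{Hom}_{\Bbbk}(M_1,M_2)$ recursively. If $n=0$ it is all of $\operatorname{Hom}_{\Bbbk}(M_1,M_2)$. If $n\ge1$, $\phi$ belongs to it iff: (i) every $(L_1,L_2)\in\operatorname{Lat}(M_1,M_2)$ has some $\phi$-refinement; and (ii) for every $\phi$-refinement $(L'_1,L'_2)\prec_\phi(L_1,L_2)$ the induced $\bar\phi$ belongs to $\mathrm{E}^{\boldsymbol{k}_1(K)}_{\mathrm{d}_1(\boldsymbol{\sigma})}(\operatorname{rest}_{\sigma_1}(L_1/L'_1),\operatorname{rest}_{\sigma_1}(L'_2/L_2))$. For $n\ge1$, $i\in\{1,\ldots,n\}$, $j\in\{1,2\}$, the subset $\mathrm{E}^K_{\boldsymbol{\sigma}}(M_1,M_2)_{i,j}$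 consists of those $\phi\in\mathrm{E}^K_{\boldsymbol{\sigma}}(M_1,M_2)$ such that: for $(i,j)=(1,1)$, $\phi(M_1)\subset L_2$ for some $L_2\in\operatorname{Lat}(M_2)$; for $(i,j)=(1,2)$, $\phi(L_1)=0$ for some $L_1\in\operatorname{Lat}(M_1)$; for $i\ge2$, for every $\phi$-refinement $(L'_1,L'_2)\prec_\phi(L_1,L_2)$ the induced $\bar\phi$ belongs to $\mathrm{E}^{\boldsymbol{k}_1(K)}_{\mathrm{d}_1(\boldsymbol{\sigma})}(\operatorname{rest}_{\sigma_1}(L_1/L'_1),\operatorname{rest}_{\sigma_1}(L'_2/L_2))_{i-1,j}$. Finally $\mathrm{E}_{\boldsymbol{\sigma}}(K):=\mathrm{E}^K_{\boldsymbol{\sigma}}(K,K)$ and $\mathrm{E}_{\boldsymbol{\sigma}}(K)_{i,j}:=\mathrm{E}^K_{\boldsymbol{\sigma}}(K,K)_{i,j}$. *)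

theory Defs
  imports "HOL-Analysis.Product_Topology" "HOL-Algebra.Algebra"
begin

section \<open>Modules and quotients\<close>

text \<open>
  A commutative \<open>k\<close>-ring is a record \<open>A\<close> of type \<open>('k, 'a) module\<close> with \<^term>\<open>Module.algebra k A\<close>; its
  structure homomorphism \<open>k \<rightarrow> A\<close> is \<open>structure_map A\<close>.  A module over \<open>A\<close> is a record whose scalars
  are the elements of \<open>A\<close>.
\<close>

definition structure_map :: "('k, 'a) module \<Rightarrow> 'k \<Rightarrow> 'a" where
  "structure_map A c = c \<odot>\<^bsub>A\<^esub> \<one>\<^bsub>A\<^esub>"

definition restrict_scalars :: "('r \<Rightarrow> 's) \<Rightarrow> ('s, 'm) module \<Rightarrow> ('r, 'm) module" where
  "restrict_scalars f M =
     \<lparr>carrier = carrier M, monoid.mult = monoid.mult M, one = one M, ring.zero = ring.zero M, add = add M,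
      smult = (\<lambda>r x. f r \<odot>\<^bsub>M\<^esub> x)\<rparr>"

definition regular_module :: "('k, 'a) module \<Rightarrow> ('a, 'a) module" where
  "regular_module A =
     \<lparr>carrier = carrier A, monoid.mult = monoid.mult A, one = one A, ring.zero = ring.zero A, add = add A,
      smult = monoid.mult A\<rparr>"

definition span_module :: "('r, 'b) ring_scheme \<Rightarrow> ('r, 'm) module \<Rightarrow> 'm set \<Rightarrow> 'm set" where
  "span_module R M S = \<Inter>{N. submodule N R M \<and> S \<subseteq> N}"

text \<open>\<open>N\<close> is a finitely generated submodule of the \<open>R\<close>-module \<open>M\<close>.\<close>

definition finite_submodule :: "('r, 'b) ring_scheme \<Rightarrow> ('r, 'm) module \<Rightarrow> 'm set \<Rightarrow> bool" where
  "finite_submodule R M N \<longleftrightarrow> (\<exists>S. finite S \<and> S \<subseteq> carrier M \<and> N = span_module R M S)"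

text \<open>
  The residue fields of an \<open>n\<close>-dimensional local field, and the quotients of lattices, are formed by
  a recursion over the variable \<open>n\<close>, so the quotient \<open>M/N\<close> must have the same element type as \<open>M\<close>.
  It is therefore realized on a set of coset representatives: \<open>coset_rep M N x\<close> is a chosen element
  of the coset \<open>N + x\<close> (it depends only on that coset), it plays the role of the class of \<open>x\<close>, and the
  operations are transported from \<open>M/N\<close>.  The choice of representatives is immaterial.  In
  particular \<open>coset_rep M N\<close> need not be additive as a map \<open>M \<rightarrow> M\<close>; it is the canonical surjection
  \<open>M \<rightarrow> M/N\<close>.  The same record serves for quotients of modules and of algebras.
\<close>

definition coset_rep :: "('r, 'm) module \<Rightarrow> 'm set \<Rightarrow> 'm \<Rightarrow> 'm" where
  "coset_rep M N x = (SOME y. y \<in> N +>\<^bsub>M\<^esub> x)"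

definition quotient :: "('r, 'm) module \<Rightarrow> 'm set \<Rightarrow> ('r, 'm) module" where
  "quotient M N =
     \<lparr>carrier = coset_rep M N ` carrier M,
      monoid.mult = (\<lambda>x y. coset_rep M N (x \<otimes>\<^bsub>M\<^esub> y)),
      one = coset_rep M N \<one>\<^bsub>M\<^esub>,
      ring.zero = coset_rep M N \<zero>\<^bsub>M\<^esub>,
      add = (\<lambda>x y. coset_rep M N (x \<oplus>\<^bsub>M\<^esub> y)),
      smult = (\<lambda>r x. coset_rep M N (r \<odot>\<^bsub>M\<^esub> x))\<rparr>"

lemma coset_rep_eq_iff:
  assumes "abelian_group M" "subgroup N (add_monoid M)" "x \<in> carrier M" "y \<in> carrier M"
  shows "coset_rep M N x = coset_rep M N y \<longleftrightarrow> x \<ominus>\<^bsub>M\<^esub> y \<in> N"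
proof -
  interpret M: abelian_group M by fact
  interpret N: subgroup N "add_monoid M" by fact
  have as: "additive_subgroup N M" by (simp add: additive_subgroup_def assms(2))
  interpret N': abelian_subgroup N M using abelian_subgroupI3[OF as assms(1)] .
  have ri: "N +>\<^bsub>M\<^esub> x = N +>\<^bsub>M\<^esub> y" if "y \<in> N +>\<^bsub>M\<^esub> x" "x \<in> carrier M" for x y
    using M.a_repr_independence[OF that assms(2)] .
  have mem: "coset_rep M N z \<in> N +>\<^bsub>M\<^esub> z" if "z \<in> carrier M" for z
    unfolding coset_rep_def by (rule someI_ex) (use that N'.a_rcos_self in blast)
  have "coset_rep M N x = coset_rep M N y \<longleftrightarrow> N +>\<^bsub>M\<^esub> x = N +>\<^bsub>M\<^esub> y"
    using mem assms(3,4) ri by (metis coset_rep_def)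
  also have "\<dots> \<longleftrightarrow> x \<in> N +>\<^bsub>M\<^esub> y"
    using assms(3,4) ri N'.a_rcos_self by metis
  also have "\<dots> \<longleftrightarrow> x \<ominus>\<^bsub>M\<^esub> y \<in> N"
    using N'.a_rcos_module_rev N'.a_rcos_module_imp assms(3,4) by (metis M.minus_eq)
  finally show ?thesis .
qed

text \<open>Homomorphisms are extensional functions, so that equality of sets of homomorphisms is meaningful.\<close>

definition linear_maps ::
    "('r, 'b) ring_scheme \<Rightarrow> ('r, 'm) module \<Rightarrow> ('r, 'p) module \<Rightarrow> ('m \<Rightarrow> 'p) set" where
  "linear_maps R M N =
     {\<phi> \<in> carrier M \<rightarrow>\<^sub>E carrier N.
        (\<forall>x\<in>carrier M. \<forall>y\<in>carrier M. \<phi> (x \<oplus>\<^bsub>M\<^esub> y) = \<phi> x \<oplus>\<^bsub>N\<^esub> \<phi> y) \<and>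
        (\<forall>r\<in>carrier R. \<forall>x\<in>carrier M. \<phi> (r \<odot>\<^bsub>M\<^esub> x) = r \<odot>\<^bsub>N\<^esub> \<phi> x)}"

definition algebra_homs ::
    "('k, 'b) ring_scheme \<Rightarrow> ('k, 'a) module \<Rightarrow> ('k, 'c) module \<Rightarrow> ('a \<Rightarrow> 'c) set" where
  "algebra_homs k A B =
     {f \<in> ring_hom A B. \<forall>c\<in>carrier k. \<forall>x\<in>carrier A. f (c \<odot>\<^bsub>A\<^esub> x) = c \<odot>\<^bsub>B\<^esub> f x}"

definition perfect_field :: "('k, 'b) ring_scheme \<Rightarrow> bool" where
  "perfect_field k \<longleftrightarrow> field k \<and>
     (\<forall>p::nat. Factorial_Ring.prime p \<and> add_pow k p \<one>\<^bsub>k\<^esub> = \<zero>\<^bsub>k\<^esub> \<longrightarrow>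
        (\<forall>x\<in>carrier k. \<exists>y\<in>carrier k. x = y [^]\<^bsub>k\<^esub> p))"


section \<open>Semi-topological rings and modules\<close>

definition linear_topology ::
    "('k, 'b) ring_scheme \<Rightarrow> ('k, 'm) module \<Rightarrow> 'm topology \<Rightarrow> bool" where
  "linear_topology k M T \<longleftrightarrow>
     topspace T = carrier M \<and>
     continuous_map (prod_topology T T) T (\<lambda>(x, y). x \<oplus>\<^bsub>M\<^esub> y) \<and>
     continuous_map (prod_topology (discrete_topology (carrier k)) T) T (\<lambda>(c, x). c \<odot>\<^bsub>M\<^esub> x) \<and>
     (\<forall>U. openin T U \<and> \<zero>\<^bsub>M\<^esub> \<in> U \<longrightarrow> (\<exists>V. openin T V \<and> submodule V k M \<and> V \<subseteq> U))"

definition ST_ring ::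
    "('k, 'b) ring_scheme \<Rightarrow> ('k, 'a) module \<Rightarrow> 'a topology \<Rightarrow> bool" where
  "ST_ring k A T \<longleftrightarrow>
     Module.algebra k A \<and> linear_topology k A T \<and>
     (\<forall>a\<in>carrier A. continuous_map T T (\<lambda>b. a \<otimes>\<^bsub>A\<^esub> b))"

definition ST_module ::
    "('k, 'b) ring_scheme \<Rightarrow> ('k, 'a) module \<Rightarrow> 'a topology \<Rightarrow> ('a, 'm) module \<Rightarrow> 'm topology \<Rightarrow> bool"
  where
  "ST_module k A TA M T \<longleftrightarrow>
     Module.module A M \<and> linear_topology k (restrict_scalars (structure_map A) M) T \<and>
     (\<forall>a\<in>carrier A. continuous_map T T (\<lambda>x. a \<odot>\<^bsub>M\<^esub> x)) \<and>
     (\<forall>x\<in>carrier M. continuous_map TA T (\<lambda>a. a \<odot>\<^bsub>M\<^esub> x))"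

definition fine_topology ::
    "('k, 'b) ring_scheme \<Rightarrow> ('k, 'a) module \<Rightarrow> 'a topology \<Rightarrow> ('a, 'm) module \<Rightarrow> 'm topology" where
  "fine_topology k A TA M =
     (THE T. ST_module k A TA M T \<and>
        (\<forall>T'. ST_module k A TA M T' \<longrightarrow> (\<forall>U. openin T' U \<longrightarrow> openin T U)))"

lemma indiscrete_topology_facts: 
  defines "I \<equiv> \<lambda>C. topology (\<lambda>U. U = {} \<or> U = C)"
  shows "openin (I C) U \<longleftrightarrow> U = {} \<or> U = C" "topspace (I C) = C"
    "f \<in> topspace Y \<rightarrow> C \<Longrightarrow> continuous_map Y (I C) f"
proof -
  have ist: "istopology (\<lambda>U. U = {} \<or> U = C)"
    unfolding istopology_def by (auto; blast)
  have op: "openin (I C) U \<longleftrightarrow> U = {} \<or> U = C" for U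
    using topology_inverse'[OF ist] by (simp add: I_def)
  then show "openin (I C) U \<longleftrightarrow> U = {} \<or> U = C" .
  show ts: "topspace (I C) = C"
    by (auto simp: topspace_def op)
  show "continuous_map Y (I C) f" if "f \<in> topspace Y \<rightarrow> C"
  proof -
    have "{x \<in> topspace Y. f x \<in> C} = topspace Y" using that by auto
    then show ?thesis using that by (auto simp: continuous_map_def op ts)
  qed
qed

lemma continuous_map_into_Sup:
  assumes "\<And>T. T \<in> S \<Longrightarrow> continuous_map Y T f" "S \<noteq> {}"
  shows "continuous_map Y (topology_generated_by (\<Union>T\<in>S. {U. openin T U})) f"
proof (rule continuous_on_generated_topo)
  show "f ` topspace Y \<subseteq> \<Union>(\<Union>T\<in>S. {U. openin T U})"
  proof
    fix y assume "y \<in> f ` topspace Y"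
    obtain T where "T \<in> S" using assms(2) by auto
    with assms(1)[OF this] \<open>y \<in> _\<close> have "y \<in> topspace T" by (auto simp: continuous_map_def)
    then show "y \<in> \<Union>(\<Union>T\<in>S. {U. openin T U})" using \<open>T \<in> S\<close> openin_topspace by blast
  qed
  show "openin Y (f -` U \<inter> topspace Y)" if U: "U \<in> (\<Union>T\<in>S. {U. openin T U})" for U
  proof -
    obtain T where T: "T \<in> S" "openin T U" using U by auto
    have "f -` U \<inter> topspace Y = {x \<in> topspace Y. f x \<in> U}" by auto
    then show ?thesis using T assms(1)[OF T(1)] by (auto simp: continuous_map_def)
  qed
qed

lemma fine_topology_exists:
  assumes ST: "ST_ring k A TA" and mod: "Module.module A M"
  shows "\<exists>!T. ST_module k A TA M T \<and>
    (\<forall>T'. ST_module k A TA M T' \<longrightarrow> (\<forall>U. openin T' U \<longrightarrow> openin T U))"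
proof -
  have alg: "Module.algebra k A" using ST by (simp add: ST_ring_def)
  have tA: "topspace TA = carrier A" using ST by (simp add: ST_ring_def linear_topology_def)
  interpret A: Module.algebra k A by fact
  interpret M: Module.module A M by fact
  let ?N = "restrict_scalars (structure_map A) M"
  have sm: "structure_map A c \<in> carrier A" if "c \<in> carrier k" for c
    using that by (simp add: structure_map_def)
  have N[simp]: "carrier ?N = carrier M" "ring.zero ?N = ring.zero M" "add ?N = add M"
    by (simp_all add: restrict_scalars_def)
  have smN: "c \<odot>\<^bsub>?N\<^esub> x = structure_map A c \<odot>\<^bsub>M\<^esub> x" for c x by (simp add: restrict_scalars_def)
  have sgN: "subgroup H (add_monoid ?N) \<longleftrightarrow> subgroup H (add_monoid M)" for H
    by (simp add: subgroup_def m_inv_def)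
  let ?S = "{T. ST_module k A TA M T}"
  let ?B = "\<Union>T\<in>?S. {U. openin T U}"
  have tsp: "topspace T = carrier M" if "ST_module k A TA M T" for T
    using that by (auto simp: ST_module_def linear_topology_def)
  have subc: "submodule (carrier M) k ?N"
    unfolding submodule_def submodule_axioms_def sgN 
    using M.add.subgroup_self by (auto simp: smN sm)
  have subI: "submodule (P \<inter> Q) k ?N" if "submodule P k ?N" "submodule Q k ?N" for P Q
    using that M.add.subgroups_Inter_pair[of P Q]
    unfolding submodule_def submodule_axioms_def sgN by auto
  obtain T0 where T0: "ST_module k A TA M T0"
  proof -
    let ?I = "topology (\<lambda>U. U = {} \<or> U = carrier M)"
    have "linear_topology k ?N ?I"
      unfolding linear_topology_def using subc
      by (auto simp: indiscrete_topology_facts(1,2) smN sm intro!: indiscrete_topology_facts(3))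
    moreover have "continuous_map ?I ?I (\<lambda>x. a \<odot>\<^bsub>M\<^esub> x)" if "a \<in> carrier A" for a
      using that by (auto simp: indiscrete_topology_facts(1,2) intro!: indiscrete_topology_facts(3))
    moreover have "continuous_map TA ?I (\<lambda>a. a \<odot>\<^bsub>M\<^esub> x)" if "x \<in> carrier M" for x
      using that by (auto simp: tA intro!: indiscrete_topology_facts(3))
    ultimately show ?thesis using mod by (intro that[of ?I]) (simp add: ST_module_def)
  qed
  define J where "J = topology_generated_by ?B"
  have Jop: "openin J U" if "ST_module k A TA M T" "openin T U" for T U
    unfolding J_def using that by (intro topology_generated_by_Basis) auto
  have Jts: "topspace J = carrier M"
  proof -
    have "\<Union>?B = carrier M"
    proof
      show "\<Union>?B \<subseteq> carrier M" using tsp openin_subset by blast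
      show "carrier M \<subseteq> \<Union>?B" using tsp[OF T0] openin_topspace[of T0] T0 by auto
    qed
    then show ?thesis unfolding J_def topology_generated_by_topspace .
  qed
  have idc: "continuous_map J T (\<lambda>x. x)" if "ST_module k A TA M T" for T
  proof -
    have "{x \<in> carrier M. x \<in> U} = U" if "openin T U" for U
      using openin_subset[OF that] tsp[OF \<open>ST_module k A TA M T\<close>] by auto
    then show ?thesis unfolding continuous_map_def Jts tsp[OF that] using Jop[OF that] by auto
  qed
  have c1: "continuous_map (prod_topology J J) J (\<lambda>(x, y). x \<oplus>\<^bsub>M\<^esub> y)"
    unfolding J_def
  proof (rule continuous_map_into_Sup, fold J_def)
    fix T assume "T \<in> ?S"
    then have T: "ST_module k A TA M T" by simp
    have "continuous_map (prod_topology T T) T (\<lambda>(x, y). x \<oplus>\<^bsub>M\<^esub> y)"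
      using T by (simp add: ST_module_def linear_topology_def)
    moreover have "continuous_map (prod_topology J J) (prod_topology T T) (\<lambda>z. (fst z, snd z))"
      using continuous_map_compose[OF continuous_map_fst idc[OF T]]
        continuous_map_compose[OF continuous_map_snd idc[OF T]]
      by (intro continuous_map_pairedI) (simp_all add: o_def)
    ultimately have "continuous_map (prod_topology J J) T ((\<lambda>(x, y). x \<oplus>\<^bsub>M\<^esub> y) \<circ> (\<lambda>z. (fst z, snd z)))"
      by (rule continuous_map_compose[rotated])
    then show "continuous_map (prod_topology J J) T (\<lambda>(x, y). x \<oplus>\<^bsub>M\<^esub> y)" by (simp add: o_def)
  qed (use T0 in auto)
  have c2: "continuous_map (prod_topology (discrete_topology (carrier k)) J) J (\<lambda>(c, x). c \<odot>\<^bsub>?N\<^esub> x)"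
    unfolding J_def
  proof (rule continuous_map_into_Sup, fold J_def)
    fix T assume "T \<in> ?S"
    then have T: "ST_module k A TA M T" by simp
    have "continuous_map (prod_topology (discrete_topology (carrier k)) T) T (\<lambda>(c, x). c \<odot>\<^bsub>?N\<^esub> x)"
      using T by (simp add: ST_module_def linear_topology_def)
    moreover have "continuous_map (prod_topology (discrete_topology (carrier k)) J) (prod_topology (discrete_topology (carrier k)) T) (\<lambda>z. (fst z, snd z))"
      using continuous_map_compose[OF continuous_map_snd idc[OF T]]
      by (intro continuous_map_pairedI) (simp_all add: o_def continuous_map_fst)
    ultimately have "continuous_map (prod_topology (discrete_topology (carrier k)) J) T
        ((\<lambda>(c, x). c \<odot>\<^bsub>?N\<^esub> x) \<circ> (\<lambda>z. (fst z, snd z)))"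
      by (rule continuous_map_compose[rotated])
    then show "continuous_map (prod_topology (discrete_topology (carrier k)) J) T (\<lambda>(c, x). c \<odot>\<^bsub>?N\<^esub> x)"
      by (simp add: o_def case_prod_unfold)
  qed (use T0 in auto)
  have c3: "continuous_map J J (\<lambda>x. a \<odot>\<^bsub>M\<^esub> x)" if "a \<in> carrier A" for a
    unfolding J_def
  proof (rule continuous_map_into_Sup, fold J_def)
    fix T assume "T \<in> ?S"
    then have T: "ST_module k A TA M T" by simp
    then have "continuous_map T T (\<lambda>x. a \<odot>\<^bsub>M\<^esub> x)" using that by (simp add: ST_module_def)
    from continuous_map_compose[OF idc[OF T] this]
    show "continuous_map J T (\<lambda>x. a \<odot>\<^bsub>M\<^esub> x)" by (simp add: o_def)
  qed (use T0 in auto)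
  have c4: "continuous_map TA J (\<lambda>a. a \<odot>\<^bsub>M\<^esub> x)" if "x \<in> carrier M" for x
    unfolding J_def by (rule continuous_map_into_Sup) (use T0 that in \<open>auto simp: ST_module_def\<close>)
  have bas: "\<exists>V. openin J V \<and> submodule V k ?N \<and> V \<subseteq> U" if "openin J U" "\<zero>\<^bsub>M\<^esub> \<in> U" for U
  proof -
    have "generate_topology_on ?B U" using that by (simp add: J_def openin_topology_generated_by_iff)
    then show ?thesis using that(2)
    proof induction
      case (Int a b)
      then obtain V W where "openin J V" "submodule V k ?N" "V \<subseteq> a" "openin J W" "submodule W k ?N" "W \<subseteq> b" by auto
      then show ?case using subI[of V W] openin_Int[of J V W] by blast
    next
      case (UN K)
      then obtain c where "c \<in> K" "\<zero>\<^bsub>M\<^esub> \<in> c" by auto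
      with UN(2)[OF this] show ?case by blast
    next
      case (Basis s)
      then obtain T where T: "ST_module k A TA M T" "openin T s" by auto
      then obtain V where "openin T V" "submodule V k ?N" "V \<subseteq> s" using Basis(2)
        unfolding ST_module_def linear_topology_def by auto
      then show ?case using Jop[OF T(1)] by blast
    qed auto
  qed
  have "ST_module k A TA M J"
    unfolding ST_module_def linear_topology_def using mod c1 c2 c3 c4 bas Jts by auto
  then show ?thesis using Jop by (intro ex1I[of _ J]) (auto simp: topology_eq)
qed

lemma fine_topology:
  assumes ST: "ST_ring k A TA" and mod: "Module.module A M"
  shows "ST_module k A TA M (fine_topology k A TA M)"
    and "ST_module k A TA M T' \<Longrightarrow> openin T' U \<Longrightarrow> openin (fine_topology k A TA M) U"
  using theI'[OF fine_topology_exists[OF assms]] unfolding fine_topology_def by blast+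

definition quotient_topology :: "'a topology \<Rightarrow> ('a \<Rightarrow> 'b) \<Rightarrow> 'b topology" where
  "quotient_topology T f =
     topology (\<lambda>U. U \<subseteq> f ` topspace T \<and> openin T {x \<in> topspace T. f x \<in> U})"


lemma quotient_map_quotient_topology: "quotient_map T (quotient_topology T f) f"
proof -
  have "istopology (\<lambda>U. U \<subseteq> f ` topspace T \<and> openin T {x \<in> topspace T. f x \<in> U})"
    unfolding istopology_def
  proof (intro conjI allI impI)
    fix S U assume "S \<subseteq> f ` topspace T \<and> openin T {x \<in> topspace T. f x \<in> S}"
      "U \<subseteq> f ` topspace T \<and> openin T {x \<in> topspace T. f x \<in> U}"
    moreover have "{x \<in> topspace T. f x \<in> S \<inter> U} =
        {x \<in> topspace T. f x \<in> S} \<inter> {x \<in> topspace T. f x \<in> U}" by auto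
    ultimately show "S \<inter> U \<subseteq> f ` topspace T" "openin T {x \<in> topspace T. f x \<in> S \<inter> U}" by auto
  next
    fix K assume K: "\<forall>U\<in>K. U \<subseteq> f ` topspace T \<and> openin T {x \<in> topspace T. f x \<in> U}"
    have "{x \<in> topspace T. f x \<in> \<Union>K} = (\<Union>U\<in>K. {x \<in> topspace T. f x \<in> U})" by auto
    then show "\<Union>K \<subseteq> f ` topspace T" "openin T {x \<in> topspace T. f x \<in> \<Union>K}" using K by auto
  qed
  then have op: "openin (quotient_topology T f) U \<longleftrightarrow>
      U \<subseteq> f ` topspace T \<and> openin T {x \<in> topspace T. f x \<in> U}" for U
    unfolding quotient_topology_def by (simp add: topology_inverse')
  have "openin (quotient_topology T f) (f ` topspace T)"
    by (auto simp: op cong: conj_cong)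
  then have "topspace (quotient_topology T f) = f ` topspace T"
    using op openin_subset openin_topspace by blast
  then show ?thesis unfolding quotient_map_def using op by auto
qed


section \<open>Iterated Laurent series\<close>

text \<open>
  Since \<open>n\<close> varies, elements of all the rings \<open>k'((t\<^sub>1, \<dots>, t\<^sub>n))\<close> live in one type: \<open>Const c\<close> for \<open>n = 0\<close>,
  and \<open>Series f\<close> for the Laurent series \<open>\<Sum>\<^sub>i f i \<cdot> t\<^sub>1\<^sup>i\<close> with coefficients \<open>f i\<close> in
  \<open>k'((t\<^sub>2, \<dots>, t\<^sub>n))\<close>.
\<close>

datatype 'a laurent = Const (const_of: 'a) | Series (coeff_of: "int \<Rightarrow> 'a laurent")

definition const_algebra :: "('k, 'a) module \<Rightarrow> ('k, 'a laurent) module" where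
  "const_algebra A =
     \<lparr>carrier = Const ` carrier A,
      monoid.mult = (\<lambda>x y. Const (const_of x \<otimes>\<^bsub>A\<^esub> const_of y)),
      one = Const \<one>\<^bsub>A\<^esub>,
      ring.zero = Const \<zero>\<^bsub>A\<^esub>,
      add = (\<lambda>x y. Const (const_of x \<oplus>\<^bsub>A\<^esub> const_of y)),
      smult = (\<lambda>c x. Const (c \<odot>\<^bsub>A\<^esub> const_of x))\<rparr>"

definition const_series :: "('k, 'a laurent) module \<Rightarrow> 'a laurent \<Rightarrow> 'a laurent" where
  "const_series A a = Series (\<lambda>i. if i = 0 then a else \<zero>\<^bsub>A\<^esub>)"

definition laurent_algebra :: "('k, 'a laurent) module \<Rightarrow> ('k, 'a laurent) module" where
  "laurent_algebra A =
     \<lparr>carrier = {Series f | f. (\<forall>i. f i \<in> carrier A) \<and> (\<exists>N. \<forall>i<N. f i = \<zero>\<^bsub>A\<^esub>)},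
      monoid.mult = (\<lambda>x y. Series (\<lambda>i.
                finsum A (\<lambda>j. coeff_of x j \<otimes>\<^bsub>A\<^esub> coeff_of y (i - j))
                  {j. coeff_of x j \<noteq> \<zero>\<^bsub>A\<^esub> \<and> coeff_of y (i - j) \<noteq> \<zero>\<^bsub>A\<^esub>})),
      one = const_series A \<one>\<^bsub>A\<^esub>,
      ring.zero = const_series A \<zero>\<^bsub>A\<^esub>,
      add = (\<lambda>x y. Series (\<lambda>i. coeff_of x i \<oplus>\<^bsub>A\<^esub> coeff_of y i)),
      smult = (\<lambda>c x. Series (\<lambda>i. c \<odot>\<^bsub>A\<^esub> coeff_of x i))\<rparr>"

definition power_series :: "('k, 'a laurent) module \<Rightarrow> 'a laurent set" where
  "power_series A = {x \<in> carrier (laurent_algebra A). \<forall>i<0. coeff_of x i = \<zero>\<^bsub>A\<^esub>}"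

definition power_series_algebra :: "('k, 'a laurent) module \<Rightarrow> ('k, 'a laurent) module" where
  "power_series_algebra A = (laurent_algebra A)\<lparr>carrier := power_series A\<rparr>"

text \<open>
  \<open>A[t]/(t\<^sup>i\<^sup>+\<^sup>1)\<close> as an \<open>A\<close>-module, its elements being represented by the polynomials of degree at most
  \<open>i\<close>; the canonical projection \<open>A[[t]] \<rightarrow> A[t]/(t\<^sup>i\<^sup>+\<^sup>1)\<close> is \<open>truncate_series A i\<close>.  Only the module
  structure matters for the fine topology, so the \<open>mult\<close> and \<open>one\<close> fields are irrelevant.
\<close>

definition truncated_module :: "('k, 'a laurent) module \<Rightarrow> nat \<Rightarrow> ('a laurent, 'a laurent) module" where
  "truncated_module A i =
     \<lparr>carrier = {x \<in> power_series A. \<forall>j>int i. coeff_of x j = \<zero>\<^bsub>A\<^esub>},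
      monoid.mult = monoid.mult (laurent_algebra A), one = one (laurent_algebra A),
      ring.zero = ring.zero (laurent_algebra A), add = add (laurent_algebra A),
      smult = (\<lambda>a x. Series (\<lambda>j. a \<otimes>\<^bsub>A\<^esub> coeff_of x j))\<rparr>"

definition truncate_series :: "('k, 'a laurent) module \<Rightarrow> nat \<Rightarrow> 'a laurent \<Rightarrow> 'a laurent" where
  "truncate_series A i x = Series (\<lambda>j. if j \<le> int i then coeff_of x j else \<zero>\<^bsub>A\<^esub>)"

text \<open>
  The inverse limit topology on \<open>A[[t]]\<close> is the one induced by the embedding in the product of all
  \<open>A[t]/(t\<^sup>i\<^sup>+\<^sup>1)\<close>.
\<close>

definition power_series_topology ::
    "('k, 'b) ring_scheme \<Rightarrow> ('k, 'a laurent) module \<Rightarrow> 'a laurent topology \<Rightarrow> 'a laurent topology"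
  where
  "power_series_topology k A TA =
     pullback_topology (power_series A) (\<lambda>x i. truncate_series A i x)
       (product_topology (\<lambda>i. fine_topology k A TA (truncated_module A i)) UNIV)"

definition laurent_topology ::
    "('k, 'b) ring_scheme \<Rightarrow> ('k, 'a laurent) module \<Rightarrow> 'a laurent topology \<Rightarrow> 'a laurent topology"
  where
  "laurent_topology k A TA =
     fine_topology k (power_series_algebra A) (power_series_topology k A TA)
       (regular_module (laurent_algebra A))"

primrec iterated_laurent :: "('k, 'a) module \<Rightarrow> nat \<Rightarrow> ('k, 'a laurent) module" where
  "iterated_laurent k' 0 = const_algebra k'"
| "iterated_laurent k' (Suc n) = laurent_algebra (iterated_laurent k' n)"

primrec iterated_laurent_topology ::
    "('k, 'b) ring_scheme \<Rightarrow> ('k, 'a) module \<Rightarrow> nat \<Rightarrow> 'a laurent topology" where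
  "iterated_laurent_topology k k' 0 = discrete_topology (carrier (const_algebra k'))"
| "iterated_laurent_topology k k' (Suc n) =
     laurent_topology k (iterated_laurent k' n) (iterated_laurent_topology k k' n)"


section \<open>Local fields\<close>

definition maximal_ideal_of :: "('a, 'b) ring_scheme \<Rightarrow> 'a set" where
  "maximal_ideal_of R = (THE I. maximalideal I R)"

primrec ideal_power :: "('a, 'b) ring_scheme \<Rightarrow> 'a set \<Rightarrow> nat \<Rightarrow> 'a set" where
  "ideal_power R I 0 = carrier R"
| "ideal_power R I (Suc i) = ideal_prod R (ideal_power R I i) I"

definition discrete_valuation_ring :: "('a, 'b) ring_scheme \<Rightarrow> bool" where
  "discrete_valuation_ring R \<longleftrightarrow> principal_domain R \<and> \<not> field R \<and> (\<exists>!I. maximalideal I R)"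

text \<open>The canonical map from \<open>R\<close> to the inverse limit of the \<open>R/m\<^sup>i\<close> is bijective.\<close>

definition complete_local_ring :: "('a, 'b) ring_scheme \<Rightarrow> bool" where
  "complete_local_ring R \<longleftrightarrow>
     (\<forall>x::nat \<Rightarrow> 'a.
        (\<forall>i. x i \<in> carrier R \<and> x (Suc i) \<ominus>\<^bsub>R\<^esub> x i \<in> ideal_power R (maximal_ideal_of R) i) \<longrightarrow>
        (\<exists>!y. y \<in> carrier R \<and> (\<forall>i. y \<ominus>\<^bsub>R\<^esub> x i \<in> ideal_power R (maximal_ideal_of R) i)))"

text \<open>
  For a subring \<open>V\<close> of \<open>K\<close> that is a local ring: the canonical surjection \<open>V \<rightarrow> V/m\<close> and the residue
  field \<open>V/m\<close>.
\<close>

definition residue_map :: "('k, 'a) module \<Rightarrow> 'a set \<Rightarrow> 'a \<Rightarrow> 'a" where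
  "residue_map K V = coset_rep (K\<lparr>carrier := V\<rparr>) (maximal_ideal_of (K\<lparr>carrier := V\<rparr>))"

definition residue_field :: "('k, 'a) module \<Rightarrow> 'a set \<Rightarrow> ('k, 'a) module" where
  "residue_field K V = quotient (K\<lparr>carrier := V\<rparr>) (maximal_ideal_of (K\<lparr>carrier := V\<rparr>))"

definition residue_topology :: "('k, 'a) module \<Rightarrow> 'a topology \<Rightarrow> 'a set \<Rightarrow> 'a topology" where
  "residue_topology K T V = quotient_topology (subtopology T V) (residue_map K V)"

text \<open>
  An \<open>n\<close>-dimensional local field is a field \<open>K\<close> together with the list \<open>Os = [O\<^sub>1, \<dots>, O\<^sub>n]\<close> of its
  valuation rings, where \<open>O\<^sub>1\<close> is a subring of \<open>K\<close> and \<open>O\<^sub>i\<^sub>+\<^sub>1\<close> is a subring of the residue field of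
  \<open>O\<^sub>i\<close>.  All recursions below pass from \<open>(K, [O\<^sub>1, \<dots>, O\<^sub>n])\<close> to \<open>(k\<^sub>1(K), [O\<^sub>2, \<dots>, O\<^sub>n])\<close>.
\<close>

primrec local_field :: "('k, 'a) module \<Rightarrow> 'a set list \<Rightarrow> bool" where
  "local_field K [] \<longleftrightarrow> field K"
| "local_field K (V # Os) \<longleftrightarrow>
     field K \<and> subring V K \<and>
     discrete_valuation_ring (K\<lparr>carrier := V\<rparr>) \<and> complete_local_ring (K\<lparr>carrier := V\<rparr>) \<and>
     (\<forall>x\<in>carrier K. \<exists>a\<in>V. \<exists>b\<in>V - {\<zero>\<^bsub>K\<^esub>}. x = a \<otimes>\<^bsub>K\<^esub> inv\<^bsub>K\<^esub> b) \<and>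
     local_field (residue_field K V) Os"

primrec last_residue_field :: "('k, 'a) module \<Rightarrow> 'a set list \<Rightarrow> ('k, 'a) module" where
  "last_residue_field K [] = K"
| "last_residue_field K (V # Os) = last_residue_field (residue_field K V) Os"

text \<open>
  The fibre product \<open>O\<^sub>1 \<times> \<dots> \<times> O\<^sub>n\<close> over the residue fields as a subring of \<open>K\<close>: a tuple in it is
  determined by its first component, the others being successive residue classes.
\<close>

primrec ring_of_integers :: "('k, 'a) module \<Rightarrow> 'a set list \<Rightarrow> 'a set" where
  "ring_of_integers K [] = carrier K"
| "ring_of_integers K (V # Os) =
     {x \<in> V. residue_map K V x \<in> ring_of_integers (residue_field K V) Os}"

text \<open>
  \<open>f : k'((t\<^sub>1, \<dots>, t\<^sub>n)) \<rightarrow> K\<close> respects the valuation rings; the residue field of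
  \<open>k'((t\<^sub>2, \<dots>, t\<^sub>n))[[t\<^sub>1]]\<close> is identified with \<open>k'((t\<^sub>2, \<dots>, t\<^sub>n))\<close> through constant series.
\<close>

primrec respects_valuations ::
    "('k, 'a) module \<Rightarrow> ('k, 'a) module \<Rightarrow> 'a set list \<Rightarrow> ('a laurent \<Rightarrow> 'a) \<Rightarrow> bool" where
  "respects_valuations k' K [] f \<longleftrightarrow> True"
| "respects_valuations k' K (V # Os) f \<longleftrightarrow>
     f ` power_series (iterated_laurent k' (length Os)) = V \<and>
     respects_valuations k' (residue_field K V) Os
       (\<lambda>a. residue_map K V (f (const_series (iterated_laurent k' (length Os)) a)))"

definition topological_local_field ::
    "('k, 'b) ring_scheme \<Rightarrow> nat \<Rightarrow> ('k, 'a) module \<Rightarrow> 'a set list \<Rightarrow> 'a topology \<Rightarrow> bool" where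
  "topological_local_field k n K Os T \<longleftrightarrow>
     length Os = n \<and> local_field K Os \<and> ST_ring k K T \<and>
     structure_map K ` carrier k \<subseteq> ring_of_integers K Os \<and>
     (let k' = last_residue_field K Os in
        finite_submodule k k' (carrier k') \<and>
        (\<exists>f \<in> algebra_homs k (iterated_laurent k' n) K.
           bij_betw f (carrier (iterated_laurent k' n)) (carrier K) \<and>
           homeomorphic_map (iterated_laurent_topology k k' n) T f \<and>
           respects_valuations k' K Os f))"


section \<open>Systems of liftings\<close>

primrec system_of_liftings ::
    "('k, 'b) ring_scheme \<Rightarrow> ('k, 'a) module \<Rightarrow> 'a set list \<Rightarrow> 'a topology \<Rightarrow> ('a \<Rightarrow> 'a) list \<Rightarrow> bool"
  where
  "system_of_liftings k K [] T \<sigma> \<longleftrightarrow> \<sigma> = []"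
| "system_of_liftings k K (V # Os) T \<sigma> \<longleftrightarrow>
     \<sigma> \<noteq> [] \<and>
     hd \<sigma> \<in> algebra_homs k (residue_field K V) (K\<lparr>carrier := V\<rparr>) \<and>
     continuous_map (residue_topology K T V) (subtopology T V) (hd \<sigma>) \<and>
     (\<forall>x\<in>carrier (residue_field K V). residue_map K V (hd \<sigma> x) = x) \<and>
     system_of_liftings k (residue_field K V) Os (residue_topology K T V) (tl \<sigma>)"


section \<open>Lattices and BT operators\<close>

definition lattices :: "('k, 'a) module \<Rightarrow> 'a set \<Rightarrow> ('a, 'm) module \<Rightarrow> 'm set set" where
  "lattices K V M =
     {L. finite_submodule (K\<lparr>carrier := V\<rparr>) M L \<and> span_module K M L = carrier M}"

definition refinement ::
    "('k, 'a) module \<Rightarrow> 'a set \<Rightarrow> ('a, 'm) module \<Rightarrow> ('a, 'p) module \<Rightarrow> ('m \<Rightarrow> 'p) \<Rightarrow>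
     'm set \<times> 'p set \<Rightarrow> 'm set \<times> 'p set \<Rightarrow> bool" where
  "refinement K V M1 M2 \<phi> = (\<lambda>(L1', L2') (L1, L2).
     L1 \<in> lattices K V M1 \<and> L2 \<in> lattices K V M2 \<and>
     L1' \<in> lattices K V M1 \<and> L2' \<in> lattices K V M2 \<and>
     L1' \<subseteq> L1 \<and> L2 \<subseteq> L2' \<and> \<phi> ` L1' \<subseteq> L2 \<and> \<phi> ` L1 \<subseteq> L2')"

text \<open>\<open>rest\<^bsub>\<sigma>\<^sub>1\<^esub>(L'/L)\<close> for submodules \<open>L \<subseteq> L'\<close> of \<open>M\<close>, where \<open>s = \<sigma>\<^sub>1\<close>.\<close>

definition rest :: "('a \<Rightarrow> 'a) \<Rightarrow> ('a, 'm) module \<Rightarrow> 'm set \<Rightarrow> 'm set \<Rightarrow> ('a, 'm) module" where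
  "rest s M L' L = restrict_scalars s (quotient (M\<lparr>carrier := L'\<rparr>) L)"

text \<open>
  The map \<open>L1/L1' \<rightarrow> L2'/L2\<close> induced by \<open>\<phi>\<close>: as the class of \<open>x\<close> modulo \<open>L1'\<close> is represented by an
  element of \<open>L1\<close>, the map \<open>\<phi>\<close> may be applied to it directly.
\<close>

definition induced_map ::
    "('a, 'm) module \<Rightarrow> ('a, 'p) module \<Rightarrow> ('m \<Rightarrow> 'p) \<Rightarrow>
     'm set \<times> 'p set \<Rightarrow> 'm set \<times> 'p set \<Rightarrow> 'm \<Rightarrow> 'p" where
  "induced_map M1 M2 \<phi> = (\<lambda>(L1', L2') (L1, L2).
     (\<lambda>x \<in> carrier (quotient (M1\<lparr>carrier := L1\<rparr>) L1'). coset_rep (M2\<lparr>carrier := L2'\<rparr>) L2 (\<phi> x)))"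

definition Hom_base ::
    "('k, 'b) ring_scheme \<Rightarrow> ('k, 'a) module \<Rightarrow> ('a, 'm) module \<Rightarrow> ('a, 'p) module \<Rightarrow> ('m \<Rightarrow> 'p) set"
  where
  "Hom_base k K M1 M2 =
     linear_maps k (restrict_scalars (structure_map K) M1) (restrict_scalars (structure_map K) M2)"

primrec BT ::
    "('k, 'b) ring_scheme \<Rightarrow> ('k, 'a) module \<Rightarrow> 'a set list \<Rightarrow> ('a \<Rightarrow> 'a) list \<Rightarrow>
     ('a, 'm) module \<Rightarrow> ('a, 'p) module \<Rightarrow> ('m \<Rightarrow> 'p) set" where
  "BT k K [] \<sigma> M1 M2 = Hom_base k K M1 M2"
| "BT k K (V # Os) \<sigma> M1 M2 =
     {\<phi> \<in> Hom_base k K M1 M2.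
        (\<forall>L1 \<in> lattices K V M1. \<forall>L2 \<in> lattices K V M2.
           \<exists>L1' L2'. refinement K V M1 M2 \<phi> (L1', L2') (L1, L2)) \<and>
        (\<forall>L1 L2 L1' L2'. refinement K V M1 M2 \<phi> (L1', L2') (L1, L2) \<longrightarrow>
           induced_map M1 M2 \<phi> (L1', L2') (L1, L2) \<in>
             BT k (residue_field K V) Os (tl \<sigma>) (rest (hd \<sigma>) M1 L1 L1') (rest (hd \<sigma>) M2 L2' L2))}"

text \<open>
  The subsets \<open>E\<^bsub>i,j\<^esub>\<close>, meant for \<open>1 \<le> i \<le> n\<close> and \<open>j \<in> {1, 2}\<close>; the value for \<open>n = 0\<close> is a dummy, never
  reached from such indices.
\<close>

primrec BT_ideal ::
    "('k, 'b) ring_scheme \<Rightarrow> ('k, 'a) module \<Rightarrow> 'a set list \<Rightarrow> ('a \<Rightarrow> 'a) list \<Rightarrow>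
     ('a, 'm) module \<Rightarrow> ('a, 'p) module \<Rightarrow> nat \<Rightarrow> nat \<Rightarrow> ('m \<Rightarrow> 'p) set" where
  "BT_ideal k K [] \<sigma> M1 M2 i j = {}"
| "BT_ideal k K (V # Os) \<sigma> M1 M2 i j =
     {\<phi> \<in> BT k K (V # Os) \<sigma> M1 M2.
        if i = 1 then
          (if j = 1 then \<exists>L2 \<in> lattices K V M2. \<phi> ` carrier M1 \<subseteq> L2
           else \<exists>L1 \<in> lattices K V M1. \<forall>x\<in>L1. \<phi> x = \<zero>\<^bsub>M2\<^esub>)
        else
          (\<forall>L1 L2 L1' L2'. refinement K V M1 M2 \<phi> (L1', L2') (L1, L2) \<longrightarrow>
             induced_map M1 M2 \<phi> (L1', L2') (L1, L2) \<in>
               BT_ideal k (residue_field K V) Os (tl \<sigma>)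
                 (rest (hd \<sigma>) M1 L1 L1') (rest (hd \<sigma>) M2 L2' L2) (i - 1) j)}"

definition BT_field ::
    "('k, 'b) ring_scheme \<Rightarrow> ('k, 'a) module \<Rightarrow> 'a set list \<Rightarrow> ('a \<Rightarrow> 'a) list \<Rightarrow> ('a \<Rightarrow> 'a) set" where
  "BT_field k K Os \<sigma> = BT k K Os \<sigma> (regular_module K) (regular_module K)"

definition BT_field_ideal ::
    "('k, 'b) ring_scheme \<Rightarrow> ('k, 'a) module \<Rightarrow> 'a set list \<Rightarrow> ('a \<Rightarrow> 'a) list \<Rightarrow> nat \<Rightarrow> nat \<Rightarrow>
     ('a \<Rightarrow> 'a) set" where
  "BT_field_ideal k K Os \<sigma> i j = BT_ideal k K Os \<sigma> (regular_module K) (regular_module K) i j"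

end

theory Submission
  imports Defs
begin

text \<open>
  The system \<open>\<sigma>\<close> enters only through the module structures on the quotients \<open>L'/L\<close> of lattices.  The
  structures given by two liftings \<open>\<sigma>\<^sub>1\<close> and \<open>\<sigma>\<^sub>1'\<close> are compared by the identity map of \<open>L'/L\<close>.  Since
  \<open>\<sigma>\<^sub>1 - \<sigma>\<^sub>1'\<close> has values in the maximal ideal, which is nilpotent on \<open>L'/L\<close>, the iterated commutators of this map
  with scalars vanish: its coordinates are continuous differential operators on the residue field \<open>k\<^sub>1(K)\<close>.  By
  induction on the dimension, a continuous differential operator on a topological local field is a
  BT operator for every system of liftings, so the identity maps are BT operators.  As BT operators are
  closed under composition and the \<open>E\<^sub>i\<^sub>,\<^sub>j\<close> under composition with BT operators, nothing depends on \<open>\<sigma>\<close>.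

  For the lattice condition in that induction, a continuous differential operator on \<open>k'((t\<^sub>1, \<dots>, t\<^sub>n))\<close> has
  to shift the \<open>t\<^sub>1\<close>-adic filtration by a bounded amount.  This is proved along the tower of Laurent series rings,
  starting from the finiteness of \<open>k'\<close> over \<open>k\<close>.
\<close>

section \<open>Finitely generated modules\<close>

text \<open>Comparing two liftings on L'/L produces operators that are not linear over the residue
  field, and whose order grows with the power of t that kills L'/L. The induction therefore runs
  over continuous differential operators of every order. An operator E from k_1(K) to O_1 is
  expanded t-adically as E = s o E0 + t E1. Its reduction E0 is again a continuous differential
  operator, now on k_1(K), and finitely many steps exhaust L'/L. Continuity is what bounds the shift
  of the filtration: commutators control an operator on Laurent polynomials only, and density
  extends the bound to all series. This calls for an explicit form of the fine topologies, in which
  Laurent polynomials are dense and coefficients are continuous. The second obstacle is that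
  condition (ii) ranges over all refinements, whereas sums and composites are visible only on
  suitable ones. Vector spaces over the residue field split, so the induced map of a given
  refinement is recovered from that of a larger one by a linear section and a linear
  retraction.\<close>

definition lin :: "('r, 'b) ring_scheme \<Rightarrow> ('r, 'm) module \<Rightarrow> ('r, 'p) module \<Rightarrow> ('m \<Rightarrow> 'p) \<Rightarrow> bool" where
  "lin R M N \<phi> \<longleftrightarrow> \<phi> \<in> carrier M \<rightarrow> carrier N \<and>
     (\<forall>x\<in>carrier M. \<forall>y\<in>carrier M. \<phi> (x \<oplus>\<^bsub>M\<^esub> y) = \<phi> x \<oplus>\<^bsub>N\<^esub> \<phi> y) \<and>
     (\<forall>r\<in>carrier R. \<forall>x\<in>carrier M. \<phi> (r \<odot>\<^bsub>M\<^esub> x) = r \<odot>\<^bsub>N\<^esub> \<phi> x)"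

text \<open>Linearity without extensionality lets maps be given by plain formulas;
  \<open>linear_maps_restrict\<close> returns to extensional ones.\<close>

lemma linear_maps_eq: "linear_maps R M N = {\<phi>. lin R M N \<phi> \<and> \<phi> \<in> extensional (carrier M)}"
  unfolding linear_maps_def lin_def by (auto simp: PiE_def)

lemma span_least: "submodule N R M \<Longrightarrow> S \<subseteq> N \<Longrightarrow> span_module R M S \<subseteq> N"
  unfolding span_module_def by auto

lemma span_superset: "S \<subseteq> span_module R M S"
  unfolding span_module_def by auto

lemma span_submodule:
  assumes "Module.module R M" "S \<subseteq> carrier M"
  shows "submodule (span_module R M S) R M"
proof -
  interpret M: Module.module R M by fact
  let ?X = "{N. submodule N R M \<and> S \<subseteq> N}"
  have c: "carrier M \<in> ?X" using M.carrier_is_submodule assms(2) by simp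
  have z: "\<zero>\<^bsub>M\<^esub> \<in> N" if "N \<in> ?X" for N using that by (simp add: submodule_def subgroup_def)
  have i: "\<ominus>\<^bsub>M\<^esub> a \<in> N" if "N \<in> ?X" "a \<in> N" for N a using that M.submoduleE(3) by blast
  have p: "a \<oplus>\<^bsub>M\<^esub> b \<in> N" if "N \<in> ?X" "a \<in> N" "b \<in> N" for N a b using that M.submoduleE(5) by blast
  have m: "a \<odot>\<^bsub>M\<^esub> b \<in> N" if "N \<in> ?X" "a \<in> carrier R" "b \<in> N" for N a b using that M.submoduleE(4) by blast
  show ?thesis
    unfolding span_module_def
  proof (rule M.submoduleI)
    show "\<Inter> ?X \<subseteq> carrier M" using c by blast
  qed (use z i p m in blast)+
qed

lemma finite_submodule_submodule:
  assumes "Module.module R M" "finite_submodule R M N"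
  shows "submodule N R M" "N \<subseteq> carrier M"
proof -
  interpret M: Module.module R M by fact
  show "submodule N R M" using assms span_submodule unfolding finite_submodule_def by auto
  then show "N \<subseteq> carrier M" using M.submoduleE by blast
qed

lemma lin_facts:
  assumes "Module.module R M" "Module.module R N" "lin R M N \<phi>"
  shows "x \<in> carrier M \<Longrightarrow> \<phi> x \<in> carrier N"
    "x \<in> carrier M \<Longrightarrow> y \<in> carrier M \<Longrightarrow> \<phi> (x \<oplus>\<^bsub>M\<^esub> y) = \<phi> x \<oplus>\<^bsub>N\<^esub> \<phi> y"
    "r \<in> carrier R \<Longrightarrow> x \<in> carrier M \<Longrightarrow> \<phi> (r \<odot>\<^bsub>M\<^esub> x) = r \<odot>\<^bsub>N\<^esub> \<phi> x"
    "\<phi> \<zero>\<^bsub>M\<^esub> = \<zero>\<^bsub>N\<^esub>"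
    "x \<in> carrier M \<Longrightarrow> \<phi> (\<ominus>\<^bsub>M\<^esub> x) = \<ominus>\<^bsub>N\<^esub> \<phi> x"
    "x \<in> carrier M \<Longrightarrow> y \<in> carrier M \<Longrightarrow> \<phi> (x \<ominus>\<^bsub>M\<^esub> y) = \<phi> x \<ominus>\<^bsub>N\<^esub> \<phi> y"
proof -
  interpret M: Module.module R M by fact
  interpret N: Module.module R N by fact
  show c: "x \<in> carrier M \<Longrightarrow> \<phi> x \<in> carrier N" for x
    using assms(3) by (auto simp: lin_def)
  show a: "x \<in> carrier M \<Longrightarrow> y \<in> carrier M \<Longrightarrow> \<phi> (x \<oplus>\<^bsub>M\<^esub> y) = \<phi> x \<oplus>\<^bsub>N\<^esub> \<phi> y" for x y
    using assms(3) by (auto simp: lin_def)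
  show "r \<in> carrier R \<Longrightarrow> x \<in> carrier M \<Longrightarrow> \<phi> (r \<odot>\<^bsub>M\<^esub> x) = r \<odot>\<^bsub>N\<^esub> \<phi> x"
    using assms(3) by (auto simp: lin_def)
  show z: "\<phi> \<zero>\<^bsub>M\<^esub> = \<zero>\<^bsub>N\<^esub>"
    using a[of "\<zero>\<^bsub>M\<^esub>" "\<zero>\<^bsub>M\<^esub>"] c[of "\<zero>\<^bsub>M\<^esub>"] by simp
  show m: "x \<in> carrier M \<Longrightarrow> \<phi> (\<ominus>\<^bsub>M\<^esub> x) = \<ominus>\<^bsub>N\<^esub> \<phi> x" for x
    using a[of "\<ominus>\<^bsub>M\<^esub> x" x] c z by (metis M.a_inv_closed M.l_neg N.minus_equality)
  show "x \<in> carrier M \<Longrightarrow> y \<in> carrier M \<Longrightarrow> \<phi> (x \<ominus>\<^bsub>M\<^esub> y) = \<phi> x \<ominus>\<^bsub>N\<^esub> \<phi> y"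
    using a m by (simp add: a_minus_def)
qed

lemma lin_vimage_submodule:
  assumes "Module.module R M" "Module.module R N" "lin R M N \<phi>" "submodule N' R N"
  shows "submodule {x \<in> carrier M. \<phi> x \<in> N'} R M"
proof -
  interpret M: Module.module R M by fact
  interpret N: Module.module R N by fact
  note E = N.submoduleE[OF assms(4)]
  have "\<zero>\<^bsub>N\<^esub> \<in> N'" using assms(4) by (simp add: submodule_def subgroup_def)
  then show ?thesis
    by (intro M.submoduleI) (auto simp: lin_facts[OF assms(1-3)] E)
qed

lemma lin_image_submodule:
  assumes "Module.module R M" "Module.module R N" "lin R M N \<phi>" "submodule M' R M"
  shows "submodule (\<phi> ` M') R N"
proof -
  interpret M: Module.module R M by fact
  interpret N: Module.module R N by fact
  note f = lin_facts[OF assms(1-3)]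
  have s: "M' \<subseteq> carrier M" using M.submoduleE[OF assms(4)] by auto
  have z: "\<zero>\<^bsub>M\<^esub> \<in> M'" using assms(4) by (simp add: submodule_def subgroup_def)
  show ?thesis
  proof (rule N.submoduleI)
    show "\<phi> ` M' \<subseteq> carrier N" using s f by auto
    show "\<zero>\<^bsub>N\<^esub> \<in> \<phi> ` M'" using f(4) z by force
    show "\<ominus>\<^bsub>N\<^esub> a \<in> \<phi> ` M'" if a: "a \<in> \<phi> ` M'" for a
    proof -
      obtain x where x: "x \<in> M'" "a = \<phi> x" using a by auto
      then have "\<ominus>\<^bsub>N\<^esub> a = \<phi> (\<ominus>\<^bsub>M\<^esub> x)" using f(5)[of x] subsetD[OF s] by auto
      then show ?thesis using M.submoduleE(3)[OF assms(4) x(1)] by auto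
    qed
    show "a \<oplus>\<^bsub>N\<^esub> b \<in> \<phi> ` M'" if ab: "a \<in> \<phi> ` M'" "b \<in> \<phi> ` M'" for a b
    proof -
      obtain x y where x: "x \<in> M'" "a = \<phi> x" "y \<in> M'" "b = \<phi> y" using ab by auto
      then have "a \<oplus>\<^bsub>N\<^esub> b = \<phi> (x \<oplus>\<^bsub>M\<^esub> y)" using f(2)[of x y] subsetD[OF s] by auto
      then show ?thesis using M.submoduleE(5)[OF assms(4) x(1,3)] by auto
    qed
    show "a \<odot>\<^bsub>N\<^esub> x \<in> \<phi> ` M'" if ax: "a \<in> carrier R" "x \<in> \<phi> ` M'" for a x
    proof -
      obtain y where y: "y \<in> M'" "x = \<phi> y" using ax by auto
      then have "a \<odot>\<^bsub>N\<^esub> x = \<phi> (a \<odot>\<^bsub>M\<^esub> y)" using f(3)[of a y] subsetD[OF s] ax by auto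
      then show ?thesis using M.submoduleE(4)[OF assms(4) ax(1) y(1)] by auto
    qed
  qed
qed

text \<open>Both inclusions follow from the minimality of spans, applied once to a preimage and once
  to an image of a submodule.\<close>

lemma lin_span_image:
  assumes "Module.module R M" "Module.module R N" "lin R M N \<phi>" "S \<subseteq> carrier M"
  shows "\<phi> ` span_module R M S = span_module R N (\<phi> ` S)"
proof
  have c: "\<phi> ` S \<subseteq> carrier N" using assms(3,4) by (auto simp: lin_def)
  have "span_module R M S \<subseteq> {x \<in> carrier M. \<phi> x \<in> span_module R N (\<phi> ` S)}"
    using assms(4) span_superset[of "\<phi> ` S" R N]
    by (intro span_least lin_vimage_submodule[OF assms(1-3)] span_submodule assms c) auto
  then show "\<phi> ` span_module R M S \<subseteq> span_module R N (\<phi> ` S)" by auto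
  show "span_module R N (\<phi> ` S) \<subseteq> \<phi> ` span_module R M S"
    using span_superset[of S R M]
    by (intro span_least lin_image_submodule[OF assms(1-3)] span_submodule assms) auto
qed

lemma finite_submodule_image:
  assumes "Module.module R M" "Module.module R N" "lin R M N \<phi>" "finite_submodule R M M'"
  shows "finite_submodule R N (\<phi> ` M')"
proof -
  obtain S where S: "finite S" "S \<subseteq> carrier M" "M' = span_module R M S"
    using assms(4) by (auto simp: finite_submodule_def)
  have "\<phi> ` S \<subseteq> carrier N" using S assms(3) by (auto simp: lin_def)
  then show ?thesis using S lin_span_image[OF assms(1-3) S(2)] unfolding finite_submodule_def
    by (intro exI[of _ "\<phi> ` S"]) auto
qed

lemma finite_submodule_join:
  assumes "Module.module R M" "finite_submodule R M N1" "finite_submodule R M N2"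
  obtains N where "finite_submodule R M N" "N1 \<subseteq> N" "N2 \<subseteq> N"
proof -
  obtain S1 S2 where S: "finite S1" "S1 \<subseteq> carrier M" "N1 = span_module R M S1"
     "finite S2" "S2 \<subseteq> carrier M" "N2 = span_module R M S2"
    using assms(2,3) by (auto simp: finite_submodule_def)
  let ?N = "span_module R M (S1 \<union> S2)"
  have sub: "submodule ?N R M" using S by (intro span_submodule assms) auto
  show ?thesis
  proof
    show "finite_submodule R M ?N" using S unfolding finite_submodule_def by blast
    show "N1 \<subseteq> ?N" "N2 \<subseteq> ?N" unfolding S(3,6)
      using span_superset[of "S1 \<union> S2" R M] by (intro span_least[OF sub]; auto)+
  qed
qed

definition fgmod :: "('r, 'b) ring_scheme \<Rightarrow> ('r, 'm) module \<Rightarrow> bool" where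
  "fgmod R M \<longleftrightarrow> Module.module R M \<and> finite_submodule R M (carrier M)"

lemma fgmod_module: "fgmod R M \<Longrightarrow> Module.module R M"
  by (simp add: fgmod_def)

section \<open>Lattices\<close>

text \<open>The axiom \<open>exhaust\<close> amounts to K = V[1/t]. Lattices are handled through
  multiples by powers of \<open>t\<close> alone; this is how the valuation enters.\<close>

locale valued = field K for K :: "('k, 'a) module" (structure) +
  fixes V :: "'a set" and t :: 'a
  assumes V_subring: "subring V K" and t_V: "t \<in> V" and t_nz: "t \<noteq> \<zero>"
    and exhaust: "x \<in> carrier K \<Longrightarrow> \<exists>n::nat. t [^] n \<otimes> x \<in> V"
begin

abbreviation (input) R where "R \<equiv> K\<lparr>carrier := V\<rparr>"

lemma V_sub: "V \<subseteq> carrier K" using subringE(1)[OF V_subring] .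
lemma V_in[simp, intro]: "x \<in> V \<Longrightarrow> x \<in> carrier K" using V_sub by auto
lemma t_K[simp]: "t \<in> carrier K" using t_V by auto
lemma V_closed[simp, intro]: "\<zero> \<in> V" "\<one> \<in> V" "x \<in> V \<Longrightarrow> y \<in> V \<Longrightarrow> x \<oplus> y \<in> V"
  "x \<in> V \<Longrightarrow> y \<in> V \<Longrightarrow> x \<otimes> y \<in> V" "x \<in> V \<Longrightarrow> \<ominus> x \<in> V"
  using subringE[OF V_subring] by auto
lemma V_minus[simp, intro]: "x \<in> V \<Longrightarrow> y \<in> V \<Longrightarrow> x \<ominus> y \<in> V" by (simp add: a_minus_def)
lemma V_pow[simp, intro]: "x \<in> V \<Longrightarrow> x [^] (n::nat) \<in> V" by (induction n) auto
lemma tpow_nz: "t [^] (n::nat) \<noteq> \<zero>" using t_nz t_K by (induction n) (auto simp: integral_iff)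

lemma R_cring: "cring R"
  using subcring_iff[OF V_sub] subcringI'[OF V_subring] by simp

lemma module_R: assumes "Module.module K M" shows "Module.module R M"
proof -
  interpret M: Module.module K M by fact
  show ?thesis
    by (rule moduleI) (auto simp: R_cring M.abelian_group_axioms M.smult_l_distr M.smult_r_distr M.smult_assoc1)
qed

lemma lattice_facts:
  assumes "Module.module K M" "L \<in> lattices K V M"
  shows "submodule L R M" "L \<subseteq> carrier M" "finite_submodule R M L" "span_module K M L = carrier M"
proof -
  show f: "finite_submodule R M L" and "span_module K M L = carrier M"
    using assms(2) by (simp_all add: lattices_def)
  show "submodule L R M" "L \<subseteq> carrier M"
    using finite_submodule_submodule[OF module_R[OF assms(1)] f] .
qed

lemma lattice_mem:
  assumes "Module.module K M" "L \<in> lattices K V M"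
  shows "\<zero>\<^bsub>M\<^esub> \<in> L" "x \<in> L \<Longrightarrow> x \<in> carrier M" "x \<in> L \<Longrightarrow> y \<in> L \<Longrightarrow> x \<oplus>\<^bsub>M\<^esub> y \<in> L"
    "x \<in> L \<Longrightarrow> y \<in> L \<Longrightarrow> x \<ominus>\<^bsub>M\<^esub> y \<in> L" "a \<in> V \<Longrightarrow> x \<in> L \<Longrightarrow> a \<odot>\<^bsub>M\<^esub> x \<in> L"
proof -
  interpret M: Module.module R M using module_R[OF assms(1)] .
  note s = lattice_facts[OF assms]
  note E = M.submoduleE[OF s(1)]
  show "\<zero>\<^bsub>M\<^esub> \<in> L" using s(1) by (simp add: submodule_def subgroup_def)
  show "x \<in> L \<Longrightarrow> x \<in> carrier M" using s(2) by auto
  show "x \<in> L \<Longrightarrow> y \<in> L \<Longrightarrow> x \<oplus>\<^bsub>M\<^esub> y \<in> L" "x \<in> L \<Longrightarrow> y \<in> L \<Longrightarrow> x \<ominus>\<^bsub>M\<^esub> y \<in> L"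
    "a \<in> V \<Longrightarrow> x \<in> L \<Longrightarrow> a \<odot>\<^bsub>M\<^esub> x \<in> L"
    using E by (auto simp: a_minus_def)
qed

text \<open>The elements that some power of \<open>t\<close> carries into L form a K-subspace
  containing L, hence all of M. One exponent serves the finitely many generators of N, and therefore
  N itself.\<close>

lemma lattice_absorb:
  assumes "Module.module K M" "L \<in> lattices K V M" "finite_submodule R M N"
  shows "\<exists>n::nat. \<forall>x\<in>N. t [^] n \<odot>\<^bsub>M\<^esub> x \<in> L"
proof -
  interpret M: Module.module K M by fact
  note s = lattice_facts[OF assms(1,2)] and m = lattice_mem[OF assms(1,2)]
  \<comment> \<open>An exponent that works may be increased, because \<open>t\<close> lies in V; so
    finitely many exponents have a common one.\<close>
  have mono: "t [^] (n + k) \<odot>\<^bsub>M\<^esub> x \<in> L" if "t [^] n \<odot>\<^bsub>M\<^esub> x \<in> L" "x \<in> carrier M" for n k :: nat and x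
  proof -
    have "t [^] (n + k) \<odot>\<^bsub>M\<^esub> x = t [^] k \<odot>\<^bsub>M\<^esub> (t [^] n \<odot>\<^bsub>M\<^esub> x)"
      using that by (simp add: M.smult_assoc1[symmetric] nat_pow_mult add.commute)
    then show ?thesis using that m(5) t_V by auto
  qed
  have ex: "\<exists>n. t [^] (n::nat) \<odot>\<^bsub>M\<^esub> x \<in> L" if "x \<in> carrier M" for x
  proof -
    let ?W = "{x \<in> carrier M. \<exists>n. t [^] (n::nat) \<odot>\<^bsub>M\<^esub> x \<in> L}"
    have W: "submodule ?W K M"
    proof (rule M.submoduleI)
      show "\<zero>\<^bsub>M\<^esub> \<in> ?W" using m(1) by auto
      show "\<ominus>\<^bsub>M\<^esub> a \<in> ?W" if a: "a \<in> ?W" for a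
      proof -
        obtain n where n: "t [^] (n::nat) \<odot>\<^bsub>M\<^esub> a \<in> L" "a \<in> carrier M" using a by auto
        have "t [^] n \<odot>\<^bsub>M\<^esub> (\<ominus>\<^bsub>M\<^esub> a) = \<zero>\<^bsub>M\<^esub> \<ominus>\<^bsub>M\<^esub> t [^] n \<odot>\<^bsub>M\<^esub> a"
          using n by (simp add: M.smult_r_minus a_minus_def)
        also have "\<dots> \<in> L" by (rule m(4)[OF m(1) n(1)])
        finally show ?thesis using n(2) by blast
      qed
      show "a \<oplus>\<^bsub>M\<^esub> b \<in> ?W" if a: "a \<in> ?W" "b \<in> ?W" for a b
      proof -
        obtain n k where n: "t [^] (n::nat) \<odot>\<^bsub>M\<^esub> a \<in> L" "a \<in> carrier M" 
          "t [^] (k::nat) \<odot>\<^bsub>M\<^esub> b \<in> L" "b \<in> carrier M" using a by auto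
        have "t [^] (n + k) \<odot>\<^bsub>M\<^esub> a \<in> L" "t [^] (n + k) \<odot>\<^bsub>M\<^esub> b \<in> L"
          using mono[of n a k] mono[of k b n] n by (auto simp: add.commute)
        then have "t [^] (n + k) \<odot>\<^bsub>M\<^esub> (a \<oplus>\<^bsub>M\<^esub> b) \<in> L" using m(3) n(2,4) by (simp add: M.smult_r_distr)
        then show ?thesis using n(2,4) by blast
      qed
      show "c \<odot>\<^bsub>M\<^esub> x \<in> ?W" if c: "c \<in> carrier K" "x \<in> ?W" for c x
      proof -
        obtain n where n: "t [^] (n::nat) \<odot>\<^bsub>M\<^esub> x \<in> L" "x \<in> carrier M" using c by auto
        obtain k where k: "t [^] (k::nat) \<otimes> c \<in> V" using exhaust c by auto
        have "t [^] (n + k) \<otimes> c = (t [^] k \<otimes> c) \<otimes> t [^] n"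
          using c by (simp add: nat_pow_mult[symmetric] m_ac)
        then have "t [^] (n + k) \<odot>\<^bsub>M\<^esub> (c \<odot>\<^bsub>M\<^esub> x) = (t [^] k \<otimes> c) \<odot>\<^bsub>M\<^esub> (t [^] n \<odot>\<^bsub>M\<^esub> x)"
          using n c by (simp add: M.smult_assoc1[symmetric])
        moreover have "\<dots> \<in> L" by (rule m(5)[OF k n(1)])
        ultimately have "t [^] (n + k) \<odot>\<^bsub>M\<^esub> (c \<odot>\<^bsub>M\<^esub> x) \<in> L" by simp
        then show ?thesis using n c by blast
      qed
    qed auto
    have "x \<in> ?W" if "x \<in> L" for x
    proof -
      have "t [^] (0::nat) \<odot>\<^bsub>M\<^esub> x \<in> L" using that s(2) by (simp add: subset_iff)
      then show ?thesis using that s(2) by blast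
    qed
    then have "L \<subseteq> ?W" by blast
    then have "span_module K M L \<subseteq> ?W" by (rule span_least[OF W])
    then show ?thesis using that s by auto
  qed
  obtain S where S: "finite S" "S \<subseteq> carrier M" "N = span_module R M S"
    using assms(3) by (auto simp: finite_submodule_def)
  have "\<exists>n. \<forall>x\<in>S. t [^] (n::nat) \<odot>\<^bsub>M\<^esub> x \<in> L"
    using S(1,2)
  proof (induction S)
    case (insert x S)
    then obtain n k where "\<forall>x\<in>S. t [^] (n::nat) \<odot>\<^bsub>M\<^esub> x \<in> L" "t [^] (k::nat) \<odot>\<^bsub>M\<^esub> x \<in> L"
      using ex[of x] by auto
    then show ?case using insert.prems mono[of n _ k] mono[of k x n]
      by (intro exI[of _ "n + k"]) (auto simp: add.commute)
  qed auto
  then obtain n where n: "\<forall>x\<in>S. t [^] (n::nat) \<odot>\<^bsub>M\<^esub> x \<in> L" by auto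
  \<comment> \<open>Multiplication by t^n is V-linear, so the preimage of L is a V-submodule; it
    contains S and hence its span N.\<close>
  have "lin R M M (\<lambda>x. t [^] n \<odot>\<^bsub>M\<^esub> x)"
    unfolding lin_def by (auto simp: M.smult_r_distr M.smult_assoc1[symmetric] m_comm)
  from lin_vimage_submodule[OF module_R[OF assms(1)] module_R[OF assms(1)] this s(1)]
  have "N \<subseteq> {x \<in> carrier M. t [^] n \<odot>\<^bsub>M\<^esub> x \<in> L}"
    unfolding S(3) by (rule span_least) (use n S in auto)
  then show ?thesis by auto
qed

text \<open>Multiplication by the inverse of \<open>u\<close> recovers L inside the K-span of u L,
  so u L spans M as well.\<close>

lemma lattice_scale:
  assumes "Module.module K M" "L \<in> lattices K V M" "u \<in> carrier K" "u \<noteq> \<zero>"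
  shows "(\<lambda>x. u \<odot>\<^bsub>M\<^esub> x) ` L \<in> lattices K V M"
proof -
  interpret M: Module.module K M by fact
  note s = lattice_facts[OF assms(1,2)]
  have l: "lin R M M (\<lambda>x. u \<odot>\<^bsub>M\<^esub> x)"
    unfolding lin_def using assms(3) by (auto simp: M.smult_r_distr M.smult_assoc1[symmetric] m_comm)
  have f: "finite_submodule R M ((\<lambda>x. u \<odot>\<^bsub>M\<^esub> x) ` L)"
    by (rule finite_submodule_image[OF module_R[OF assms(1)] module_R[OF assms(1)] l s(3)])
  have c: "(\<lambda>x. u \<odot>\<^bsub>M\<^esub> x) ` L \<subseteq> carrier M" using s(2) assms(3) by blast
  have sm: "submodule (span_module K M ((\<lambda>x. u \<odot>\<^bsub>M\<^esub> x) ` L)) K M" by (intro span_submodule c assms)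
  have "L \<subseteq> span_module K M ((\<lambda>x. u \<odot>\<^bsub>M\<^esub> x) ` L)"
  proof
    fix x assume x: "x \<in> L"
    have xc: "x \<in> carrier M" using x s(2) by blast
    have u: "inv u \<in> carrier K" "inv u \<otimes> u = \<one>" using assms(3,4) field_Units by auto
    have "inv u \<odot>\<^bsub>M\<^esub> (u \<odot>\<^bsub>M\<^esub> x) = x"
      using xc u assms(3) by (simp add: M.smult_assoc1[symmetric])
    moreover have "inv u \<odot>\<^bsub>M\<^esub> (u \<odot>\<^bsub>M\<^esub> x) \<in> span_module K M ((\<lambda>x. u \<odot>\<^bsub>M\<^esub> x) ` L)"
      by (rule M.submoduleE(4)[OF sm u(1)]) (rule subsetD[OF span_superset imageI[OF x]])
    ultimately show "x \<in> span_module K M ((\<lambda>x. u \<odot>\<^bsub>M\<^esub> x) ` L)" by simp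
  qed
  from span_least[OF sm this] have "carrier M \<subseteq> span_module K M ((\<lambda>x. u \<odot>\<^bsub>M\<^esub> x) ` L)"
    unfolding s(4) .
  moreover have "span_module K M ((\<lambda>x. u \<odot>\<^bsub>M\<^esub> x) ` L) \<subseteq> carrier M"
    using M.submoduleE(1)[OF sm] .
  ultimately show ?thesis using f by (auto simp: lattices_def)
qed

lemma lattice_superset:
  assumes "Module.module K M" "L \<in> lattices K V M" "finite_submodule R M N" "L \<subseteq> N"
  shows "N \<in> lattices K V M"
proof -
  interpret M: Module.module K M by fact
  have c: "N \<subseteq> carrier M" using finite_submodule_submodule[OF module_R[OF assms(1)] assms(3)] by simp
  note sm = span_submodule[OF assms(1) c]
  have "carrier M \<subseteq> span_module K M N" unfolding lattice_facts(4)[OF assms(1,2), symmetric]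
    by (rule span_least[OF sm]) (rule subset_trans[OF assms(4) span_superset])
  then show ?thesis using assms(3) M.submoduleE(1)[OF sm] by (auto simp: lattices_def)
qed

lemma lattice_join:
  assumes "Module.module K M" "L \<in> lattices K V M" "finite_submodule R M N"
  obtains L' where "L' \<in> lattices K V M" "L \<subseteq> L'" "N \<subseteq> L'"
  using finite_submodule_join[OF module_R[OF assms(1)] lattice_facts(3)[OF assms(1,2)] assms(3)]
    lattice_superset[OF assms(1,2)] by metis

text \<open>For the intersection of L1 and L2 finite generation would have to be shown; a multiple
  t^n L1 that is absorbed by L2 serves instead.\<close>

lemma lattice_meet:
  assumes "Module.module K M" "L1 \<in> lattices K V M" "L2 \<in> lattices K V M"
  obtains L where "L \<in> lattices K V M" "L \<subseteq> L1" "L \<subseteq> L2"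
proof -
  obtain n where n: "\<forall>x\<in>L1. t [^] (n::nat) \<odot>\<^bsub>M\<^esub> x \<in> L2"
    using lattice_absorb[OF assms(1,3) lattice_facts(3)[OF assms(1,2)]] by auto
  show ?thesis
  proof
    show "(\<lambda>x. t [^] n \<odot>\<^bsub>M\<^esub> x) ` L1 \<in> lattices K V M"
      by (rule lattice_scale[OF assms(1,2)]) (auto simp: tpow_nz)
    show "(\<lambda>x. t [^] n \<odot>\<^bsub>M\<^esub> x) ` L1 \<subseteq> L1" using lattice_mem(5)[OF assms(1,2)] t_V by auto
    show "(\<lambda>x. t [^] n \<odot>\<^bsub>M\<^esub> x) ` L1 \<subseteq> L2" using n by auto
  qed
qed

text \<open>Generators of M over K span a lattice over V.\<close>

lemma lattice_exists:
  assumes "fgmod K M"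
  obtains L where "L \<in> lattices K V M"
proof -
  have m: "Module.module K M" using assms by (simp add: fgmod_def)
  interpret M: Module.module K M by fact
  obtain S where S: "finite S" "S \<subseteq> carrier M" "carrier M = span_module K M S"
    using assms by (auto simp: fgmod_def finite_submodule_def)
  let ?L = "span_module R M S"
  have f: "finite_submodule R M ?L" using S by (auto simp: finite_submodule_def)
  have c: "?L \<subseteq> carrier M" using finite_submodule_submodule[OF module_R[OF m] f] by simp
  note sm = span_submodule[OF m c]
  have "span_module K M S \<subseteq> span_module K M ?L"
    by (rule span_least[OF sm]) (rule subset_trans[OF span_superset span_superset])
  then have "span_module K M ?L = carrier M" using M.submoduleE(1)[OF sm] S(3) by blast
  then show ?thesis using that[of ?L] f by (simp add: lattices_def)
qed

end

section \<open>Linear maps, submodules and complements over a field\<close>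

lemma (in abelian_group) a_inv_zero[simp]: "\<ominus> \<zero> = \<zero>"
  by (rule minus_equality) auto

lemma linear_maps_lin: "\<phi> \<in> linear_maps R M N \<Longrightarrow> lin R M N \<phi>"
  by (simp add: linear_maps_eq)

lemma linear_maps_restrict:
  assumes "Module.module R M" "lin R M N \<phi>"
  shows "(\<lambda>x\<in>carrier M. \<phi> x) \<in> linear_maps R M N"
proof -
  interpret M: Module.module R M by fact
  show ?thesis using assms(2) unfolding linear_maps_eq lin_def by auto
qed

lemma submodule_mem:
  assumes "Module.module R M" "submodule N R M"
  shows "\<zero>\<^bsub>M\<^esub> \<in> N" "x \<in> N \<Longrightarrow> x \<in> carrier M" "x \<in> N \<Longrightarrow> y \<in> N \<Longrightarrow> x \<oplus>\<^bsub>M\<^esub> y \<in> N"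
    "x \<in> N \<Longrightarrow> y \<in> N \<Longrightarrow> x \<ominus>\<^bsub>M\<^esub> y \<in> N" "a \<in> carrier R \<Longrightarrow> x \<in> N \<Longrightarrow> a \<odot>\<^bsub>M\<^esub> x \<in> N"
    "x \<in> N \<Longrightarrow> \<ominus>\<^bsub>M\<^esub> x \<in> N"
proof -
  interpret M: Module.module R M by fact
  note E = M.submoduleE[OF assms(2)]
  show "\<zero>\<^bsub>M\<^esub> \<in> N" using assms(2) by (simp add: submodule_def subgroup_def)
  show "x \<in> N \<Longrightarrow> x \<in> carrier M" using E(1) by auto
  show "x \<in> N \<Longrightarrow> y \<in> N \<Longrightarrow> x \<oplus>\<^bsub>M\<^esub> y \<in> N" "x \<in> N \<Longrightarrow> y \<in> N \<Longrightarrow> x \<ominus>\<^bsub>M\<^esub> y \<in> N"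
    "a \<in> carrier R \<Longrightarrow> x \<in> N \<Longrightarrow> a \<odot>\<^bsub>M\<^esub> x \<in> N" "x \<in> N \<Longrightarrow> \<ominus>\<^bsub>M\<^esub> x \<in> N"
    using E by (auto simp: a_minus_def)
qed

lemma regular_module_simps[simp]:
  "carrier (regular_module A) = carrier A" "smult (regular_module A) = monoid.mult A"
  "add (regular_module A) = add A" "ring.zero (regular_module A) = ring.zero A"
  by (simp_all add: regular_module_def)

lemma regular_module_module: "cring F \<Longrightarrow> Module.module F (regular_module F)"
proof -
  assume "cring F"
  then interpret cring F .
  have "abelian_group (regular_module F)"
    by (rule abelian_groupI) (auto intro: a_assoc a_comm bexI[of _ "\<ominus>\<^bsub>F\<^esub> _"] simp: l_neg)
  then show ?thesis by (intro moduleI) (auto intro: is_cring l_distr r_distr m_assoc)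
qed

text \<open>The set is N + F y, written so that membership yields the coefficient of y.\<close>

lemma submodule_extend:
  assumes "Module.module F M" "submodule N F M" "y \<in> carrier M"
  shows "submodule {z \<in> carrier M. \<exists>a\<in>carrier F. z \<ominus>\<^bsub>M\<^esub> a \<odot>\<^bsub>M\<^esub> y \<in> N} F M"
proof -
  interpret M: Module.module F M by fact
  note m = submodule_mem[OF assms(1,2)]
  let ?W = "{z \<in> carrier M. \<exists>a\<in>carrier F. z \<ominus>\<^bsub>M\<^esub> a \<odot>\<^bsub>M\<^esub> y \<in> N}"
  show ?thesis
  proof (rule M.submoduleI)
    have "\<zero>\<^bsub>M\<^esub> \<ominus>\<^bsub>M\<^esub> \<zero>\<^bsub>F\<^esub> \<odot>\<^bsub>M\<^esub> y \<in> N" using m(1) assms(3) by (simp add: a_minus_def)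
    then show "\<zero>\<^bsub>M\<^esub> \<in> ?W" by auto
    show "\<ominus>\<^bsub>M\<^esub> x \<in> ?W" if x: "x \<in> ?W" for x
    proof -
      obtain a where a: "a \<in> carrier F" "x \<ominus>\<^bsub>M\<^esub> a \<odot>\<^bsub>M\<^esub> y \<in> N" "x \<in> carrier M" using x by auto
      have "\<ominus>\<^bsub>M\<^esub> x \<ominus>\<^bsub>M\<^esub> (\<ominus>\<^bsub>F\<^esub> a) \<odot>\<^bsub>M\<^esub> y = \<ominus>\<^bsub>M\<^esub> (x \<ominus>\<^bsub>M\<^esub> a \<odot>\<^bsub>M\<^esub> y)"
        using a assms(3) by (simp add: M.smult_l_minus a_minus_def M.minus_add)
      then have "\<ominus>\<^bsub>M\<^esub> x \<ominus>\<^bsub>M\<^esub> (\<ominus>\<^bsub>F\<^esub> a) \<odot>\<^bsub>M\<^esub> y \<in> N" using m(6)[OF a(2)] by simp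
      then show ?thesis using a(1,3) by (intro CollectI conjI bexI[of _ "\<ominus>\<^bsub>F\<^esub> a"]) simp_all
    qed
    show "x \<oplus>\<^bsub>M\<^esub> x' \<in> ?W" if x: "x \<in> ?W" "x' \<in> ?W" for x x'
    proof -
      obtain a b where a: "a \<in> carrier F" "x \<ominus>\<^bsub>M\<^esub> a \<odot>\<^bsub>M\<^esub> y \<in> N" "x \<in> carrier M" 
         "b \<in> carrier F" "x' \<ominus>\<^bsub>M\<^esub> b \<odot>\<^bsub>M\<^esub> y \<in> N" "x' \<in> carrier M" using x by auto
      have "(x \<oplus>\<^bsub>M\<^esub> x') \<ominus>\<^bsub>M\<^esub> (a \<oplus>\<^bsub>F\<^esub> b) \<odot>\<^bsub>M\<^esub> y = (x \<ominus>\<^bsub>M\<^esub> a \<odot>\<^bsub>M\<^esub> y) \<oplus>\<^bsub>M\<^esub> (x' \<ominus>\<^bsub>M\<^esub> b \<odot>\<^bsub>M\<^esub> y)"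
        using a assms(3) by (simp add: M.smult_l_distr a_minus_def M.minus_add M.add.m_ac)
      then have "(x \<oplus>\<^bsub>M\<^esub> x') \<ominus>\<^bsub>M\<^esub> (a \<oplus>\<^bsub>F\<^esub> b) \<odot>\<^bsub>M\<^esub> y \<in> N" using m(3)[OF a(2,5)] by simp
      then show ?thesis using a(1,3,4,6) by (intro CollectI conjI bexI[of _ "a \<oplus>\<^bsub>F\<^esub> b"]) simp_all
    qed
    show "c \<odot>\<^bsub>M\<^esub> x \<in> ?W" if x: "c \<in> carrier F" "x \<in> ?W" for c x
    proof -
      obtain a where a: "a \<in> carrier F" "x \<ominus>\<^bsub>M\<^esub> a \<odot>\<^bsub>M\<^esub> y \<in> N" "x \<in> carrier M" using x by auto
      have "c \<odot>\<^bsub>M\<^esub> x \<ominus>\<^bsub>M\<^esub> (c \<otimes>\<^bsub>F\<^esub> a) \<odot>\<^bsub>M\<^esub> y = c \<odot>\<^bsub>M\<^esub> (x \<ominus>\<^bsub>M\<^esub> a \<odot>\<^bsub>M\<^esub> y)"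
        using a x(1) assms(3) by (simp add: a_minus_def M.smult_r_distr M.smult_r_minus M.smult_assoc1)
      then have "c \<odot>\<^bsub>M\<^esub> x \<ominus>\<^bsub>M\<^esub> (c \<otimes>\<^bsub>F\<^esub> a) \<odot>\<^bsub>M\<^esub> y \<in> N" using m(5)[OF x(1) a(2)] by simp
      then show ?thesis using a(1,3) x(1) by (intro CollectI conjI bexI[of _ "c \<otimes>\<^bsub>F\<^esub> a"]) simp_all
    qed
  qed auto
qed

text \<open>
  An induction principle that builds a projection with kernel complementary to \<open>N\<close> as a finite sum of
  maps \<open>x \<mapsto> l x \<cdot> y\<close>.  It replaces the use of bases: sections, retractions and expansions in
  coordinates are all instances.
\<close>

lemma projection_induct:
  assumes "field F" "Module.module F M" "submodule N F M" "finite S" "S \<subseteq> carrier M"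
    "carrier M = span_module F M (N \<union> S)"
    and base: "P (\<lambda>x\<in>carrier M. \<zero>\<^bsub>M\<^esub>)"
    and step: "\<And>e l y. P e \<Longrightarrow> e \<in> linear_maps F M M \<Longrightarrow> l \<in> linear_maps F M (regular_module F) \<Longrightarrow>
      y \<in> carrier M \<Longrightarrow> P (\<lambda>x\<in>carrier M. e x \<oplus>\<^bsub>M\<^esub> l x \<odot>\<^bsub>M\<^esub> y)"
  shows "\<exists>e\<in>linear_maps F M M. P e \<and> (\<forall>x\<in>N. e x = \<zero>\<^bsub>M\<^esub>) \<and> (\<forall>x\<in>carrier M. x \<ominus>\<^bsub>M\<^esub> e x \<in> N)"
  using assms(4,3,5,6)
proof (induction S arbitrary: N)
  case empty
  interpret F: field F by fact
  interpret M: Module.module F M by fact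
  note m = submodule_mem[OF assms(2) empty.prems(1)]
  have "carrier M \<subseteq> N" using span_least[OF empty.prems(1), of N] empty.prems(3) by simp
  moreover define z where "z = (\<lambda>x\<in>carrier M. \<zero>\<^bsub>M\<^esub>)"
  have "z \<in> linear_maps F M M"
    unfolding z_def by (rule linear_maps_restrict[OF assms(2)]) (auto simp: lin_def)
  moreover have "P z" using base by (simp only: z_def)
  moreover have "z x = \<zero>\<^bsub>M\<^esub>" if "x \<in> carrier M" for x using that by (simp add: z_def)
  ultimately show ?case using m(2)
    by (intro bexI[of _ z] conjI ballI) (auto simp: a_minus_def)
next
  case (insert y S)
  interpret F: field F by fact
  interpret M: Module.module F M by fact
  note m = submodule_mem[OF assms(2) insert.prems(1)]
  have y: "y \<in> carrier M" and S: "S \<subseteq> carrier M" using insert.prems by auto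
  let ?N = "{z \<in> carrier M. \<exists>a\<in>carrier F. z \<ominus>\<^bsub>M\<^esub> a \<odot>\<^bsub>M\<^esub> y \<in> N}"
  have N': "submodule ?N F M" by (rule submodule_extend[OF assms(2) insert.prems(1) y])
  have NN: "N \<subseteq> ?N"
  proof
    fix z assume z: "z \<in> N"
    have "z \<ominus>\<^bsub>M\<^esub> \<zero>\<^bsub>F\<^esub> \<odot>\<^bsub>M\<^esub> y \<in> N" using z y m by (simp add: a_minus_def)
    then show "z \<in> ?N" using z m(2) by blast
  qed
  have yN: "y \<in> ?N"
  proof -
    have "y \<ominus>\<^bsub>M\<^esub> \<one>\<^bsub>F\<^esub> \<odot>\<^bsub>M\<^esub> y \<in> N" using y m(1) by (simp add: M.r_neg a_minus_def)
    then show ?thesis using y by blast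
  qed
  have c: "carrier M = span_module F M (?N \<union> S)"
  proof
    have sm: "submodule (span_module F M (?N \<union> S)) F M" by (rule span_submodule[OF assms(2)]) (use S in auto)
    have "N \<union> insert y S \<subseteq> span_module F M (?N \<union> S)"
      by (rule subset_trans[OF _ span_superset]) (use NN yN in auto)
    from span_least[OF sm this] show "carrier M \<subseteq> span_module F M (?N \<union> S)"
      using insert.prems(3) by simp
    show "span_module F M (?N \<union> S) \<subseteq> carrier M" using M.submoduleE(1)[OF sm] .
  qed
  obtain e where e: "e \<in> linear_maps F M M" "P e" "\<And>x. x \<in> ?N \<Longrightarrow> e x = \<zero>\<^bsub>M\<^esub>"
    "\<And>x. x \<in> carrier M \<Longrightarrow> x \<ominus>\<^bsub>M\<^esub> e x \<in> ?N"
    using insert.IH[OF N' S c] by auto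
  note el = lin_facts[OF assms(2,2) linear_maps_lin[OF e(1)]]
  show ?case
  proof (cases "y \<in> N")
    \<comment> \<open>If y lies in N, then N + F y = N and the map from the induction hypothesis
      already works.\<close>
    case True
    have "?N \<subseteq> N"
    proof
      fix z assume "z \<in> ?N"
      then obtain a where a: "a \<in> carrier F" "z \<ominus>\<^bsub>M\<^esub> a \<odot>\<^bsub>M\<^esub> y \<in> N" "z \<in> carrier M" by auto
      have "(z \<ominus>\<^bsub>M\<^esub> a \<odot>\<^bsub>M\<^esub> y) \<oplus>\<^bsub>M\<^esub> a \<odot>\<^bsub>M\<^esub> y = z"
        using a y by (simp add: a_minus_def M.a_assoc M.l_neg)
      then show "z \<in> N" using m(3)[OF a(2) m(5)[OF a(1) True]] by simp
    qed
    then show ?thesis using e NN by (intro bexI[OF _ e(1)]) auto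
  next
    case False
    \<comment> \<open>With y outside N the coefficient of y modulo N is unique: a nonzero multiple
      of y in N would, after division, put y itself into N.\<close>
    have uniq: "a = b" if ab: "a \<in> carrier F" "b \<in> carrier F" "z \<in> carrier M" "z \<ominus>\<^bsub>M\<^esub> a \<odot>\<^bsub>M\<^esub> y \<in> N"
        "z \<ominus>\<^bsub>M\<^esub> b \<odot>\<^bsub>M\<^esub> y \<in> N" for a b z
    proof (rule ccontr)
      assume "a \<noteq> b"
      then have d: "a \<ominus>\<^bsub>F\<^esub> b \<noteq> \<zero>\<^bsub>F\<^esub>" "a \<ominus>\<^bsub>F\<^esub> b \<in> carrier F" using ab by auto
      have "(z \<ominus>\<^bsub>M\<^esub> b \<odot>\<^bsub>M\<^esub> y) \<ominus>\<^bsub>M\<^esub> (z \<ominus>\<^bsub>M\<^esub> a \<odot>\<^bsub>M\<^esub> y) = a \<odot>\<^bsub>M\<^esub> y \<ominus>\<^bsub>M\<^esub> b \<odot>\<^bsub>M\<^esub> y"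
      proof -
        have "(z \<ominus>\<^bsub>M\<^esub> b \<odot>\<^bsub>M\<^esub> y) \<ominus>\<^bsub>M\<^esub> (z \<ominus>\<^bsub>M\<^esub> a \<odot>\<^bsub>M\<^esub> y) = (\<ominus>\<^bsub>M\<^esub> z \<oplus>\<^bsub>M\<^esub> z) \<oplus>\<^bsub>M\<^esub> (a \<odot>\<^bsub>M\<^esub> y \<ominus>\<^bsub>M\<^esub> b \<odot>\<^bsub>M\<^esub> y)"
          using ab y by (simp add: a_minus_def M.minus_add M.add.m_ac)
        then show ?thesis using ab y by (simp add: M.l_neg)
      qed
      also have "\<dots> = (a \<ominus>\<^bsub>F\<^esub> b) \<odot>\<^bsub>M\<^esub> y"
        using ab y by (simp add: a_minus_def M.smult_l_distr M.smult_l_minus)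
      finally have "(a \<ominus>\<^bsub>F\<^esub> b) \<odot>\<^bsub>M\<^esub> y \<in> N" using m(4)[OF ab(5,4)] by simp
      from m(5)[OF _ this, of "inv\<^bsub>F\<^esub> (a \<ominus>\<^bsub>F\<^esub> b)"]
      have "inv\<^bsub>F\<^esub> (a \<ominus>\<^bsub>F\<^esub> b) \<odot>\<^bsub>M\<^esub> ((a \<ominus>\<^bsub>F\<^esub> b) \<odot>\<^bsub>M\<^esub> y) \<in> N" using d by (simp add: F.field_Units)
      moreover have "inv\<^bsub>F\<^esub> (a \<ominus>\<^bsub>F\<^esub> b) \<odot>\<^bsub>M\<^esub> ((a \<ominus>\<^bsub>F\<^esub> b) \<odot>\<^bsub>M\<^esub> y) = y"
        using d y by (simp add: M.smult_assoc1[symmetric] F.field_Units)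
      ultimately show False using False by simp
    qed
    \<comment> \<open>The coordinate along y of the part of x that \<open>e\<close> leaves over.
      Additivity and homogeneity follow from uniqueness, since the sum or multiple of coordinates
      also satisfies the defining condition.\<close>
    define l0 where "l0 = (\<lambda>x. SOME a. a \<in> carrier F \<and> (x \<ominus>\<^bsub>M\<^esub> e x) \<ominus>\<^bsub>M\<^esub> a \<odot>\<^bsub>M\<^esub> y \<in> N)"
    have l0: "l0 x \<in> carrier F" "(x \<ominus>\<^bsub>M\<^esub> e x) \<ominus>\<^bsub>M\<^esub> l0 x \<odot>\<^bsub>M\<^esub> y \<in> N" if "x \<in> carrier M" for x
    proof -
      have "\<exists>a. a \<in> carrier F \<and> (x \<ominus>\<^bsub>M\<^esub> e x) \<ominus>\<^bsub>M\<^esub> a \<odot>\<^bsub>M\<^esub> y \<in> N" using e(4)[OF that] by auto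
      from someI_ex[OF this] show "l0 x \<in> carrier F" "(x \<ominus>\<^bsub>M\<^esub> e x) \<ominus>\<^bsub>M\<^esub> l0 x \<odot>\<^bsub>M\<^esub> y \<in> N"
        by (simp_all add: l0_def)
    qed
    have l0_eq: "l0 x = a" if "x \<in> carrier M" "a \<in> carrier F" "(x \<ominus>\<^bsub>M\<^esub> e x) \<ominus>\<^bsub>M\<^esub> a \<odot>\<^bsub>M\<^esub> y \<in> N" for x a
      by (rule uniq[OF l0(1)[OF that(1)] that(2) _ l0(2)[OF that(1)] that(3)]) (use that el(1) in simp)
    have "lin F M (regular_module F) l0"
      unfolding lin_def
    proof (intro conjI ballI)
      show "l0 \<in> carrier M \<rightarrow> carrier (regular_module F)" using l0 by auto
      fix x z assume xz: "x \<in> carrier M" "z \<in> carrier M"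
      have "((x \<oplus>\<^bsub>M\<^esub> z) \<ominus>\<^bsub>M\<^esub> e (x \<oplus>\<^bsub>M\<^esub> z)) \<ominus>\<^bsub>M\<^esub> (l0 x \<oplus>\<^bsub>F\<^esub> l0 z) \<odot>\<^bsub>M\<^esub> y =
        ((x \<ominus>\<^bsub>M\<^esub> e x) \<ominus>\<^bsub>M\<^esub> l0 x \<odot>\<^bsub>M\<^esub> y) \<oplus>\<^bsub>M\<^esub> ((z \<ominus>\<^bsub>M\<^esub> e z) \<ominus>\<^bsub>M\<^esub> l0 z \<odot>\<^bsub>M\<^esub> y)"
        using xz l0(1) el(1,2) y by (simp add: a_minus_def M.smult_l_distr M.minus_add M.add.m_ac)
      also have "\<dots> \<in> N" by (rule m(3)[OF l0(2)[OF xz(1)] l0(2)[OF xz(2)]])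
      finally show "l0 (x \<oplus>\<^bsub>M\<^esub> z) = l0 x \<oplus>\<^bsub>regular_module F\<^esub> l0 z"
        using xz l0(1) by (intro l0_eq) auto
    next
      fix r x assume rx: "r \<in> carrier F" "x \<in> carrier M"
      have "((r \<odot>\<^bsub>M\<^esub> x) \<ominus>\<^bsub>M\<^esub> e (r \<odot>\<^bsub>M\<^esub> x)) \<ominus>\<^bsub>M\<^esub> (r \<otimes>\<^bsub>F\<^esub> l0 x) \<odot>\<^bsub>M\<^esub> y =
        r \<odot>\<^bsub>M\<^esub> ((x \<ominus>\<^bsub>M\<^esub> e x) \<ominus>\<^bsub>M\<^esub> l0 x \<odot>\<^bsub>M\<^esub> y)"
        using rx l0(1) el(1,3) y by (simp add: a_minus_def M.smult_r_distr M.smult_r_minus M.smult_assoc1)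
      also have "\<dots> \<in> N" by (rule m(5)[OF rx(1) l0(2)[OF rx(2)]])
      finally show "l0 (r \<odot>\<^bsub>M\<^esub> x) = r \<odot>\<^bsub>regular_module F\<^esub> l0 x"
        using rx l0(1) by (intro l0_eq[OF M.smult_closed]) auto
    qed
    note L = linear_maps_restrict[OF assms(2) this]
    define l where "l = restrict l0 (carrier M)"
    have ll: "l \<in> linear_maps F M (regular_module F)" using L by (simp add: l_def)
    let ?e = "\<lambda>x\<in>carrier M. e x \<oplus>\<^bsub>M\<^esub> l x \<odot>\<^bsub>M\<^esub> y"
    have "lin F M M (\<lambda>x. e x \<oplus>\<^bsub>M\<^esub> l x \<odot>\<^bsub>M\<^esub> y)"
      unfolding lin_def using el(1-3) y linear_maps_lin[OF ll, unfolded lin_def]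
      by (auto simp: M.smult_l_distr M.smult_r_distr M.smult_assoc1 M.add.m_ac Pi_iff)
    note E = linear_maps_restrict[OF assms(2) this]
    show ?thesis
    proof (intro bexI[OF _ E] conjI ballI)
      show "P ?e" by (rule step[OF e(2,1) ll y])
      show "?e x = \<zero>\<^bsub>M\<^esub>" if x: "x \<in> N" for x
      proof -
        have "x \<in> ?N" "x \<in> carrier M" using NN x by auto
        moreover have "(x \<ominus>\<^bsub>M\<^esub> \<zero>\<^bsub>M\<^esub>) \<ominus>\<^bsub>M\<^esub> \<zero>\<^bsub>F\<^esub> \<odot>\<^bsub>M\<^esub> y \<in> N" using x y m(2)[OF x] by (simp add: a_minus_def)
        ultimately have "l0 x = \<zero>\<^bsub>F\<^esub>" using e(3) by (intro l0_eq) auto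
        then show ?thesis using e(3)[OF \<open>x \<in> ?N\<close>] \<open>x \<in> carrier M\<close> y by (simp add: l_def)
      qed
      show "x \<ominus>\<^bsub>M\<^esub> ?e x \<in> N" if x: "x \<in> carrier M" for x
      proof -
        have "x \<ominus>\<^bsub>M\<^esub> ?e x = (x \<ominus>\<^bsub>M\<^esub> e x) \<ominus>\<^bsub>M\<^esub> l0 x \<odot>\<^bsub>M\<^esub> y"
          using x y l0(1) el(1) by (simp add: l_def a_minus_def M.minus_add M.a_assoc)
        then show ?thesis using l0(2)[OF x] by simp
      qed
    qed
  qed
qed

section \<open>Quotients of lattices\<close>

lemma coset_rep_carrier_update[simp]:
  "coset_rep (M\<lparr>carrier := C\<rparr>) L = coset_rep M L"
  by (simp add: coset_rep_def[abs_def] a_r_coset_def r_coset_def)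

lemma coset_rep_regular_module[simp]: "coset_rep (regular_module M) L = coset_rep M L"
  by (simp add: coset_rep_def[abs_def] a_r_coset_def r_coset_def)

lemma coset_rep_eq:
  assumes "Module.module R M" "submodule L R M" "x \<in> carrier M" "y \<in> carrier M"
  shows "coset_rep M L x = coset_rep M L y \<longleftrightarrow> x \<ominus>\<^bsub>M\<^esub> y \<in> L"
  using assms by (intro coset_rep_eq_iff) (auto simp: module_def submodule_def)

lemma coset_rep_diff:
  assumes "Module.module R M" "submodule L R M" "x \<in> carrier M"
  shows "\<exists>h\<in>L. coset_rep M L x = h \<oplus>\<^bsub>M\<^esub> x"
proof -
  interpret M: Module.module R M by fact
  have "\<zero>\<^bsub>M\<^esub> \<oplus>\<^bsub>M\<^esub> x \<in> L +>\<^bsub>M\<^esub> x" using submodule_mem(1)[OF assms(1,2)]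
    by (auto simp: a_r_coset_def r_coset_def)
  then have "coset_rep M L x \<in> L +>\<^bsub>M\<^esub> x" unfolding coset_rep_def by (rule someI)
  then show ?thesis by (auto simp: a_r_coset_def r_coset_def)
qed

lemma coset_rep_facts:
  assumes "Module.module R M" "submodule L R M" "x \<in> carrier M"
  shows "coset_rep M L x \<in> carrier M" "coset_rep M L x \<ominus>\<^bsub>M\<^esub> x \<in> L"
      "coset_rep M L (coset_rep M L x) = coset_rep M L x"
    "submodule L' R M \<Longrightarrow> L \<subseteq> L' \<Longrightarrow> x \<in> L' \<Longrightarrow> coset_rep M L x \<in> L'"
proof -
  interpret M: Module.module R M by fact
  obtain h where h: "h \<in> L" "coset_rep M L x = h \<oplus>\<^bsub>M\<^esub> x" using coset_rep_diff[OF assms] by blast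
  note m = submodule_mem[OF assms(1,2)]
  show c: "coset_rep M L x \<in> carrier M" using h m(2)[OF h(1)] assms(3) by simp
  show d: "coset_rep M L x \<ominus>\<^bsub>M\<^esub> x \<in> L"
    using h m(2)[OF h(1)] assms(3) by (simp add: a_minus_def M.a_assoc M.r_neg)
  show "coset_rep M L (coset_rep M L x) = coset_rep M L x"
    using coset_rep_eq[OF assms(1,2) c assms(3)] d by simp
  show "coset_rep M L x \<in> L'" if "submodule L' R M" "L \<subseteq> L'" "x \<in> L'"
    using h submodule_mem(3)[OF assms(1) that(1)] that by auto
qed

text \<open>The module axioms pass along any surjection that is compatible with the operations. It
  is applied to \<open>coset_rep\<close>, whose values are the classes of the quotient.\<close>

lemma module_surj:
  assumes "Module.module R M" "carrier Q = f ` carrier M" "ring.zero Q = f \<zero>\<^bsub>M\<^esub>"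
    "\<And>x y. x \<in> carrier M \<Longrightarrow> y \<in> carrier M \<Longrightarrow> f x \<oplus>\<^bsub>Q\<^esub> f y = f (x \<oplus>\<^bsub>M\<^esub> y)"
    "\<And>r x. r \<in> carrier R \<Longrightarrow> x \<in> carrier M \<Longrightarrow> r \<odot>\<^bsub>Q\<^esub> f x = f (r \<odot>\<^bsub>M\<^esub> x)"
  shows "Module.module R Q"
proof -
  interpret M: Module.module R M by fact
  have "abelian_group Q"
  proof (rule abelian_groupI)
    fix x assume "x \<in> carrier Q"
    then obtain a where a: "a \<in> carrier M" "x = f a" using assms(2) by auto
    have "f (\<ominus>\<^bsub>M\<^esub> a) \<oplus>\<^bsub>Q\<^esub> f a = \<zero>\<^bsub>Q\<^esub>" using a assms(3,4) by (simp add: M.l_neg)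
    then show "\<exists>y\<in>carrier Q. y \<oplus>\<^bsub>Q\<^esub> x = \<zero>\<^bsub>Q\<^esub>" using a assms(2) by auto
  qed (use assms in \<open>auto simp: M.add.m_ac\<close>)
  then show ?thesis
    by (rule moduleI[OF M.R.is_cring])
      (use assms in \<open>auto simp: M.smult_l_distr M.smult_r_distr M.smult_assoc1\<close>)
qed

lemma quotient_simps[simp]:
  "carrier (quotient M N) = coset_rep M N ` carrier M" "ring.zero (quotient M N) = coset_rep M N \<zero>\<^bsub>M\<^esub>"
  "one (quotient M N) = coset_rep M N \<one>\<^bsub>M\<^esub>"
  "x \<oplus>\<^bsub>quotient M N\<^esub> y = coset_rep M N (x \<oplus>\<^bsub>M\<^esub> y)" "x \<otimes>\<^bsub>quotient M N\<^esub> y = coset_rep M N (x \<otimes>\<^bsub>M\<^esub> y)"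
  "r \<odot>\<^bsub>quotient M N\<^esub> x = coset_rep M N (r \<odot>\<^bsub>M\<^esub> x)"
  by (simp_all add: quotient_def)

text \<open>The operations of \<open>quotient\<close> are computed on chosen representatives.
  Passing to other representatives changes the sum by an element of N only.\<close>

lemma coset_rep_add:
  assumes "Module.module R M" "submodule N R M" "x \<in> carrier M" "y \<in> carrier M"
  shows "coset_rep M N (coset_rep M N x \<oplus>\<^bsub>M\<^esub> coset_rep M N y) = coset_rep M N (x \<oplus>\<^bsub>M\<^esub> y)"
proof -
  interpret M: Module.module R M by fact
  note f = coset_rep_facts[OF assms(1,2)]
  let ?x = "coset_rep M N x" and ?y = "coset_rep M N y"
  have "(?x \<oplus>\<^bsub>M\<^esub> ?y) \<ominus>\<^bsub>M\<^esub> (x \<oplus>\<^bsub>M\<^esub> y) = (?x \<ominus>\<^bsub>M\<^esub> x) \<oplus>\<^bsub>M\<^esub> (?y \<ominus>\<^bsub>M\<^esub> y)"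
    using assms f(1) by (simp add: a_minus_def M.minus_add M.add.m_ac)
  also have "\<dots> \<in> N" by (intro submodule_mem[OF assms(1,2)] f assms)
  finally show ?thesis using assms f(1) by (subst coset_rep_eq[OF assms(1,2)]) auto
qed

lemma coset_rep_smult:
  assumes "Module.module R M" "submodule N R M" "r \<in> carrier R" "x \<in> carrier M"
  shows "coset_rep M N (r \<odot>\<^bsub>M\<^esub> coset_rep M N x) = coset_rep M N (r \<odot>\<^bsub>M\<^esub> x)"
proof -
  interpret M: Module.module R M by fact
  note f = coset_rep_facts[OF assms(1,2)]
  have "r \<odot>\<^bsub>M\<^esub> coset_rep M N x \<ominus>\<^bsub>M\<^esub> r \<odot>\<^bsub>M\<^esub> x = r \<odot>\<^bsub>M\<^esub> (coset_rep M N x \<ominus>\<^bsub>M\<^esub> x)"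
    using assms f(1) by (simp add: a_minus_def M.smult_r_distr M.smult_r_minus)
  also have "\<dots> \<in> N" by (intro submodule_mem[OF assms(1,2)] f assms)
  finally show ?thesis using assms f(1) by (subst coset_rep_eq[OF assms(1,2)]) auto
qed

lemma quotient_module:
  assumes "Module.module R M" "submodule L R M"
  shows "Module.module R (quotient M L)"
  by (rule module_surj[OF assms(1), where f = "coset_rep M L"])
    (use assms in \<open>auto simp: coset_rep_add coset_rep_smult\<close>)

lemma submodule_restrict:
  assumes "Module.module R M" "submodule L R M" "submodule L' R M" "L \<subseteq> L'"
  shows "submodule L R (M\<lparr>carrier := L'\<rparr>)" "Module.module R (M\<lparr>carrier := L'\<rparr>)"
proof -
  interpret M: Module.module R M by fact
  interpret L': submodule L' R M by fact
  interpret L: submodule L R M by fact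
  show m: "Module.module R (M\<lparr>carrier := L'\<rparr>)" by (rule L'.submodule_is_module[OF assms(1)])
  show "submodule L R (M\<lparr>carrier := L'\<rparr>)"
    using L.submodule_is_module[OF assms(1)] module.module_incl_imp_submodule[OF m, of L] assms(4) by simp
qed

section \<open>Uniformizers, residue fields and liftings\<close>

definition unif :: "('k, 'a) module \<Rightarrow> 'a set \<Rightarrow> 'a \<Rightarrow> bool" where
  "unif K V t \<longleftrightarrow> valued K V t \<and>
     maximal_ideal_of (K\<lparr>carrier := V\<rparr>) = (\<lambda>v. t \<otimes>\<^bsub>K\<^esub> v) ` V"

text \<open>The algebraic part of a local field with liftings: at each level a k-algebra, a
  uniformizer and a section of the residue map. The closure properties of BT operators are proved at
  this generality; topology comes in only with differential operators.\<close>

primrec lifted_local_field :: "('k, 'b) ring_scheme \<Rightarrow> ('k, 'a) module \<Rightarrow> 'a set list \<Rightarrow> ('a \<Rightarrow> 'a) list \<Rightarrow> bool" where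
  "lifted_local_field k K [] \<sigma> \<longleftrightarrow> field K \<and> Module.algebra k K"
| "lifted_local_field k K (V # Os) \<sigma> \<longleftrightarrow> Module.algebra k K \<and> structure_map K ` carrier k \<subseteq> V \<and> (\<exists>t. unif K V t) \<and>
     hd \<sigma> \<in> algebra_homs k (residue_field K V) (K\<lparr>carrier := V\<rparr>) \<and>
     (\<forall>x\<in>carrier (residue_field K V). residue_map K V (hd \<sigma> x) = x) \<and>
     lifted_local_field k (residue_field K V) Os (tl \<sigma>)"

lemma lifted_local_field_field: "lifted_local_field k K Os \<sigma> \<Longrightarrow> field K \<and> Module.algebra k K"
  by (cases Os) (auto simp: unif_def valued_def)

locale resid = valued K V t for k :: "('k, 'b) ring_scheme" and K :: "('k, 'a) module" (structure) and V t +
  assumes alg: "Module.algebra k K" and k_V: "c \<in> carrier k \<Longrightarrow> structure_map K c \<in> V"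
    and max: "maximal_ideal_of R = (\<lambda>v. t \<otimes> v) ` V"
begin

abbreviation (input) F where "F \<equiv> residue_field K V"
abbreviation (input) res where "res \<equiv> residue_map K V"
abbreviation (input) m where "m \<equiv> maximal_ideal_of R"

lemma R_module: "Module.module R (regular_module K)"
  by (rule module_R) (rule regular_module_module[OF is_cring])

lemma m_submodule: "submodule m R (regular_module K)"
proof -
  interpret M: Module.module R "regular_module K" by (rule R_module)
  have "\<ominus>\<^bsub>regular_module K\<^esub> a = \<ominus> a" for a by (simp add: a_inv_def regular_module_def m_inv_def)
  then show ?thesis unfolding max
  proof (intro M.submoduleI)
    show "\<zero>\<^bsub>regular_module K\<^esub> \<in> (\<otimes>) t ` V" by (auto intro!: image_eqI[of _ _ \<zero>])
    show "(\<And>a. \<ominus>\<^bsub>regular_module K\<^esub> a = \<ominus> a) \<Longrightarrow> a \<in> (\<otimes>) t ` V \<Longrightarrow> \<ominus>\<^bsub>regular_module K\<^esub> a \<in> (\<otimes>) t ` V" for a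
      by (auto simp: r_minus[symmetric])
    show "a \<in> (\<otimes>) t ` V \<Longrightarrow> b \<in> (\<otimes>) t ` V \<Longrightarrow> a \<oplus>\<^bsub>regular_module K\<^esub> b \<in> (\<otimes>) t ` V" for a b
      by (auto simp: r_distr[symmetric])
    show "a \<odot>\<^bsub>regular_module K\<^esub> x \<in> (\<otimes>) t ` V" if ax: "a \<in> carrier R" "x \<in> (\<otimes>) t ` V" for a x
    proof -
      obtain v where v: "v \<in> V" "x = t \<otimes> v" using ax by auto
      then have "a \<otimes> x = t \<otimes> (a \<otimes> v)" using ax by (simp add: m_lcomm)
      then show ?thesis using v ax by auto
    qed
  qed (auto simp: t_V)
qed

lemma res_eq_coset_rep: "res = coset_rep (regular_module K) m"
  by (simp add: residue_map_def)

lemma reg_minus: "x \<ominus>\<^bsub>regular_module K\<^esub> y = x \<ominus> y"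
  by (simp add: a_minus_def a_inv_def regular_module_def m_inv_def)

lemma m_V: "m \<subseteq> V" unfolding max using t_V by auto

lemma V_submodule: "submodule V R (regular_module K)"
proof -
  interpret M: Module.module R "regular_module K" by (rule R_module)
  have "\<ominus>\<^bsub>regular_module K\<^esub> a = \<ominus> a" for a by (simp add: a_inv_def regular_module_def m_inv_def)
  then show ?thesis by (intro M.submoduleI) auto
qed

lemma res_eq_iff: "x \<in> carrier K \<Longrightarrow> y \<in> carrier K \<Longrightarrow> res x = res y \<longleftrightarrow> x \<ominus> y \<in> m"
  using coset_rep_eq[OF R_module m_submodule, of x y] by (simp add: res_eq_coset_rep reg_minus)

lemma res_V: "x \<in> V \<Longrightarrow> res x \<in> V"
  using coset_rep_facts(4)[OF R_module m_submodule _ V_submodule m_V] by (simp add: res_eq_coset_rep)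

lemma res_res: "x \<in> carrier K \<Longrightarrow> res (res x) = res x"
  using coset_rep_facts(3)[OF R_module m_submodule] by (simp add: res_eq_coset_rep)

lemma res_diff: "x \<in> carrier K \<Longrightarrow> res x \<ominus> x \<in> m"
  using coset_rep_facts(2)[OF R_module m_submodule] by (simp add: res_eq_coset_rep reg_minus)

lemma F_def': "F = quotient R m" "res = coset_rep R m"
  by (simp_all add: residue_field_def residue_map_def)

lemma F_carrier: "carrier F = res ` V" by (simp add: F_def')

lemma F_mem: "x \<in> V \<Longrightarrow> res x \<in> carrier F" "q \<in> carrier F \<Longrightarrow> q \<in> V" "q \<in> carrier F \<Longrightarrow> res q = q"
  using res_V res_res by (auto simp: F_carrier)

lemma res_add: "x \<in> V \<Longrightarrow> y \<in> V \<Longrightarrow> res x \<oplus>\<^bsub>F\<^esub> res y = res (x \<oplus> y)"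
  using coset_rep_add[OF R_module m_submodule, of x y] by (simp add: F_def' res_eq_coset_rep[unfolded F_def'])

lemma m_ideal: "x \<in> m \<Longrightarrow> y \<in> V \<Longrightarrow> x \<otimes> y \<in> m"
  unfolding max by (auto simp: m_assoc)
lemma m_add: "x \<in> m \<Longrightarrow> y \<in> m \<Longrightarrow> x \<oplus> y \<in> m"
  unfolding max by (auto simp: r_distr[symmetric])

text \<open>Replacing both factors by their representatives changes the product by (res x - x) res y
  + (res y - y) x, which lies in the maximal ideal.\<close>

lemma res_mult:
  assumes "x \<in> V" "y \<in> V" shows "res x \<otimes>\<^bsub>F\<^esub> res y = res (x \<otimes> y)"
proof -
  have v: "res x \<in> V" "res y \<in> V" using assms res_V by auto
  have "res x \<otimes> res y \<ominus> x \<otimes> y = (res x \<ominus> x) \<otimes> res y \<oplus> (res y \<ominus> y) \<otimes> x"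
    using assms v[THEN V_in]
        by (simp add: a_minus_def l_distr r_distr l_minus r_minus a_assoc m_comm l_neg r_neg1 r_neg2)
  also have "\<dots> \<in> m" using v assms by (intro m_add m_ideal res_diff) auto
  finally have "res (res x \<otimes> res y) = res (x \<otimes> y)" using assms v by (subst res_eq_iff) auto
  then show ?thesis by (simp add: F_def')
qed

lemma res_zero_one: "res \<zero> = \<zero>\<^bsub>F\<^esub>" "res \<one> = \<one>\<^bsub>F\<^esub>" by (simp_all add: F_def')

lemma res_smult: "c \<in> carrier k \<Longrightarrow> c \<odot>\<^bsub>F\<^esub> x = res (c \<odot>\<^bsub>K\<^esub> x)" by (simp add: F_def')

lemma res_zero_iff: "x \<in> V \<Longrightarrow> res x = \<zero>\<^bsub>F\<^esub> \<longleftrightarrow> x \<in> m"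
  using res_eq_iff[of x \<zero>] by (simp add: res_zero_one a_minus_def)

end

locale lifted = resid k K V t for k :: "('k, 'b) ring_scheme" and K :: "('k, 'a) module" (structure) and V t +
  fixes s :: "'a \<Rightarrow> 'a"
  assumes s_hom: "s \<in> algebra_homs k (residue_field K V) R"
    and s_sec: "x \<in> carrier (residue_field K V) \<Longrightarrow> residue_map K V (s x) = x"
    and F_field: "field (residue_field K V)" and F_alg: "Module.algebra k (residue_field K V)"

lemma lifted_local_field_lifted:
  assumes "lifted_local_field k K (V # Os) \<sigma>"
  obtains t where "lifted k K V t (hd \<sigma>)" "lifted_local_field k (residue_field K V) Os (tl \<sigma>)"
  using assms lifted_local_field_field[of k "residue_field K V" Os "tl \<sigma>"]
  unfolding lifted_def lifted_axioms_def resid_def resid_axioms_def by (auto simp: unif_def image_subset_iff)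

context lifted
begin

sublocale F: field F by (rule F_field)

lemma s_facts:
  "x \<in> carrier F \<Longrightarrow> s x \<in> V" "x \<in> carrier F \<Longrightarrow> y \<in> carrier F \<Longrightarrow> s (x \<oplus>\<^bsub>F\<^esub> y) = s x \<oplus> s y"
  "x \<in> carrier F \<Longrightarrow> y \<in> carrier F \<Longrightarrow> s (x \<otimes>\<^bsub>F\<^esub> y) = s x \<otimes> s y" "s \<one>\<^bsub>F\<^esub> = \<one>"
  "c \<in> carrier k \<Longrightarrow> x \<in> carrier F \<Longrightarrow> s (c \<odot>\<^bsub>F\<^esub> x) = c \<odot>\<^bsub>K\<^esub> s x"
  "x \<in> carrier F \<Longrightarrow> res (s x) = x"
  using s_hom s_sec ring_hom_memE[of s F R] by (auto simp: algebra_homs_def)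

lemma s_zero: "s \<zero>\<^bsub>F\<^esub> = \<zero>"
proof -
  have "s (\<zero>\<^bsub>F\<^esub> \<oplus>\<^bsub>F\<^esub> \<zero>\<^bsub>F\<^esub>) = s \<zero>\<^bsub>F\<^esub> \<oplus> s \<zero>\<^bsub>F\<^esub>" by (rule s_facts) auto
  then show ?thesis using s_facts(1)[of "\<zero>\<^bsub>F\<^esub>"] by simp
qed

lemma s_structure_map: "c \<in> carrier k \<Longrightarrow> s (structure_map F c) = structure_map K c"
  by (simp add: structure_map_def s_facts)

text \<open>One step of the t-adic expansion: v and s (res v) have the same residue, so their
  difference is a multiple of \<open>t\<close>.\<close>

lemma V_decomp:
  assumes "v \<in> V" obtains w where "w \<in> V" "v = s (res v) \<oplus> t \<otimes> w"
proof -
  have r: "res v \<in> carrier F" using F_mem assms by auto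
  have sv: "s (res v) \<in> V" using s_facts(1)[OF r] .
  have "res v = res (s (res v))" using s_facts(6)[OF r] by simp
  then have "v \<ominus> s (res v) \<in> m" using res_eq_iff assms sv by auto
  then obtain w where w: "w \<in> V" "v \<ominus> s (res v) = t \<otimes> w" unfolding max by auto
  have "s (res v) \<oplus> (v \<ominus> s (res v)) = v" using assms sv[THEN V_in]
      by (simp add: a_minus_def r_neg r_neg1 r_neg2 a_lcomm)
  then show ?thesis using that w by metis
qed

end

section \<open>Linear sections and retractions; quotients of lattices as vector spaces\<close>

lemma (in abelian_group) minus_eq_zeroD:
  assumes "x \<in> carrier G" "y \<in> carrier G" "x \<ominus> y = \<zero>" shows "x = y"
proof -
  have "(x \<ominus> y) \<oplus> y = x" using assms(1,2) by (simp add: a_minus_def a_assoc l_neg)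
  then show ?thesis using assms by simp
qed

text \<open>\<open>projection_induct\<close> is used with the zero submodule, where the projection
  becomes the identity. Each summand l x y of it is lifted through a preimage of y, and the lifts
  add up to a section.\<close>

lemma linear_section:
  fixes F :: "('k, 'a) module"
  assumes "field F" "fgmod F N" "Module.module F M" "lin F M N p" "p ` carrier M = carrier N"
  obtains s where "s \<in> linear_maps F N M" "\<And>x. x \<in> carrier N \<Longrightarrow> p (s x) = x"
proof -
  have mN: "Module.module F N" using assms(2) by (simp add: fgmod_def)
  interpret F: field F by fact
  interpret M: Module.module F M by fact
  interpret N: Module.module F N by fact
  obtain S where S: "finite S" "S \<subseteq> carrier N" "carrier N = span_module F N S"
    using assms(2) by (auto simp: fgmod_def finite_submodule_def)
  note p = lin_facts[OF assms(3) mN assms(4)]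
  have Z: "submodule {\<zero>\<^bsub>N\<^esub>} F N" by (rule N.submoduleI) auto
  have sp: "carrier N = span_module F N ({\<zero>\<^bsub>N\<^esub>} \<union> S)"
  proof
    have c: "{\<zero>\<^bsub>N\<^esub>} \<union> S \<subseteq> carrier N" using S by auto
    have "S \<subseteq> span_module F N ({\<zero>\<^bsub>N\<^esub>} \<union> S)" by (rule subset_trans[OF _ span_superset]) auto
    from span_least[OF span_submodule[OF mN c] this]
    show "carrier N \<subseteq> span_module F N ({\<zero>\<^bsub>N\<^esub>} \<union> S)" using S(3) by simp
    show "span_module F N ({\<zero>\<^bsub>N\<^esub>} \<union> S) \<subseteq> carrier N"
      by (rule N.submoduleE(1)[OF span_submodule[OF mN c]])
  qed
  \<comment> \<open>The property carried through the induction: the partial projection e factors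
    through p.\<close>
  define P where "P e \<longleftrightarrow> (\<exists>s\<in>linear_maps F N M. \<forall>x\<in>carrier N. p (s x) = e x)" for e
  have "\<exists>e\<in>linear_maps F N N. P e \<and> (\<forall>x\<in>{\<zero>\<^bsub>N\<^esub>}. e x = \<zero>\<^bsub>N\<^esub>) \<and> (\<forall>x\<in>carrier N. x \<ominus>\<^bsub>N\<^esub> e x \<in> {\<zero>\<^bsub>N\<^esub>})"
  proof (rule projection_induct[OF assms(1) mN Z S(1,2) sp])
    have "(\<lambda>x\<in>carrier N. \<zero>\<^bsub>M\<^esub>) \<in> linear_maps F N M"
      by (rule linear_maps_restrict[OF mN]) (auto simp: lin_def)
    then show "P (\<lambda>x\<in>carrier N. \<zero>\<^bsub>N\<^esub>)" unfolding P_def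
      by (rule bexI[rotated]) (simp add: p(4))
  next
    fix e l y assume h: "P e" "e \<in> linear_maps F N N" "l \<in> linear_maps F N (regular_module F)" "y \<in> carrier N"
    obtain s where s: "s \<in> linear_maps F N M" "\<And>x. x \<in> carrier N \<Longrightarrow> p (s x) = e x"
      using h(1) by (auto simp: P_def)
    have "y \<in> p ` carrier M" using h(4) assms(5) by simp
    then obtain z where z: "z \<in> carrier M" "p z = y" by auto
    note sl = lin_facts[OF mN assms(3) linear_maps_lin[OF s(1)]]
      and ll = lin_facts[OF mN regular_module_module[OF F.is_cring] linear_maps_lin[OF h(3)], simplified]
    have "lin F N M (\<lambda>x. s x \<oplus>\<^bsub>M\<^esub> l x \<odot>\<^bsub>M\<^esub> z)"
      unfolding lin_def using z sl(1-3) ll(1-3)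
      by (auto simp: M.smult_l_distr M.smult_r_distr M.smult_assoc1 M.add.m_ac)
    from linear_maps_restrict[OF mN this]
    show "P (\<lambda>x\<in>carrier N. e x \<oplus>\<^bsub>N\<^esub> l x \<odot>\<^bsub>N\<^esub> y)" unfolding P_def
      by (rule bexI[rotated]) (use z sl(1) ll(1) s(2) in \<open>auto simp: p\<close>)
  qed
  then obtain e where e: "P e" "\<And>x. x \<in> carrier N \<Longrightarrow> x \<ominus>\<^bsub>N\<^esub> e x = \<zero>\<^bsub>N\<^esub>" "e \<in> linear_maps F N N" by auto
  have ex: "e x = x" if "x \<in> carrier N" for x
    using N.minus_eq_zeroD[OF that lin_facts(1)[OF mN mN linear_maps_lin[OF e(3)] that] e(2)[OF that]] by simp
  then show ?thesis using e(1) that unfolding P_def by auto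
qed

text \<open>If e vanishes on N and x - e x always lies in N, then x - e x is a retraction onto
  N.\<close>

lemma linear_projection:
  fixes F :: "('k, 'a) module"
  assumes "field F" "fgmod F M" "submodule N F M"
  obtains b where "b \<in> linear_maps F M (M\<lparr>carrier := N\<rparr>)" "\<And>x. x \<in> N \<Longrightarrow> b x = x"
proof -
  have mM: "Module.module F M" using assms(2) by (simp add: fgmod_def)
  interpret M: Module.module F M by fact
  obtain S where S: "finite S" "S \<subseteq> carrier M" "carrier M = span_module F M S"
    using assms(2) by (auto simp: fgmod_def finite_submodule_def)
  note m = submodule_mem[OF mM assms(3)]
  have c: "N \<union> S \<subseteq> carrier M" using S m(2) by auto
  have sp: "carrier M = span_module F M (N \<union> S)"
  proof
    have "S \<subseteq> span_module F M (N \<union> S)" by (rule subset_trans[OF _ span_superset]) auto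
    from span_least[OF span_submodule[OF mM c] this]
    show "carrier M \<subseteq> span_module F M (N \<union> S)" using S(3) by simp
    show "span_module F M (N \<union> S) \<subseteq> carrier M"
      by (rule M.submoduleE(1)[OF span_submodule[OF mM c]])
  qed
  have "\<exists>e\<in>linear_maps F M M. True \<and> (\<forall>x\<in>N. e x = \<zero>\<^bsub>M\<^esub>) \<and> (\<forall>x\<in>carrier M. x \<ominus>\<^bsub>M\<^esub> e x \<in> N)"
    by (rule projection_induct[OF assms(1) mM assms(3) S(1,2) sp]) auto
  then obtain e where e: "e \<in> linear_maps F M M" "\<And>x. x \<in> N \<Longrightarrow> e x = \<zero>\<^bsub>M\<^esub>"
    "\<And>x. x \<in> carrier M \<Longrightarrow> x \<ominus>\<^bsub>M\<^esub> e x \<in> N" by auto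
  note el = lin_facts[OF mM mM linear_maps_lin[OF e(1)]]
  have "lin F M (M\<lparr>carrier := N\<rparr>) (\<lambda>x. x \<ominus>\<^bsub>M\<^esub> e x)"
    unfolding lin_def using e(3) el(1-3)
    by (auto simp: a_minus_def M.minus_add M.add.m_ac M.smult_r_distr M.smult_r_minus)
  from linear_maps_restrict[OF mM this]
  show ?thesis by (rule that) (use e(2) m(2) in \<open>auto simp: a_minus_def\<close>)
qed

lemma restrict_scalars_simps[simp]:
  "carrier (restrict_scalars f M) = carrier M" "ring.zero (restrict_scalars f M) = ring.zero M"
  "add (restrict_scalars f M) = add M" "r \<odot>\<^bsub>restrict_scalars f M\<^esub> x = f r \<odot>\<^bsub>M\<^esub> x"
  by (simp_all add: restrict_scalars_def)

lemma rest_simps[simp]: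
  "carrier (rest s M L' L) = coset_rep M L ` L'" "ring.zero (rest s M L' L) = coset_rep M L \<zero>\<^bsub>M\<^esub>"
  "x \<oplus>\<^bsub>rest s M L' L\<^esub> y = coset_rep M L (x \<oplus>\<^bsub>M\<^esub> y)"
  "a \<odot>\<^bsub>rest s M L' L\<^esub> x = coset_rep M L (s a \<odot>\<^bsub>M\<^esub> x)"
  by (simp_all add: rest_def)

text \<open>It stands to \<open>Hom_base\<close> as \<open>lin\<close> stands to
  \<open>linear_maps\<close>: linearity over k through the structure map, without
  extensionality.\<close>

definition khom :: "('k, 'b) ring_scheme \<Rightarrow> ('k, 'a) module \<Rightarrow> ('a, 'm) module \<Rightarrow> ('a, 'p) module \<Rightarrow> ('m \<Rightarrow> 'p) \<Rightarrow> bool"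
    where
  "khom k K M N \<phi> \<longleftrightarrow> \<phi> \<in> carrier M \<rightarrow> carrier N \<and>
     (\<forall>x\<in>carrier M. \<forall>y\<in>carrier M. \<phi> (x \<oplus>\<^bsub>M\<^esub> y) = \<phi> x \<oplus>\<^bsub>N\<^esub> \<phi> y) \<and>
     (\<forall>c\<in>carrier k. \<forall>x\<in>carrier M. \<phi> (structure_map K c \<odot>\<^bsub>M\<^esub> x) = structure_map K c \<odot>\<^bsub>N\<^esub> \<phi> x)"

lemma Hom_base_iff: "\<phi> \<in> Hom_base k K M N \<longleftrightarrow> khom k K M N \<phi> \<and> \<phi> \<in> extensional (carrier M)"
  unfolding Hom_base_def linear_maps_def khom_def by (auto simp: PiE_def)

context lifted
begin

text \<open>The first claims say that \<open>coset_rep M L\<close> is compatible with all operations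
  once scalars of the residue field act through \<open>s\<close>. Finite generation holds because
  some t^n kills L'/L: the classes of t^j x with j at most n and x among generators of L' span it
  over the residue field.\<close>

lemma rest_facts:
  assumes M: "Module.module K M" and L: "L \<in> lattices K V M" and L': "L' \<in> lattices K V M" and sub: "L \<subseteq> L'"
  shows "x \<in> L' \<Longrightarrow> coset_rep M L x \<in> carrier (rest s M L' L)"
    "q \<in> carrier (rest s M L' L) \<Longrightarrow> q \<in> L'"
    "q \<in> carrier (rest s M L' L) \<Longrightarrow> coset_rep M L q = q"
    "x \<in> L' \<Longrightarrow> y \<in> L' \<Longrightarrow> coset_rep M L x \<oplus>\<^bsub>rest s M L' L\<^esub> coset_rep M L y = coset_rep M L (x \<oplus>\<^bsub>M\<^esub> y)"
    "a \<in> carrier F \<Longrightarrow> x \<in> L' \<Longrightarrow> a \<odot>\<^bsub>rest s M L' L\<^esub> coset_rep M L x = coset_rep M L (s a \<odot>\<^bsub>M\<^esub> x)"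
    "x \<in> L' \<Longrightarrow> y \<in> L' \<Longrightarrow> coset_rep M L x = coset_rep M L y \<longleftrightarrow> x \<ominus>\<^bsub>M\<^esub> y \<in> L"
    "c \<in> carrier k \<Longrightarrow> x \<in> L' \<Longrightarrow> structure_map F c \<odot>\<^bsub>rest s M L' L\<^esub> coset_rep M L x = coset_rep M L (structure_map K c
        \<odot>\<^bsub>M\<^esub> x)"
    "Module.module F (rest s M L' L)"
    "fgmod F (rest s M L' L)"
proof -
  let ?Q = "rest s M L' L"
  interpret M: Module.module R M by (rule module_R[OF M])
  note l = lattice_facts[OF M L] and l' = lattice_facts[OF M L']
    and lm = lattice_mem[OF M L] and lm' = lattice_mem[OF M L']
  note f = coset_rep_facts[OF module_R[OF M] l(1)]
  show c: "x \<in> L' \<Longrightarrow> coset_rep M L x \<in> carrier ?Q" for x by simp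
  show "q \<in> carrier ?Q \<Longrightarrow> q \<in> L'" for q using f(4)[OF _ l'(1) sub] lm'(2) by auto
  show "q \<in> carrier ?Q \<Longrightarrow> coset_rep M L q = q" for q using f(3) lm'(2) by auto
  show a: "x \<in> L' \<Longrightarrow> y \<in> L' \<Longrightarrow> coset_rep M L x \<oplus>\<^bsub>?Q\<^esub> coset_rep M L y = coset_rep M L (x \<oplus>\<^bsub>M\<^esub> y)" for x y
    using coset_rep_add[OF module_R[OF M] l(1)] lm'(2) by simp
  show sm: "a \<in> carrier F \<Longrightarrow> x \<in> L' \<Longrightarrow> a \<odot>\<^bsub>?Q\<^esub> coset_rep M L x = coset_rep M L (s a \<odot>\<^bsub>M\<^esub> x)" for a x
    using coset_rep_smult[OF module_R[OF M] l(1)] lm'(2) s_facts(1) by simp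
  show eq: "x \<in> L' \<Longrightarrow> y \<in> L' \<Longrightarrow> coset_rep M L x = coset_rep M L y \<longleftrightarrow> x \<ominus>\<^bsub>M\<^esub> y \<in> L" for x y
    using coset_rep_eq[OF module_R[OF M] l(1)] lm'(2) by simp
  show "c \<in> carrier k \<Longrightarrow> x \<in> L' \<Longrightarrow> structure_map F c \<odot>\<^bsub>?Q\<^esub> coset_rep M L x = coset_rep M L (structure_map K c \<odot>\<^bsub>M\<^esub>
      x)" for c x
    using coset_rep_smult[OF module_R[OF M] l(1)] lm'(2) k_V by (simp add: s_structure_map)
  have agL: "abelian_group (M\<lparr>carrier := L'\<rparr>)"
    using submodule_restrict(2)[OF module_R[OF M] l(1) l'(1) sub] by (simp add: module_def)
  show mod: "Module.module F ?Q"
  proof -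
    have "Module.module R (quotient (M\<lparr>carrier := L'\<rparr>) L)"
      using submodule_restrict[OF module_R[OF M] l(1) l'(1) sub] by (intro quotient_module)
    then have ag: "abelian_group (quotient (M\<lparr>carrier := L'\<rparr>) L)" by (simp add: module_def)
    have "abelian_group ?Q"
    proof -
      interpret q: abelian_group "quotient (M\<lparr>carrier := L'\<rparr>) L" by fact
      have *: "carrier ?Q = carrier (quotient (M\<lparr>carrier := L'\<rparr>) L)"
        "add ?Q = add (quotient (M\<lparr>carrier := L'\<rparr>) L)" "ring.zero ?Q = ring.zero (quotient (M\<lparr>carrier := L'\<rparr>) L)"
        by (simp_all add: rest_def restrict_scalars_def)
      show ?thesis
        by (rule abelian_groupI) (unfold *, auto intro: q.a_closed q.a_assoc q.a_comm q.l_neg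
          simp del: quotient_simps intro!: bexI[of _ "\<ominus>\<^bsub>quotient (M\<lparr>carrier := L'\<rparr>) L\<^esub> _"])
    qed
    then show ?thesis
    proof (rule moduleI[OF F.is_cring])
      fix a x assume ax: "a \<in> carrier F" "x \<in> carrier ?Q"
      then obtain u where u: "u \<in> L'" "x = coset_rep M L u" by auto
      show "a \<odot>\<^bsub>?Q\<^esub> x \<in> carrier ?Q" using u ax s_facts(1) lm'(5) sm by auto
    next
      fix a b x assume ax: "a \<in> carrier F" "b \<in> carrier F" "x \<in> carrier ?Q"
      then obtain u where u: "u \<in> L'" "x = coset_rep M L u" by auto
      have v: "s a \<in> V" "s b \<in> V" using ax s_facts(1) by auto
      show "(a \<oplus>\<^bsub>F\<^esub> b) \<odot>\<^bsub>?Q\<^esub> x = (a \<odot>\<^bsub>?Q\<^esub> x) \<oplus>\<^bsub>?Q\<^esub> (b \<odot>\<^bsub>?Q\<^esub> x)"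
        unfolding u(2) using u(1) ax v lm'(2,5) sm a M.smult_l_distr by (simp add: s_facts del: rest_simps)
      show "(a \<otimes>\<^bsub>F\<^esub> b) \<odot>\<^bsub>?Q\<^esub> x = a \<odot>\<^bsub>?Q\<^esub> (b \<odot>\<^bsub>?Q\<^esub> x)"
        unfolding u(2) using u(1) ax v lm'(2,5) sm a M.smult_assoc1 by (simp add: s_facts del: rest_simps)
    next
      fix a x y assume ax: "a \<in> carrier F" "x \<in> carrier ?Q" "y \<in> carrier ?Q"
      then obtain u w where u: "u \<in> L'" "x = coset_rep M L u" "w \<in> L'" "y = coset_rep M L w" by auto
      have v: "s a \<in> V" using ax s_facts(1) by auto
      show "a \<odot>\<^bsub>?Q\<^esub> (x \<oplus>\<^bsub>?Q\<^esub> y) = (a \<odot>\<^bsub>?Q\<^esub> x) \<oplus>\<^bsub>?Q\<^esub> (a \<odot>\<^bsub>?Q\<^esub> y)"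
        unfolding u(2,4) using u(1,3) ax v lm'(2,3,5) sm a M.smult_r_distr by (simp del: rest_simps)
    next
      fix x assume ax: "x \<in> carrier ?Q"
      then obtain u where u: "u \<in> L'" "x = coset_rep M L u" by auto
      show "\<one>\<^bsub>F\<^esub> \<odot>\<^bsub>?Q\<^esub> x = x"
        unfolding u(2) using u(1) lm'(2) sm M.smult_one by (simp add: s_facts del: rest_simps)
    qed
  qed
  obtain n where n: "\<And>x. x \<in> L' \<Longrightarrow> t [^] (n::nat) \<odot>\<^bsub>M\<^esub> x \<in> L"
    using lattice_absorb[OF M L l'(3)] by auto
  obtain S where S: "finite S" "S \<subseteq> carrier M" "L' = span_module R M S"
    using l'(3) by (auto simp: finite_submodule_def)
  have SL: "S \<subseteq> L'" unfolding S(3) by (rule span_superset)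
  \<comment> \<open>Generators of the graded pieces t^j L' / t^(j+1) L', collected for all j up to
    n.\<close>
  let ?G = "(\<lambda>(j, x). coset_rep M L (t [^] j \<odot>\<^bsub>M\<^esub> x)) ` ({..n} \<times> S)"
  have tl: "t [^] (j::nat) \<odot>\<^bsub>M\<^esub> x \<in> L'" if "x \<in> L'" for j x using that t_V lm'(5) by auto
  have G: "finite ?G" "?G \<subseteq> carrier ?Q" using S(1) SL tl by auto
  note sp = span_submodule[OF mod G(2)]
  note spm = submodule_mem[OF mod sp]
  \<comment> \<open>Downward induction on the power of \<open>t\<close>: the class of t^n x is zero,
    and the case of t^i uses that of t^(i+1). From j = n on, natural subtraction merely repeats the
    power 0.\<close>
  have main: "coset_rep M L (t [^] (n - j) \<odot>\<^bsub>M\<^esub> x) \<in> span_module F ?Q ?G" if "x \<in> L'" for j x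
    using that
  proof (induction j arbitrary: x)
    case 0
    then have "coset_rep M L (t [^] n \<odot>\<^bsub>M\<^esub> x) = coset_rep M L \<zero>\<^bsub>M\<^esub>"
      using n lm'(1) tl lm(2) by (subst eq) (auto simp: a_minus_def)
    then show ?case using spm(1) by simp
  next
    case (Suc j)
    show ?case
    proof (cases "j < n")
      case False
      then show ?thesis using Suc by auto
    next
      case True
      define i where "i = n - Suc j"
      have i: "n - j = Suc i" using True by (simp add: i_def)
      \<comment> \<open>It is enough to treat the elements of S, because the y for which the claim
        holds form a V-submodule.\<close>
      let ?W = "{y \<in> L'. coset_rep M L (t [^] i \<odot>\<^bsub>M\<^esub> y) \<in> span_module F ?Q ?G}"
      have W: "submodule ?W R M"
      proof (rule M.submoduleI)
        show "?W \<subseteq> carrier M" using lm'(2) by auto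
        show "\<zero>\<^bsub>M\<^esub> \<in> ?W" using lm'(1) spm(1) t_V by simp
        show add: "y \<oplus>\<^bsub>M\<^esub> z \<in> ?W" if yz: "y \<in> ?W" "z \<in> ?W" for y z
        proof -
          have "coset_rep M L (t [^] i \<odot>\<^bsub>M\<^esub> y) \<oplus>\<^bsub>?Q\<^esub> coset_rep M L (t [^] i \<odot>\<^bsub>M\<^esub> z) =
              coset_rep M L (t [^] i \<odot>\<^bsub>M\<^esub> (y \<oplus>\<^bsub>M\<^esub> z))"
            using yz a tl M.smult_r_distr lm'(2) t_V by (simp del: rest_simps)
          moreover have "coset_rep M L (t [^] i \<odot>\<^bsub>M\<^esub> y) \<oplus>\<^bsub>?Q\<^esub> coset_rep M L (t [^] i \<odot>\<^bsub>M\<^esub> z) \<in> span_module F ?Q ?G"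
            by (rule spm(3)) (use yz in auto)
          ultimately show ?thesis using yz lm'(3) by simp
        qed
        show sm': "v \<odot>\<^bsub>M\<^esub> y \<in> ?W" if vy: "v \<in> carrier R" "y \<in> ?W" for v y
        proof -
          have v: "v \<in> V" and y: "y \<in> L'" "coset_rep M L (t [^] i \<odot>\<^bsub>M\<^esub> y) \<in> span_module F ?Q ?G" using vy by auto
          \<comment> \<open>The scalar v is split as s (res v) + t w. The first part acts as a
            scalar of the residue field; the second raises the power of \<open>t\<close>, where the
            induction hypothesis applies.\<close>
          obtain w where w: "w \<in> V" "v = s (res v) \<oplus> t \<otimes> w" using V_decomp[OF v] by blast
          have r: "res v \<in> carrier F" "s (res v) \<in> V" using F_mem(1)[OF v] s_facts(1) by auto
          have yM: "y \<in> carrier M" using lm'(2) y by auto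
          have "t [^] i \<odot>\<^bsub>M\<^esub> (v \<odot>\<^bsub>M\<^esub> y) = (t [^] i \<otimes> v) \<odot>\<^bsub>M\<^esub> y"
            using v yM t_V M.smult_assoc1[of "t [^] i" v y] by simp
          also have "t [^] i \<otimes> v = s (res v) \<otimes> t [^] i \<oplus> t [^] Suc i \<otimes> w"
            using w(1) r(2) t_V by (subst w(2)) (simp add: r_distr m_ac)
          also have "\<dots> \<odot>\<^bsub>M\<^esub> y = s (res v) \<odot>\<^bsub>M\<^esub> (t [^] i \<odot>\<^bsub>M\<^esub> y) \<oplus>\<^bsub>M\<^esub> t [^] Suc i \<odot>\<^bsub>M\<^esub> (w \<odot>\<^bsub>M\<^esub> y)"
            using w(1) r(2) t_V yM M.smult_assoc1[of "s (res v)" "t [^] i" y] M.smult_assoc1[of "t [^] Suc i" w y]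
              M.smult_l_distr[of "s (res v) \<otimes> t [^] i" "t [^] Suc i \<otimes> w" y] by (simp del: nat_pow_Suc)
          finally have e: "t [^] i \<odot>\<^bsub>M\<^esub> (v \<odot>\<^bsub>M\<^esub> y) = s (res v) \<odot>\<^bsub>M\<^esub> (t [^] i \<odot>\<^bsub>M\<^esub> y) \<oplus>\<^bsub>M\<^esub> t [^] Suc i \<odot>\<^bsub>M\<^esub> (w \<odot>\<^bsub>M\<^esub>
              y)" .
          have "coset_rep M L (t [^] i \<odot>\<^bsub>M\<^esub> (v \<odot>\<^bsub>M\<^esub> y)) =
             (res v \<odot>\<^bsub>?Q\<^esub> coset_rep M L (t [^] i \<odot>\<^bsub>M\<^esub> y)) \<oplus>\<^bsub>?Q\<^esub> coset_rep M L (t [^] Suc i \<odot>\<^bsub>M\<^esub> (w \<odot>\<^bsub>M\<^esub> y))"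
            unfolding e
                by (simp only: sm[OF r(1) tl[OF y(1)]] a[OF lm'(5)[OF r(2) tl[OF y(1)]] tl[OF lm'(5)[OF w(1)
                y(1)]]])
          also have "\<dots> \<in> span_module F ?Q ?G"
            using Suc.IH[of "w \<odot>\<^bsub>M\<^esub> y"] y w(1) lm'(5) unfolding i by (intro spm(3,5) r) auto
          finally show ?thesis using lm'(5) v y by auto
        qed
        show "\<ominus>\<^bsub>M\<^esub> y \<in> ?W" if y: "y \<in> ?W" for y
        proof -
          have "\<ominus>\<^bsub>M\<^esub> y = (\<ominus> \<one>) \<odot>\<^bsub>M\<^esub> y"
          proof -
            have yM: "y \<in> carrier M" using y lm'(2) by auto
            have "(\<ominus> \<one>) \<odot>\<^bsub>M\<^esub> y \<oplus>\<^bsub>M\<^esub> y = (\<ominus> \<one> \<oplus> \<one>) \<odot>\<^bsub>M\<^esub> y"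
              using M.smult_l_distr[of "\<ominus> \<one>" \<one> y] M.smult_one[OF yM] yM by simp
            also have "\<dots> = \<zero>\<^bsub>M\<^esub>" using M.smult_l_null[OF yM] by (simp add: l_neg)
            finally show ?thesis using yM M.smult_closed[of "\<ominus> \<one>" y] by (intro M.minus_equality) auto
          qed
          moreover have "(\<ominus> \<one>) \<odot>\<^bsub>M\<^esub> y \<in> ?W" by (rule sm'[OF _ y]) simp
          ultimately show ?thesis by simp
        qed
      qed
      have "S \<subseteq> ?W"
      proof
        fix x assume x: "x \<in> S"
        have "coset_rep M L (t [^] i \<odot>\<^bsub>M\<^esub> x) \<in> ?G" using x by (auto simp: i_def)
        from subsetD[OF span_superset this] show "x \<in> ?W" using x SL by auto
      qed
      from span_least[OF W this] have "L' \<subseteq> ?W" using S(3) by simp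
      then show ?thesis using Suc.prems by (auto simp: i_def)
    qed
  qed
  have "carrier ?Q \<subseteq> span_module F ?Q ?G" using main[of _ n] M.smult_one lm'(2) by auto
  then have "carrier ?Q = span_module F ?Q ?G" using spm(2) by blast
  then show "fgmod F ?Q" using mod G unfolding fgmod_def finite_submodule_def by blast
qed

end

section \<open>Closure properties of BT operators\<close>

lemma khom_facts:
  assumes "Module.module K M" "Module.module K N" "khom k K M N \<phi>"
  shows "x \<in> carrier M \<Longrightarrow> \<phi> x \<in> carrier N"
    "x \<in> carrier M \<Longrightarrow> y \<in> carrier M \<Longrightarrow> \<phi> (x \<oplus>\<^bsub>M\<^esub> y) = \<phi> x \<oplus>\<^bsub>N\<^esub> \<phi> y"
    "c \<in> carrier k \<Longrightarrow> x \<in> carrier M \<Longrightarrow> \<phi> (structure_map K c \<odot>\<^bsub>M\<^esub> x) = structure_map K c \<odot>\<^bsub>N\<^esub> \<phi> x"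
    "\<phi> \<zero>\<^bsub>M\<^esub> = \<zero>\<^bsub>N\<^esub>"
    "x \<in> carrier M \<Longrightarrow> y \<in> carrier M \<Longrightarrow> \<phi> (x \<ominus>\<^bsub>M\<^esub> y) = \<phi> x \<ominus>\<^bsub>N\<^esub> \<phi> y"
proof -
  interpret M: Module.module K M by fact
  interpret N: Module.module K N by fact
  show c: "x \<in> carrier M \<Longrightarrow> \<phi> x \<in> carrier N" for x
    using assms(3) by (auto simp: khom_def)
  show a: "x \<in> carrier M \<Longrightarrow> y \<in> carrier M \<Longrightarrow> \<phi> (x \<oplus>\<^bsub>M\<^esub> y) = \<phi> x \<oplus>\<^bsub>N\<^esub> \<phi> y" for x y
    using assms(3) by (auto simp: khom_def)
  show "c \<in> carrier k \<Longrightarrow> x \<in> carrier M \<Longrightarrow> \<phi> (structure_map K c \<odot>\<^bsub>M\<^esub> x) = structure_map K c \<odot>\<^bsub>N\<^esub> \<phi> x"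
    using assms(3) by (auto simp: khom_def)
  show z: "\<phi> \<zero>\<^bsub>M\<^esub> = \<zero>\<^bsub>N\<^esub>"
    using a[of "\<zero>\<^bsub>M\<^esub>" "\<zero>\<^bsub>M\<^esub>"] c[of "\<zero>\<^bsub>M\<^esub>"] by simp
  have m: "x \<in> carrier M \<Longrightarrow> \<phi> (\<ominus>\<^bsub>M\<^esub> x) = \<ominus>\<^bsub>N\<^esub> \<phi> x" for x
    using a[of "\<ominus>\<^bsub>M\<^esub> x" x] c z by (metis M.a_inv_closed M.l_neg N.minus_equality)
  show "x \<in> carrier M \<Longrightarrow> y \<in> carrier M \<Longrightarrow> \<phi> (x \<ominus>\<^bsub>M\<^esub> y) = \<phi> x \<ominus>\<^bsub>N\<^esub> \<phi> y"
    using a m by (simp add: a_minus_def)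
qed

lemma lin_khom:
  assumes "structure_map K ` carrier k \<subseteq> carrier K" "lin K M N \<phi>"
  shows "khom k K M N \<phi>"
  using assms unfolding lin_def khom_def by (auto simp: image_subset_iff)

lemma structure_map_closed: "Module.algebra k K \<Longrightarrow> structure_map K ` carrier k \<subseteq> carrier K"
proof -
  assume "Module.algebra k K"
  then interpret Module.algebra k K .
  show ?thesis by (auto simp: structure_map_def)
qed

lemma khom_compose:
  assumes "Module.module K M1" "Module.module K M2" "structure_map K ` carrier k \<subseteq> carrier K"
    "khom k K M1 M2 \<phi>" "khom k K M2 M3 \<psi>"
  shows "khom k K M1 M3 (compose (carrier M1) \<psi> \<phi>)"
proof -
  interpret M1: Module.module K M1 by fact
  interpret M2: Module.module K M2 by fact
  show ?thesis using assms(3-5) unfolding khom_def compose_def by (auto simp: image_subset_iff Pi_iff)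
qed

lemma khom_add:
  assumes "Module.module K M1" "Module.module K M2" "structure_map K ` carrier k \<subseteq> carrier K"
    "khom k K M1 M2 \<phi>" "khom k K M1 M2 \<psi>"
  shows "khom k K M1 M2 (\<lambda>x\<in>carrier M1. \<phi> x \<oplus>\<^bsub>M2\<^esub> \<psi> x)"
proof -
  interpret M1: Module.module K M1 by fact
  interpret M2: Module.module K M2 by fact
  show ?thesis using assms(3-5) unfolding khom_def
    by (auto simp: image_subset_iff Pi_iff M2.add.m_ac M2.smult_r_distr)
qed

lemma refinement_iff: "refinement K V M1 M2 \<phi> (L1', L2') (L1, L2) \<longleftrightarrow>
     L1 \<in> lattices K V M1 \<and> L2 \<in> lattices K V M2 \<and>
     L1' \<in> lattices K V M1 \<and> L2' \<in> lattices K V M2 \<and>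
     L1' \<subseteq> L1 \<and> L2 \<subseteq> L2' \<and> (\<forall>x\<in>L1'. \<phi> x \<in> L2) \<and> (\<forall>x\<in>L1. \<phi> x \<in> L2')"
  by (auto simp: refinement_def)

text \<open>Condition (i) for BT operators, kept apart because no lifting occurs in it: it is
  unchanged when liftings are compared.\<close>

definition refinable :: "('k, 'a) module \<Rightarrow> 'a set \<Rightarrow> ('a, 'm) module \<Rightarrow> ('a, 'p) module \<Rightarrow> ('m \<Rightarrow> 'p) \<Rightarrow> bool" where
  "refinable K V M1 M2 \<phi> \<longleftrightarrow> (\<forall>L1 \<in> lattices K V M1. \<forall>L2 \<in> lattices K V M2.
           \<exists>L1' L2'. refinement K V M1 M2 \<phi> (L1', L2') (L1, L2))"

lemma BT_Cons_iff: "\<phi> \<in> BT k K (V # Os) \<sigma> M1 M2 \<longleftrightarrow> \<phi> \<in> Hom_base k K M1 M2 \<and> refinable K V M1 M2 \<phi> \<and>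
        (\<forall>L1 L2 L1' L2'. refinement K V M1 M2 \<phi> (L1', L2') (L1, L2) \<longrightarrow>
           induced_map M1 M2 \<phi> (L1', L2') (L1, L2) \<in>
             BT k (residue_field K V) Os (tl \<sigma>) (rest (hd \<sigma>) M1 L1 L1') (rest (hd \<sigma>) M2 L2' L2))"
  by (simp add: refinable_def)

lemma BT_Hom_base: "\<phi> \<in> BT k K Os \<sigma> M1 M2 \<Longrightarrow> \<phi> \<in> Hom_base k K M1 M2"
  by (cases Os) auto

section \<open>Induced maps and change of refinement\<close>

context lifted
begin

lemma k_K: "structure_map K ` carrier k \<subseteq> carrier K" using k_V by auto

text \<open>The chosen representative of the class of x differs from x by an element of L1', which
  \<open>\<phi>\<close> sends into L2. So the value on representatives does not depend on the
  choice, and k-linearity is inherited from \<open>\<phi>\<close>.\<close>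

lemma induced_facts:
  assumes M: "Module.module K M1" "Module.module K M2" and \<phi>: "khom k K M1 M2 \<phi>"
    and r: "refinement K V M1 M2 \<phi> (L1', L2') (L1, L2)"
  shows "x \<in> L1 \<Longrightarrow> induced_map M1 M2 \<phi> (L1', L2') (L1, L2) (coset_rep M1 L1' x) = coset_rep M2 L2 (\<phi> x)"
    "induced_map M1 M2 \<phi> (L1', L2') (L1, L2) \<in> Hom_base k F (rest s M1 L1 L1') (rest s M2 L2' L2)"
proof -
  note r' = r[unfolded refinement_iff]
  interpret M1: Module.module K M1 by fact
  interpret M2: Module.module K M2 by fact
  have sub: "L1' \<subseteq> L1" "L2 \<subseteq> L2'" and l: "L1 \<in> lattices K V M1" "L1' \<in> lattices K V M1"
    "L2 \<in> lattices K V M2" "L2' \<in> lattices K V M2" using r' by auto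
  note q1 = rest_facts[OF M(1) l(2,1) sub(1)] and q2 = rest_facts[OF M(2) l(3,4) sub(2)]
  note m1 = lattice_mem[OF M(1) l(1)]
  note f = khom_facts[OF M \<phi>]
  let ?i = "induced_map M1 M2 \<phi> (L1', L2') (L1, L2)"
  show i: "?i (coset_rep M1 L1' x) = coset_rep M2 L2 (\<phi> x)" if x: "x \<in> L1" for x
  proof -
    have c: "coset_rep M1 L1' x \<in> carrier (rest s M1 L1 L1')" by (rule q1(1)[OF x])
    then have c': "coset_rep M1 L1' x \<in> carrier (quotient (M1\<lparr>carrier := L1\<rparr>) L1')" by simp
    note cL = q1(2)[OF c]
    have "coset_rep M1 L1' x \<ominus>\<^bsub>M1\<^esub> x \<in> L1'" using q1(6)[OF cL x] q1(3)[OF c] by simp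
    then have "\<phi> (coset_rep M1 L1' x \<ominus>\<^bsub>M1\<^esub> x) \<in> L2" using r' by auto
    then have "\<phi> (coset_rep M1 L1' x) \<ominus>\<^bsub>M2\<^esub> \<phi> x \<in> L2" using f(5) m1(2) cL x by simp
    moreover have "\<phi> (coset_rep M1 L1' x) \<in> L2'" "\<phi> x \<in> L2'" using r' cL x by auto
    ultimately have "coset_rep M2 L2 (\<phi> (coset_rep M1 L1' x)) = coset_rep M2 L2 (\<phi> x)"
      using q2(6) by simp
    then show ?thesis using c' by (simp add: induced_map_def)
  qed
  have rep: "\<exists>x\<in>L1. q = coset_rep M1 L1' x" if "q \<in> carrier (rest s M1 L1 L1')" for q using that by auto
  have "khom k F (rest s M1 L1 L1') (rest s M2 L2' L2) ?i"
    unfolding khom_def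
  proof (intro conjI ballI funcsetI)
    fix q assume "q \<in> carrier (rest s M1 L1 L1')"
    then obtain x where x: "x \<in> L1" "q = coset_rep M1 L1' x" using rep by blast
    show "?i q \<in> carrier (rest s M2 L2' L2)" unfolding x(2) i[OF x(1)] using r' x(1) by (intro q2(1)) auto
  next
    fix q q' assume "q \<in> carrier (rest s M1 L1 L1')" "q' \<in> carrier (rest s M1 L1 L1')"
    then obtain x y where x: "x \<in> L1" "q = coset_rep M1 L1' x" "y \<in> L1" "q' = coset_rep M1 L1' y" using rep
        by blast
    have "\<phi> x \<in> L2'" "\<phi> y \<in> L2'" using r' x by auto
    then show "?i (q \<oplus>\<^bsub>rest s M1 L1 L1'\<^esub> q') = ?i q \<oplus>\<^bsub>rest s M2 L2' L2\<^esub> ?i q'"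
      unfolding x(2,4) q1(4)[OF x(1,3)] i[OF x(1)] i[OF x(3)] i[OF m1(3)[OF x(1,3)]]
      using f(2)[OF m1(2)[OF x(1)] m1(2)[OF x(3)]] q2(4) by simp
  next
    fix c q assume c: "c \<in> carrier k" and "q \<in> carrier (rest s M1 L1 L1')"
    then obtain x where x: "x \<in> L1" "q = coset_rep M1 L1' x" using rep by blast
    have "\<phi> x \<in> L2'" using r' x by auto
    then show "?i (structure_map F c \<odot>\<^bsub>rest s M1 L1 L1'\<^esub> q) = structure_map F c \<odot>\<^bsub>rest s M2 L2' L2\<^esub> ?i q"
      unfolding x(2) q1(7)[OF c x(1)] i[OF x(1)] i[OF m1(5)[OF k_V[OF c] x(1)]]
      using f(3)[OF c m1(2)[OF x(1)]] q2(7)[OF c] by simp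
  qed
  then show "?i \<in> Hom_base k F (rest s M1 L1 L1') (rest s M2 L2' L2)"
    by (simp add: Hom_base_iff induced_map_def)
qed

lemma extensional_rest_eqI:
  assumes "f \<in> extensional (carrier (rest s M L' L))" "g \<in> extensional (carrier (rest s M L' L))"
    "\<And>x. x \<in> L' \<Longrightarrow> f (coset_rep M L x) = g (coset_rep M L x)"
  shows "f = g"
  by (rule extensionalityI[OF assms(1,2)]) (use assms(3) in auto)

text \<open>Passing from a large refinement back to a small one. Here a is a linear section of L1/P1
  -> L1/L1' and b a linear retraction of P2/L2 onto L2'/L2. Both depend only on the lattices, so
  they serve every \<open>\<phi>\<close>; it then suffices to know the induced map on the larger
  refinement.\<close>

lemma refine_maps:
  assumes M: "Module.module K M1" "Module.module K M2"
    and l: "L1 \<in> lattices K V M1" "L1' \<in> lattices K V M1" "P1 \<in> lattices K V M1"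
     "L2 \<in> lattices K V M2" "L2' \<in> lattices K V M2" "P2 \<in> lattices K V M2"
    and sub: "P1 \<subseteq> L1'" "L1' \<subseteq> L1" "L2 \<subseteq> L2'" "L2' \<subseteq> P2"
  obtains a b where "a \<in> linear_maps F (rest s M1 L1 L1') (rest s M1 L1 P1)"
    "b \<in> linear_maps F (rest s M2 P2 L2) (rest s M2 L2' L2)"
    "\<And>\<phi>. khom k K M1 M2 \<phi> \<Longrightarrow> refinement K V M1 M2 \<phi> (L1', L2') (L1, L2) \<Longrightarrow>
      refinement K V M1 M2 \<phi> (P1, P2) (L1, L2) \<Longrightarrow>
      induced_map M1 M2 \<phi> (L1', L2') (L1, L2) =
        compose (carrier (rest s M1 L1 L1')) b (compose (carrier (rest s M1 L1 L1')) (induced_map M1 M2 \<phi> (P1, P2)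
            (L1, L2)) a)"
proof -
  have PL: "P1 \<subseteq> L1" "L2 \<subseteq> P2" using sub by auto
  interpret M1: Module.module K M1 by fact
  interpret M2: Module.module K M2 by fact
  note q = rest_facts[OF M(1) l(2,1) sub(2)] and p = rest_facts[OF M(1) l(3,1) PL(1)]
   and q2 = rest_facts[OF M(2) l(4,5) sub(3)] and p2 = rest_facts[OF M(2) l(4,6) PL(2)]
  let ?Q = "rest s M1 L1 L1'" and ?P = "rest s M1 L1 P1" and ?Q2 = "rest s M2 L2' L2" and ?P2 = "rest s M2 P2 L2"
  note m1 = lattice_mem[OF M(1) l(1)] and m2 = lattice_mem[OF M(2) l(5)]
  \<comment> \<open>The projection L1/P1 -> L1/L1'; on representatives it is again
    \<open>coset_rep\<close>, since P1 lies in L1'.\<close>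
  define pr where "pr = coset_rep M1 L1'"
  have pr: "pr (coset_rep M1 P1 x) = coset_rep M1 L1' x" if x: "x \<in> L1" for x
  proof -
    note c = p(1)[OF x]
    have "coset_rep M1 P1 x \<ominus>\<^bsub>M1\<^esub> x \<in> P1" using p(6)[OF p(2)[OF c] x] p(3)[OF c] by simp
    then show ?thesis unfolding pr_def using q(6)[OF p(2)[OF c] x] sub(1) by auto
  qed
  have "lin F ?P ?Q pr"
    unfolding lin_def
  proof (intro conjI ballI funcsetI)
    fix z assume "z \<in> carrier ?P"
    then obtain x where x: "x \<in> L1" "z = coset_rep M1 P1 x" by auto
    show "pr z \<in> carrier ?Q" unfolding x(2) pr[OF x(1)] by (rule q(1)[OF x(1)])
    fix a assume a: "a \<in> carrier F"
    show "pr (a \<odot>\<^bsub>?P\<^esub> z) = a \<odot>\<^bsub>?Q\<^esub> pr z"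
      unfolding x(2) p(5)[OF a x(1)] pr[OF x(1)] q(5)[OF a x(1)] by (rule pr[OF m1(5)[OF s_facts(1)[OF a] x(1)]])
  next
    fix z w assume "z \<in> carrier ?P" "w \<in> carrier ?P"
    then obtain x y where x: "x \<in> L1" "z = coset_rep M1 P1 x" "y \<in> L1" "w = coset_rep M1 P1 y" by auto
    show "pr (z \<oplus>\<^bsub>?P\<^esub> w) = pr z \<oplus>\<^bsub>?Q\<^esub> pr w"
      unfolding x(2,4) p(4)[OF x(1,3)] pr[OF x(1)] pr[OF x(3)] q(4)[OF x(1,3)] by (rule pr[OF m1(3)[OF x(1,3)]])
  qed
  moreover have "pr ` carrier ?P = carrier ?Q"
  proof
    show "pr ` carrier ?P \<subseteq> carrier ?Q" using calculation by (auto simp: lin_def simp del: rest_simps)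
    show "carrier ?Q \<subseteq> pr ` carrier ?P"
    proof
      fix z assume "z \<in> carrier ?Q"
      then obtain x where x: "x \<in> L1" "z = coset_rep M1 L1' x" by auto
      show "z \<in> pr ` carrier ?P" unfolding x(2) pr[OF x(1), symmetric] by (rule imageI[OF p(1)[OF x(1)]])
    qed
  qed
  ultimately obtain a where a: "a \<in> linear_maps F ?Q ?P" "\<And>x. x \<in> carrier ?Q \<Longrightarrow> pr (a x) = x"
    using linear_section[OF F_field q(9) p(8), of pr] by blast
  \<comment> \<open>Both quotients choose their representatives modulo the same L2, so L2'/L2 is
    literally a subset of P2/L2 with the same operations.\<close>
  have eqr: "?Q2 = ?P2\<lparr>carrier := carrier ?Q2\<rparr>"
    by (simp add: rest_def restrict_scalars_def quotient_def)
  have sQ: "carrier ?Q2 \<subseteq> carrier ?P2" using sub(4) by auto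
  have "submodule (carrier ?Q2) F ?P2"
    using module.module_incl_imp_submodule[OF p2(8) sQ] q2(8) eqr by metis
  then obtain b where b: "b \<in> linear_maps F ?P2 (?P2\<lparr>carrier := carrier ?Q2\<rparr>)" "\<And>x. x \<in> carrier ?Q2 \<Longrightarrow> b x = x"
    using linear_projection[OF F_field p2(9)] by blast
  show ?thesis
  proof
    show "a \<in> linear_maps F ?Q ?P" by (rule a)
    show "b \<in> linear_maps F ?P2 ?Q2" using b(1) eqr by metis
    fix \<phi> assume \<phi>: "khom k K M1 M2 \<phi>" "refinement K V M1 M2 \<phi> (L1', L2') (L1, L2)"
      "refinement K V M1 M2 \<phi> (P1, P2) (L1, L2)"
    note i = induced_facts[OF M \<phi>(1,2)] and i' = induced_facts[OF M \<phi>(1,3)] and f = khom_facts[OF M \<phi>(1)]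
    show "induced_map M1 M2 \<phi> (L1', L2') (L1, L2) =
        compose (carrier ?Q) b (compose (carrier ?Q) (induced_map M1 M2 \<phi> (P1, P2) (L1, L2)) a)" (is "?l = ?r")
    proof (rule extensional_rest_eqI)
      show "?l \<in> extensional (carrier ?Q)" using i(2) by (simp add: Hom_base_iff)
      show "?r \<in> extensional (carrier ?Q)" by (rule compose_extensional)
      fix x assume x: "x \<in> L1"
      define z where "z = coset_rep M1 L1' x"
      have z: "z \<in> carrier ?Q" unfolding z_def by (rule q(1)[OF x])
      have az: "a z \<in> carrier ?P" using lin_facts(1)[OF q(8) p(8) linear_maps_lin[OF a(1)] z] .
      define y where "y = a z"
      have y: "y \<in> L1" "coset_rep M1 P1 y = y" unfolding y_def using p(2,3)[OF az] by auto
      have "coset_rep M1 L1' y = z" using a(2)[OF z] by (simp add: pr_def y_def)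
      then have yx: "y \<ominus>\<^bsub>M1\<^esub> x \<in> L1'" using q(6)[OF y(1) x] by (simp add: z_def)
      have \<phi>L: "\<phi> y \<in> L2'" "\<phi> x \<in> L2'" using \<phi>(2) y x by (auto simp: refinement_iff)
      \<comment> \<open>The section may choose a lift y different from x, but y - x lies in L1', so
        both have the same image modulo L2.\<close>
      have "\<phi> y \<ominus>\<^bsub>M2\<^esub> \<phi> x \<in> L2" using \<phi>(2) yx f(5)[OF m1(2)[OF y(1)] m1(2)[OF x]] by (auto simp: refinement_iff)
      then have e: "coset_rep M2 L2 (\<phi> y) = coset_rep M2 L2 (\<phi> x)" using q2(6) \<phi>L by simp
      have "?r z = b (induced_map M1 M2 \<phi> (P1, P2) (L1, L2) y)" using z
          by (simp add: compose_def y_def del: rest_simps)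
      also have "\<dots> = b (coset_rep M2 L2 (\<phi> y))" using i'(1)[OF y(1)] y(2) by simp
      also have "\<dots> = coset_rep M2 L2 (\<phi> x)" using b(2)[OF q2(1)[OF \<phi>L(2)]] e by simp
      finally show "?l (coset_rep M1 L1' x) = ?r (coset_rep M1 L1' x)" using i(1)[OF x] by (simp add: z_def)
    qed
  qed
qed

text \<open>The roles of the middle lattices are exchanged: \<phi> enlarges L2 to L2' in its target,
  and \<psi> shrinks L2' to L2 in its source. The two induced maps therefore meet in L2'/L2.\<close>

lemma refinement_compose:
  assumes "refinement K V M1 M2 \<phi> (L1', L2') (L1, L2)" "refinement K V M2 M3 \<psi> (L2, L3') (L2', L3)"
    "Module.module K M1"
  shows "refinement K V M1 M3 (compose (carrier M1) \<psi> \<phi>) (L1', L3') (L1, L3)"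
  using assms(1,2) lattice_mem(2)[OF assms(3), of L1] lattice_mem(2)[OF assms(3), of L1'] unfolding refinement_iff
      by (auto simp: compose_def)

lemma induced_compose:
  assumes M: "Module.module K M1" "Module.module K M2" "Module.module K M3"
    and h: "khom k K M1 M2 \<phi>" "khom k K M2 M3 \<psi>"
    and r: "refinement K V M1 M2 \<phi> (L1', L2') (L1, L2)" "refinement K V M2 M3 \<psi> (L2, L3') (L2', L3)"
  shows "induced_map M1 M3 (compose (carrier M1) \<psi> \<phi>) (L1', L3') (L1, L3) =
    compose (carrier (rest s M1 L1 L1')) (induced_map M2 M3 \<psi> (L2, L3') (L2', L3)) (induced_map M1 M2 \<phi> (L1', L2')
        (L1, L2))"
    (is "?l = ?r")
proof (rule extensional_rest_eqI)
  note c = khom_compose[OF M(1,2) k_K h] and rc = refinement_compose[OF r M(1)]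
  note i = induced_facts[OF M(1,3) c rc] and i1 = induced_facts[OF M(1,2) h(1) r(1)]
      and i2 = induced_facts[OF M(2,3) h(2) r(2)]
  show "?l \<in> extensional (carrier (rest s M1 L1 L1'))" using i(2) by (simp add: Hom_base_iff)
  show "?r \<in> extensional (carrier (rest s M1 L1 L1'))" by (rule compose_extensional)
  fix x assume x: "x \<in> L1"
  have "L1 \<in> lattices K V M1" "\<phi> x \<in> L2'" using r(1) x by (auto simp: refinement_iff)
  moreover have "x \<in> carrier M1" using lattice_mem(2)[OF M(1) calculation(1) x] .
  ultimately show "?l (coset_rep M1 L1' x) = ?r (coset_rep M1 L1' x)"
    using i(1)[OF x] i1(1)[OF x] i2(1)[of "\<phi> x"] x by (simp add: compose_def)
qed

text \<open>The order of the choices matters. L2 is taken so small that \<psi> maps it into L3; then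
  L2' so large that it contains L2 and the image of L1 under \<phi>; then P3 so large that it
  contains the image of L2' under \<psi>. Finally P1 is shrunk and P3 enlarged past the prescribed
  L1' and L3', which leaves the conditions intact.\<close>

lemma factor:
  assumes M: "fgmod K M1" "fgmod K M2" "fgmod K M3"
    and h: "refinable K V M1 M2 \<phi>" "refinable K V M2 M3 \<psi>"
    and l: "L1 \<in> lattices K V M1" "L1' \<in> lattices K V M1" "L1' \<subseteq> L1"
     "L3 \<in> lattices K V M3" "L3' \<in> lattices K V M3" "L3 \<subseteq> L3'"
  obtains P1 L2 L2' P3 where "refinement K V M1 M2 \<phi> (P1, L2') (L1, L2)"
    "refinement K V M2 M3 \<psi> (L2, P3) (L2', L3)" "P1 \<subseteq> L1'" "L3' \<subseteq> P3"
proof -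
  obtain L0 where L0: "L0 \<in> lattices K V M2" using lattice_exists[OF M(2)] .
  obtain L2 A where r1: "refinement K V M2 M3 \<psi> (L2, A) (L0, L3)" using h(2) L0 l(4) unfolding refinable_def
      by blast
  then have L2: "L2 \<in> lattices K V M2" by (simp add: refinement_iff)
  obtain B L2' where r2: "refinement K V M1 M2 \<phi> (B, L2') (L1, L2)" using h(1) L2 l(1) unfolding refinable_def
      by blast
  then have B: "B \<in> lattices K V M1" and L2': "L2' \<in> lattices K V M2" by (auto simp: refinement_iff)
  obtain C D where r3: "refinement K V M2 M3 \<psi> (C, D) (L2', L3)" using h(2) L2' l(4) unfolding refinable_def
      by blast
  then have D: "D \<in> lattices K V M3" by (auto simp: refinement_iff)
  obtain P1 where P1: "P1 \<in> lattices K V M1" "P1 \<subseteq> L1'" "P1 \<subseteq> B"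
    using lattice_meet[OF fgmod_module[OF M(1)] l(2) B] .
  obtain P3 where P3: "P3 \<in> lattices K V M3" "D \<subseteq> P3" "L3' \<subseteq> P3"
    using lattice_join[OF fgmod_module[OF M(3)] D lattice_facts(3)[OF fgmod_module[OF M(3)] l(5)]] .
  show ?thesis
  proof
    show "refinement K V M1 M2 \<phi> (P1, L2') (L1, L2)" using r2 P1 by (auto simp: refinement_iff)
    show "refinement K V M2 M3 \<psi> (L2, P3) (L2', L3)"
      using r1 r2 r3 P3 unfolding refinement_iff by blast
  qed (use P1 P3 in auto)
qed

end

section \<open>Linear maps, composites, sums and the two-sided ideals\<close>

lemma (in lifted) refinable_linear:
  assumes M: "Module.module K M1" "Module.module K M2" and \<phi>: "lin K M1 M2 \<phi>"
  shows "refinable K V M1 M2 \<phi>"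
  unfolding refinable_def
proof (intro ballI)
  fix L1 L2 assume l: "L1 \<in> lattices K V M1" "L2 \<in> lattices K V M2"
  interpret M1: Module.module K M1 by fact
  interpret M2: Module.module K M2 by fact
  note l1 = lattice_facts[OF M(1) l(1)] and m1 = lattice_mem[OF M(1) l(1)]
  have "lin R M1 M2 \<phi>" using \<phi> by (auto simp: lin_def)
  from finite_submodule_image[OF module_R[OF M(1)] module_R[OF M(2)] this l1(3)]
  have f: "finite_submodule R M2 (\<phi> ` L1)" .
  obtain L2' where L2': "L2' \<in> lattices K V M2" "L2 \<subseteq> L2'" "\<phi> ` L1 \<subseteq> L2'"
    using lattice_join[OF M(2) l(2) f] .
  obtain n where n: "\<forall>x\<in>\<phi> ` L1. t [^] (n::nat) \<odot>\<^bsub>M2\<^esub> x \<in> L2"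
    using lattice_absorb[OF M(2) l(2) f] by auto
  let ?L1 = "(\<lambda>x. t [^] n \<odot>\<^bsub>M1\<^esub> x) ` L1"
  have "?L1 \<in> lattices K V M1" by (rule lattice_scale[OF M(1) l(1)]) (auto simp: tpow_nz)
  moreover have "?L1 \<subseteq> L1" using m1(5) t_V by auto
  moreover have "\<phi> x \<in> L2" if x: "x \<in> ?L1" for x
  proof -
    obtain y where y: "y \<in> L1" "x = t [^] n \<odot>\<^bsub>M1\<^esub> y" using x by auto
    then have "\<phi> x = t [^] n \<odot>\<^bsub>M2\<^esub> \<phi> y" using lin_facts(3)[OF M \<phi>] m1(2) by simp
    then show ?thesis using n y by auto
  qed
  ultimately have "refinement K V M1 M2 \<phi> (?L1, L2') (L1, L2)"
    using l L2' unfolding refinement_iff by blast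
  then show "\<exists>L1' L2'. refinement K V M1 M2 \<phi> (L1', L2') (L1, L2)" by blast
qed

text \<open>A map that is linear over K induces maps that are linear over the residue field, as
  \<open>hd \<sigma>\<close> defines the scalars on both sides; the claim passes down by
  induction.\<close>

theorem BT_linear:
  assumes "lifted_local_field k K Os \<sigma>" "Module.module K M1" "Module.module K M2" "\<phi> \<in> linear_maps K M1 M2"
  shows "\<phi> \<in> BT k K Os \<sigma> M1 M2"
  using assms
proof (induction Os arbitrary: K \<sigma> M1 M2 \<phi>)
  case Nil
  then have "khom k K M1 M2 \<phi>"
    by (intro lin_khom structure_map_closed linear_maps_lin) auto
  then show ?case using Nil.prems(4) by (auto simp: Hom_base_iff linear_maps_eq)
next
  case (Cons V Os)
  obtain t where t: "lifted k K V t (hd \<sigma>)" and F: "lifted_local_field k (residue_field K V) Os (tl \<sigma>)"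
    using lifted_local_field_lifted[OF Cons.prems(1)] .
  interpret lifted k K V t "hd \<sigma>" by fact
  note M = Cons.prems(2,3)
  interpret M1: Module.module K M1 by fact
  interpret M2: Module.module K M2 by fact
  have l: "lin K M1 M2 \<phi>" using Cons.prems(4) by (rule linear_maps_lin)
  have kh: "khom k K M1 M2 \<phi>" by (rule lin_khom[OF k_K l])
  show ?case unfolding BT_Cons_iff
  proof (intro conjI allI impI)
    show "\<phi> \<in> Hom_base k K M1 M2" using kh Cons.prems(4) by (auto simp: Hom_base_iff linear_maps_eq)
    show "refinable K V M1 M2 \<phi>" by (rule refinable_linear[OF M l])
    fix L1 L2 L1' L2' assume r: "refinement K V M1 M2 \<phi> (L1', L2') (L1, L2)"
    note r' = r[unfolded refinement_iff]
    have lt: "L1 \<in> lattices K V M1" "L1' \<in> lattices K V M1" "L2 \<in> lattices K V M2" "L2' \<in> lattices K V M2"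
      "L1' \<subseteq> L1" "L2 \<subseteq> L2'" using r' by auto
    note q1 = rest_facts[OF M(1) lt(2,1,5)] and q2 = rest_facts[OF M(2) lt(3,4,6)]
    note i = induced_facts[OF M kh r]
    let ?i = "induced_map M1 M2 \<phi> (L1', L2') (L1, L2)"
    have "?i \<in> linear_maps F (rest (hd \<sigma>) M1 L1 L1') (rest (hd \<sigma>) M2 L2' L2)"
      unfolding linear_maps_eq lin_def
    proof (intro CollectI conjI ballI)
      fix a q assume a: "a \<in> carrier F" and "q \<in> carrier (rest (hd \<sigma>) M1 L1 L1')"
      then obtain x where x: "x \<in> L1" "q = coset_rep M1 L1' x" by auto
      have xM: "x \<in> carrier M1" using lattice_mem(2)[OF M(1) lt(1) x(1)] .
      have \<phi>x: "\<phi> x \<in> L2'" using r' x by auto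
      have "\<phi> (hd \<sigma> a \<odot>\<^bsub>M1\<^esub> x) = hd \<sigma> a \<odot>\<^bsub>M2\<^esub> \<phi> x"
        using lin_facts(3)[OF M l _ xM] s_facts(1)[OF a] by auto
      then show "?i (a \<odot>\<^bsub>rest (hd \<sigma>) M1 L1 L1'\<^esub> q) = a \<odot>\<^bsub>rest (hd \<sigma>) M2 L2' L2\<^esub> ?i q"
        unfolding x(2) q1(5)[OF a x(1)] i(1)[OF x(1)] q2(5)[OF a \<phi>x]
        using i(1)[OF lattice_mem(5)[OF M(1) lt(1) s_facts(1)[OF a] x(1)]] by simp
    qed (use i(2) in \<open>auto simp: Hom_base_iff khom_def simp del: rest_simps\<close>)
    then show "?i \<in> BT k F Os (tl \<sigma>) (rest (hd \<sigma>) M1 L1 L1') (rest (hd \<sigma>) M2 L2' L2)"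
      by (rule Cons.IH[OF F q1(8) q2(8)])
  qed
qed

text \<open>For a refinement of the composite, \<open>factor\<close> supplies a larger one on which
  the induced map is a composite of induced maps. \<open>refine_maps\<close> returns to the given
  refinement at the price of two further compositions, with linear maps, which the induction
  hypothesis also covers.\<close>

theorem BT_compose:
  fixes K :: "('k, 'a) module" and M1 M2 M3 :: "('a, 'm) module"
  assumes "lifted_local_field k K Os \<sigma>" "fgmod K M1" "fgmod K M2" "fgmod K M3"
    "\<phi> \<in> BT k K Os \<sigma> M1 M2" "\<psi> \<in> BT k K Os \<sigma> M2 M3"
  shows "compose (carrier M1) \<psi> \<phi> \<in> BT k K Os \<sigma> M1 M3"
  using assms
proof (induction Os arbitrary: K \<sigma> M1 M2 M3 \<phi> \<psi>)
  case Nil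
  then have "khom k K M1 M3 (compose (carrier M1) \<psi> \<phi>)"
    by (intro khom_compose[of K M1 M2] structure_map_closed) (auto simp: Hom_base_iff fgmod_def)
  then show ?case by (auto simp: Hom_base_iff)
next
  case (Cons V Os)
  obtain t where t: "lifted k K V t (hd \<sigma>)" and F: "lifted_local_field k (residue_field K V) Os (tl \<sigma>)"
    using lifted_local_field_lifted[OF Cons.prems(1)] .
  interpret lifted k K V t "hd \<sigma>" by fact
  note f = Cons.prems(2-4)
  note M = f[THEN fgmod_module]
  let ?c = "compose (carrier M1) \<psi> \<phi>"
  note \<phi> = Cons.prems(5)[unfolded BT_Cons_iff] and \<psi> = Cons.prems(6)[unfolded BT_Cons_iff]
  have h: "khom k K M1 M2 \<phi>" "khom k K M2 M3 \<psi>" using \<phi> \<psi> by (auto simp: Hom_base_iff)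
  have rf: "refinable K V M1 M2 \<phi>" "refinable K V M2 M3 \<psi>" using \<phi> \<psi> by auto
  have c: "khom k K M1 M3 ?c" by (rule khom_compose[OF M(1,2) k_K h])
  show ?case unfolding BT_Cons_iff
  proof (intro conjI allI impI)
    show "?c \<in> Hom_base k K M1 M3" using c by (simp add: Hom_base_iff)
    show "refinable K V M1 M3 ?c" unfolding refinable_def
    proof (intro ballI)
      fix L1 L3 assume l: "L1 \<in> lattices K V M1" "L3 \<in> lattices K V M3"
      obtain P1 L2 L2' P3 where "refinement K V M1 M2 \<phi> (P1, L2') (L1, L2)"
          "refinement K V M2 M3 \<psi> (L2, P3) (L2', L3)"
        by (rule factor[OF f rf l(1) l(1) _ l(2) l(2)]) auto
      from refinement_compose[OF this M(1)]
      show "\<exists>L1' L3'. refinement K V M1 M3 ?c (L1', L3') (L1, L3)" by blast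
    qed
    fix L1 L3 L1' L3' assume r: "refinement K V M1 M3 ?c (L1', L3') (L1, L3)"
    note r' = r[unfolded refinement_iff]
    have l: "L1 \<in> lattices K V M1" "L1' \<in> lattices K V M1" "L1' \<subseteq> L1" "L3 \<in> lattices K V M3"
        "L3' \<in> lattices K V M3"
      "L3 \<subseteq> L3'" using r' by auto
    obtain P1 L2 L2' P3 where p: "refinement K V M1 M2 \<phi> (P1, L2') (L1, L2)"
      "refinement K V M2 M3 \<psi> (L2, P3) (L2', L3)" "P1 \<subseteq> L1'" "L3' \<subseteq> P3"
      using factor[OF f rf l] .
    note p1 = p(1)[unfolded refinement_iff] and p2 = p(2)[unfolded refinement_iff]
    have lp: "P1 \<in> lattices K V M1" "P1 \<subseteq> L1" "L2 \<in> lattices K V M2" "L2' \<in> lattices K V M2" "L2 \<subseteq> L2'"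
      "P3 \<in> lattices K V M3" "L3 \<subseteq> P3" using p1 p2 by auto
    obtain a b where ab: "a \<in> linear_maps F (rest (hd \<sigma>) M1 L1 L1') (rest (hd \<sigma>) M1 L1 P1)"
      "b \<in> linear_maps F (rest (hd \<sigma>) M3 P3 L3) (rest (hd \<sigma>) M3 L3' L3)" and
      e: "\<And>\<phi>. khom k K M1 M3 \<phi> \<Longrightarrow> refinement K V M1 M3 \<phi> (L1', L3') (L1, L3) \<Longrightarrow>
      refinement K V M1 M3 \<phi> (P1, P3) (L1, L3) \<Longrightarrow>
      induced_map M1 M3 \<phi> (L1', L3') (L1, L3) =
        compose (carrier (rest (hd \<sigma>) M1 L1 L1')) b (compose (carrier (rest (hd \<sigma>) M1 L1 L1')) (induced_map M1 M3 \<phi>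
            (P1, P3) (L1, L3)) a)"
      using refine_maps[OF M(1,3) l(1,2) lp(1) l(4,5) lp(6) p(3) l(3,6) p(4)] by blast
    note e = e[OF c r refinement_compose[OF p(1,2) M(1)]]
    note g = rest_facts(9)[OF M(1) l(2,1,3)] rest_facts(9)[OF M(1) lp(1) l(1) lp(2)]
      rest_facts(9)[OF M(2) lp(3-5)] rest_facts(9)[OF M(3) l(4) lp(6,7)] rest_facts(9)[OF M(3) l(4,5,6)]
    note ic = induced_compose[OF M h p(1,2)]
    have d: "induced_map M1 M3 ?c (P1, P3) (L1, L3) \<in> BT k F Os (tl \<sigma>) (rest (hd \<sigma>) M1 L1 P1) (rest (hd \<sigma>) M3 P3
        L3)"
      unfolding ic by (rule Cons.IH[OF F g(2,3,4)]) (use \<phi> \<psi> p in auto)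
    show "induced_map M1 M3 ?c (L1', L3') (L1, L3) \<in> BT k F Os (tl \<sigma>) (rest (hd \<sigma>) M1 L1 L1') (rest (hd \<sigma>) M3 L3'
        L3)"
      unfolding e
      by (rule Cons.IH[OF F g(1,4,5) Cons.IH[OF F g(1,2,4) BT_linear[OF F g(1,2)[THEN fgmod_module] ab(1)] d]
        BT_linear[OF F g(4,5)[THEN fgmod_module] ab(2)]])
  qed
qed

lemma refinement_mono:
  assumes "refinement K V M1 M2 \<phi> (L1', L2') (L1, L2)" "P1 \<in> lattices K V M1" "P1 \<subseteq> L1'"
    "P2 \<in> lattices K V M2" "L2' \<subseteq> P2"
  shows "refinement K V M1 M2 \<phi> (P1, P2) (L1, L2)"
  using assms unfolding refinement_iff by (auto simp: subset_iff)

text \<open>On a common refinement of both summands the induced map of the sum is the sum of the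
  induced maps. A given refinement of the sum alone need not refine either summand, which is why the
  passage through \<open>refine_maps\<close> is needed here too.\<close>

theorem BT_add:
  fixes K :: "('k, 'a) module" and M1 M2 :: "('a, 'm) module"
  assumes "lifted_local_field k K Os \<sigma>" "fgmod K M1" "fgmod K M2"
    "\<phi> \<in> BT k K Os \<sigma> M1 M2" "\<psi> \<in> BT k K Os \<sigma> M1 M2"
  shows "(\<lambda>x\<in>carrier M1. \<phi> x \<oplus>\<^bsub>M2\<^esub> \<psi> x) \<in> BT k K Os \<sigma> M1 M2"
  using assms
proof (induction Os arbitrary: K \<sigma> M1 M2 \<phi> \<psi>)
  case Nil
  then have "khom k K M1 M2 (\<lambda>x\<in>carrier M1. \<phi> x \<oplus>\<^bsub>M2\<^esub> \<psi> x)"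
    by (intro khom_add structure_map_closed) (auto simp: Hom_base_iff fgmod_def)
  then show ?case by (simp only: BT.simps Hom_base_iff restrict_extensional simp_thms)
next
  case (Cons V Os)
  obtain t where t: "lifted k K V t (hd \<sigma>)" and F: "lifted_local_field k (residue_field K V) Os (tl \<sigma>)"
    using lifted_local_field_lifted[OF Cons.prems(1)] .
  interpret lifted k K V t "hd \<sigma>" by fact
  note f = Cons.prems(2,3)
  note M = f[THEN fgmod_module]
  interpret M2: Module.module K M2 by (rule M)
  define c where "c = (\<lambda>x\<in>carrier M1. \<phi> x \<oplus>\<^bsub>M2\<^esub> \<psi> x)"
  note \<phi> = Cons.prems(4)[unfolded BT_Cons_iff] and \<psi> = Cons.prems(5)[unfolded BT_Cons_iff]
  have h: "khom k K M1 M2 \<phi>" "khom k K M1 M2 \<psi>" using \<phi> \<psi> by (auto simp: Hom_base_iff)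
  have c: "khom k K M1 M2 c" unfolding c_def by (rule khom_add[OF M k_K h])
  have cx: "c x = \<phi> x \<oplus>\<^bsub>M2\<^esub> \<psi> x" if "x \<in> carrier M1" for x using that by (simp add: c_def)
  \<comment> \<open>A refinement common to \<phi>, \<psi> and their sum, chosen beyond any
    prescribed L1' and L2' so that \<open>refine_maps\<close> can lead back to those.\<close>
  have com: "\<exists>P1 P2. refinement K V M1 M2 \<phi> (P1, P2) (L1, L2) \<and> refinement K V M1 M2 \<psi> (P1, P2) (L1, L2) \<and>
     refinement K V M1 M2 c (P1, P2) (L1, L2) \<and> P1 \<subseteq> L1' \<and> L2' \<subseteq> P2"
    if l: "L1 \<in> lattices K V M1" "L2 \<in> lattices K V M2" "L1' \<in> lattices K V M1" "L2' \<in> lattices K V M2"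
        for L1 L2 L1' L2'
  proof -
    obtain A B C D where r: "refinement K V M1 M2 \<phi> (A, B) (L1, L2)" "refinement K V M1 M2 \<psi> (C, D) (L1, L2)"
      using \<phi> \<psi> l unfolding refinable_def by meson
    have ll: "A \<in> lattices K V M1" "B \<in> lattices K V M2" "C \<in> lattices K V M1" "D \<in> lattices K V M2"
      using r by (auto simp: refinement_iff)
    obtain Q where Q: "Q \<in> lattices K V M1" "Q \<subseteq> A" "Q \<subseteq> C" using lattice_meet[OF M(1) ll(1,3)] .
    obtain P1 where P1: "P1 \<in> lattices K V M1" "P1 \<subseteq> Q" "P1 \<subseteq> L1'" using lattice_meet[OF M(1) Q(1) l(3)] .
    obtain Q2 where Q2: "Q2 \<in> lattices K V M2" "B \<subseteq> Q2" "D \<subseteq> Q2" 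
      using lattice_join[OF M(2) ll(2) lattice_facts(3)[OF M(2) ll(4)]] .
    obtain P2 where P2: "P2 \<in> lattices K V M2" "Q2 \<subseteq> P2" "L2' \<subseteq> P2"
      using lattice_join[OF M(2) Q2(1) lattice_facts(3)[OF M(2) l(4)]] .
    have p: "refinement K V M1 M2 \<phi> (P1, P2) (L1, L2)" "refinement K V M1 M2 \<psi> (P1, P2) (L1, L2)"
      by (rule refinement_mono[OF r(1) P1(1) subset_trans[OF P1(2) Q(2)] P2(1) subset_trans[OF Q2(2) P2(2)]],
          rule refinement_mono[OF r(2) P1(1) subset_trans[OF P1(2) Q(3)] P2(1) subset_trans[OF Q2(3) P2(2)]])
    moreover have "refinement K V M1 M2 c (P1, P2) (L1, L2)"
      unfolding refinement_iff
    proof (intro conjI ballI)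
      note p' = p[unfolded refinement_iff]
      show "c x \<in> L2" if "x \<in> P1" for x
        using cx[OF lattice_mem(2)[OF M(1) P1(1) that]] lattice_mem(3)[OF M(2) l(2)] p' that by simp
      show "c x \<in> P2" if "x \<in> L1" for x
        using cx[OF lattice_mem(2)[OF M(1) l(1) that]] lattice_mem(3)[OF M(2) P2(1)] p' that by simp
    qed (use p[unfolded refinement_iff] in auto)
    ultimately show ?thesis using P1 P2 by blast
  qed
  have "c \<in> BT k K (V # Os) \<sigma> M1 M2" unfolding BT_Cons_iff
  proof (intro conjI allI impI)
    show "c \<in> Hom_base k K M1 M2" unfolding Hom_base_iff using c by (simp add: c_def)
    show "refinable K V M1 M2 c" unfolding refinable_def using com by blast
    fix L1 L2 L1' L2' assume r: "refinement K V M1 M2 c (L1', L2') (L1, L2)"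
    note r' = r[unfolded refinement_iff]
    have l: "L1 \<in> lattices K V M1" "L1' \<in> lattices K V M1" "L1' \<subseteq> L1" "L2 \<in> lattices K V M2"
        "L2' \<in> lattices K V M2"
      "L2 \<subseteq> L2'" using r' by auto
    obtain P1 P2 where p: "refinement K V M1 M2 \<phi> (P1, P2) (L1, L2)" "refinement K V M1 M2 \<psi> (P1, P2) (L1, L2)"
     "refinement K V M1 M2 c (P1, P2) (L1, L2)" "P1 \<subseteq> L1'" "L2' \<subseteq> P2" using com[OF l(1,4,2,5)] by blast
    have lp: "P1 \<in> lattices K V M1" "P1 \<subseteq> L1" "P2 \<in> lattices K V M2" "L2 \<subseteq> P2" using p(1)
        by (auto simp: refinement_iff)
    obtain a b where ab: "a \<in> linear_maps F (rest (hd \<sigma>) M1 L1 L1') (rest (hd \<sigma>) M1 L1 P1)"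
      "b \<in> linear_maps F (rest (hd \<sigma>) M2 P2 L2) (rest (hd \<sigma>) M2 L2' L2)" and
      e: "\<And>\<phi>. khom k K M1 M2 \<phi> \<Longrightarrow> refinement K V M1 M2 \<phi> (L1', L2') (L1, L2) \<Longrightarrow>
      refinement K V M1 M2 \<phi> (P1, P2) (L1, L2) \<Longrightarrow>
      induced_map M1 M2 \<phi> (L1', L2') (L1, L2) =
        compose (carrier (rest (hd \<sigma>) M1 L1 L1')) b (compose (carrier (rest (hd \<sigma>) M1 L1 L1')) (induced_map M1 M2 \<phi>
            (P1, P2) (L1, L2)) a)"
      using refine_maps[OF M l(1,2) lp(1) l(4,5) lp(3) p(4) l(3,6) p(5)] by blast
    note e = e[OF c r p(3)]
    note g = rest_facts(9)[OF M(1) l(2,1,3)] rest_facts(9)[OF M(1) lp(1) l(1) lp(2)]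
      rest_facts(9)[OF M(2) l(4) lp(3,4)] rest_facts(9)[OF M(2) l(4,5,6)]
    note i = induced_facts[OF M c p(3)] and i1 = induced_facts[OF M h(1) p(1)]
        and i2 = induced_facts[OF M h(2) p(2)]
    have eq: "induced_map M1 M2 c (P1, P2) (L1, L2) = (\<lambda>x\<in>carrier (rest (hd \<sigma>) M1 L1 P1). 
        induced_map M1 M2 \<phi> (P1, P2) (L1, L2) x \<oplus>\<^bsub>rest (hd \<sigma>) M2 P2 L2\<^esub> induced_map M1 M2 \<psi> (P1, P2) (L1, L2)
            x)" (is "?l = ?r")
    proof (rule extensional_rest_eqI)
      show "?l \<in> extensional (carrier (rest (hd \<sigma>) M1 L1 P1))" using i(2) by (simp add: Hom_base_iff)
      show "?r \<in> extensional (carrier (rest (hd \<sigma>) M1 L1 P1))" by (rule restrict_extensional)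
      fix x assume x: "x \<in> L1"
      have "\<phi> x \<in> P2" "\<psi> x \<in> P2" using p(1,2) x by (auto simp: refinement_iff)
      then show "?l (coset_rep M1 P1 x) = ?r (coset_rep M1 P1 x)"
        using i(1)[OF x] i1(1)[OF x] i2(1)[OF x] x lattice_mem(2)[OF M(1) l(1) x] rest_facts(4)[OF M(2) l(4)
            lp(3,4), of "\<phi> x" "\<psi> x"] cx
        by (simp del: rest_simps(3))
    qed
    have d: "induced_map M1 M2 c (P1, P2) (L1, L2) \<in> BT k F Os (tl \<sigma>) (rest (hd \<sigma>) M1 L1 P1) (rest (hd \<sigma>) M2 P2
        L2)"
      unfolding eq by (rule Cons.IH[OF F g(2,3)]) (use \<phi> \<psi> p in blast)+
    show "induced_map M1 M2 c (L1', L2') (L1, L2) \<in> BT k F Os (tl \<sigma>) (rest (hd \<sigma>) M1 L1 L1') (rest (hd \<sigma>) M2 L2'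
        L2)"
      unfolding e
      by (rule BT_compose[OF F g(1,3,4) BT_compose[OF F g(1,2,3) BT_linear[OF F g(1,2)[THEN fgmod_module] ab(1)] d]
        BT_linear[OF F g(3,4)[THEN fgmod_module] ab(2)]])
  qed
  then show ?case by (simp only: c_def)
qed

lemma BT_ideal_BT: "\<phi> \<in> BT_ideal k K Os \<sigma> M1 M2 i j \<Longrightarrow> \<phi> \<in> BT k K Os \<sigma> M1 M2"
  by (cases Os) auto

text \<open>The ideal property on both sides at once, by a disjunction, so that one induction also
  handles the composition with the linear maps from \<open>refine_maps\<close>. At i = 1 a bounded
  image or an annihilated lattice is carried through the other factor by its refinability.\<close>

theorem BT_ideal_compose:
  fixes K :: "('k, 'a) module" and M1 M2 M3 :: "('a, 'm) module"
  assumes "lifted_local_field k K Os \<sigma>" "fgmod K M1" "fgmod K M2" "fgmod K M3"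
    "\<phi> \<in> BT k K Os \<sigma> M1 M2" "\<psi> \<in> BT k K Os \<sigma> M2 M3"
    "\<phi> \<in> BT_ideal k K Os \<sigma> M1 M2 i j \<or> \<psi> \<in> BT_ideal k K Os \<sigma> M2 M3 i j"
  shows "compose (carrier M1) \<psi> \<phi> \<in> BT_ideal k K Os \<sigma> M1 M3 i j"
  using assms
proof (induction Os arbitrary: K \<sigma> M1 M2 M3 \<phi> \<psi> i)
  case Nil
  then show ?case by auto
next
  case (Cons V Os)
  obtain t where t: "lifted k K V t (hd \<sigma>)" and F: "lifted_local_field k (residue_field K V) Os (tl \<sigma>)"
    using lifted_local_field_lifted[OF Cons.prems(1)] .
  interpret lifted k K V t "hd \<sigma>" by fact
  note f = Cons.prems(2-4)
  note M = f[THEN fgmod_module]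
  interpret M1: Module.module K M1 by (rule M)
  interpret M3: Module.module K M3 by (rule M)
  let ?c = "compose (carrier M1) \<psi> \<phi>"
  note \<phi> = Cons.prems(5)[unfolded BT_Cons_iff] and \<psi> = Cons.prems(6)[unfolded BT_Cons_iff]
  have h: "khom k K M1 M2 \<phi>" "khom k K M2 M3 \<psi>" using \<phi> \<psi> by (auto simp: Hom_base_iff)
  note kf = khom_facts[OF M(1,2) h(1)] khom_facts[OF M(2,3) h(2)]
  have rf: "refinable K V M1 M2 \<phi>" "refinable K V M2 M3 \<psi>" using \<phi> \<psi> by auto
  have c: "khom k K M1 M3 ?c" by (rule khom_compose[OF M(1,2) k_K h])
  have bt: "?c \<in> BT k K (V # Os) \<sigma> M1 M3" by (rule BT_compose[OF Cons.prems(1-6)])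
  obtain A where A: "A \<in> lattices K V M1" using lattice_exists[OF f(1)] .
  obtain C where C: "C \<in> lattices K V M3" using lattice_exists[OF f(3)] .
  \<comment> \<open>The split follows \<open>BT_ideal\<close>, which only separates i = 1 from other
    i and j = 1 from other j.\<close>
  consider "i = 1" "j = 1" | "i = 1" "j \<noteq> 1" | "i \<noteq> 1" by blast
  then show ?case
  proof cases
    case 1
    have "\<exists>L \<in> lattices K V M3. ?c ` carrier M1 \<subseteq> L"
      using Cons.prems(7)
    proof
      assume "\<phi> \<in> BT_ideal k K (V # Os) \<sigma> M1 M2 i j"
      then obtain L2 where L2: "L2 \<in> lattices K V M2" "\<phi> ` carrier M1 \<subseteq> L2" using 1 by auto
      obtain X' L3 where "refinement K V M2 M3 \<psi> (X', L3) (L2, C)" using rf(2) L2(1) C unfolding refinable_def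
          by blast
      then show ?thesis using L2 by (intro bexI[of _ L3]) (auto simp: refinement_iff compose_def)
    next
      assume "\<psi> \<in> BT_ideal k K (V # Os) \<sigma> M2 M3 i j"
      then obtain L3 where "L3 \<in> lattices K V M3" "\<psi> ` carrier M2 \<subseteq> L3" using 1 by auto
      then show ?thesis using kf(1) by (intro bexI[of _ L3]) (auto simp: compose_def)
    qed
    then show ?thesis using 1 bt by simp
  next
    case 2
    have "\<exists>L \<in> lattices K V M1. \<forall>x\<in>L. ?c x = \<zero>\<^bsub>M3\<^esub>"
      using Cons.prems(7)
    proof
      assume "\<phi> \<in> BT_ideal k K (V # Os) \<sigma> M1 M2 i j"
      then obtain L1 where L1: "L1 \<in> lattices K V M1" "\<forall>x\<in>L1. \<phi> x = \<zero>\<^bsub>M2\<^esub>" using 2 by auto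
      then show ?thesis using kf(9) lattice_mem(2)[OF M(1) L1(1)] by (intro bexI[of _ L1]) (auto simp: compose_def)
    next
      assume "\<psi> \<in> BT_ideal k K (V # Os) \<sigma> M2 M3 i j"
      then obtain L2 where L2: "L2 \<in> lattices K V M2" "\<forall>x\<in>L2. \<psi> x = \<zero>\<^bsub>M3\<^esub>" using 2 by auto
      obtain L1 X' where r: "refinement K V M1 M2 \<phi> (L1, X') (A, L2)" using rf(1) L2(1) A unfolding refinable_def
          by blast
      then have "L1 \<in> lattices K V M1" by (simp add: refinement_iff)
      then show ?thesis using L2 r lattice_mem(2)[OF M(1)]
          by (intro bexI[of _ L1]) (auto simp: refinement_iff compose_def)
    qed
    then show ?thesis using 2 bt by simp
  next
    case 3
    have "induced_map M1 M3 ?c (L1', L3') (L1, L3) \<in> BT_ideal k F Os (tl \<sigma>) (rest (hd \<sigma>) M1 L1 L1') (rest (hd \<sigma>) M3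
        L3' L3) (i - 1) j"
      if r: "refinement K V M1 M3 ?c (L1', L3') (L1, L3)" for L1 L1' L3 L3'
    proof -
      note r' = r[unfolded refinement_iff]
      have l: "L1 \<in> lattices K V M1" "L1' \<in> lattices K V M1" "L1' \<subseteq> L1" "L3 \<in> lattices K V M3"
          "L3' \<in> lattices K V M3"
        "L3 \<subseteq> L3'" using r' by auto
      obtain P1 L2 L2' P3 where p: "refinement K V M1 M2 \<phi> (P1, L2') (L1, L2)"
        "refinement K V M2 M3 \<psi> (L2, P3) (L2', L3)" "P1 \<subseteq> L1'" "L3' \<subseteq> P3"
        using factor[OF f rf l] .
      note p1 = p(1)[unfolded refinement_iff] and p2 = p(2)[unfolded refinement_iff]
      have lp: "P1 \<in> lattices K V M1" "P1 \<subseteq> L1" "L2 \<in> lattices K V M2" "L2' \<in> lattices K V M2" "L2 \<subseteq> L2'"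
        "P3 \<in> lattices K V M3" "L3 \<subseteq> P3" using p1 p2 by auto
      obtain a b where ab: "a \<in> linear_maps F (rest (hd \<sigma>) M1 L1 L1') (rest (hd \<sigma>) M1 L1 P1)"
        "b \<in> linear_maps F (rest (hd \<sigma>) M3 P3 L3) (rest (hd \<sigma>) M3 L3' L3)" and
        e: "\<And>\<phi>. khom k K M1 M3 \<phi> \<Longrightarrow> refinement K V M1 M3 \<phi> (L1', L3') (L1, L3) \<Longrightarrow>
        refinement K V M1 M3 \<phi> (P1, P3) (L1, L3) \<Longrightarrow>
        induced_map M1 M3 \<phi> (L1', L3') (L1, L3) =
          compose (carrier (rest (hd \<sigma>) M1 L1 L1')) b (compose (carrier (rest (hd \<sigma>) M1 L1 L1')) (induced_map M1 M3
              \<phi> (P1, P3) (L1, L3)) a)"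
        using refine_maps[OF M(1,3) l(1,2) lp(1) l(4,5) lp(6) p(3) l(3,6) p(4)] by blast
      note e = e[OF c r refinement_compose[OF p(1,2) M(1)]]
      note g = rest_facts(9)[OF M(1) l(2,1,3)] rest_facts(9)[OF M(1) lp(1) l(1) lp(2)]
        rest_facts(9)[OF M(2) lp(3-5)] rest_facts(9)[OF M(3) l(4) lp(6,7)] rest_facts(9)[OF M(3) l(4,5,6)]
      note ic = induced_compose[OF M h p(1,2)]
      \<comment> \<open>Whichever factor lies in the ideal, its induced map lies in the ideal of
        index i - 1 one level below.\<close>
      have or: "induced_map M1 M2 \<phi> (P1, L2') (L1, L2) \<in> BT_ideal k F Os (tl \<sigma>) (rest (hd \<sigma>) M1 L1 P1) (rest (hd \<sigma>)
          M2 L2' L2) (i - 1) j \<or>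
        induced_map M2 M3 \<psi> (L2, P3) (L2', L3) \<in> BT_ideal k F Os (tl \<sigma>) (rest (hd \<sigma>) M2 L2' L2) (rest (hd \<sigma>) M3 P3
            L3) (i - 1) j"
        using Cons.prems(7) 3 p by auto
      have "induced_map M1 M3 ?c (P1, P3) (L1, L3) \<in> BT_ideal k F Os (tl \<sigma>) (rest (hd \<sigma>) M1 L1 P1) (rest (hd \<sigma>) M3
          P3 L3) (i - 1) j"
        unfolding ic by (rule Cons.IH[OF F g(2,3,4) _ _ or]) (use \<phi> \<psi> p in auto)
      from Cons.IH[OF F g(1,2,4) BT_linear[OF F g(1,2)[THEN fgmod_module] ab(1)] BT_ideal_BT[OF this] disjI2[OF
          this]]
      have d: "compose (carrier (rest (hd \<sigma>) M1 L1 L1')) (induced_map M1 M3 ?c (P1, P3) (L1, L3)) a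
         \<in> BT_ideal k F Os (tl \<sigma>) (rest (hd \<sigma>) M1 L1 L1') (rest (hd \<sigma>) M3 P3 L3) (i - 1) j" .
      show ?thesis unfolding e
        by (rule Cons.IH[OF F g(1,4,5) BT_ideal_BT[OF d] BT_linear[OF F g(4,5)[THEN fgmod_module] ab(2)] disjI1[OF
            d]])
    qed
    then show ?thesis using 3 bt by simp
  qed
qed

section \<open>Differential operators\<close>

text \<open>
  \<open>E\<close> is a differential operator of order \<open>< d\<close> modulo \<open>J\<close>: all \<open>d\<close>-fold iterated commutators with
  elements \<open>a\<close> of \<open>A\<close>, acting on the source by \<open>a\<close> and on the target by \<open>h a\<close>, have values in \<open>J\<close>.
\<close>

primrec diff_op :: "('x, 'm) ring_scheme \<Rightarrow> ('a, 'n) ring_scheme \<Rightarrow> ('x \<Rightarrow> 'a) \<Rightarrow> 'a set \<Rightarrow> nat \<Rightarrow> ('x \<Rightarrow> 'a) \<Rightarrow> bool"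
    where
  "diff_op A K h J 0 E \<longleftrightarrow> (\<forall>x\<in>carrier A. E x \<in> J)"
| "diff_op A K h J (Suc d) E \<longleftrightarrow>
     (\<forall>a\<in>carrier A. diff_op A K h J d (\<lambda>x. E (a \<otimes>\<^bsub>A\<^esub> x) \<ominus>\<^bsub>K\<^esub> h a \<otimes>\<^bsub>K\<^esub> E x))"

lemma diff_op_cong:
  assumes "monoid A" "\<And>x. x \<in> carrier A \<Longrightarrow> E x = E' x"
  shows "diff_op A K h J d E \<longleftrightarrow> diff_op A K h J d E'"
  using assms(2)
proof (induction d arbitrary: E E')
  case (Suc d)
  interpret monoid A by fact
  show ?case unfolding diff_op.simps
    by (intro ball_cong refl Suc.IH) (simp add: Suc.prems)
qed simp

lemma diff_op_transfer:
  assumes "diff_op A K h J d E'" "cring A" "\<And>x. x \<in> carrier A \<Longrightarrow> E x = E' x"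
  shows "diff_op A K h J d E"
proof -
  interpret A: cring A by fact
  show ?thesis by (rule iffD2[OF diff_op_cong[OF A.monoid_axioms assms(3)] assms(1)])
qed

text \<open>Multiplication by \<open>u\<close> commutes with the scalars on the target, so
  commutators of u E are u times those of E; J' only has to contain u J.\<close>

lemma diff_op_scale:
  assumes "cring K" "cring A" "u \<in> carrier K" "\<And>a. a \<in> carrier A \<Longrightarrow> h a \<in> carrier K"
    "\<And>x. x \<in> carrier A \<Longrightarrow> E x \<in> carrier K"
    "\<And>y. y \<in> carrier K \<Longrightarrow> y \<in> J \<Longrightarrow> u \<otimes>\<^bsub>K\<^esub> y \<in> J'"
    "diff_op A K h J d E"
  shows "diff_op A K h J' d (\<lambda>x. u \<otimes>\<^bsub>K\<^esub> E x)"
  using assms(5,7)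
proof (induction d arbitrary: E)
  case (Suc d)
  interpret K: cring K by fact
  interpret A: cring A by fact
  have "diff_op A K h J' d (\<lambda>x. u \<otimes>\<^bsub>K\<^esub> E (a \<otimes>\<^bsub>A\<^esub> x) \<ominus>\<^bsub>K\<^esub> h a \<otimes>\<^bsub>K\<^esub> (u \<otimes>\<^bsub>K\<^esub> E x))" if a: "a \<in> carrier A" for a
  proof -
    have "diff_op A K h J' d (\<lambda>x. u \<otimes>\<^bsub>K\<^esub> (E (a \<otimes>\<^bsub>A\<^esub> x) \<ominus>\<^bsub>K\<^esub> h a \<otimes>\<^bsub>K\<^esub> E x))"
      by (rule Suc.IH) (use Suc.prems a assms(4) in simp_all)
    then show ?thesis
      by (rule diff_op_transfer[OF _ assms(2)])
        (use a Suc.prems(1) assms(3,4) in \<open>simp add: a_minus_def K.r_distr K.r_minus K.m_lcomm\<close>)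
  qed
  then show ?case by simp
qed (use assms in auto)

lemma diff_op_diff:
  assumes "cring K" "cring A" "\<And>a. a \<in> carrier A \<Longrightarrow> h a \<in> carrier K"
    "\<And>x. x \<in> carrier A \<Longrightarrow> E x \<in> carrier K" "\<And>x. x \<in> carrier A \<Longrightarrow> E' x \<in> carrier K"
    "\<And>x y. x \<in> J \<Longrightarrow> y \<in> J \<Longrightarrow> x \<ominus>\<^bsub>K\<^esub> y \<in> J"
    "diff_op A K h J d E" "diff_op A K h J d E'"
  shows "diff_op A K h J d (\<lambda>x. E x \<ominus>\<^bsub>K\<^esub> E' x)"
  using assms(4,5,7,8)
proof (induction d arbitrary: E E')
  case (Suc d)
  interpret K: cring K by fact
  interpret A: cring A by fact
  have "diff_op A K h J d (\<lambda>x. (E (a \<otimes>\<^bsub>A\<^esub> x) \<ominus>\<^bsub>K\<^esub> E' (a \<otimes>\<^bsub>A\<^esub> x)) \<ominus>\<^bsub>K\<^esub> h a \<otimes>\<^bsub>K\<^esub> (E x \<ominus>\<^bsub>K\<^esub> E' x))"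
    if a: "a \<in> carrier A" for a
  proof -
    have "diff_op A K h J d (\<lambda>x. (E (a \<otimes>\<^bsub>A\<^esub> x) \<ominus>\<^bsub>K\<^esub> h a \<otimes>\<^bsub>K\<^esub> E x) \<ominus>\<^bsub>K\<^esub> (E' (a \<otimes>\<^bsub>A\<^esub> x) \<ominus>\<^bsub>K\<^esub> h a \<otimes>\<^bsub>K\<^esub> E' x))"
      by (rule Suc.IH) (use Suc.prems a assms(3) in simp_all)
    then show ?thesis
      by (rule diff_op_transfer[OF _ assms(2)])
        (use a Suc.prems(1,2) assms(3) in \<open>simp add: a_minus_def K.r_distr K.r_minus K.minus_add K.a_ac\<close>)
  qed
  then show ?case by simp
qed (use assms in auto)

text \<open>As g is multiplicative, the commutator with a after precomposition is the precomposition
  of the commutator with g a. A general y restricts E to a line; y = 1 restricts it to a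
  subring.\<close>

lemma diff_op_precompose:
  assumes "cring A'" "cring A" "\<And>x. x \<in> carrier A' \<Longrightarrow> g x \<in> carrier A"
    "\<And>x y. x \<in> carrier A' \<Longrightarrow> y \<in> carrier A' \<Longrightarrow> g (x \<otimes>\<^bsub>A'\<^esub> y) = g x \<otimes>\<^bsub>A\<^esub> g y"
    "y \<in> carrier A" "diff_op A K h J d E"
  shows "diff_op A' K (\<lambda>x. h (g x)) J d (\<lambda>x. E (g x \<otimes>\<^bsub>A\<^esub> y))"
  using assms(6)
proof (induction d arbitrary: E)
  case 0
  interpret A: cring A by fact
  show ?case using 0 assms(3,5) by simp
next
  case (Suc d)
  interpret A: cring A by fact
  interpret A': cring A' by fact
  have "diff_op A' K (\<lambda>x. h (g x)) J d (\<lambda>x. E (g (a \<otimes>\<^bsub>A'\<^esub> x) \<otimes>\<^bsub>A\<^esub> y) \<ominus>\<^bsub>K\<^esub> h (g a) \<otimes>\<^bsub>K\<^esub> E (g x \<otimes>\<^bsub>A\<^esub> y))"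
    if a: "a \<in> carrier A'" for a
  proof -
    have "diff_op A' K (\<lambda>x. h (g x)) J d (\<lambda>x. E (g a \<otimes>\<^bsub>A\<^esub> (g x \<otimes>\<^bsub>A\<^esub> y)) \<ominus>\<^bsub>K\<^esub> h (g a) \<otimes>\<^bsub>K\<^esub> E (g x \<otimes>\<^bsub>A\<^esub> y))"
      by (rule Suc.IH) (use Suc.prems a assms(3) in simp)
    then show ?thesis
      by (rule diff_op_transfer[OF _ assms(1)])
        (use a assms(3-5) in \<open>simp add: A.m_assoc\<close>)
  qed
  then show ?case by simp
qed

text \<open>Reduction turns commutators modulo J into exact ones, because J lies in the maximal
  ideal, and turns the scalar s a into a, because \<open>s\<close> is a section.\<close>

lemma (in lifted) diff_op_res:
  assumes "\<And>x. x \<in> carrier F \<Longrightarrow> E x \<in> V" "J \<subseteq> m" "diff_op F K s J d E"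
  shows "diff_op F F id {\<zero>\<^bsub>F\<^esub>} d (\<lambda>x. res (E x))"
  using assms(1,3)
proof (induction d arbitrary: E)
  case 0
  then show ?case using assms(2) res_zero_iff by auto
next
  case (Suc d)
  have "diff_op F F id {\<zero>\<^bsub>F\<^esub>} d (\<lambda>x. res (E (a \<otimes>\<^bsub>F\<^esub> x)) \<ominus>\<^bsub>F\<^esub> id a \<otimes>\<^bsub>F\<^esub> res (E x))" if a: "a \<in> carrier F" for a
  proof -
    have d: "diff_op F F id {\<zero>\<^bsub>F\<^esub>} d (\<lambda>x. res (E (a \<otimes>\<^bsub>F\<^esub> x) \<ominus> s a \<otimes> E x))"
      using Suc.prems a s_facts(1) by (intro Suc.IH) auto
    have "res (E (a \<otimes>\<^bsub>F\<^esub> x) \<ominus> s a \<otimes> E x) = res (E (a \<otimes>\<^bsub>F\<^esub> x)) \<ominus>\<^bsub>F\<^esub> id a \<otimes>\<^bsub>F\<^esub> res (E x)" if x: "x \<in> carrier F" for x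
    proof -
      let ?u = "E (a \<otimes>\<^bsub>F\<^esub> x)" and ?v = "s a \<otimes> E x"
      have v: "?u \<in> V" "?v \<in> V" using Suc.prems a x s_facts(1) by auto
      have r: "res ?v = a \<otimes>\<^bsub>F\<^esub> res (E x)" using res_mult[of "s a" "E x"] s_facts(1,6)[OF a] Suc.prems(1)[OF x]
          by simp
      have "(?u \<ominus> ?v) \<oplus> ?v = ?u" using v[THEN V_in] by (simp add: a_minus_def a_assoc l_neg)
      then have "res (?u \<ominus> ?v) \<oplus>\<^bsub>F\<^esub> res ?v = res ?u" using res_add[of "?u \<ominus> ?v" ?v] v by simp
      then have "res (?u \<ominus> ?v) = res ?u \<ominus>\<^bsub>F\<^esub> res ?v"
        using F_mem(1)[of "?u \<ominus> ?v"] F_mem(1) v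
        by (metis F.add.inv_solve_right a_minus_def V_minus)
      then show ?thesis using r by simp
    qed
    then show ?thesis using diff_op_transfer[OF d F.is_cring] by simp
  qed
  then show ?case unfolding diff_op.simps by blast
qed

lemma (in lifted) s_diff: "x \<in> carrier F \<Longrightarrow> y \<in> carrier F \<Longrightarrow> s (x \<ominus>\<^bsub>F\<^esub> y) = s x \<ominus> s y"
proof -
  assume x: "x \<in> carrier F" and y: "y \<in> carrier F"
  have "s (x \<ominus>\<^bsub>F\<^esub> y) \<oplus> s y = s x" using s_facts(2)[of "x \<ominus>\<^bsub>F\<^esub> y" y] x y
    by (simp add: a_minus_def F.a_assoc F.l_neg)
  then show ?thesis using s_facts(1)[of "x \<ominus>\<^bsub>F\<^esub> y"] s_facts(1)[OF x] s_facts(1)[OF y] x y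
    by (metis V_in F.minus_closed add.inv_solve_right a_minus_def)
qed

text \<open>Since \<open>s\<close> is a ring homomorphism, it maps commutators on the residue field
  to commutators in K, with no error term.\<close>

lemma (in lifted) diff_op_lift:
  assumes "\<And>x. x \<in> carrier F \<Longrightarrow> E x \<in> carrier F" "\<zero> \<in> J" "diff_op F F id {\<zero>\<^bsub>F\<^esub>} d E"
  shows "diff_op F K s J d (\<lambda>x. s (E x))"
  using assms(1,3)
proof (induction d arbitrary: E)
  case 0
  then show ?case using assms(2) by (auto simp: s_zero)
next
  case (Suc d)
  have "diff_op F K s J d (\<lambda>x. s (E (a \<otimes>\<^bsub>F\<^esub> x)) \<ominus> s a \<otimes> s (E x))" if a: "a \<in> carrier F" for a
  proof -
    have "diff_op F K s J d (\<lambda>x. s (E (a \<otimes>\<^bsub>F\<^esub> x) \<ominus>\<^bsub>F\<^esub> id a \<otimes>\<^bsub>F\<^esub> E x))"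
      by (rule Suc.IH) (use Suc.prems a in auto)
    then show ?thesis
      by (rule diff_op_transfer[OF _ F.is_cring]) (use a Suc.prems(1) in \<open>auto simp: s_diff s_facts\<close>)
  qed
  then show ?case by simp
qed

section \<open>Comparison of the module structures\<close>

lemma fgmod_regular: "cring F \<Longrightarrow> fgmod F (regular_module F)"
proof -
  assume F: "cring F"
  interpret cring F by fact
  interpret M: Module.module F "regular_module F" by (rule regular_module_module[OF F])
  let ?S = "span_module F (regular_module F) {\<one>\<^bsub>F\<^esub>}"
  have c: "{\<one>\<^bsub>F\<^esub>} \<subseteq> carrier (regular_module F)" by simp
  note sm = span_submodule[OF regular_module_module[OF F] c]
  have "x \<in> ?S" if "x \<in> carrier F" for x
    using submodule_mem(5)[OF regular_module_module[OF F] sm that, of "\<one>\<^bsub>F\<^esub>"] span_superset[of "{\<one>\<^bsub>F\<^esub>}" F] that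
        by auto
  then have "carrier (regular_module F) = ?S"
    using submodule_mem(2)[OF regular_module_module[OF F] sm] by auto
  then show ?thesis using regular_module_module[OF F] c unfolding fgmod_def finite_submodule_def
    by (intro conjI exI[of _ "{\<one>\<^bsub>F\<^esub>}"]) auto
qed

text \<open>Along \<open>projection_induct\<close> the identity of M is written as a finite sum of
  maps x -> l x y. So \<phi> is a finite sum of linear forms followed by the restrictions of \<phi>
  to lines, and closure under composition and sums applies.\<close>

lemma BT_from_lines:
  fixes F :: "('k, 'a) module" and M N :: "('a, 'a) module"
  assumes F: "lifted_local_field k F Os \<tau>" and M: "fgmod F M" and N: "fgmod F N" and \<phi>: "\<phi> \<in> Hom_base k F M N"
    and lines: "\<And>y. y \<in> carrier M \<Longrightarrow> (\<lambda>x\<in>carrier F. \<phi> (x \<odot>\<^bsub>M\<^esub> y)) \<in> BT k F Os \<tau> (regular_module F) N"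
  shows "\<phi> \<in> BT k F Os \<tau> M N"
proof -
  have field: "field F" using lifted_local_field_field[OF F] by simp
  interpret F: field F by fact
  note mM = fgmod_module[OF M] and mN = fgmod_module[OF N]
  note fF = fgmod_regular[OF F.is_cring]
  interpret M: Module.module F M by (rule mM)
  interpret N: Module.module F N by (rule mN)
  have kh: "khom k F M N \<phi>" "\<phi> \<in> extensional (carrier M)" using \<phi> by (auto simp: Hom_base_iff)
  note f = khom_facts[OF mM mN kh(1)]
  obtain S where S: "finite S" "S \<subseteq> carrier M" "carrier M = span_module F M S"
    using M by (auto simp: fgmod_def finite_submodule_def)
  have Z: "submodule {\<zero>\<^bsub>M\<^esub>} F M" by (rule M.submoduleI) auto
  have sp: "carrier M = span_module F M ({\<zero>\<^bsub>M\<^esub>} \<union> S)"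
  proof
    have c: "{\<zero>\<^bsub>M\<^esub>} \<union> S \<subseteq> carrier M" using S by auto
    have "S \<subseteq> span_module F M ({\<zero>\<^bsub>M\<^esub>} \<union> S)" by (rule subset_trans[OF _ span_superset]) auto
    from span_least[OF span_submodule[OF mM c] this]
    show "carrier M \<subseteq> span_module F M ({\<zero>\<^bsub>M\<^esub>} \<union> S)" using S(3) by simp
    show "span_module F M ({\<zero>\<^bsub>M\<^esub>} \<union> S) \<subseteq> carrier M"
      by (rule M.submoduleE(1)[OF span_submodule[OF mM c]])
  qed
  have "\<exists>e\<in>linear_maps F M M. compose (carrier M) \<phi> e \<in> BT k F Os \<tau> M N \<and>
     (\<forall>x\<in>{\<zero>\<^bsub>M\<^esub>}. e x = \<zero>\<^bsub>M\<^esub>) \<and> (\<forall>x\<in>carrier M. x \<ominus>\<^bsub>M\<^esub> e x \<in> {\<zero>\<^bsub>M\<^esub>})"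
  proof (rule projection_induct[OF field mM Z S(1,2) sp])
    have "(\<lambda>x\<in>carrier M. \<zero>\<^bsub>N\<^esub>) \<in> linear_maps F M N"
      by (rule linear_maps_restrict[OF mM]) (auto simp: lin_def)
    moreover have "compose (carrier M) \<phi> (\<lambda>x\<in>carrier M. \<zero>\<^bsub>M\<^esub>) = (\<lambda>x\<in>carrier M. \<zero>\<^bsub>N\<^esub>)"
      using f(4) by (auto simp: compose_def fun_eq_iff)
    ultimately show "compose (carrier M) \<phi> (\<lambda>x\<in>carrier M. \<zero>\<^bsub>M\<^esub>) \<in> BT k F Os \<tau> M N"
      using BT_linear[OF F mM mN] by simp
  next
    fix e l y assume h: "compose (carrier M) \<phi> e \<in> BT k F Os \<tau> M N" "e \<in> linear_maps F M M"
      "l \<in> linear_maps F M (regular_module F)" "y \<in> carrier M"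
    note ll = lin_facts(1)[OF mM fgmod_module[OF fF] linear_maps_lin[OF h(3)]]
      and el = lin_facts(1)[OF mM mM linear_maps_lin[OF h(2)]]
    have "l \<in> BT k F Os \<tau> M (regular_module F)" by (rule BT_linear[OF F mM fgmod_module[OF fF] h(3)])
    from BT_add[OF F M N h(1) BT_compose[OF F M fF N this lines[OF h(4)]]]
    show "compose (carrier M) \<phi> (\<lambda>x\<in>carrier M. e x \<oplus>\<^bsub>M\<^esub> l x \<odot>\<^bsub>M\<^esub> y) \<in> BT k F Os \<tau> M N"
      by (rule back_subst[where P = "\<lambda>z. z \<in> BT k F Os \<tau> M N"])
        (use ll el h(4) f(2) in \<open>auto simp: compose_def fun_eq_iff\<close>)
  qed
  then obtain e where e: "e \<in> linear_maps F M M" "compose (carrier M) \<phi> e \<in> BT k F Os \<tau> M N"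
     "\<And>x. x \<in> carrier M \<Longrightarrow> x \<ominus>\<^bsub>M\<^esub> e x = \<zero>\<^bsub>M\<^esub>" by auto
  have ex: "e x = x" if "x \<in> carrier M" for x
    using M.minus_eq_zeroD[OF that lin_facts(1)[OF mM mM linear_maps_lin[OF e(1)] that] e(3)[OF that]] by simp
  have "compose (carrier M) \<phi> e = \<phi>"
    by (rule extensionalityI[OF compose_extensional kh(2)]) (simp add: compose_def ex)
  then show ?thesis using e(2) by simp
qed

text \<open>The statement proved by induction on the dimension. All orders d are included, because
  the comparison of liftings on L'/L needs an order that grows with the exponent l for which t^l
  kills the quotient.\<close>

definition diff_ops_BT :: "('k, 'b) ring_scheme \<Rightarrow> ('k, 'a) module \<Rightarrow> 'a set list \<Rightarrow> 'a topology \<Rightarrow> ('a \<Rightarrow> 'a) list \<Rightarrow>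
    bool" where
  "diff_ops_BT k K Os T \<sigma> \<longleftrightarrow> (\<forall>d. \<forall>E\<in>Hom_base k K (regular_module K) (regular_module K).
     continuous_map T T E \<and> diff_op K K id {\<zero>\<^bsub>K\<^esub>} d E \<longrightarrow>
     E \<in> BT k K Os \<sigma> (regular_module K) (regular_module K))"

text \<open>Negation is multiplication by the fixed element -1, hence continuous.\<close>

lemma ST_ring_continuous_diff:
  assumes ST: "ST_ring k K T" "cring K" and f: "continuous_map Y T f" "continuous_map Y T g"
  shows "continuous_map Y T (\<lambda>x. f x \<ominus>\<^bsub>K\<^esub> g x)"
proof -
  interpret K: cring K by fact
  have t: "topspace T = carrier K" "continuous_map (prod_topology T T) T (\<lambda>(x, y). x \<oplus>\<^bsub>K\<^esub> y)"
    "continuous_map T T (\<lambda>b. (\<ominus>\<^bsub>K\<^esub> \<one>\<^bsub>K\<^esub>) \<otimes>\<^bsub>K\<^esub> b)"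
    using ST by (auto simp: ST_ring_def linear_topology_def)
  have "continuous_map Y (prod_topology T T) (\<lambda>x. (f x, (\<ominus>\<^bsub>K\<^esub> \<one>\<^bsub>K\<^esub>) \<otimes>\<^bsub>K\<^esub> g x))"
    using continuous_map_compose[OF f(2) t(3)] f(1) by (simp add: continuous_map_pairedI o_def)
  from continuous_map_compose[OF this t(2)] show ?thesis
    by (rule continuous_map_eq) (use f(2) in \<open>auto simp: continuous_map_def t(1) Pi_iff K.minus_eq K.l_minus\<close>)
qed

section \<open>Expansion of operators along powers of the uniformizer\<close>

locale tlifted = lifted k K V t s for k :: "('k, 'b) ring_scheme" and K :: "('k, 'a) module" (structure)
    and V t s +
  fixes T :: "'a topology"
  assumes ST: "ST_ring k K T" and s_cont: "continuous_map (residue_topology K T V) (subtopology T V) s"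
begin

abbreviation (input) TF where "TF \<equiv> residue_topology K T V"

lemma topspace_T: "topspace T = carrier K" using ST by (simp add: ST_ring_def linear_topology_def)

lemma res_cont: "continuous_map (subtopology T V) TF res"
  using quotient_map_quotient_topology unfolding residue_topology_def by (rule quotient_imp_continuous_map)

lemma topspace_TF: "topspace TF = carrier F"
proof -
  have "topspace TF = res ` topspace (subtopology T V)"
    using quotient_map_quotient_topology[of "subtopology T V" res]
    unfolding residue_topology_def quotient_map_def by simp
  also have "topspace (subtopology T V) = V" using topspace_T V_sub by (auto simp: topspace_subtopology)
  finally show ?thesis by (simp add: F_carrier)
qed

lemma cont_add: "continuous_map Y T f \<Longrightarrow> continuous_map Y T g \<Longrightarrow> continuous_map Y T (\<lambda>x. f x \<oplus> g x)"
  using continuous_map_compose[of Y "prod_topology T T" "\<lambda>x. (f x, g x)" T "\<lambda>(x, y). x \<oplus> y"] ST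
  by (simp add: ST_ring_def linear_topology_def continuous_map_pairedI o_def)

lemma cont_mult: "a \<in> carrier K \<Longrightarrow> continuous_map Y T f \<Longrightarrow> continuous_map Y T (\<lambda>x. a \<otimes> f x)"
  using continuous_map_compose[of Y T f T "\<lambda>x. a \<otimes> x"] ST by (simp add: ST_ring_def o_def)

lemma cont_diff: "continuous_map Y T f \<Longrightarrow> continuous_map Y T g \<Longrightarrow> continuous_map Y T (\<lambda>x. f x \<ominus> g x)"
  by (rule ST_ring_continuous_diff[OF ST is_cring])

text \<open>Induction on l, by E = s o E0 + t E1 with E0 the reduction of E. The first summand
  contributes E0, a continuous differential operator on the residue field and so a BT operator by
  hypothesis, followed by the linear map sending z to the class of s z y. The second contributes the
  same statement for E1 and t y, with l lowered by one.\<close>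

lemma expand:
  fixes M :: "('a, 'a) module"
  assumes F: "lifted_local_field k F Os \<tau>" and Q: "diff_ops_BT k F Os TF \<tau>"
    and M: "Module.module K M" and L: "L \<in> lattices K V M" "L' \<in> lattices K V M" "L \<subseteq> L'"
    and y: "y \<in> L'" "t [^] (l::nat) \<odot>\<^bsub>M\<^esub> y \<in> L"
    and E: "\<And>x. x \<in> carrier F \<Longrightarrow> E x \<in> V" 
      "\<And>x y. x \<in> carrier F \<Longrightarrow> y \<in> carrier F \<Longrightarrow> E (x \<oplus>\<^bsub>F\<^esub> y) = E x \<oplus> E y"
      "\<And>c x. c \<in> carrier k \<Longrightarrow> x \<in> carrier F \<Longrightarrow> E (structure_map F c \<otimes>\<^bsub>F\<^esub> x) = structure_map K c \<otimes> E x"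
      "continuous_map TF T E" "diff_op F K s ((\<lambda>v. t [^] l \<otimes> v) ` V) d E"
  shows "(\<lambda>x\<in>carrier F. coset_rep M L (E x \<odot>\<^bsub>M\<^esub> y)) \<in> BT k F Os \<tau> (regular_module F) (rest s M L' L)"
  using y E
proof (induction l arbitrary: y E)
  case 0
  interpret M: Module.module K M by (rule M)
  note q = rest_facts[OF M L] and lm = lattice_mem[OF M L(1)] and lm' = lattice_mem[OF M L(2)]
  interpret Q: Module.module F "rest s M L' L" by (rule q(8))
  \<comment> \<open>For l = 0 the vector y lies in L, and V-valued coefficients keep it there, so
    the map is zero.\<close>
  have "y \<in> L" using 0(2) lm'(2)[OF 0(1)] by simp
  have "coset_rep M L (E x \<odot>\<^bsub>M\<^esub> y) = \<zero>\<^bsub>rest s M L' L\<^esub>" if "x \<in> carrier F" for x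
  proof -
    have "E x \<odot>\<^bsub>M\<^esub> y \<in> L" using lm(5) \<open>y \<in> L\<close> 0(3)[OF that] by simp
    then show ?thesis using q(6)[of "E x \<odot>\<^bsub>M\<^esub> y" "\<zero>\<^bsub>M\<^esub>"] lm(2) L(3) lm'(1) by (auto simp: a_minus_def)
  qed
  then have eq: "(\<lambda>x\<in>carrier F. coset_rep M L (E x \<odot>\<^bsub>M\<^esub> y)) = (\<lambda>x\<in>carrier (regular_module F). \<zero>\<^bsub>rest s M L' L\<^esub>)"
    by (auto simp: fun_eq_iff)
  have "(\<lambda>x\<in>carrier (regular_module F). \<zero>\<^bsub>rest s M L' L\<^esub>) \<in> linear_maps F (regular_module F) (rest s M L' L)"
    by (rule linear_maps_restrict[OF regular_module_module[OF F.is_cring]]) 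
      (unfold lin_def, auto simp del: rest_simps)
  then show ?case unfolding eq by (rule BT_linear[OF F regular_module_module[OF F.is_cring] q(8)])
next
  case (Suc l)
  interpret M: Module.module K M by (rule M)
  note q = rest_facts[OF M L] and lm = lattice_mem[OF M L(1)] and lm' = lattice_mem[OF M L(2)]
  note fF = fgmod_regular[OF F.is_cring]
  let ?F = "regular_module F" and ?Q = "rest s M L' L"
  have yM: "y \<in> carrier M" using lm'(2) Suc.prems(1) by simp
  define E0 where "E0 = (\<lambda>x\<in>carrier F. res (E x))"
  define E1 where "E1 x = inv t \<otimes> (E x \<ominus> s (E0 x))" for x
  have E0: "E0 x \<in> carrier F" "s (E0 x) \<in> V" "E0 x = res (E x)" if "x \<in> carrier F" for x
    using that F_mem(1) Suc.prems(3) s_facts(1) by (auto simp: E0_def)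
  have tinv: "inv t \<in> carrier K" "inv t \<otimes> t = \<one>" "t \<otimes> inv t = \<one>" using t_nz field_Units by auto
  have E1: "E1 x \<in> V" "E x = s (E0 x) \<oplus> t \<otimes> E1 x" "t \<otimes> E1 x = E x \<ominus> s (E0 x)" if x: "x \<in> carrier F" for x
  proof -
    obtain w where w: "w \<in> V" "E x = s (E0 x) \<oplus> t \<otimes> w"
      using V_decomp[OF Suc.prems(3)[OF x]] E0(3)[OF x] by metis
    have "E x \<ominus> s (E0 x) = t \<otimes> w" using w(1) E0(2)[OF x]
      by (subst w(2)) (simp add: a_minus_def a_assoc a_comm r_neg r_neg1)
    then have "E1 x = w" using w(1) tinv by (simp add: E1_def m_assoc[symmetric])
    then show "E1 x \<in> V" "E x = s (E0 x) \<oplus> t \<otimes> E1 x" "t \<otimes> E1 x = E x \<ominus> s (E0 x)"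
      using w \<open>E x \<ominus> s (E0 x) = t \<otimes> w\<close> by auto
  qed
  \<comment> \<open>The modulus t^(l+1) V lies in the maximal ideal exactly because the exponent is
    a successor; this makes the reduction E0 an honest differential operator.\<close>
  have tVm: "(\<lambda>v. t [^] Suc l \<otimes> v) ` V \<subseteq> m"
  proof -
    have "t [^] Suc l \<otimes> v = t \<otimes> (t [^] l \<otimes> v)" if "v \<in> V" for v
      using that by (simp add: m_ac)
    then show ?thesis unfolding max using t_V by auto
  qed
  have dop0: "diff_op F F id {\<zero>\<^bsub>F\<^esub>} d E0"
    by (rule diff_op_transfer[OF diff_op_res[OF Suc.prems(3) tVm Suc.prems(7)] F.is_cring]) (auto simp: E0_def)
  have Econt: "continuous_map TF (subtopology T V) E"
    using Suc.prems(6,3) by (auto simp: continuous_map_in_subtopology topspace_TF)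
  have cont0: "continuous_map TF TF E0"
  proof (rule continuous_map_eq)
    show "continuous_map TF TF (res \<circ> E)" by (rule continuous_map_compose[OF Econt res_cont])
  qed (simp add: E0_def topspace_TF)
  have res_sm: "res (structure_map K c \<otimes> v) = structure_map F c \<otimes>\<^bsub>F\<^esub> res v" if "c \<in> carrier k" "v \<in> V" for c v
  proof -
    have "res (structure_map K c) = structure_map F c"
      using s_structure_map[OF that(1)] s_facts(6)[of "structure_map F c"] structure_map_closed[OF F_alg] that(1)
          by auto
    then show ?thesis using res_mult[OF k_V[OF that(1)] that(2)] by simp
  qed
  have kF: "structure_map F c \<in> carrier F" if "c \<in> carrier k" for c using structure_map_closed[OF F_alg] that
      by auto
  have "E0 \<in> Hom_base k F ?F ?F"
    unfolding Hom_base_iff khom_def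
    using Suc.prems(3-5) kF by (auto simp: E0_def F_mem res_add res_sm)
  then have B0: "E0 \<in> BT k F Os \<tau> ?F ?F" using Q cont0 dop0 unfolding diff_ops_BT_def by blast
  \<comment> \<open>The linear map through which the reduction E0 acts on the class of y.\<close>
  define \<mu> where "\<mu> = (\<lambda>z\<in>carrier ?F. coset_rep M L (s z \<odot>\<^bsub>M\<^esub> y))"
  have "lin F ?F ?Q (\<lambda>z. coset_rep M L (s z \<odot>\<^bsub>M\<^esub> y))"
    unfolding lin_def
  proof (intro conjI ballI funcsetI)
    fix z assume "z \<in> carrier ?F"
    then have z: "z \<in> carrier F" by simp
    have zy: "s z \<odot>\<^bsub>M\<^esub> y \<in> L'" using lm'(5) s_facts(1)[OF z] Suc.prems(1) by simp
    show "coset_rep M L (s z \<odot>\<^bsub>M\<^esub> y) \<in> carrier ?Q" by (rule q(1)[OF zy])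
    { fix r assume r: "r \<in> carrier F"
      show "coset_rep M L (s (r \<odot>\<^bsub>?F\<^esub> z) \<odot>\<^bsub>M\<^esub> y) = r \<odot>\<^bsub>?Q\<^esub> coset_rep M L (s z \<odot>\<^bsub>M\<^esub> y)"
        unfolding q(5)[OF r zy] using r z yM V_in[OF s_facts(1)] by (simp add: s_facts M.smult_assoc1) }
    fix w assume "w \<in> carrier ?F"
    then have w: "w \<in> carrier F" by simp
    have wy: "s w \<odot>\<^bsub>M\<^esub> y \<in> L'" using lm'(5) s_facts(1)[OF w] Suc.prems(1) by simp
    show "coset_rep M L (s (z \<oplus>\<^bsub>?F\<^esub> w) \<odot>\<^bsub>M\<^esub> y) = coset_rep M L (s z \<odot>\<^bsub>M\<^esub> y) \<oplus>\<^bsub>?Q\<^esub> coset_rep M L (s w \<odot>\<^bsub>M\<^esub> y)"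
      unfolding q(4)[OF zy wy] using z w yM V_in[OF s_facts(1)] by (simp add: s_facts M.smult_l_distr)
  qed
  then have "\<mu> \<in> linear_maps F ?F ?Q" unfolding \<mu>_def by (rule linear_maps_restrict[OF fgmod_module[OF fF]])
  from BT_linear[OF F fgmod_module[OF fF] q(8) this]
  have B1: "compose (carrier ?F) \<mu> E0 \<in> BT k F Os \<tau> ?F ?Q" by (rule BT_compose[OF F fF fF q(9) B0])
  \<comment> \<open>Continuity is asked with values in K rather than V, because there multiplication
    by the inverse of \<open>t\<close> is continuous.\<close>
  have cont1: "continuous_map TF T E1"
  proof -
    have "continuous_map TF T (s \<circ> E0)"
      by (rule continuous_map_compose[OF cont0]) (use s_cont in \<open>auto simp: continuous_map_in_subtopology\<close>)
    then show ?thesis unfolding E1_def by (intro cont_mult cont_diff Suc.prems(6) tinv) (simp add: o_def)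
  qed
  let ?J = "\<lambda>l::nat. (\<lambda>v. t [^] l \<otimes> v) ` V"
  \<comment> \<open>Commutators of E and of s o E0 both lie in t^(l+1) V; division by
    \<open>t\<close> leaves t^l V, the modulus for the induction hypothesis.\<close>
  have dop1: "diff_op F K s (?J l) d E1"
    unfolding E1_def
  proof (rule diff_op_scale[OF is_cring F.is_cring tinv(1), where J = "?J (Suc l)"])
    show "diff_op F K s (?J (Suc l)) d (\<lambda>x. E x \<ominus> s (E0 x))"
    proof (rule diff_op_diff[OF is_cring F.is_cring])
      show "diff_op F K s (?J (Suc l)) d E" by (rule Suc.prems(7))
      show "diff_op F K s (?J (Suc l)) d (\<lambda>x. s (E0 x))"
        by (rule diff_op_lift[OF E0(1) _ dop0]) (auto intro!: image_eqI[of _ _ \<zero>])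
      show "x \<ominus> y \<in> ?J (Suc l)" if xy: "x \<in> ?J (Suc l)" "y \<in> ?J (Suc l)" for x y
      proof -
        obtain v w where v: "v \<in> V" "x = t [^] Suc l \<otimes> v" "w \<in> V" "y = t [^] Suc l \<otimes> w" using xy by auto
        have "x \<ominus> y = t [^] Suc l \<otimes> (v \<ominus> w)" unfolding v(2,4) using v(1,3)
          by (simp add: a_minus_def r_distr r_minus del: nat_pow_Suc)
        then show ?thesis using v by blast
      qed
    qed (use E0 Suc.prems(3) s_facts(1) in auto)
    show "inv t \<otimes> y \<in> ?J l" if y: "y \<in> carrier K" "y \<in> ?J (Suc l)" for y
    proof -
      obtain v where v: "v \<in> V" "y = t [^] Suc l \<otimes> v" using y by auto
      have "t [^] Suc l \<otimes> v = t \<otimes> (t [^] l \<otimes> v)" using v by (simp add: m_ac)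
      then have "inv t \<otimes> y = t [^] l \<otimes> v" using v tinv by (simp add: m_assoc[symmetric])
      then show ?thesis using v by auto
    qed
  qed (use E0 Suc.prems(3) s_facts(1) in auto)
  have "t [^] l \<odot>\<^bsub>M\<^esub> (t \<odot>\<^bsub>M\<^esub> y) \<in> L" using Suc.prems(2) yM by (simp add: M.smult_assoc1)
  moreover have "t \<odot>\<^bsub>M\<^esub> y \<in> L'" using lm'(5)[OF t_V] Suc.prems(1) by simp
  ultimately have B2: "(\<lambda>x\<in>carrier F. coset_rep M L (E1 x \<odot>\<^bsub>M\<^esub> (t \<odot>\<^bsub>M\<^esub> y))) \<in> BT k F Os \<tau> ?F ?Q"
  proof (intro Suc.IH E1(1) cont1 dop1)
    fix x y assume x: "x \<in> carrier F" "y \<in> carrier F"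
    show "E1 (x \<oplus>\<^bsub>F\<^esub> y) = E1 x \<oplus> E1 y"
    proof -
      have z: "E x \<in> carrier K" "E y \<in> carrier K" "s (E0 x) \<in> carrier K" "s (E0 y) \<in> carrier K"
          using x Suc.prems(3) E0(2) by auto
      have "E0 (x \<oplus>\<^bsub>F\<^esub> y) = E0 x \<oplus>\<^bsub>F\<^esub> E0 y" using x Suc.prems(3,4) by (simp add: E0_def res_add)
      then have "s (E0 (x \<oplus>\<^bsub>F\<^esub> y)) = s (E0 x) \<oplus> s (E0 y)" using x E0(1) s_facts(2) by simp
      moreover have "(E x \<oplus> E y) \<ominus> (s (E0 x) \<oplus> s (E0 y)) = (E x \<ominus> s (E0 x)) \<oplus> (E y \<ominus> s (E0 y))"
        using z by (simp add: a_minus_def minus_add a_ac)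
      ultimately show ?thesis unfolding E1_def using x Suc.prems(4) z tinv by (simp add: r_distr)
    qed
  next
    fix c x assume x: "c \<in> carrier k" "x \<in> carrier F"
    show "E1 (structure_map F c \<otimes>\<^bsub>F\<^esub> x) = structure_map K c \<otimes> E1 x"
    proof -
      have z: "E x \<in> carrier K" "s (E0 x) \<in> carrier K" "structure_map K c \<in> carrier K"
          using x Suc.prems(3) E0(2) k_V by auto
      have "E0 (structure_map F c \<otimes>\<^bsub>F\<^esub> x) = structure_map F c \<otimes>\<^bsub>F\<^esub> E0 x"
        using x Suc.prems(3,5) kF by (simp add: E0_def res_sm)
      then have "s (E0 (structure_map F c \<otimes>\<^bsub>F\<^esub> x)) = structure_map K c \<otimes> s (E0 x)"
        using x E0(1) kF by (simp add: s_facts(3) s_structure_map)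
      moreover have "structure_map K c \<otimes> E x \<ominus> structure_map K c \<otimes> s (E0 x) = structure_map K c \<otimes> (E x \<ominus> s (E0 x))"
        using z by (simp add: a_minus_def r_distr r_minus)
      ultimately show ?thesis unfolding E1_def using x Suc.prems(5) z tinv by (simp add: m_lcomm)
    qed
  qed
  from BT_add[OF F fF q(9) B1 B2] show ?case
  proof (rule back_subst[where P = "\<lambda>z. z \<in> BT k F Os \<tau> ?F ?Q"])
    show "(\<lambda>x\<in>carrier ?F. compose (carrier ?F) \<mu> E0 x \<oplus>\<^bsub>?Q\<^esub> (\<lambda>x\<in>carrier F. coset_rep M L (E1 x \<odot>\<^bsub>M\<^esub> (t \<odot>\<^bsub>M\<^esub> y))) x)
        = (\<lambda>x\<in>carrier F. coset_rep M L (E x \<odot>\<^bsub>M\<^esub> y))"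
    proof (rule extensionalityI[of _ "carrier F"])
      fix x assume x: "x \<in> carrier F"
      have a: "s (E0 x) \<odot>\<^bsub>M\<^esub> y \<in> L'" "E1 x \<odot>\<^bsub>M\<^esub> (t \<odot>\<^bsub>M\<^esub> y) \<in> L'"
        using E0(2)[OF x] E1(1)[OF x] Suc.prems(1) lm'(5) t_V by auto
      have "E x \<odot>\<^bsub>M\<^esub> y = s (E0 x) \<odot>\<^bsub>M\<^esub> y \<oplus>\<^bsub>M\<^esub> E1 x \<odot>\<^bsub>M\<^esub> (t \<odot>\<^bsub>M\<^esub> y)"
        using E0(2)[OF x] E1(1)[OF x] yM
        by (subst E1(2)[OF x]) (simp add: M.smult_l_distr M.smult_assoc1[symmetric] m_comm)
      then show "(\<lambda>x\<in>carrier ?F. compose (carrier ?F) \<mu> E0 x \<oplus>\<^bsub>?Q\<^esub> (\<lambda>x\<in>carrier F. coset_rep M L (E1 x \<odot>\<^bsub>M\<^esub> (t \<odot>\<^bsub>M\<^esub>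
          y))) x) x
        = (\<lambda>x\<in>carrier F. coset_rep M L (E x \<odot>\<^bsub>M\<^esub> y)) x"
        using x q(4)[OF a] E0(1)[OF x] by (simp add: compose_def \<mu>_def del: rest_simps)
    qed auto
  qed
qed

end

section \<open>The identity map between the structures of two liftings\<close>

context tlifted
begin

text \<open>The commutator of s with a, when a acts on the target through s', is multiplication of s
  by s a - s' a. This difference has residue zero, so every commutator gains a factor
  \<open>t\<close>, and l of them reach t^l V.\<close>

lemma diff_op_other_lifting:
  assumes s': "lifted k K V t s'"
  shows "diff_op F K s' ((\<lambda>v. t [^] (l::nat) \<otimes> v) ` V) l s"
proof -
  interpret s': lifted k K V t s' by fact
  \<comment> \<open>The factor t^i w carries the powers of \<open>t\<close> and the cofactors gained
    so far, as the induction requires.\<close>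
  have "diff_op F K s' ((\<lambda>v. t [^] (i + j) \<otimes> v) ` V) j (\<lambda>x. (t [^] i \<otimes> w) \<otimes> s x)" if "w \<in> V" for w and i j :: nat
    using that
  proof (induction j arbitrary: i w)
    case 0
    have "(t [^] i \<otimes> w) \<otimes> s x = t [^] i \<otimes> (w \<otimes> s x)" if "x \<in> carrier F" for x
      using 0 s_facts(1)[OF that] by (simp add: m_assoc)
    then show ?case using 0 s_facts(1) by auto
  next
    case (Suc j)
    have "diff_op F K s' ((\<lambda>v. t [^] (i + Suc j) \<otimes> v) ` V) j
        (\<lambda>x. (t [^] i \<otimes> w) \<otimes> s (a \<otimes>\<^bsub>F\<^esub> x) \<ominus> s' a \<otimes> ((t [^] i \<otimes> w) \<otimes> s x))" if a: "a \<in> carrier F" for a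
    proof -
      have sa: "s a \<in> V" "s' a \<in> V" using s_facts(1)[OF a] s'.s_facts(1)[OF a] by auto
      have "s a \<ominus> s' a \<in> m"
        using res_eq_iff[of "s a" "s' a"] sa s_facts(6)[OF a] s'.s_facts(6)[OF a] by auto
      then obtain z where z: "z \<in> V" "s a \<ominus> s' a = t \<otimes> z" unfolding max by auto
      have "w \<otimes> z \<in> V" using Suc.prems z by simp
      from Suc.IH[OF this, of "Suc i", unfolded add_Suc_shift] show ?thesis
      proof (rule diff_op_transfer[OF _ F.is_cring])
        fix x assume x: "x \<in> carrier F"
        have sx: "s x \<in> V" using s_facts(1)[OF x] .
        have "(t [^] i \<otimes> w) \<otimes> s (a \<otimes>\<^bsub>F\<^esub> x) \<ominus> s' a \<otimes> ((t [^] i \<otimes> w) \<otimes> s x) = (t [^] i \<otimes> w) \<otimes> ((s a \<ominus> s' a) \<otimes> s x)"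
          using sa sx Suc.prems a x by (simp add: s_facts a_minus_def l_distr r_distr l_minus r_minus m_ac)
        also have "\<dots> = t [^] Suc i \<otimes> (w \<otimes> z) \<otimes> s x"
          unfolding z(2) using z(1) sx Suc.prems by (simp add: m_ac)
        finally show "(t [^] i \<otimes> w) \<otimes> s (a \<otimes>\<^bsub>F\<^esub> x) \<ominus> s' a \<otimes> ((t [^] i \<otimes> w) \<otimes> s x) = t [^] Suc i \<otimes> (w \<otimes> z) \<otimes> s x" .
      qed
    qed
    then show ?case by simp
  qed
  from this[of \<one> 0 l] have "diff_op F K s' ((\<lambda>v. t [^] l \<otimes> v) ` V) l (\<lambda>x. (t [^] (0::nat) \<otimes> \<one>) \<otimes> s x)" by simp
  then show ?thesis
    by (rule diff_op_transfer[OF _ F.is_cring]) (use s_facts(1) in simp)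
qed

text \<open>On the line through the class of y the identity becomes x -> class of s x y, with target
  structure given by s'. This is the situation of \<open>expand\<close> for the lifting s' and the
  operator E = s.\<close>

lemma identity_BT:
  fixes M :: "('a, 'a) module"
  assumes s': "tlifted k K V t s' T" and F: "lifted_local_field k F Os \<tau>" and Q: "diff_ops_BT k F Os TF \<tau>"
    and M: "Module.module K M" and L: "L \<in> lattices K V M" "L' \<in> lattices K V M" "L \<subseteq> L'"
  shows "(\<lambda>x\<in>carrier (rest s M L' L). x) \<in> BT k F Os \<tau> (rest s M L' L) (rest s' M L' L)"
proof -
  interpret s': tlifted k K V t s' T by fact
  interpret M: Module.module K M by (rule M)
  note q = rest_facts[OF M L] and q' = s'.rest_facts[OF M L] and lm' = lattice_mem[OF M L(2)]
  define \<phi> where "\<phi> = (\<lambda>x\<in>carrier (rest s M L' L). x)"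
  have \<phi>: "\<phi> (coset_rep M L x) = coset_rep M L x" if "x \<in> L'" for x using that by (simp add: \<phi>_def)
  have rep: "\<exists>x\<in>L'. q = coset_rep M L x" if "q \<in> carrier (rest s M L' L)" for q using that by auto
  have cc: "carrier (rest s M L' L) = carrier (rest s' M L' L)" by simp
  have "\<phi> \<in> BT k F Os \<tau> (rest s M L' L) (rest s' M L' L)"
  proof (rule BT_from_lines[OF F q(9) q'(9)])
    have "khom k F (rest s M L' L) (rest s' M L' L) \<phi>"
      unfolding khom_def
    proof (intro conjI ballI funcsetI)
      show "\<phi> q \<in> carrier (rest s' M L' L)" if "q \<in> carrier (rest s M L' L)" for q
        using that unfolding \<phi>_def by simp
      show "\<phi> (x \<oplus>\<^bsub>rest s M L' L\<^esub> y) = \<phi> x \<oplus>\<^bsub>rest s' M L' L\<^esub> \<phi> y"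
        if xy: "x \<in> carrier (rest s M L' L)" "y \<in> carrier (rest s M L' L)" for x y
      proof -
        obtain u v where u: "u \<in> L'" "x = coset_rep M L u" "v \<in> L'" "y = coset_rep M L v" using rep xy by meson
        show ?thesis unfolding u(2,4) q(4)[OF u(1,3)] \<phi>[OF u(1)] \<phi>[OF u(3)] q'(4)[OF u(1,3)]
          using \<phi> lm'(3)[OF u(1,3)] by simp
      qed
      show "\<phi> (structure_map F c \<odot>\<^bsub>rest s M L' L\<^esub> x) = structure_map F c \<odot>\<^bsub>rest s' M L' L\<^esub> \<phi> x"
        if cx: "c \<in> carrier k" "x \<in> carrier (rest s M L' L)" for c x
      proof -
        obtain u where u: "u \<in> L'" "x = coset_rep M L u" using rep cx by meson
        show ?thesis unfolding u(2) q(7)[OF cx(1) u(1)] \<phi>[OF u(1)] q'(7)[OF cx(1) u(1)]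
          using \<phi> lm'(5)[OF k_V[OF cx(1)] u(1)] by simp
      qed
    qed
    then show "\<phi> \<in> Hom_base k F (rest s M L' L) (rest s' M L' L)" by (simp add: Hom_base_iff \<phi>_def)
    fix q0 assume q0: "q0 \<in> carrier (rest s M L' L)"
    obtain y where y: "y \<in> L'" "q0 = coset_rep M L y" using rep[OF q0] by auto
    obtain l where l: "t [^] (l::nat) \<odot>\<^bsub>M\<^esub> y \<in> L"
      using lattice_absorb[OF M L(1) lattice_facts(3)[OF M L(2)]] y(1) by auto
    have "continuous_map TF T s" using s_cont by (simp add: continuous_map_in_subtopology)
    from s'.expand[OF F Q M L y(1) l s_facts(1,2) _ this diff_op_other_lifting[OF s'.lifted_axioms]]
    have "(\<lambda>x\<in>carrier F. coset_rep M L (s x \<odot>\<^bsub>M\<^esub> y)) \<in> BT k F Os \<tau> (regular_module F) (rest s' M L' L)"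
      using structure_map_closed[OF F_alg] by (auto simp: s_facts(3) s_structure_map image_subset_iff)
    moreover have "(\<lambda>x\<in>carrier F. \<phi> (x \<odot>\<^bsub>rest s M L' L\<^esub> q0)) = (\<lambda>x\<in>carrier F. coset_rep M L (s x \<odot>\<^bsub>M\<^esub> y))"
      unfolding y(2) using q(5)[OF _ y(1)] \<phi>[OF lm'(5)[OF s_facts(1) y(1)]]
          by (auto simp: fun_eq_iff simp del: rest_simps)
    ultimately show "(\<lambda>x\<in>carrier F. \<phi> (x \<odot>\<^bsub>rest s M L' L\<^esub> q0)) \<in> BT k F Os \<tau> (regular_module F) (rest s' M L' L)"
      by simp
  qed
  then show ?thesis by (simp only: \<phi>_def)
qed

lemma compose_restrict_id:
  assumes "f \<in> A \<rightarrow> B" "f \<in> extensional A"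
  shows "compose A (\<lambda>x\<in>B. x) (compose A f (\<lambda>x\<in>A. x)) = f"
  using assms by (auto simp: compose_def fun_eq_iff extensional_def Pi_iff)

text \<open>The map is conjugated by the identities from the s'-structure to the s-structure on the
  source and back on the target; as a function it does not change.\<close>

lemma change_lifting:
  fixes M1 M2 :: "('a, 'a) module"
  assumes s': "tlifted k K V t s' T" and F: "lifted_local_field k F Os \<tau>" and Q: "diff_ops_BT k F Os TF \<tau>"
    and M: "Module.module K M1" "Module.module K M2" and l: "L1 \<in> lattices K V M1" "L1' \<in> lattices K V M1"
        "L1' \<subseteq> L1"
     "L2 \<in> lattices K V M2" "L2' \<in> lattices K V M2" "L2 \<subseteq> L2'"
    and \<phi>: "\<phi> \<in> BT k F Os \<tau> (rest s M1 L1 L1') (rest s M2 L2' L2)"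
  shows "\<phi> \<in> BT k F Os \<tau> (rest s' M1 L1 L1') (rest s' M2 L2' L2)"
    and "\<phi> \<in> BT_ideal k F Os \<tau> (rest s M1 L1 L1') (rest s M2 L2' L2) i j \<Longrightarrow>
      \<phi> \<in> BT_ideal k F Os \<tau> (rest s' M1 L1 L1') (rest s' M2 L2' L2) i j"
proof -
  interpret s': tlifted k K V t s' T by fact
  note q1 = rest_facts[OF M(1) l(2,1,3)] and q2 = rest_facts[OF M(2) l(4,5,6)]
   and q1' = s'.rest_facts[OF M(1) l(2,1,3)] and q2' = s'.rest_facts[OF M(2) l(4,5,6)]
  note c1 = s'.identity_BT[OF tlifted_axioms F Q M(1) l(2,1,3)] and c2 = identity_BT[OF s' F Q M(2) l(4,5,6)]
  have c1': "(\<lambda>x\<in>carrier (rest s M1 L1 L1'). x) \<in> BT k F Os \<tau> (rest s' M1 L1 L1') (rest s M1 L1 L1')"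
    using c1 by simp
  have cc: "carrier (rest s M1 L1 L1') = carrier (rest s' M1 L1 L1')" by simp
  note kh = BT_Hom_base[OF \<phi>, unfolded Hom_base_iff]
  have e: "compose (carrier (rest s' M1 L1 L1')) (\<lambda>x\<in>carrier (rest s M2 L2' L2). x)
     (compose (carrier (rest s' M1 L1 L1')) \<phi> (\<lambda>x\<in>carrier (rest s M1 L1 L1'). x)) = \<phi>"
    unfolding cc[symmetric] by (rule compose_restrict_id) (use kh in \<open>auto simp: khom_def simp del: rest_simps\<close>)
  note b = BT_compose[OF F q1'(9) q1(9) q2(9) c1' \<phi>]
  from BT_compose[OF F q1'(9) q2(9) q2'(9) b c2]
  show "\<phi> \<in> BT k F Os \<tau> (rest s' M1 L1 L1') (rest s' M2 L2' L2)" unfolding e .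
  show "\<phi> \<in> BT_ideal k F Os \<tau> (rest s' M1 L1 L1') (rest s' M2 L2' L2) i j"
    if "\<phi> \<in> BT_ideal k F Os \<tau> (rest s M1 L1 L1') (rest s M2 L2' L2) i j"
    using BT_ideal_compose[OF F q1'(9) q2(9) q2'(9) b c2 disjI1[OF BT_ideal_compose[OF F q1'(9) q1(9) q2(9) c1' \<phi>
        disjI2[OF that]]]]
    unfolding e .
qed

text \<open>Two changes are made for each refinement: the hypothesis \<open>IH\<close> replaces the
  liftings of the residue field while s is kept, and \<open>change_lifting\<close> then replaces s.
  Refinements themselves do not involve liftings, so they are the same on both sides.\<close>

lemma BT_step:
  fixes M1 M2 :: "('a, 'a) module"
  assumes s: "s = hd \<rho>" and s': "tlifted k K V t (hd \<rho>') T" and F: "lifted_local_field k F Os (tl \<rho>')"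
      and Q: "diff_ops_BT k F Os TF (tl \<rho>')"
    and M: "Module.module K M1" "Module.module K M2"
    and IH: "\<And>(N1 :: ('a, 'a) module) (N2 :: ('a, 'a) module). fgmod F N1 \<Longrightarrow> fgmod F N2 \<Longrightarrow>
        BT k F Os (tl \<rho>) N1 N2 \<subseteq> BT k F Os (tl \<rho>') N1 N2"
      "\<And>(N1 :: ('a, 'a) module) (N2 :: ('a, 'a) module) i. fgmod F N1 \<Longrightarrow> fgmod F N2 \<Longrightarrow> BT_ideal k F Os (tl \<rho>) N1 N2 i
          j \<subseteq> BT_ideal k F Os (tl \<rho>') N1 N2 i j"
  shows "BT k K (V # Os) \<rho> M1 M2 \<subseteq> BT k K (V # Os) \<rho>' M1 M2"
    "BT_ideal k K (V # Os) \<rho> M1 M2 i j \<subseteq> BT_ideal k K (V # Os) \<rho>' M1 M2 i j"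
proof -
  have g: "fgmod F (rest s M1 L1 L1')" "fgmod F (rest s M2 L2' L2)"
    if "refinement K V M1 M2 \<phi> (L1', L2') (L1, L2)" for \<phi> L1 L2 L1' L2'
    using rest_facts(9)[OF M(1), of L1' L1] rest_facts(9)[OF M(2), of L2 L2'] that by (auto simp: refinement_iff)
  have c: "\<psi> \<in> BT k F Os (tl \<rho>') (rest s M1 L1 L1') (rest s M2 L2' L2) \<Longrightarrow>
      \<psi> \<in> BT k F Os (tl \<rho>') (rest (hd \<rho>') M1 L1 L1') (rest (hd \<rho>') M2 L2' L2)"
    "\<psi> \<in> BT_ideal k F Os (tl \<rho>') (rest s M1 L1 L1') (rest s M2 L2' L2) i j \<Longrightarrow>
      \<psi> \<in> BT_ideal k F Os (tl \<rho>') (rest (hd \<rho>') M1 L1 L1') (rest (hd \<rho>') M2 L2' L2) i j"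
    if "refinement K V M1 M2 \<phi> (L1', L2') (L1, L2)" for \<phi> \<psi> L1 L2 L1' L2' i
    using change_lifting(1)[OF s' F Q M, of L1 L1' L2 L2' \<psi>] change_lifting(2)[OF s' F Q M, of L1 L1' L2 L2' \<psi> i j]
      BT_ideal_BT[of \<psi> k F Os "tl \<rho>'"] that by (auto simp: refinement_iff)
  show sub: "BT k K (V # Os) \<rho> M1 M2 \<subseteq> BT k K (V # Os) \<rho>' M1 M2"
  proof
    fix \<phi> assume \<phi>: "\<phi> \<in> BT k K (V # Os) \<rho> M1 M2"
    show "\<phi> \<in> BT k K (V # Os) \<rho>' M1 M2" unfolding BT_Cons_iff
    proof (intro conjI allI impI)
      show "\<phi> \<in> Hom_base k K M1 M2" "refinable K V M1 M2 \<phi>" using \<phi>[unfolded BT_Cons_iff] by auto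
      fix L1 L2 L1' L2' assume r: "refinement K V M1 M2 \<phi> (L1', L2') (L1, L2)"
      then have "induced_map M1 M2 \<phi> (L1', L2') (L1, L2) \<in> BT k F Os (tl \<rho>) (rest s M1 L1 L1') (rest s M2 L2' L2)"
        using \<phi>[unfolded BT_Cons_iff] unfolding s by blast
      then show "induced_map M1 M2 \<phi> (L1', L2') (L1, L2) \<in> BT k F Os (tl \<rho>') (rest (hd \<rho>') M1 L1 L1') (rest (hd \<rho>')
          M2 L2' L2)"
        using c(1)[OF r] IH(1)[OF g[OF r]] by blast
    qed
  qed
  show "BT_ideal k K (V # Os) \<rho> M1 M2 i j \<subseteq> BT_ideal k K (V # Os) \<rho>' M1 M2 i j"
  proof
    fix \<phi> assume \<phi>: "\<phi> \<in> BT_ideal k K (V # Os) \<rho> M1 M2 i j"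
    then have bt: "\<phi> \<in> BT k K (V # Os) \<rho>' M1 M2" using sub BT_ideal_BT by blast
    show "\<phi> \<in> BT_ideal k K (V # Os) \<rho>' M1 M2 i j"
    proof (cases "i = 1")
      case True
      then show ?thesis using \<phi> bt by simp
    next
      case False
      have "induced_map M1 M2 \<phi> (L1', L2') (L1, L2) \<in> BT_ideal k F Os (tl \<rho>') (rest (hd \<rho>') M1 L1 L1') (rest (hd
          \<rho>') M2 L2' L2) (i - 1) j"
        if r: "refinement K V M1 M2 \<phi> (L1', L2') (L1, L2)" for L1 L2 L1' L2'
      proof -
        have "induced_map M1 M2 \<phi> (L1', L2') (L1, L2) \<in> BT_ideal k F Os (tl \<rho>) (rest s M1 L1 L1') (rest s M2 L2'
            L2) (i - 1) j"
          using \<phi> r False unfolding s by simp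
        then show ?thesis using c(2)[OF r] IH(2)[OF g[OF r]] by blast
      qed
      then show ?thesis using bt False by simp
    qed
  qed
qed

section \<open>Continuous differential operators are BT operators\<close>

text \<open>D maps t^n V into t^(n-c) V for every integer n, with denominators cleared; n = i and n
  = -i are separate clauses because exponents are natural numbers.\<close>

definition bounded_op :: "('a \<Rightarrow> 'a) \<Rightarrow> bool" where
  "bounded_op D \<longleftrightarrow> (\<exists>c::nat. \<forall>i::nat. \<forall>x\<in>V. (\<exists>v\<in>V. t [^] c \<otimes> D (t [^] i \<otimes> x) = t [^] i \<otimes> v) \<and>
     t [^] (c + i) \<otimes> D (inv (t [^] i) \<otimes> x) \<in> V)"

lemma V_lattice: "V \<in> lattices K V (regular_module K)"
proof -
  have m: "Module.module K (regular_module K)" by (rule regular_module_module[OF is_cring])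
  have c: "{\<one>} \<subseteq> carrier (regular_module K)" by simp
  note smR = span_submodule[OF R_module c] and smK = submodule_mem(5)[OF R_module span_submodule[OF R_module c]]
  have 1: "\<one> \<in> span_module R (regular_module K) {\<one>}" by (rule subsetD[OF span_superset]) simp
  have "V \<subseteq> span_module R (regular_module K) {\<one>}"
  proof
    fix v assume v: "v \<in> V"
    then show "v \<in> span_module R (regular_module K) {\<one>}" using smK[of v \<one>] 1 by simp
  qed
  moreover have "span_module R (regular_module K) {\<one>} \<subseteq> V"
    by (rule span_least[OF V_submodule]) auto
  ultimately have "finite_submodule R (regular_module K) V" unfolding finite_submodule_def
    by (intro exI[of _ "{\<one>}"]) auto
  moreover have "span_module K (regular_module K) V = carrier (regular_module K)"
  proof
    have cV: "V \<subseteq> carrier (regular_module K)" using V_sub by simp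
    note sm = span_submodule[OF m cV]
    have "\<one> \<in> span_module K (regular_module K) V" by (rule subsetD[OF span_superset]) simp
    then show "carrier (regular_module K) \<subseteq> span_module K (regular_module K) V"
      using submodule_mem(5)[OF m sm, of _ \<one>] by auto
    show "span_module K (regular_module K) V \<subseteq> carrier (regular_module K)"
      using submodule_mem(2)[OF m sm] by auto
  qed
  ultimately show ?thesis by (simp add: lattices_def)
qed

text \<open>Boundedness gives refinability, since every lattice lies between multiples of V by
  powers of \<open>t\<close>. For condition (ii) the target is enlarged to a cyclic lattice u V with
  u = t^(-n). Along each line D then has the form E x u with E valued in V, to which
  \<open>expand\<close> applies.\<close>

lemma diff_ops_BT_step:
  assumes s: "s = hd \<rho>" and F: "lifted_local_field k F Os (tl \<rho>)" and Q: "diff_ops_BT k F Os TF (tl \<rho>)"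
    and BD: "\<And>D d. D \<in> Hom_base k K (regular_module K) (regular_module K) \<Longrightarrow> continuous_map T T D \<Longrightarrow>
      diff_op K K id {\<zero>} d D \<Longrightarrow> bounded_op D"
  shows "diff_ops_BT k K (V # Os) T \<rho>"
  unfolding diff_ops_BT_def
proof (intro allI ballI impI, elim conjE)
  let ?K = "regular_module K"
  fix d D assume D: "D \<in> Hom_base k K ?K ?K" and cont: "continuous_map T T D" and diff_op: "diff_op K K id {\<zero>} d D"
  have mK: "Module.module K ?K" by (rule regular_module_module[OF is_cring])
  have kh: "khom k K ?K ?K D" using D by (simp add: Hom_base_iff)
  note f = khom_facts[OF mK mK kh, simplified, unfolded reg_minus]
  obtain c where c1: "\<And>i x. x \<in> V \<Longrightarrow> \<exists>v\<in>V. t [^] (c::nat) \<otimes> D (t [^] (i::nat) \<otimes> x) = t [^] i \<otimes> v"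
    and c2: "\<And>i x. x \<in> V \<Longrightarrow> t [^] (c + i) \<otimes> D (inv (t [^] (i::nat)) \<otimes> x) \<in> V"
    using BD[OF D cont diff_op] unfolding bounded_op_def by blast
  have tp: "t [^] n \<in> carrier K" "inv (t [^] n) \<in> carrier K" "inv (t [^] n) \<otimes> t [^] n = \<one>"
      "t [^] n \<otimes> inv (t [^] n) = \<one>"
    "inv (t [^] n) \<noteq> \<zero>" for n :: nat
  proof -
    show "t [^] n \<in> carrier K" by simp
    have "t [^] n \<in> Units K" using tpow_nz field_Units by simp
    then show "inv (t [^] n) \<in> carrier K" "inv (t [^] n) \<otimes> t [^] n = \<one>" "t [^] n \<otimes> inv (t [^] n) = \<one>" by auto
    then show "inv (t [^] n) \<noteq> \<zero>" by auto
  qed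
  \<comment> \<open>The lattices t^(-n) V; each lattice is contained in one of them, and t^n tests
    membership.\<close>
  define W where "W n = (\<lambda>x. inv (t [^] (n::nat)) \<otimes> x) ` V" for n
  have W: "W n \<in> lattices K V ?K" for n
    using lattice_scale[OF mK V_lattice tp(2,5)] by (simp add: W_def)
  have W_mem: "x \<in> W n \<longleftrightarrow> t [^] n \<otimes> x \<in> V" if x: "x \<in> carrier K" for x n
  proof
    assume "x \<in> W n"
    then obtain v where v: "v \<in> V" "x = inv (t [^] n) \<otimes> v" by (auto simp: W_def)
    then have "t [^] n \<otimes> x = v" using tp[of n] by (simp add: m_assoc[symmetric])
    then show "t [^] n \<otimes> x \<in> V" using v by simp
  next
    assume h: "t [^] n \<otimes> x \<in> V"
    have "x = inv (t [^] n) \<otimes> (t [^] n \<otimes> x)" using tp[of n] x by (simp add: m_assoc[symmetric])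
    then show "x \<in> W n" using h unfolding W_def by blast
  qed
  have in_W: "\<exists>n. L \<subseteq> W n" if L: "L \<in> lattices K V ?K" for L
  proof -
    obtain n where "\<forall>x\<in>L. t [^] (n::nat) \<otimes> x \<in> V"
      using lattice_absorb[OF mK V_lattice lattice_facts(3)[OF mK L]] by auto
    then show ?thesis using W_mem lattice_mem(2)[OF mK L] by (intro exI[of _ n]) auto
  qed
  have ref: "refinable K V ?K ?K D" unfolding refinable_def
  proof (intro ballI)
    fix L1 L2 assume L: "L1 \<in> lattices K V ?K" "L2 \<in> lattices K V ?K"
    obtain i where i: "L1 \<subseteq> W i" using in_W[OF L(1)] by auto
    obtain j where j: "\<forall>x\<in>V. t [^] (j::nat) \<otimes> x \<in> L2"
      using lattice_absorb[OF mK L(2) lattice_facts(3)[OF mK V_lattice]] by auto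
    \<comment> \<open>D loses at most c powers of \<open>t\<close>, so it maps t^(j+c) V into t^j V,
      which lies in L2.\<close>
    let ?A = "(\<lambda>x. t [^] (j + c) \<otimes> x) ` V"
    have A: "?A \<in> lattices K V ?K" using lattice_scale[OF mK V_lattice tp(1) tpow_nz, of "j + c"] by simp
    obtain L1' where L1': "L1' \<in> lattices K V ?K" "L1' \<subseteq> L1" "L1' \<subseteq> ?A" using lattice_meet[OF mK L(1) A] .
    obtain L2' where L2': "L2' \<in> lattices K V ?K" "L2 \<subseteq> L2'" "W (c + i) \<subseteq> L2'"
      using lattice_join[OF mK L(2) lattice_facts(3)[OF mK W]] .
    have "D x \<in> L2" if x: "x \<in> L1'" for x
    proof -
      obtain v where v: "v \<in> V" "x = t [^] (j + c) \<otimes> v" using x L1'(3) by auto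
      obtain w where w: "w \<in> V" "t [^] c \<otimes> D x = t [^] (j + c) \<otimes> w" using c1[OF v(1), of "j + c"] v(2) by auto
      have Dx: "D x \<in> carrier K" using f(1) v by simp
      have "t [^] c \<otimes> D x = t [^] c \<otimes> (t [^] j \<otimes> w)" unfolding w(2) using w(1)
          by (simp add: nat_pow_mult[symmetric] m_ac)
      then have "D x = t [^] j \<otimes> w" using m_lcancel[OF tpow_nz, of c "D x" "t [^] j \<otimes> w"] Dx w by simp
      then show ?thesis using j w by simp
    qed
    moreover have "D x \<in> L2'" if x: "x \<in> L1" for x
    proof -
      obtain v where v: "v \<in> V" "x = inv (t [^] i) \<otimes> v" using x i by (auto simp: W_def)
      have "t [^] (c + i) \<otimes> D x \<in> V" unfolding v(2) by (rule c2[OF v(1)])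
      then have "D x \<in> W (c + i)" using W_mem f(1) lattice_mem(2)[OF mK L(1) x] by simp
      then show ?thesis using L2'(3) by auto
    qed
    ultimately show "\<exists>L1' L2'. refinement K V ?K ?K D (L1', L2') (L1, L2)"
      using L L1' L2' unfolding refinement_iff by blast
  qed
  show "D \<in> BT k K (V # Os) \<rho> ?K ?K" unfolding BT_Cons_iff
  proof (intro conjI allI impI D ref)
    fix L1 L2 L1' L2' assume r: "refinement K V ?K ?K D (L1', L2') (L1, L2)"
    note r' = r[unfolded refinement_iff]
    have l: "L1 \<in> lattices K V ?K" "L1' \<in> lattices K V ?K" "L1' \<subseteq> L1" "L2 \<in> lattices K V ?K"
        "L2' \<in> lattices K V ?K"
      "L2 \<subseteq> L2'" using r' by auto
    obtain n where n: "L2' \<subseteq> W n" using in_W[OF l(5)] by auto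
    \<comment> \<open>Only the target is enlarged; on the source \<open>refine_maps\<close> is used
      with P1 = L1'.\<close>
    have rb: "refinement K V ?K ?K D (L1', W n) (L1, L2)" using refinement_mono[OF r l(2) subset_refl W n] .
    have lW: "L2 \<subseteq> W n" using n l(6) by auto
    obtain a b where ab: "a \<in> linear_maps F (rest s ?K L1 L1') (rest s ?K L1 L1')"
      "b \<in> linear_maps F (rest s ?K (W n) L2) (rest s ?K L2' L2)" and
      e: "\<And>\<phi>. khom k K ?K ?K \<phi> \<Longrightarrow> refinement K V ?K ?K \<phi> (L1', L2') (L1, L2) \<Longrightarrow>
      refinement K V ?K ?K \<phi> (L1', W n) (L1, L2) \<Longrightarrow>
      induced_map ?K ?K \<phi> (L1', L2') (L1, L2) =
        compose (carrier (rest s ?K L1 L1')) b (compose (carrier (rest s ?K L1 L1')) (induced_map ?K ?K \<phi> (L1', W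
            n) (L1, L2)) a)"
      using refine_maps[OF mK mK l(1,2,2) l(4,5) W subset_refl l(3,6) n] by blast
    note e = e[OF kh r rb]
    note q1 = rest_facts[OF mK l(2,1,3)] and qW = rest_facts[OF mK l(4) W lW] and q2 = rest_facts[OF mK l(4,5,6)]
    note i = induced_facts[OF mK mK kh rb]
    define u where "u = inv (t [^] n)"
    have u: "u \<in> carrier K" "t [^] n \<otimes> u = \<one>" "u \<in> W n" using tp[of n]
        by (auto simp: u_def W_def intro!: image_eqI[of _ _ \<one>])
    obtain l0 where l0: "t [^] (l0::nat) \<otimes> u \<in> L2"
      using lattice_absorb[OF mK l(4) lattice_facts(3)[OF mK W]] u(3) by auto
    have d: "induced_map ?K ?K D (L1', W n) (L1, L2) \<in> BT k F Os (tl \<rho>) (rest s ?K L1 L1') (rest s ?K (W n) L2)"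
    proof (rule BT_from_lines[OF F q1(9) qW(9) i(2)])
      fix q0 assume q0: "q0 \<in> carrier (rest s ?K L1 L1')"
      define y where "y = q0"
      have y: "y \<in> L1" "coset_rep ?K L1' y = q0" unfolding y_def using q1(2,3)[OF q0] by auto
      have yK: "y \<in> carrier K" using lattice_mem(2)[OF mK l(1) y(1)] by simp
      \<comment> \<open>D (s x y) lies in W n = u V, so multiplication by t^n brings it into V, and
        the factor \<open>u\<close> restores it.\<close>
      define E where "E x = t [^] n \<otimes> D (s x \<otimes> y)" for x
      have sx: "s x \<in> carrier K" "s x \<otimes> y \<in> L1" "D (s x \<otimes> y) \<in> W n" "D (s x \<otimes> y) \<in> carrier K" if x: "x \<in> carrier F"
          for x
      proof -
        show "s x \<in> carrier K" using s_facts(1)[OF x] by simp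
        show "s x \<otimes> y \<in> L1" using lattice_mem(5)[OF mK l(1) s_facts(1)[OF x] y(1)] by simp
        then show "D (s x \<otimes> y) \<in> W n" using rb by (auto simp: refinement_iff)
        then show "D (s x \<otimes> y) \<in> carrier K" using lattice_mem(2)[OF mK W] by auto
      qed
      have "(\<lambda>x\<in>carrier F. coset_rep ?K L2 (E x \<odot>\<^bsub>?K\<^esub> u)) \<in> BT k F Os (tl \<rho>) (regular_module F) (rest s ?K (W n)
          L2)"
      proof (rule expand[OF F Q mK l(4) W lW u(3), where d = d and l = l0])
        show "t [^] l0 \<odot>\<^bsub>?K\<^esub> u \<in> L2" using l0 by simp
        show "E x \<in> V" if "x \<in> carrier F" for x using W_mem sx[OF that] by (simp add: E_def)
        show "E (x \<oplus>\<^bsub>F\<^esub> z) = E x \<oplus> E z" if xz: "x \<in> carrier F" "z \<in> carrier F" for x z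
          using sx(1,4)[OF xz(1)] sx(1,4)[OF xz(2)] xz yK
          by (simp add: E_def s_facts l_distr f(2) r_distr)
        show "E (structure_map F c \<otimes>\<^bsub>F\<^esub> x) = structure_map K c \<otimes> E x" if x: "c \<in> carrier k" "x \<in> carrier F" for c x
        proof -
          have "structure_map F c \<in> carrier F" "structure_map K c \<in> carrier K"
            using structure_map_closed[OF F_alg] k_V x by auto
          then have "s (structure_map F c \<otimes>\<^bsub>F\<^esub> x) \<otimes> y = structure_map K c \<otimes> (s x \<otimes> y)"
            using x sx(1)[OF x(2)] yK by (simp add: s_facts(3) s_structure_map m_assoc)
          then show ?thesis using f(3)[OF x(1), of "s x \<otimes> y"] sx[OF x(2)] yK k_V[OF x(1)]
              by (simp add: E_def m_lcomm)
        qed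
        show "continuous_map TF T E"
        proof -
          have "continuous_map TF T s" using s_cont by (simp add: continuous_map_in_subtopology)
          from cont_mult[OF yK this] have "continuous_map TF T (\<lambda>x. s x \<otimes> y)"
            by (rule continuous_map_eq) (use sx yK in \<open>simp add: topspace_TF m_comm\<close>)
          from continuous_map_compose[OF this cont] show ?thesis unfolding E_def
            by (intro cont_mult) (simp_all add: o_def)
        qed
        have "diff_op F K (\<lambda>x. id (s x)) {\<zero>} d (\<lambda>x. D (s x \<otimes> y))"
          by (rule diff_op_precompose[OF F.is_cring is_cring _ _ yK diff_op]) (auto simp: s_facts V_in[OF
              s_facts(1)])
        \<comment> \<open>The commutators vanish exactly, so they lie in t^l0 V whatever l0
          is.\<close>
        then show "diff_op F K s ((\<lambda>v. t [^] l0 \<otimes> v) ` V) d E" unfolding E_def id_def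
          by (intro diff_op_scale[OF is_cring F.is_cring,
              where J = "{\<zero>}"]) (use sx in \<open>auto intro!: image_eqI[of _ _ \<zero>]\<close>)
      qed
      moreover have "(\<lambda>x\<in>carrier F. induced_map ?K ?K D (L1', W n) (L1, L2) (x \<odot>\<^bsub>rest s ?K L1 L1'\<^esub> q0)) =
        (\<lambda>x\<in>carrier F. coset_rep ?K L2 (E x \<odot>\<^bsub>?K\<^esub> u))"
      proof (rule extensionalityI[of _ "carrier F"])
        fix x assume x: "x \<in> carrier F"
        have "E x \<otimes> u = (t [^] n \<otimes> u) \<otimes> D (s x \<otimes> y)" using sx(4)[OF x] u(1) by (simp add: E_def m_ac)
        then have "E x \<otimes> u = D (s x \<otimes> y)" using sx(4)[OF x] u(2) by simp
        then show "(\<lambda>x\<in>carrier F. induced_map ?K ?K D (L1', W n) (L1, L2) (x \<odot>\<^bsub>rest s ?K L1 L1'\<^esub> q0)) x =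
          (\<lambda>x\<in>carrier F. coset_rep ?K L2 (E x \<odot>\<^bsub>?K\<^esub> u)) x"
          unfolding y(2)[symmetric] q1(5)[OF x y(1)] restrict_apply'[OF x]
          using i(1)[OF sx(2)[OF x]] by simp
      qed auto
      ultimately show "(\<lambda>x\<in>carrier F. induced_map ?K ?K D (L1', W n) (L1, L2) (x \<odot>\<^bsub>rest s ?K L1 L1'\<^esub> q0)) \<in> 
        BT k F Os (tl \<rho>) (regular_module F) (rest s ?K (W n) L2)" by simp
    qed
    have "induced_map ?K ?K D (L1', L2') (L1, L2) \<in> BT k F Os (tl \<rho>) (rest s ?K L1 L1') (rest s ?K L2' L2)"
      unfolding e by (rule BT_compose[OF F q1(9) qW(9) q2(9) BT_compose[OF F q1(9) q1(9) qW(9)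
        BT_linear[OF F q1(8) q1(8) ab(1)] d] BT_linear[OF F qW(8) q2(8) ab(2)]])
    then show "induced_map ?K ?K D (L1', L2') (L1, L2) \<in> BT k F Os (tl \<rho>) (rest (hd \<rho>) ?K L1 L1') (rest (hd \<rho>) ?K
        L2' L2)"
      unfolding s .
  qed
qed

end

section \<open>The algebra of Laurent series\<close>

locale laurent = cring A for A :: "('k, 'a laurent) module" (structure) +
  fixes k :: "('k, 'b) ring_scheme"
  assumes alg: "Module.algebra k A"
begin

abbreviation (input) "L \<equiv> laurent_algebra A"
abbreviation (input) "c \<equiv> coeff_of"

definition mono :: "'a laurent \<Rightarrow> int \<Rightarrow> 'a laurent" where
  "mono a n = Series (\<lambda>i. if i = n then a else \<zero>)"

lemma L_iff: "x \<in> carrier L \<longleftrightarrow> x = Series (c x) \<and> (\<forall>i. c x i \<in> carrier A) \<and> (\<exists>N. \<forall>i<N. c x i = \<zero>)"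
  by (cases x) (auto simp: laurent_algebra_def)

lemma L_c[simp]: "x \<in> carrier L \<Longrightarrow> c x i \<in> carrier A" by (simp add: L_iff)

lemma L_bound: "x \<in> carrier L \<Longrightarrow> \<exists>N. \<forall>i<N. c x i = \<zero>"
  by (simp add: L_iff)

lemma L_eqI: "x \<in> carrier L \<Longrightarrow> y \<in> carrier L \<Longrightarrow> (\<And>i. c x i = c y i) \<Longrightarrow> x = y"
  unfolding L_iff by (metis ext)

lemma Series_L: "(\<And>i. f i \<in> carrier A) \<Longrightarrow> (\<And>i. i < N \<Longrightarrow> f i = \<zero>) \<Longrightarrow> Series f \<in> carrier L"
  by (auto simp: L_iff)

lemma c_simps[simp]:
  "c (x \<oplus>\<^bsub>L\<^esub> y) i = c x i \<oplus> c y i" "c \<zero>\<^bsub>L\<^esub> i = \<zero>" "c \<one>\<^bsub>L\<^esub> i = (if i = 0 then \<one> else \<zero>)"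
  "c (r \<odot>\<^bsub>L\<^esub> x) i = r \<odot>\<^bsub>A\<^esub> c x i" "c (mono a n) i = (if i = n then a else \<zero>)"
  "c (const_series A a) i = (if i = 0 then a else \<zero>)"
  by (simp_all add: laurent_algebra_def const_series_def mono_def)

lemma const_mono: "const_series A a = mono a 0" by (simp add: const_series_def mono_def)

lemma mono_L[simp]: "a \<in> carrier A \<Longrightarrow> mono a n \<in> carrier L"
  unfolding mono_def by (rule Series_L[where N = n]) auto

lemma one_L: "\<one>\<^bsub>L\<^esub> = mono \<one> 0" by (simp add: laurent_algebra_def const_mono)
lemma zero_L: "\<zero>\<^bsub>L\<^esub> = mono \<zero> 0" by (simp add: laurent_algebra_def const_mono)

lemma add_L[simp]: assumes x: "x \<in> carrier L" and y: "y \<in> carrier L" shows "x \<oplus>\<^bsub>L\<^esub> y \<in> carrier L"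
proof -
  obtain N where "\<forall>i<N. c x i = \<zero>" using L_bound[OF x] by auto
  then have N: "\<And>i. i < N \<Longrightarrow> c x i = \<zero>" by blast
  obtain M where "\<forall>i<M. c y i = \<zero>" using L_bound[OF y] by auto
  then have M: "\<And>i. i < M \<Longrightarrow> c y i = \<zero>" by blast
  show ?thesis unfolding laurent_algebra_def using x y N M
    by (auto intro!: exI[of _ "min N M"])
qed

lemma c_mult_def: "c (x \<otimes>\<^bsub>L\<^esub> y) i = finsum A (\<lambda>j. c x j \<otimes> c y (i - j)) {j. c x j \<noteq> \<zero> \<and> c y (i - j) \<noteq> \<zero>}"
  by (simp add: laurent_algebra_def)

lemma c_mult:
  assumes x: "x \<in> carrier L" and y: "y \<in> carrier L" and "finite S"
    "\<And>j. j \<notin> S \<Longrightarrow> c x j = \<zero> \<or> c y (i - j) = \<zero>"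
  shows "c (x \<otimes>\<^bsub>L\<^esub> y) i = finsum A (\<lambda>j. c x j \<otimes> c y (i - j)) S"
  unfolding c_mult_def
proof (rule add.finprod_mono_neutral_cong_left)
  show "{j. c x j \<noteq> \<zero> \<and> c y (i - j) \<noteq> \<zero>} \<subseteq> S" using assms(4) by blast
  show "c x j \<otimes> c y (i - j) = \<zero>" if "j \<in> S - {j. c x j \<noteq> \<zero> \<and> c y (i - j) \<noteq> \<zero>}" for j
    using that x y by auto
qed (use assms in auto)

text \<open>The convolution is supported on j from N to i - M. Any larger interval may be used, so
  that several products can be summed over one index set.\<close>

lemma c_mult_interval:
  assumes x: "x \<in> carrier L" and y: "y \<in> carrier L" and N: "\<And>i. i < N \<Longrightarrow> c x i = \<zero>" and M: "\<And>i. i < M \<Longrightarrow> c y i = \<zero>"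
    and "a \<le> N" "i - M \<le> b"
  shows "c (x \<otimes>\<^bsub>L\<^esub> y) i = finsum A (\<lambda>j. c x j \<otimes> c y (i - j)) {a..b}"
proof (rule c_mult[OF x y])
  fix j assume "j \<notin> {a..b}"
  then have "j < N \<or> i - j < M" using assms(5,6) by auto
  then show "c x j = \<zero> \<or> c y (i - j) = \<zero>" using N M by auto
qed simp

lemma mult_Series: "x \<otimes>\<^bsub>L\<^esub> y = Series (c (x \<otimes>\<^bsub>L\<^esub> y))" by (simp add: laurent_algebra_def)

lemma mult_low:
  assumes N: "\<And>i. i < N \<Longrightarrow> c x i = \<zero>" and M: "\<And>i. i < M \<Longrightarrow> c y i = \<zero>" and "i < N + M"
  shows "c (x \<otimes>\<^bsub>L\<^esub> y) i = \<zero>"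
proof -
  have *: "{j. c x j \<noteq> \<zero> \<and> c y (i - j) \<noteq> \<zero>} = {}"
  proof -
    have "c x j = \<zero> \<or> c y (i - j) = \<zero>" for j
      using N[of j] M[of "i - j"] assms(3) by (cases "j < N") auto
    then show ?thesis by auto
  qed
  show ?thesis unfolding c_mult_def * by simp
qed

lemma mult_L[simp]: assumes x: "x \<in> carrier L" and y: "y \<in> carrier L" shows "x \<otimes>\<^bsub>L\<^esub> y \<in> carrier L"
proof -
  obtain N where "\<forall>i<N. c x i = \<zero>" using L_bound[OF x] by auto
  then have N: "\<And>i. i < N \<Longrightarrow> c x i = \<zero>" by blast
  obtain M where "\<forall>i<M. c y i = \<zero>" using L_bound[OF y] by auto
  then have M: "\<And>i. i < M \<Longrightarrow> c y i = \<zero>" by blast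
  show ?thesis
  proof (subst mult_Series, rule Series_L[where N = "N + M"])
    show "c (x \<otimes>\<^bsub>L\<^esub> y) i \<in> carrier A" for i unfolding c_mult_def by (rule finsum_closed) (use x y in auto)
  qed (rule mult_low[OF N M])
qed

lemma mono_mult_c: assumes "a \<in> carrier A" "x \<in> carrier L" shows "c (mono a n \<otimes>\<^bsub>L\<^esub> x) i = a \<otimes> c x (i - n)"
  using assms by (subst c_mult[where S = "{n}"]) auto

lemma mono_mono: "a \<in> carrier A \<Longrightarrow> b \<in> carrier A \<Longrightarrow> mono a n \<otimes>\<^bsub>L\<^esub> mono b p = mono (a \<otimes> b) (n + p)"
  by (rule L_eqI) (auto simp: mono_mult_c)

lemma mult_comm: assumes x: "x \<in> carrier L" and y: "y \<in> carrier L" shows "x \<otimes>\<^bsub>L\<^esub> y = y \<otimes>\<^bsub>L\<^esub> x"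
proof (rule L_eqI)
  fix i
  obtain N where "\<forall>i<N. c x i = \<zero>" using L_bound[OF x] by auto
  then have N: "\<And>i. i < N \<Longrightarrow> c x i = \<zero>" by blast
  obtain M where "\<forall>i<M. c y i = \<zero>" using L_bound[OF y] by auto
  then have M: "\<And>i. i < M \<Longrightarrow> c y i = \<zero>" by blast
  have "c (x \<otimes>\<^bsub>L\<^esub> y) i = finsum A (\<lambda>j. c x j \<otimes> c y (i - j)) {N..i - M}"
    by (rule c_mult_interval[OF x y N M]) auto
  also have "{N..i - M} = (\<lambda>j. i - j) ` {M..i - N}" by (auto intro!: image_eqI[of _ _ "i - j" for j])
  also have "finsum A (\<lambda>j. c x j \<otimes> c y (i - j)) \<dots> = finsum A (\<lambda>j. c x (i - j) \<otimes> c y (i - (i - j))) {M..i - N}"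
    by (rule finsum_reindex) (use x y in \<open>auto simp: inj_on_def\<close>)
  also have "\<dots> = finsum A (\<lambda>j. c y j \<otimes> c x (i - j)) {M..i - N}"
    by (rule finsum_cong') (use x y in \<open>auto simp: m_comm\<close>)
  also have "\<dots> = c (y \<otimes>\<^bsub>L\<^esub> x) i" by (rule c_mult_interval[OF y x M N, symmetric]) auto
  finally show "c (x \<otimes>\<^bsub>L\<^esub> y) i = c (y \<otimes>\<^bsub>L\<^esub> x) i" .
qed (use x y in auto)

lemma finsum_swap:
  assumes "finite S" "finite S'" "\<And>i j. i \<in> S \<Longrightarrow> j \<in> S' \<Longrightarrow> f i j \<in> carrier A"
  shows "finsum A (\<lambda>i. finsum A (f i) S') S = finsum A (\<lambda>j. finsum A (\<lambda>i. f i j) S) S'"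
  using assms(1,3)
proof (induction S)
  case empty
  then show ?case by (simp add: finsum_zero)
next
  case (insert x S)
  have "finsum A (\<lambda>j. finsum A (\<lambda>i. f i j) (insert x S)) S' = finsum A (\<lambda>j. f x j \<oplus> finsum A (\<lambda>i. f i j) S) S'"
    by (rule finsum_cong') (use insert in \<open>auto intro!: finsum_insert finsum_closed\<close>)
  also have "\<dots> = finsum A (f x) S' \<oplus> finsum A (\<lambda>j. finsum A (\<lambda>i. f i j) S) S'"
    by (rule finsum_addf) (use insert in \<open>auto intro!: finsum_closed\<close>)
  finally show ?case using insert
    by (subst finsum_insert) (auto intro!: finsum_closed)
qed

lemma mult_assoc:
  assumes x: "x \<in> carrier L" and y: "y \<in> carrier L" and z: "z \<in> carrier L"
  shows "(x \<otimes>\<^bsub>L\<^esub> y) \<otimes>\<^bsub>L\<^esub> z = x \<otimes>\<^bsub>L\<^esub> (y \<otimes>\<^bsub>L\<^esub> z)"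
proof (rule L_eqI)
  fix i
  obtain N where "\<forall>i<N. c x i = \<zero>" using L_bound[OF x] by auto
  then have N: "\<And>i. i < N \<Longrightarrow> c x i = \<zero>" by blast
  obtain M where "\<forall>i<M. c y i = \<zero>" using L_bound[OF y] by auto
  then have M: "\<And>i. i < M \<Longrightarrow> c y i = \<zero>" by blast
  obtain P where "\<forall>i<P. c z i = \<zero>" using L_bound[OF z] by auto
  then have P: "\<And>i. i < P \<Longrightarrow> c z i = \<zero>" by blast
  \<comment> \<open>Here j is the exponent from x and p that from x y. The bounds j >= N, p - j >= M
    and i - p >= P give both intervals, independent of the other index, so that the sums may be
    exchanged.\<close>
  let ?S = "{N..i - P - M}" and ?T = "{N + M..i - P}"
  have "c ((x \<otimes>\<^bsub>L\<^esub> y) \<otimes>\<^bsub>L\<^esub> z) i = finsum A (\<lambda>p. c (x \<otimes>\<^bsub>L\<^esub> y) p \<otimes> c z (i - p)) ?T"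
    by (rule c_mult_interval[OF mult_L[OF x y] z mult_low[OF N M] P]) auto
  also have "\<dots> = finsum A (\<lambda>p. finsum A (\<lambda>j. (c x j \<otimes> c y (p - j)) \<otimes> c z (i - p)) ?S) ?T"
  proof (rule finsum_cong'[OF refl])
    fix p assume p: "p \<in> ?T"
    have "c (x \<otimes>\<^bsub>L\<^esub> y) p = finsum A (\<lambda>j. c x j \<otimes> c y (p - j)) ?S"
      by (rule c_mult_interval[OF x y N M]) (use p in auto)
    then show "c (x \<otimes>\<^bsub>L\<^esub> y) p \<otimes> c z (i - p) = finsum A (\<lambda>j. (c x j \<otimes> c y (p - j)) \<otimes> c z (i - p)) ?S"
      using x y z by (simp add: finsum_ldistr)
  qed (use x y z in \<open>auto intro!: finsum_closed\<close>)
  also have "\<dots> = finsum A (\<lambda>j. finsum A (\<lambda>p. (c x j \<otimes> c y (p - j)) \<otimes> c z (i - p)) ?T) ?S"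
    by (rule finsum_swap) (use x y z in auto)
  also have "\<dots> = finsum A (\<lambda>j. c x j \<otimes> c (y \<otimes>\<^bsub>L\<^esub> z) (i - j)) ?S"
  proof (rule finsum_cong'[OF refl])
    fix j assume j: "j \<in> ?S"
    have inj: "inj_on (\<lambda>q. q + j) {N + M - j..i - P - j}" by (auto simp: inj_on_def)
    have im: "?T = (\<lambda>q. q + j) ` {N + M - j..i - P - j}" by (auto intro!: image_eqI[of _ _ "p - j" for p])
    have "finsum A (\<lambda>p. (c x j \<otimes> c y (p - j)) \<otimes> c z (i - p)) ?T =
       finsum A (\<lambda>q. (c x j \<otimes> c y (q + j - j)) \<otimes> c z (i - (q + j))) {N + M - j..i - P - j}"
      unfolding im by (rule finsum_reindex[OF _ inj]) (use x y z in auto)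
    also have "\<dots> = finsum A (\<lambda>q. c x j \<otimes> (c y q \<otimes> c z (i - j - q))) {N + M - j..i - P - j}"
      by (rule finsum_cong') (use x y z in \<open>auto simp: m_assoc algebra_simps\<close>)
    also have "\<dots> = c x j \<otimes> finsum A (\<lambda>q. c y q \<otimes> c z (i - j - q)) {N + M - j..i - P - j}"
      using x y z by (simp add: finsum_rdistr)
    also have "finsum A (\<lambda>q. c y q \<otimes> c z (i - j - q)) {N + M - j..i - P - j} = c (y \<otimes>\<^bsub>L\<^esub> z) (i - j)"
      by (rule c_mult_interval[OF y z M P, symmetric]) (use j in auto)
    finally show "finsum A (\<lambda>p. (c x j \<otimes> c y (p - j)) \<otimes> c z (i - p)) ?T = c x j \<otimes> c (y \<otimes>\<^bsub>L\<^esub> z) (i - j)" .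
  qed (use x y z in auto)
  also have "\<dots> = c (x \<otimes>\<^bsub>L\<^esub> (y \<otimes>\<^bsub>L\<^esub> z)) i"
    by (rule c_mult_interval[OF x mult_L[OF y z] N mult_low[OF M P], symmetric]) auto
  finally show "c ((x \<otimes>\<^bsub>L\<^esub> y) \<otimes>\<^bsub>L\<^esub> z) i = c (x \<otimes>\<^bsub>L\<^esub> (y \<otimes>\<^bsub>L\<^esub> z)) i" .
qed (use x y z in auto)

lemma mult_distr:
  assumes x: "x \<in> carrier L" and y: "y \<in> carrier L" and z: "z \<in> carrier L"
  shows "(x \<oplus>\<^bsub>L\<^esub> y) \<otimes>\<^bsub>L\<^esub> z = x \<otimes>\<^bsub>L\<^esub> z \<oplus>\<^bsub>L\<^esub> y \<otimes>\<^bsub>L\<^esub> z"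
proof (rule L_eqI)
  fix i
  obtain N where "\<forall>i<N. c x i = \<zero>" using L_bound[OF x] by auto
  then have N: "\<And>i. i < N \<Longrightarrow> c x i = \<zero>" by blast
  obtain M where "\<forall>i<M. c y i = \<zero>" using L_bound[OF y] by auto
  then have M: "\<And>i. i < M \<Longrightarrow> c y i = \<zero>" by blast
  obtain P where "\<forall>i<P. c z i = \<zero>" using L_bound[OF z] by auto
  then have P: "\<And>i. i < P \<Longrightarrow> c z i = \<zero>" by blast
  let ?S = "{min N M..i - P}"
  have "c ((x \<oplus>\<^bsub>L\<^esub> y) \<otimes>\<^bsub>L\<^esub> z) i = finsum A (\<lambda>j. c (x \<oplus>\<^bsub>L\<^esub> y) j \<otimes> c z (i - j)) ?S"
    by (rule c_mult_interval[OF add_L[OF x y] z _ P, where N = "min N M"]) (auto simp: N M)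
  also have "\<dots> = finsum A (\<lambda>j. c x j \<otimes> c z (i - j) \<oplus> c y j \<otimes> c z (i - j)) ?S"
    by (rule finsum_cong') (use x y z in \<open>auto simp: l_distr\<close>)
  also have "\<dots> = finsum A (\<lambda>j. c x j \<otimes> c z (i - j)) ?S \<oplus> finsum A (\<lambda>j. c y j \<otimes> c z (i - j)) ?S"
    by (rule finsum_addf) (use x y z in auto)
  also have "\<dots> = c (x \<otimes>\<^bsub>L\<^esub> z) i \<oplus> c (y \<otimes>\<^bsub>L\<^esub> z) i"
    using c_mult_interval[OF x z N P, where a = "min N M" and b = "i - P" and i = i] c_mult_interval[OF y z M P,
        where a = "min N M" and b = "i - P" and i = i] by simp
  finally show "c ((x \<oplus>\<^bsub>L\<^esub> y) \<otimes>\<^bsub>L\<^esub> z) i = c (x \<otimes>\<^bsub>L\<^esub> z \<oplus>\<^bsub>L\<^esub> y \<otimes>\<^bsub>L\<^esub> z) i" by simp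
qed (use x y z in auto)

lemma neg_L: assumes "x \<in> carrier L" shows "Series (\<lambda>i. \<ominus> c x i) \<in> carrier L"
proof -
  obtain N where "\<forall>i<N. c x i = \<zero>" using L_bound[OF assms] by auto
  then have N: "\<And>i. i < N \<Longrightarrow> c x i = \<zero>" by blast
  show ?thesis by (rule Series_L[where N = N]) (use assms N in auto)
qed

lemma L_abelian: "abelian_group L"
proof (rule abelian_groupI)
  show "x \<oplus>\<^bsub>L\<^esub> y \<in> carrier L" if "x \<in> carrier L" "y \<in> carrier L" for x y using that by simp
  show z: "\<zero>\<^bsub>L\<^esub> \<in> carrier L" by (simp add: zero_L)
  show "x \<oplus>\<^bsub>L\<^esub> y \<oplus>\<^bsub>L\<^esub> z = x \<oplus>\<^bsub>L\<^esub> (y \<oplus>\<^bsub>L\<^esub> z)" if "x \<in> carrier L" "y \<in> carrier L" "z \<in> carrier L" for x y z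
    by (rule L_eqI) (simp_all add: that a_assoc)
  show "x \<oplus>\<^bsub>L\<^esub> y = y \<oplus>\<^bsub>L\<^esub> x" if "x \<in> carrier L" "y \<in> carrier L" for x y
    by (rule L_eqI) (simp_all add: that a_comm)
  show "\<zero>\<^bsub>L\<^esub> \<oplus>\<^bsub>L\<^esub> x = x" if "x \<in> carrier L" for x
    by (rule L_eqI) (simp_all add: that z)
  show "\<exists>y\<in>carrier L. y \<oplus>\<^bsub>L\<^esub> x = \<zero>\<^bsub>L\<^esub>" if "x \<in> carrier L" for x
    by (rule bexI[OF _ neg_L[OF that]], rule L_eqI) (simp_all add: that neg_L l_neg z)
qed

lemma L_cring: "cring L"
proof (rule cringI)
  show "comm_monoid L"
  proof (rule comm_monoidI)
    show "\<one>\<^bsub>L\<^esub> \<otimes>\<^bsub>L\<^esub> x = x" if "x \<in> carrier L" for x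
      by (rule L_eqI) (simp_all add: that one_L mono_mult_c)
    show "x \<otimes>\<^bsub>L\<^esub> y = y \<otimes>\<^bsub>L\<^esub> x" if "x \<in> carrier L" "y \<in> carrier L" for x y
      by (rule mult_comm[OF that])
    show "x \<otimes>\<^bsub>L\<^esub> y \<otimes>\<^bsub>L\<^esub> z = x \<otimes>\<^bsub>L\<^esub> (y \<otimes>\<^bsub>L\<^esub> z)" if "x \<in> carrier L" "y \<in> carrier L" "z \<in> carrier L" for x y z
      by (rule mult_assoc[OF that])
  qed (simp_all add: one_L)
qed (rule L_abelian, rule mult_distr)

lemma A_smult: "r \<in> carrier k \<Longrightarrow> a \<in> carrier A \<Longrightarrow> r \<odot>\<^bsub>A\<^esub> a \<in> carrier A"
  "r \<in> carrier k \<Longrightarrow> r \<odot>\<^bsub>A\<^esub> \<zero> = \<zero>"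
  "r \<in> carrier k \<Longrightarrow> a \<in> carrier A \<Longrightarrow> (r \<odot>\<^bsub>A\<^esub> \<one>) \<otimes> a = r \<odot>\<^bsub>A\<^esub> a"
proof -
  interpret K: Module.algebra k A by (rule alg)
  show "r \<in> carrier k \<Longrightarrow> a \<in> carrier A \<Longrightarrow> r \<odot>\<^bsub>A\<^esub> a \<in> carrier A" by (rule K.smult_closed)
  show "r \<in> carrier k \<Longrightarrow> r \<odot>\<^bsub>A\<^esub> \<zero> = \<zero>" by (rule K.smult_r_null)
  show "r \<in> carrier k \<Longrightarrow> a \<in> carrier A \<Longrightarrow> (r \<odot>\<^bsub>A\<^esub> \<one>) \<otimes> a = r \<odot>\<^bsub>A\<^esub> a"
    using K.smult_assoc2[of r \<one> a] by simp
qed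

lemma smult_L: assumes "r \<in> carrier k" "x \<in> carrier L" shows "r \<odot>\<^bsub>L\<^esub> x \<in> carrier L"
proof -
  obtain N where N: "\<forall>i<N. c x i = \<zero>" using L_bound[OF assms(2)] by auto
  have "r \<odot>\<^bsub>L\<^esub> x = Series (\<lambda>i. r \<odot>\<^bsub>A\<^esub> c x i)" by (simp add: laurent_algebra_def)
  also have "\<dots> \<in> carrier L"
    by (rule Series_L[where N = N]) (use assms N in \<open>simp_all add: A_smult(1,2)\<close>)
  finally show ?thesis .
qed

lemma smult_eq: "r \<in> carrier k \<Longrightarrow> x \<in> carrier L \<Longrightarrow> r \<odot>\<^bsub>L\<^esub> x = mono (r \<odot>\<^bsub>A\<^esub> \<one>) 0 \<otimes>\<^bsub>L\<^esub> x"
  by (rule L_eqI) (simp_all add: smult_L A_smult mono_mult_c)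

lemma L_alg: "Module.algebra k L"
proof -
  interpret K: Module.algebra k A by (rule alg)
  interpret L: cring L by (rule L_cring)
  show ?thesis
  proof (rule algebraI)
    show "cring k" by (rule K.R_cring)
    show "(a \<odot>\<^bsub>L\<^esub> x) \<otimes>\<^bsub>L\<^esub> y = a \<odot>\<^bsub>L\<^esub> (x \<otimes>\<^bsub>L\<^esub> y)"
      if "a \<in> carrier k" "x \<in> carrier L" "y \<in> carrier L" for a x y
      using that by (simp add: smult_eq mult_assoc A_smult)
  next
    fix a b x assume h: "a \<in> carrier k" "b \<in> carrier k" "x \<in> carrier L"
    show "(a \<oplus>\<^bsub>k\<^esub> b) \<odot>\<^bsub>L\<^esub> x = a \<odot>\<^bsub>L\<^esub> x \<oplus>\<^bsub>L\<^esub> b \<odot>\<^bsub>L\<^esub> x"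
      by (rule L_eqI) (simp_all add: h smult_L K.smult_l_distr)
    show "(a \<otimes>\<^bsub>k\<^esub> b) \<odot>\<^bsub>L\<^esub> x = a \<odot>\<^bsub>L\<^esub> (b \<odot>\<^bsub>L\<^esub> x)"
      by (rule L_eqI) (simp_all add: h smult_L K.smult_assoc1)
  next
    fix a x y assume h: "a \<in> carrier k" "x \<in> carrier L" "y \<in> carrier L"
    show "a \<odot>\<^bsub>L\<^esub> (x \<oplus>\<^bsub>L\<^esub> y) = a \<odot>\<^bsub>L\<^esub> x \<oplus>\<^bsub>L\<^esub> a \<odot>\<^bsub>L\<^esub> y"
      by (rule L_eqI) (simp_all add: h smult_L K.smult_r_distr)
  next
    fix x assume h: "x \<in> carrier L"
    show "\<one>\<^bsub>k\<^esub> \<odot>\<^bsub>L\<^esub> x = x"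
      by (rule L_eqI) (simp_all add: h smult_L)
  qed (simp_all add: L_cring smult_L)
qed

lemma c_neg[simp]: "x \<in> carrier L \<Longrightarrow> c (\<ominus>\<^bsub>L\<^esub> x) i = \<ominus> c x i"
proof -
  assume x: "x \<in> carrier L"
  interpret L: cring L by (rule L_cring)
  have "c (\<ominus>\<^bsub>L\<^esub> x \<oplus>\<^bsub>L\<^esub> x) i = \<zero>" using x by (simp only: L.l_neg c_simps)
  then have "c (\<ominus>\<^bsub>L\<^esub> x) i \<oplus> c x i = \<zero>" by simp
  then show ?thesis using minus_equality[of "c (\<ominus>\<^bsub>L\<^esub> x) i" "c x i"] x L_c[OF L.a_inv_closed[OF x]] by simp
qed

lemma c_minus[simp]: "x \<in> carrier L \<Longrightarrow> y \<in> carrier L \<Longrightarrow> c (x \<ominus>\<^bsub>L\<^esub> y) i = c x i \<ominus> c y i"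
  by (simp add: a_minus_def)

text \<open>The hypotheses on x make it a Laurent polynomial, that is, a finite sum of monomials.
  The induction on the width of the window N..N+d-1 strips the top monomial.\<close>

lemma polynomial_mem:
  assumes G: "\<zero>\<^bsub>L\<^esub> \<in> G" "\<And>x y. x \<in> G \<Longrightarrow> y \<in> G \<Longrightarrow> x \<oplus>\<^bsub>L\<^esub> y \<in> G" and x: "x \<in> carrier L" and hi: "\<And>i. i > n \<Longrightarrow> c x i = \<zero>"
    and mem: "\<And>i. mono (c x i) i \<in> G"
  shows "x \<in> G"
proof -
  interpret L: cring L by (rule L_cring)
  obtain N where "\<forall>i<N. c x i = \<zero>" using L_bound[OF x] by auto
  then have N: "\<And>i. i < N \<Longrightarrow> c x i = \<zero>" by blast
  have *: "y \<in> G" if "y \<in> carrier L" "\<And>i. i < N \<or> i \<ge> N + int d \<Longrightarrow> c y i = \<zero>" "\<And>i. mono (c y i) i \<in> G" for y d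
    using that
  proof (induction d arbitrary: y)
    case 0
    have "y = \<zero>\<^bsub>L\<^esub>" by (rule L_eqI) (use 0 in \<open>auto, metis le_less_linear\<close>)
    then show ?case using G(1) by simp
  next
    case (Suc d)
    let ?m = "mono (c y (N + int d)) (N + int d)"
    have m: "?m \<in> carrier L" using Suc.prems(1) by simp
    have c': "c (y \<ominus>\<^bsub>L\<^esub> ?m) i = (if i = N + int d then \<zero> else c y i)" for i
      using Suc.prems(1) by (simp add: m) (simp add: a_minus_def r_neg)
    have z: "mono \<zero> i \<in> G" for i
    proof -
      have "mono \<zero> i = \<zero>\<^bsub>L\<^esub>" by (rule L_eqI) (auto simp: zero_L)
      then show ?thesis using G(1) by simp
    qed
    have "y \<ominus>\<^bsub>L\<^esub> ?m \<in> G"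
    proof (rule Suc.IH)
      show "c (y \<ominus>\<^bsub>L\<^esub> ?m) i = \<zero>" if "i < N \<or> N + int d \<le> i" for i
        unfolding c' using Suc.prems(2)[of i] that by auto
      show "mono (c (y \<ominus>\<^bsub>L\<^esub> ?m) i) i \<in> G" for i unfolding c' using Suc.prems(3)[of i] z by simp
    qed (use Suc.prems(1) m in auto)
    then have "(y \<ominus>\<^bsub>L\<^esub> ?m) \<oplus>\<^bsub>L\<^esub> ?m \<in> G" by (rule G(2)) (rule Suc.prems(3))
    moreover have "(y \<ominus>\<^bsub>L\<^esub> ?m) \<oplus>\<^bsub>L\<^esub> ?m = y" using Suc.prems(1) m by (simp add: a_minus_def L.a_assoc L.l_neg)
    ultimately show ?case by simp
  qed
  show ?thesis
  \<comment> \<open>The window has to reach n itself, hence the width n + 1 - N; if that is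
    negative, \<open>nat\<close> gives the empty window and x is zero.\<close>
  proof (rule *[OF x _ mem, of "nat (n + 1 - N)"])
    fix i assume "i < N \<or> N + int (nat (n + 1 - N)) \<le> i"
    then have "i < N \<or> n < i" by (cases "N \<le> n + 1") auto
    then show "c x i = \<zero>" using N hi by blast
  qed
qed

end

section \<open>Linear topologies\<close>

text \<open>Translations are continuous, so the open submodules around 0 can be moved to any
  point.\<close>

lemma linear_topology_facts:
  assumes M: "Module.module k M" and T: "linear_topology k M T"
  shows "topspace T = carrier M"
    "openin T U \<Longrightarrow> y \<in> U \<Longrightarrow> \<exists>V. openin T V \<and> submodule V k M \<and> (\<forall>h\<in>V. y \<oplus>\<^bsub>M\<^esub> h \<in> U)"
    "openin T V \<Longrightarrow> y \<in> carrier M \<Longrightarrow> openin T {x \<in> carrier M. x \<ominus>\<^bsub>M\<^esub> y \<in> V}"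
proof -
  interpret M: Module.module k M by (rule M)
  show ts: "topspace T = carrier M" using T by (simp add: linear_topology_def)
  have tr: "continuous_map T T (\<lambda>x. y \<oplus>\<^bsub>M\<^esub> x)" if y: "y \<in> carrier M" for y
  proof -
    have "continuous_map T (prod_topology T T) (\<lambda>x. (y, x))"
      by (intro continuous_map_pairedI) (use y ts in auto)
    from continuous_map_compose[OF this, of T "\<lambda>(x, y). x \<oplus>\<^bsub>M\<^esub> y"] show ?thesis
      using T by (simp add: linear_topology_def o_def)
  qed
  show "\<exists>V. openin T V \<and> submodule V k M \<and> (\<forall>h\<in>V. y \<oplus>\<^bsub>M\<^esub> h \<in> U)" if U: "openin T U" "y \<in> U"
  proof -
    have y: "y \<in> carrier M" using U openin_subset ts by blast
    have "openin T {x \<in> topspace T. y \<oplus>\<^bsub>M\<^esub> x \<in> U}" using tr[OF y] U(1) by (simp add: continuous_map_def)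
    moreover have "\<zero>\<^bsub>M\<^esub> \<in> {x \<in> topspace T. y \<oplus>\<^bsub>M\<^esub> x \<in> U}" using y U(2) by (simp add: ts)
    ultimately obtain V where "openin T V" "submodule V k M" "V \<subseteq> {x \<in> topspace T. y \<oplus>\<^bsub>M\<^esub> x \<in> U}"
      using T unfolding linear_topology_def by meson
    then show ?thesis by blast
  qed
  show "openin T {x \<in> carrier M. x \<ominus>\<^bsub>M\<^esub> y \<in> V}" if V: "openin T V" "y \<in> carrier M"
  proof -
    have "openin T {x \<in> topspace T. \<ominus>\<^bsub>M\<^esub> y \<oplus>\<^bsub>M\<^esub> x \<in> V}" using tr[of "\<ominus>\<^bsub>M\<^esub> y"] V by (simp add: continuous_map_def)
    moreover have "{x \<in> topspace T. \<ominus>\<^bsub>M\<^esub> y \<oplus>\<^bsub>M\<^esub> x \<in> V} = {x \<in> carrier M. x \<ominus>\<^bsub>M\<^esub> y \<in> V}"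
      using V(2) by (auto simp: ts a_minus_def M.a_comm)
    ultimately show ?thesis by simp
  qed
qed

text \<open>An additive map is continuous if it is so at 0, and there the target has a basis of open
  submodules.\<close>

lemma linear_continuous:
  assumes M: "Module.module k M" "linear_topology k M T" and M': "Module.module k M'" "linear_topology k M' T'"
    and f: "\<And>x. x \<in> carrier M \<Longrightarrow> f x \<in> carrier M'"
      "\<And>x y. x \<in> carrier M \<Longrightarrow> y \<in> carrier M \<Longrightarrow> f (x \<oplus>\<^bsub>M\<^esub> y) = f x \<oplus>\<^bsub>M'\<^esub> f y"
    and nbhd: "\<And>V'. openin T' V' \<Longrightarrow> submodule V' k M' \<Longrightarrow> \<exists>V. openin T V \<and> \<zero>\<^bsub>M\<^esub> \<in> V \<and> (\<forall>h\<in>V. f h \<in> V')"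
  shows "continuous_map T T' f"
proof -
  interpret M: Module.module k M by (rule M)
  note t = linear_topology_facts[OF M] and t' = linear_topology_facts[OF M']
  have "openin T {x \<in> carrier M. f x \<in> U}" if U: "openin T' U" for U
  proof (subst openin_subopen, intro ballI)
    fix x assume "x \<in> {x \<in> carrier M. f x \<in> U}"
    then have x: "x \<in> carrier M" "f x \<in> U" by auto
    obtain V' where V': "openin T' V'" "submodule V' k M'" "\<forall>h\<in>V'. f x \<oplus>\<^bsub>M'\<^esub> h \<in> U" using t'(2)[OF U x(2)] by auto
    obtain V where V: "openin T V" "\<zero>\<^bsub>M\<^esub> \<in> V" "\<forall>h\<in>V. f h \<in> V'" using nbhd[OF V'(1,2)] by auto
    let ?S = "{z \<in> carrier M. z \<ominus>\<^bsub>M\<^esub> x \<in> V}"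
    have "openin T ?S" by (rule t(3)[OF V(1) x(1)])
    moreover have "x \<in> ?S" using V(2) x(1) by (simp add: a_minus_def M.r_neg)
    moreover have "?S \<subseteq> {x \<in> carrier M. f x \<in> U}"
    proof
      fix z assume z: "z \<in> ?S"
      then have "x \<oplus>\<^bsub>M\<^esub> (z \<ominus>\<^bsub>M\<^esub> x) = z \<oplus>\<^bsub>M\<^esub> (x \<oplus>\<^bsub>M\<^esub> \<ominus>\<^bsub>M\<^esub> x)" using x(1) by (simp add: a_minus_def M.a_lcomm)
      then have "x \<oplus>\<^bsub>M\<^esub> (z \<ominus>\<^bsub>M\<^esub> x) = z" using x(1) z by (simp add: M.r_neg)
      then have "f z = f x \<oplus>\<^bsub>M'\<^esub> f (z \<ominus>\<^bsub>M\<^esub> x)" using f(2)[OF x(1), of "z \<ominus>\<^bsub>M\<^esub> x"] z x(1) by simp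
      then show "z \<in> {x \<in> carrier M. f x \<in> U}" using z V V' by auto
    qed
    ultimately show "\<exists>S. openin T S \<and> x \<in> S \<and> S \<subseteq> {x \<in> carrier M. f x \<in> U}" by blast
  qed
  then show ?thesis using f(1) t(1) t'(1) by (auto simp: continuous_map_def)
qed

section \<open>Topologies given by a filter base of submodules\<close>

definition lintop :: "('k, 'm) module \<Rightarrow> 'm set set \<Rightarrow> 'm topology" where
  "lintop M B = topology (\<lambda>U. U \<subseteq> carrier M \<and> (\<forall>x\<in>U. \<exists>N\<in>B. \<forall>h\<in>N. x \<oplus>\<^bsub>M\<^esub> h \<in> U))"

text \<open>All members of B are subgroups, so (x + N) + (y + N) = x + y + N gives continuity of
  addition; scalars are discrete and preserve N. Directedness of B is what makes intersections of
  open sets open.\<close>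

lemma lintop:
  assumes M: "Module.module k M" and B: "B \<noteq> {}" "\<And>N. N \<in> B \<Longrightarrow> submodule N k M"
    "\<And>N N'. N \<in> B \<Longrightarrow> N' \<in> B \<Longrightarrow> \<exists>N''\<in>B. N'' \<subseteq> N \<inter> N'"
  shows "openin (lintop M B) U \<longleftrightarrow> U \<subseteq> carrier M \<and> (\<forall>x\<in>U. \<exists>N\<in>B. \<forall>h\<in>N. x \<oplus>\<^bsub>M\<^esub> h \<in> U)"
    "linear_topology k M (lintop M B)" "N \<in> B \<Longrightarrow> openin (lintop M B) N"
proof -
  interpret M: Module.module k M by (rule M)
  let ?T = "lintop M B"
  have "istopology (\<lambda>U. U \<subseteq> carrier M \<and> (\<forall>x\<in>U. \<exists>N\<in>B. \<forall>h\<in>N. x \<oplus>\<^bsub>M\<^esub> h \<in> U))"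
    unfolding istopology_def
  proof (intro conjI allI impI ballI; (elim conjE)?)
    fix S U x assume h: "\<forall>x\<in>S. \<exists>N\<in>B. \<forall>h\<in>N. x \<oplus>\<^bsub>M\<^esub> h \<in> S" "\<forall>x\<in>U. \<exists>N\<in>B. \<forall>h\<in>N. x \<oplus>\<^bsub>M\<^esub> h \<in> U" "x \<in> S \<inter> U"
    then obtain N N' where N: "N \<in> B" "\<forall>h\<in>N. x \<oplus>\<^bsub>M\<^esub> h \<in> S" "N' \<in> B" "\<forall>h\<in>N'. x \<oplus>\<^bsub>M\<^esub> h \<in> U" by blast
    obtain N'' where "N'' \<in> B" "N'' \<subseteq> N \<inter> N'" using B(3)[OF N(1,3)] by auto
    then show "\<exists>N\<in>B. \<forall>h\<in>N. x \<oplus>\<^bsub>M\<^esub> h \<in> S \<inter> U" using N by blast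
  next
    fix \<K> x assume h: "\<forall>K\<in>\<K>. K \<subseteq> carrier M \<and> (\<forall>x\<in>K. \<exists>N\<in>B. \<forall>h\<in>N. x \<oplus>\<^bsub>M\<^esub> h \<in> K)" "x \<in> \<Union>\<K>"
    then obtain K where K: "K \<in> \<K>" "x \<in> K" by auto
    then obtain N where "N \<in> B" "\<forall>h\<in>N. x \<oplus>\<^bsub>M\<^esub> h \<in> K" using h(1) by blast
    then show "\<exists>N\<in>B. \<forall>h\<in>N. x \<oplus>\<^bsub>M\<^esub> h \<in> \<Union>\<K>" using K(1) by blast
  qed blast+
  then show op: "openin ?T U \<longleftrightarrow> U \<subseteq> carrier M \<and> (\<forall>x\<in>U. \<exists>N\<in>B. \<forall>h\<in>N. x \<oplus>\<^bsub>M\<^esub> h \<in> U)" for U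
    unfolding lintop_def by (simp add: topology_inverse')
  have sub: "N \<subseteq> carrier M" "\<zero>\<^bsub>M\<^esub> \<in> N" "x \<in> N \<Longrightarrow> y \<in> N \<Longrightarrow> x \<oplus>\<^bsub>M\<^esub> y \<in> N" "r \<in> carrier k \<Longrightarrow> x \<in> N \<Longrightarrow> r \<odot>\<^bsub>M\<^esub> x \<in> N"
    if "N \<in> B" for N x y r
    using submodule_mem[OF M B(2)[OF that]] by auto
  show openN: "openin ?T N" if N: "N \<in> B" for N unfolding op
    using sub(1)[OF N] sub(3)[OF N] N by auto
  obtain N0 where N0: "N0 \<in> B" using B(1) by auto
  have "openin ?T (carrier M)" unfolding op using N0 sub(1)[OF N0] by (auto intro!: bexI[OF _ N0])
  then have "carrier M \<subseteq> topspace ?T" by (rule openin_subset)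
  moreover have "topspace ?T \<subseteq> carrier M" using openin_topspace[of ?T] unfolding op by blast
  ultimately have ts: "topspace ?T = carrier M" by (rule subset_antisym[rotated])
  have tr: "openin ?T ((\<lambda>h. x \<oplus>\<^bsub>M\<^esub> h) ` N)" "x \<in> (\<lambda>h. x \<oplus>\<^bsub>M\<^esub> h) ` N" if N: "N \<in> B" and x: "x \<in> carrier M" for N x
  proof -
    show "x \<in> (\<lambda>h. x \<oplus>\<^bsub>M\<^esub> h) ` N" using sub(2)[OF N] x by (force intro: image_eqI[of _ _ "\<zero>\<^bsub>M\<^esub>"])
    show "openin ?T ((\<lambda>h. x \<oplus>\<^bsub>M\<^esub> h) ` N)" unfolding op
    proof (intro conjI ballI)
      show "(\<lambda>h. x \<oplus>\<^bsub>M\<^esub> h) ` N \<subseteq> carrier M" using sub(1)[OF N] x by auto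
      fix y assume "y \<in> (\<lambda>h. x \<oplus>\<^bsub>M\<^esub> h) ` N"
      then obtain h where h: "h \<in> N" "y = x \<oplus>\<^bsub>M\<^esub> h" by auto
      have "y \<oplus>\<^bsub>M\<^esub> h' \<in> (\<lambda>h. x \<oplus>\<^bsub>M\<^esub> h) ` N" if h': "h' \<in> N" for h'
      proof (rule image_eqI)
        show "y \<oplus>\<^bsub>M\<^esub> h' = x \<oplus>\<^bsub>M\<^esub> (h \<oplus>\<^bsub>M\<^esub> h')" using h h' x sub(1)[OF N] by (simp add: M.a_assoc subset_iff)
        show "h \<oplus>\<^bsub>M\<^esub> h' \<in> N" using sub(3)[OF N h(1) h'] .
      qed
      then show "\<exists>N'\<in>B. \<forall>h'\<in>N'. y \<oplus>\<^bsub>M\<^esub> h' \<in> (\<lambda>h. x \<oplus>\<^bsub>M\<^esub> h) ` N" using N by blast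
    qed
  qed
  show "linear_topology k M ?T" unfolding linear_topology_def
  proof (intro conjI allI impI ts)
    show "continuous_map (prod_topology ?T ?T) ?T (\<lambda>(x, y). x \<oplus>\<^bsub>M\<^esub> y)"
      unfolding continuous_map_def
    proof (intro conjI allI impI)
      show "(\<lambda>(x, y). x \<oplus>\<^bsub>M\<^esub> y) \<in> topspace (prod_topology ?T ?T) \<rightarrow> topspace ?T" by (auto simp: ts)
      fix U assume U: "openin ?T U"
      show "openin (prod_topology ?T ?T) {z \<in> topspace (prod_topology ?T ?T). (case z of (x, y) \<Rightarrow> x \<oplus>\<^bsub>M\<^esub> y) \<in> U}"
        unfolding openin_prod_topology_alt
      proof (intro allI impI)
        fix x y assume "(x, y) \<in> {z \<in> topspace (prod_topology ?T ?T). (case z of (x, y) \<Rightarrow> x \<oplus>\<^bsub>M\<^esub> y) \<in> U}"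
        then have xy: "x \<in> carrier M" "y \<in> carrier M" "x \<oplus>\<^bsub>M\<^esub> y \<in> U" by (auto simp: ts)
        then obtain N where N: "N \<in> B" "\<forall>h\<in>N. x \<oplus>\<^bsub>M\<^esub> y \<oplus>\<^bsub>M\<^esub> h \<in> U" using U op by blast
        have "(x \<oplus>\<^bsub>M\<^esub> h) \<oplus>\<^bsub>M\<^esub> (y \<oplus>\<^bsub>M\<^esub> h') \<in> U" if h: "h \<in> N" "h' \<in> N" for h h'
        proof -
          have "(x \<oplus>\<^bsub>M\<^esub> h) \<oplus>\<^bsub>M\<^esub> (y \<oplus>\<^bsub>M\<^esub> h') = x \<oplus>\<^bsub>M\<^esub> y \<oplus>\<^bsub>M\<^esub> (h \<oplus>\<^bsub>M\<^esub> h')"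
            using h sub(1)[OF N(1)] xy by (simp add: M.add.m_ac subset_iff)
          then show ?thesis using N(2) sub(3)[OF N(1) h] by simp
        qed
        then have "(\<lambda>h. x \<oplus>\<^bsub>M\<^esub> h) ` N \<times> (\<lambda>h. y \<oplus>\<^bsub>M\<^esub> h) ` N \<subseteq> {z \<in> topspace (prod_topology ?T ?T).
            (case z of (x, y) \<Rightarrow> x \<oplus>\<^bsub>M\<^esub> y) \<in> U}"
          using xy sub(1)[OF N(1)] by (auto simp: ts subset_iff)
        then show "\<exists>U' V. openin ?T U' \<and> openin ?T V \<and> x \<in> U' \<and> y \<in> V \<and> U' \<times> V \<subseteq> {z \<in> topspace (prod_topology ?T
            ?T). (case z of (x, y) \<Rightarrow> x \<oplus>\<^bsub>M\<^esub> y) \<in> U}"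
          using tr[OF N(1) xy(1)] tr[OF N(1) xy(2)] by blast
      qed
    qed
    show "continuous_map (prod_topology (discrete_topology (carrier k)) ?T) ?T (\<lambda>(c, x). c \<odot>\<^bsub>M\<^esub> x)"
      unfolding continuous_map_def
    proof (intro conjI allI impI)
      show "(\<lambda>(c, x). c \<odot>\<^bsub>M\<^esub> x) \<in> topspace (prod_topology (discrete_topology (carrier k)) ?T) \<rightarrow> topspace ?T"
          by (auto simp: ts)
      fix U assume U: "openin ?T U"
      let ?P = "{z \<in> topspace (prod_topology (discrete_topology (carrier k)) ?T). (case z of (c, x) \<Rightarrow> c \<odot>\<^bsub>M\<^esub> x) \<in>
          U}"
      show "openin (prod_topology (discrete_topology (carrier k)) ?T) ?P"
        unfolding openin_prod_topology_alt
      proof (intro allI impI)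
        fix c x assume "(c, x) \<in> ?P"
        then have cx: "c \<in> carrier k" "x \<in> carrier M" "c \<odot>\<^bsub>M\<^esub> x \<in> U" by (auto simp: ts)
        then obtain N where N: "N \<in> B" "\<forall>h\<in>N. c \<odot>\<^bsub>M\<^esub> x \<oplus>\<^bsub>M\<^esub> h \<in> U" using U op by blast
        have "c \<odot>\<^bsub>M\<^esub> (x \<oplus>\<^bsub>M\<^esub> h) \<in> U" if h: "h \<in> N" for h
          using N(2) sub(4)[OF N(1) cx(1) h] h sub(1)[OF N(1)] cx by (simp add: M.smult_r_distr subset_iff)
        then have "{c} \<times> (\<lambda>h. x \<oplus>\<^bsub>M\<^esub> h) ` N \<subseteq> ?P" using cx sub(1)[OF N(1)] by (auto simp: ts subset_iff)
        moreover have "openin (discrete_topology (carrier k)) {c}" using cx by simp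
        ultimately show "\<exists>U' V. openin (discrete_topology (carrier k)) U' \<and> openin ?T V \<and> c \<in> U' \<and> x \<in> V \<and>
            U' \<times> V \<subseteq> ?P"
          using tr[OF N(1) cx(2)] by blast
      qed
    qed
    show "\<exists>V. openin ?T V \<and> submodule V k M \<and> V \<subseteq> U" if "openin ?T U \<and> \<zero>\<^bsub>M\<^esub> \<in> U" for U
    proof -
      have "\<exists>N\<in>B. \<forall>h\<in>N. \<zero>\<^bsub>M\<^esub> \<oplus>\<^bsub>M\<^esub> h \<in> U" using that unfolding op by blast
      then obtain N where N: "N \<in> B" "\<forall>h\<in>N. \<zero>\<^bsub>M\<^esub> \<oplus>\<^bsub>M\<^esub> h \<in> U" by blast
      then have "N \<subseteq> U" using sub(1)[OF N(1)] by (auto simp: subset_iff)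
      then show ?thesis using B(2)[OF N(1)] openN[OF N(1)] by blast
    qed
  qed
qed

lemma submodule_cong:
  fixes M M' :: "('k, 'm) module"
  assumes "carrier M = carrier M'" "add M = add M'" "ring.zero M = ring.zero M'" "submodule V k M"
    "\<And>r x. r \<in> carrier k \<Longrightarrow> x \<in> carrier M \<Longrightarrow> r \<odot>\<^bsub>M\<^esub> x = r \<odot>\<^bsub>M'\<^esub> x"
  shows "submodule V k M'"
proof -
  have "add_monoid M = add_monoid M'" using assms(1-3) by simp
  moreover have "V \<subseteq> carrier M" using assms(4) by (simp add: submodule_def subgroup_def)
  ultimately show ?thesis using assms(4,5) unfolding submodule_def submodule_axioms_def
    by (simp add: subset_iff)
qed

text \<open>For records such as \<open>restrict_scalars (structure_map A) M\<close>, which have the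
  same module structure as another record but are not equal to it.\<close>

lemma linear_topology_cong:
  fixes M M' :: "('k, 'm) module"
  assumes T: "linear_topology k M T" and e: "carrier M = carrier M'" "add M = add M'" "ring.zero M = ring.zero M'"
    "\<And>r x. r \<in> carrier k \<Longrightarrow> x \<in> carrier M \<Longrightarrow> r \<odot>\<^bsub>M\<^esub> x = r \<odot>\<^bsub>M'\<^esub> x"
  shows "linear_topology k M' T"
  unfolding linear_topology_def
proof (intro conjI allI impI)
  have ts: "topspace T = carrier M" using T by (simp add: linear_topology_def)
  then show "topspace T = carrier M'" using e(1) by simp
  show "continuous_map (prod_topology T T) T (\<lambda>(x, y). x \<oplus>\<^bsub>M'\<^esub> y)"
    using T e(2) by (simp add: linear_topology_def)
  have c: "continuous_map (prod_topology (discrete_topology (carrier k)) T) T (\<lambda>(c, x). c \<odot>\<^bsub>M\<^esub> x)"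
    using T by (simp add: linear_topology_def)
  show "continuous_map (prod_topology (discrete_topology (carrier k)) T) T (\<lambda>(c, x). c \<odot>\<^bsub>M'\<^esub> x)"
    by (rule continuous_map_eq[OF c]) (use e(4) ts in auto)
  fix U assume U: "openin T U \<and> \<zero>\<^bsub>M'\<^esub> \<in> U"
  then obtain V where V: "openin T V" "submodule V k M" "V \<subseteq> U" using T e(3) by (auto simp: linear_topology_def)
  show "\<exists>V. openin T V \<and> submodule V k M' \<and> V \<subseteq> U" using V submodule_cong[OF e(1-3) V(2) e(4)] by blast
qed

lemma linear_topology_subtopology:
  assumes M: "Module.module k M" and T: "linear_topology k M T" and C: "submodule C k M"
  shows "linear_topology k (M\<lparr>carrier := C\<rparr>) (subtopology T C)"
  unfolding linear_topology_def
proof (intro conjI allI impI)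
  note m = submodule_mem[OF M C]
  have ts: "topspace T = carrier M" using T by (simp add: linear_topology_def)
  have CM: "C \<subseteq> carrier M" using m(2) by auto
  show "topspace (subtopology T C) = carrier (M\<lparr>carrier := C\<rparr>)" using CM ts by (auto simp: topspace_subtopology)
  have "continuous_map (prod_topology T T) T (\<lambda>(x, y). x \<oplus>\<^bsub>M\<^esub> y)" using T by (simp add: linear_topology_def)
  from continuous_map_from_subtopology[OF this, of "C \<times> C"]
  have "continuous_map (prod_topology (subtopology T C) (subtopology T C)) T (\<lambda>(x, y). x \<oplus>\<^bsub>M\<^esub> y)"
    by (simp flip: subtopology_Times)
  then show "continuous_map (prod_topology (subtopology T C) (subtopology T C)) (subtopology T C) (\<lambda>(x, y).
      x \<oplus>\<^bsub>M\<lparr>carrier := C\<rparr>\<^esub> y)"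
    using m(3) by (auto simp: continuous_map_in_subtopology)
  have "continuous_map (prod_topology (discrete_topology (carrier k)) T) T (\<lambda>(c, x). c \<odot>\<^bsub>M\<^esub> x)"
    using T by (simp add: linear_topology_def)
  from continuous_map_from_subtopology[OF this, of "carrier k \<times> C"]
  have "continuous_map (prod_topology (discrete_topology (carrier k)) (subtopology T C)) T (\<lambda>(c, x). c \<odot>\<^bsub>M\<^esub> x)"
    using subtopology_Times[of "discrete_topology (carrier k)" T "carrier k" C]
      subtopology_topspace[of "discrete_topology (carrier k)"] by simp
  then show "continuous_map (prod_topology (discrete_topology (carrier k)) (subtopology T C)) (subtopology T C)
      (\<lambda>(c, x). c \<odot>\<^bsub>M\<lparr>carrier := C\<rparr>\<^esub> x)"
    using m(5) by (auto simp: continuous_map_in_subtopology)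
  fix U assume "openin (subtopology T C) U \<and> \<zero>\<^bsub>M\<lparr>carrier := C\<rparr>\<^esub> \<in> U"
  then obtain U0 where U0: "openin T U0" "U = U0 \<inter> C" "\<zero>\<^bsub>M\<^esub> \<in> U0" by (auto simp: openin_subtopology)
  then obtain V where V: "openin T V" "submodule V k M" "V \<subseteq> U0" using T by (auto simp: linear_topology_def)
  have VC: "submodule (V \<inter> C) k M"
  proof -
    interpret M: Module.module k M by (rule M)
    show ?thesis by (rule M.submoduleI) (use m submodule_mem[OF M V(2)] in auto)
  qed
  have "submodule (V \<inter> C) k (M\<lparr>carrier := C\<rparr>)"
  proof -
    interpret M: Module.module k M by (rule M)
    interpret C: submodule C k M by (rule C)
    interpret VC: submodule "V \<inter> C" k M by (rule VC)
    show ?thesis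
        using VC.submodule_is_module[OF M] module.module_incl_imp_submodule[OF C.submodule_is_module[OF M], of
        "V \<inter> C"] by simp
  qed
  then show "\<exists>V. openin (subtopology T C) V \<and> submodule V k (M\<lparr>carrier := C\<rparr>) \<and> V \<subseteq> U"
    using V U0(2) by (intro exI[of _ "V \<inter> C"]) (auto simp: openin_subtopology)
qed

lemma fine_topology_eqI:
  assumes "ST_module k A TA M S" "\<And>T' U. ST_module k A TA M T' \<Longrightarrow> openin T' U \<Longrightarrow> openin S U"
  shows "fine_topology k A TA M = S"
  unfolding fine_topology_def
proof (rule the_equality)
  show "ST_module k A TA M S \<and> (\<forall>T'. ST_module k A TA M T' \<longrightarrow> (\<forall>U. openin T' U \<longrightarrow> openin S U))"
    using assms by blast
  show "T = S" if "ST_module k A TA M T \<and> (\<forall>T'. ST_module k A TA M T' \<longrightarrow> (\<forall>U. openin T' U \<longrightarrow> openin T U))" for T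
    using that assms by (auto simp: topology_eq)
qed

text \<open>The identity map is additive, so its continuity may be tested on open
  submodules.\<close>

lemma finer_topology:
  assumes M: "Module.module k M" "linear_topology k M T" "linear_topology k M T'"
    and "\<And>V. openin T' V \<Longrightarrow> submodule V k M \<Longrightarrow> \<exists>W. openin T W \<and> \<zero>\<^bsub>M\<^esub> \<in> W \<and> W \<subseteq> V" "openin T' U"
  shows "openin T U"
proof -
  have "continuous_map T T' (\<lambda>x. x)"
  proof (rule linear_continuous[OF M(1,2) M(1,3)])
    show "\<exists>W. openin T W \<and> \<zero>\<^bsub>M\<^esub> \<in> W \<and> (\<forall>h\<in>W. h \<in> V')" if "openin T' V'" "submodule V' k M" for V'
      using assms(4)[OF that] by auto
  qed auto
  moreover have "{x \<in> topspace T. x \<in> U} = U"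
    using openin_subset[OF assms(5)] linear_topology_facts(1)[OF M(1,2)] linear_topology_facts(1)[OF M(1,3)]
        by auto
  ultimately show ?thesis using assms(5) by (auto simp: continuous_map_def)
qed

section \<open>The topology of Laurent series\<close>

locale tlaurent = laurent A k for A :: "('k, 'a laurent) module" (structure) and k :: "('k, 'b) ring_scheme" +
  fixes TA :: "'a laurent topology"
  assumes ST: "ST_ring k A TA"
begin

text \<open>
  The fine topology, made explicit: a neighborhood of \<open>0\<close> bounds the \<open>i\<close>-th coefficient by an open submodule
  \<open>U i\<close> of \<open>A\<close>, where the \<open>U i\<close> are arbitrary for \<open>i \<rightarrow> - \<infinity>\<close> and equal to \<open>A\<close> for large \<open>i\<close>.
\<close>

definition W :: "(int \<Rightarrow> 'a laurent set) \<Rightarrow> 'a laurent set" where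
  "W U = {x \<in> carrier L. \<forall>i. c x i \<in> U i}"

definition nbhd_family :: "(int \<Rightarrow> 'a laurent set) \<Rightarrow> bool" where
  "nbhd_family U \<longleftrightarrow> (\<forall>i. openin TA (U i) \<and> submodule (U i) k A) \<and> (\<exists>N. \<forall>i\<ge>N. U i = carrier A)"

definition \<Theta> :: "'a laurent topology" where
  "\<Theta> = lintop L {W U |U. nbhd_family U}"

lemma mA: "Module.module k A" using alg by (simp add: Module.algebra_def)
lemma mL: "Module.module k L" using L_alg by (simp add: Module.algebra_def)
lemma lA: "linear_topology k A TA" using ST by (simp add: ST_ring_def)
lemma topspace_TA: "topspace TA = carrier A" using lA by (simp add: linear_topology_def)

lemma open_A: "openin TA (carrier A)" using openin_topspace[of TA] by (simp add: topspace_TA)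
lemma sub_A: "submodule (carrier A) k A" using Module.module.carrier_is_submodule[OF mA] .

lemma sub_mem:
  assumes "submodule U k A"
  shows "\<zero> \<in> U" "x \<in> U \<Longrightarrow> x \<in> carrier A" "x \<in> U \<Longrightarrow> y \<in> U \<Longrightarrow> x \<oplus> y \<in> U" "x \<in> U \<Longrightarrow> y \<in> U \<Longrightarrow> x \<ominus> y \<in> U"
    "r \<in> carrier k \<Longrightarrow> x \<in> U \<Longrightarrow> r \<odot>\<^bsub>A\<^esub> x \<in> U" "x \<in> U \<Longrightarrow> \<ominus> x \<in> U"
  using submodule_mem[OF mA assms] by auto

lemma nbhd_familyD:
  assumes "nbhd_family U" shows "openin TA (U i)" "submodule (U i) k A" "\<exists>N. \<forall>i\<ge>N. U i = carrier A"
  using assms by (auto simp: nbhd_family_def)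

lemma W_submodule: assumes "nbhd_family U" shows "submodule (W U) k L"
proof -
  interpret L: Module.module k L by (rule mL)
  interpret LC: cring L by (rule L_cring)
  note m = sub_mem[OF nbhd_familyD(2)[OF assms]]
  show ?thesis
    by (rule L.submoduleI) (auto simp: W_def m smult_L)
qed

lemma inter_sub: assumes "submodule U k A" "submodule U' k A" shows "submodule (U \<inter> U') k A"
proof -
  interpret M: Module.module k A by (rule mA)
  show ?thesis by (rule M.submoduleI) (use sub_mem[OF assms(1)] sub_mem[OF assms(2)] in auto)
qed

lemma good_inter: assumes "nbhd_family U" "nbhd_family U'" shows "nbhd_family (\<lambda>i. U i \<inter> U' i)"
proof -
  obtain N N' where "\<forall>i\<ge>N. U i = carrier A" "\<forall>i\<ge>N'. U' i = carrier A" using assms by (auto simp: nbhd_family_def)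
  then have "\<forall>i\<ge>max N N'. U i \<inter> U' i = carrier A" by auto
  then have "\<exists>N. \<forall>i\<ge>N. U i \<inter> U' i = carrier A" by blast
  then show ?thesis using nbhd_familyD(1,2)[OF assms(1)] nbhd_familyD(1,2)[OF assms(2)] inter_sub
      unfolding nbhd_family_def
    by (simp add: openin_Int)
qed

lemma good_carrier: "nbhd_family (\<lambda>i. carrier A)"
  using open_A sub_A by (auto simp: nbhd_family_def)

lemma theta:
  "openin \<Theta> U \<longleftrightarrow> U \<subseteq> carrier L \<and> (\<forall>x\<in>U. \<exists>V. nbhd_family V \<and> (\<forall>h\<in>W V. x \<oplus>\<^bsub>L\<^esub> h \<in> U))"
  "linear_topology k L \<Theta>" "nbhd_family V \<Longrightarrow> openin \<Theta> (W V)" "topspace \<Theta> = carrier L"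
proof -
  let ?B = "{W U |U. nbhd_family U}"
  have B: "?B \<noteq> {}" "\<And>N. N \<in> ?B \<Longrightarrow> submodule N k L"
    "\<And>N N'. N \<in> ?B \<Longrightarrow> N' \<in> ?B \<Longrightarrow> \<exists>N''\<in>?B. N'' \<subseteq> N \<inter> N'"
  proof -
    show "?B \<noteq> {}" using good_carrier by auto
    show "\<And>N. N \<in> ?B \<Longrightarrow> submodule N k L" using W_submodule by auto
    fix N N' assume "N \<in> ?B" "N' \<in> ?B"
    then obtain U U' where U: "nbhd_family U" "N = W U" "nbhd_family U'" "N' = W U'" by auto
    have "W (\<lambda>i. U i \<inter> U' i) \<subseteq> N \<inter> N'" using U by (auto simp: W_def)
    then show "\<exists>N''\<in>?B. N'' \<subseteq> N \<inter> N'" using good_inter[OF U(1,3)] by blast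
  qed
  note l = lintop[OF mL B]
  show op: "openin \<Theta> U \<longleftrightarrow> U \<subseteq> carrier L \<and> (\<forall>x\<in>U. \<exists>V. nbhd_family V \<and> (\<forall>h\<in>W V. x \<oplus>\<^bsub>L\<^esub> h \<in> U))" for U
  proof -
    have e: "(\<exists>N\<in>?B. P N) \<longleftrightarrow> (\<exists>V. nbhd_family V \<and> P (W V))" for P by blast
    show ?thesis unfolding \<Theta>_def using l(1)[of U] unfolding e .
  qed
  show lt: "linear_topology k L \<Theta>" unfolding \<Theta>_def by (rule l(2))
  show "openin \<Theta> (W V)" if "nbhd_family V"
    unfolding op using submodule_mem(2,3)[OF mL W_submodule[OF that]] that by blast
  show "topspace \<Theta> = carrier L" using lt by (simp add: linear_topology_def)
qed

lemma theta_nbhd: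
  assumes "openin \<Theta> V'" "submodule V' k L" obtains U where "nbhd_family U" "W U \<subseteq> V'"
proof -
  interpret LC: cring L by (rule L_cring)
  have "\<zero>\<^bsub>L\<^esub> \<in> V'" using submodule_mem(1)[OF mL assms(2)] .
  then obtain U where U: "nbhd_family U" "\<forall>h\<in>W U. \<zero>\<^bsub>L\<^esub> \<oplus>\<^bsub>L\<^esub> h \<in> V'" using assms(1) unfolding theta(1) by blast
  then have "W U \<subseteq> V'" by (auto simp: W_def)
  then show ?thesis using U that by blast
qed

lemma W_zero: "nbhd_family U \<Longrightarrow> \<zero>\<^bsub>L\<^esub> \<in> W U"
  using submodule_mem(1)[OF mL W_submodule] .

lemma coeff_continuous: "continuous_map \<Theta> TA (\<lambda>x. c x i)"
proof (rule linear_continuous[OF mL theta(2) mA lA])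
  fix V' assume V': "openin TA V'" "submodule V' k A"
  let ?U = "\<lambda>j. if j = i then V' else carrier A"
  have g: "nbhd_family ?U" using V' open_A sub_A unfolding nbhd_family_def
    by (intro conjI exI[of _ "i + 1"]) simp_all
  have "\<forall>h\<in>W ?U. c h i \<in> V'" unfolding W_def by (auto dest: spec[of _ i])
  then show "\<exists>V. openin \<Theta> V \<and> \<zero>\<^bsub>L\<^esub> \<in> V \<and> (\<forall>h\<in>V. c h i \<in> V')"
    using theta(3)[OF g] W_zero[OF g] by blast
qed auto

lemma preimage_mult:
  assumes "x \<in> carrier A" "openin TA U" "submodule U k A"
  shows "openin TA {a \<in> carrier A. x \<otimes> a \<in> U}" "submodule {a \<in> carrier A. x \<otimes> a \<in> U} k A"
proof -
  interpret M: Module.module k A by (rule mA)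
  interpret MA: Module.algebra k A by (rule alg)
  have "continuous_map TA TA (\<lambda>b. x \<otimes> b)" using ST assms(1) by (simp add: ST_ring_def)
  then show "openin TA {a \<in> carrier A. x \<otimes> a \<in> U}" using assms(2) by (simp add: continuous_map_def topspace_TA)
  note m = sub_mem[OF assms(3)]
  have sm: "x \<otimes> (r \<odot>\<^bsub>A\<^esub> a) = r \<odot>\<^bsub>A\<^esub> (x \<otimes> a)" if "r \<in> carrier k" "a \<in> carrier A" for r a
  proof -
    have "x \<otimes> (r \<odot>\<^bsub>A\<^esub> a) = (r \<odot>\<^bsub>A\<^esub> a) \<otimes> x" using assms(1) that A_smult(1) by (simp add: m_comm)
    also have "\<dots> = r \<odot>\<^bsub>A\<^esub> (a \<otimes> x)" using MA.smult_assoc2[OF that assms(1)] .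
    finally show ?thesis using assms(1) that by (simp add: m_comm)
  qed
  show "submodule {a \<in> carrier A. x \<otimes> a \<in> U} k A"
    by (rule M.submoduleI) (use assms(1) m in \<open>auto simp: r_minus r_distr sm A_smult(1)\<close>)
qed

lemma open_sub_INT:
  assumes "finite J" "\<And>j. j \<in> J \<Longrightarrow> openin TA (G j) \<and> submodule (G j) k A"
  shows "openin TA (carrier A \<inter> (\<Inter>j\<in>J. G j)) \<and> submodule (carrier A \<inter> (\<Inter>j\<in>J. G j)) k A"
  using assms
proof (induction J)
  case empty
  then show ?case using open_A sub_A by simp
next
  case (insert j J)
  have "carrier A \<inter> (\<Inter>i\<in>insert j J. G i) = G j \<inter> (carrier A \<inter> (\<Inter>i\<in>J. G i))" by auto
  then show ?case using insert inter_sub openin_Int by (metis insert_iff)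
qed

lemma finsum_mem:
  assumes "submodule U k A" "finite S" "\<And>j. j \<in> S \<Longrightarrow> f j \<in> U" shows "finsum A f S \<in> U"
  using assms(2,3)
proof (induction S)
  case empty then show ?case using sub_mem(1)[OF assms(1)] by simp
next
  case (insert j S)
  then show ?case using sub_mem(2,3)[OF assms(1)] by (subst finsum_insert) auto
qed

text \<open>To put x y into W U, the l-th coefficient of y must be multiplied into U (l + j) by the
  j-th coefficient of x. Conditions arise only for j from the lowest exponent B of x up to N - l,
  where U becomes all of A: finitely many for each l, and none once l is at least N - B.\<close>

lemma mult_continuous: assumes x: "x \<in> carrier L" shows "continuous_map \<Theta> \<Theta> (\<lambda>y. x \<otimes>\<^bsub>L\<^esub> y)"
proof (rule linear_continuous[OF mL theta(2) mL theta(2)])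
  interpret LC: cring L by (rule L_cring)
  fix V' assume "openin \<Theta> V'" "submodule V' k L"
  then obtain U where U: "nbhd_family U" "W U \<subseteq> V'" by (rule theta_nbhd)
  obtain N where N: "\<forall>i\<ge>N. U i = carrier A" using nbhd_familyD(3)[OF U(1)] by auto
  obtain B where B: "\<forall>i<B. c x i = \<zero>" using L_bound[OF x] by auto
  define G where "G l j = {a \<in> carrier A. c x j \<otimes> a \<in> U (l + j)}" for l j :: int
  \<comment> \<open>The intersection with \<open>carrier A\<close> covers the empty family of
    conditions, so U' l is A for large l, as \<open>nbhd_family\<close> demands.\<close>
  define U' where "U' l = carrier A \<inter> (\<Inter>j\<in>{B..<N - l}. G l j)" for l
  have "openin TA (U' l) \<and> submodule (U' l) k A" for l
    unfolding U'_def by (rule open_sub_INT)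
      (use preimage_mult[OF L_c[OF x]] nbhd_familyD[OF U(1)] in \<open>simp_all add: G_def\<close>)
  moreover have "\<forall>l\<ge>N - B. U' l = carrier A" by (auto simp: U'_def)
  ultimately have g: "nbhd_family U'" unfolding nbhd_family_def by blast
  have "x \<otimes>\<^bsub>L\<^esub> y \<in> W U" if y: "y \<in> W U'" for y
  proof -
    have yL: "y \<in> carrier L" and yU: "\<And>l. c y l \<in> U' l" using y by (auto simp: W_def)
    obtain M where M: "\<forall>i<M. c y i = \<zero>" using L_bound[OF yL] by auto
    have "c (x \<otimes>\<^bsub>L\<^esub> y) i \<in> U i" for i
    proof (cases "i \<ge> N")
      case True
      then show ?thesis using N mult_L[OF x yL] by simp
    next
      case False
      have "c (x \<otimes>\<^bsub>L\<^esub> y) i = finsum A (\<lambda>j. c x j \<otimes> c y (i - j)) {B..i - M}"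
        by (rule c_mult_interval[OF x yL]) (use B M in auto)
      also have "\<dots> \<in> U i"
      proof (rule finsum_mem[OF nbhd_familyD(2)[OF U(1)]])
        fix j assume j: "j \<in> {B..i - M}"
        then have "c y (i - j) \<in> G (i - j) j" using yU[of "i - j"] False unfolding U'_def by auto
        then show "c x j \<otimes> c y (i - j) \<in> U i" by (simp add: G_def)
      qed simp
      finally show ?thesis .
    qed
    then show ?thesis using x yL by (simp add: W_def)
  qed
  then show "\<exists>V. openin \<Theta> V \<and> \<zero>\<^bsub>L\<^esub> \<in> V \<and> (\<forall>h\<in>V. x \<otimes>\<^bsub>L\<^esub> h \<in> V')"
    using theta(3)[OF g] W_zero[OF g] U(2) by blast
next
  interpret LC: cring L by (rule L_cring)
  show "x \<otimes>\<^bsub>L\<^esub> (y \<oplus>\<^bsub>L\<^esub> z) = x \<otimes>\<^bsub>L\<^esub> y \<oplus>\<^bsub>L\<^esub> x \<otimes>\<^bsub>L\<^esub> z" if "y \<in> carrier L" "z \<in> carrier L" for y z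
    using LC.r_distr[OF that x] .
qed (use x in auto)

text \<open>A single a has to satisfy the condition c x j a in U j; only the j between the lowest
  exponent of x and the bound from which U j is A impose one.\<close>

lemma const_continuous: assumes x: "x \<in> carrier L" shows "continuous_map TA \<Theta> (\<lambda>a. mono a 0 \<otimes>\<^bsub>L\<^esub> x)"
proof (rule linear_continuous[OF mA lA mL theta(2)])
  fix V' assume "openin \<Theta> V'" "submodule V' k L"
  then obtain U where U: "nbhd_family U" "W U \<subseteq> V'" by (rule theta_nbhd)
  obtain N where N: "\<forall>i\<ge>N. U i = carrier A" using nbhd_familyD(3)[OF U(1)] by auto
  obtain B where B: "\<forall>i<B. c x i = \<zero>" using L_bound[OF x] by auto
  define G where "G j = {a \<in> carrier A. c x j \<otimes> a \<in> U j}" for j :: int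
  let ?V = "carrier A \<inter> (\<Inter>j\<in>{B..<N}. G j)"
  have V: "openin TA ?V \<and> submodule ?V k A"
    by (rule open_sub_INT)
      (use preimage_mult[OF L_c[OF x]] nbhd_familyD[OF U(1)] in \<open>simp_all add: G_def\<close>)
  have "mono a 0 \<otimes>\<^bsub>L\<^esub> x \<in> W U" if a: "a \<in> ?V" for a
  proof -
    have aA: "a \<in> carrier A" using a by auto
    have "c (mono a 0 \<otimes>\<^bsub>L\<^esub> x) j \<in> U j" for j
    proof -
      have e: "c (mono a 0 \<otimes>\<^bsub>L\<^esub> x) j = c x j \<otimes> a" using mono_mult_c[OF aA x, of 0 j] aA x by (simp add: m_comm)
      consider "j < B" | "j \<in> {B..<N}" | "j \<ge> N" by fastforce
      then show ?thesis
      proof cases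
        case 1 then show ?thesis using e B aA sub_mem(1)[OF nbhd_familyD(2)[OF U(1)]] by simp
      next
        case 2 then have "a \<in> G j" using a by blast
        then show ?thesis using e by (simp add: G_def)
      next
        case 3 then show ?thesis using N e aA x by simp
      qed
    qed
    then show ?thesis using aA x by (simp add: W_def)
  qed
  then show "\<exists>V. openin TA V \<and> \<zero> \<in> V \<and> (\<forall>h\<in>V. mono h 0 \<otimes>\<^bsub>L\<^esub> x \<in> V')"
    using V sub_mem(1)[OF conjunct2[OF V]] U(2) by (intro exI[of _ ?V]) blast
next
  fix a b assume "a \<in> carrier A" "b \<in> carrier A"
  then show "mono (a \<oplus> b) 0 \<otimes>\<^bsub>L\<^esub> x = mono a 0 \<otimes>\<^bsub>L\<^esub> x \<oplus>\<^bsub>L\<^esub> mono b 0 \<otimes>\<^bsub>L\<^esub> x"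
    using x by - (rule L_eqI, simp_all add: mono_mult_c l_distr)
qed (use x in auto)

lemma mono_continuous: "continuous_map TA \<Theta> (\<lambda>a. mono a n)"
  by (rule continuous_map_eq[OF const_continuous[of "mono \<one> n"]]) (simp_all add: mono_mono topspace_TA)

lemma L_ST_ring: "ST_ring k L \<Theta>"
  unfolding ST_ring_def by (intro conjI ballI L_alg theta(2) mult_continuous)

text \<open>Zero is cut out by the vanishing of all coefficients, and each coefficient is
  continuous.\<close>

lemma theta_closed_zero:
  assumes "closedin TA {\<zero>}" shows "closedin \<Theta> {\<zero>\<^bsub>L\<^esub>}"
proof -
  interpret LC: cring L by (rule L_cring)
  have "{\<zero>\<^bsub>L\<^esub>} = (\<Inter>i. {x \<in> topspace \<Theta>. c x i \<in> {\<zero>}})"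
  proof -
    have "x = \<zero>\<^bsub>L\<^esub>" if "x \<in> carrier L" "\<And>i. c x i = \<zero>" for x by (rule L_eqI) (use that in auto)
    then show ?thesis by (auto simp: theta(4))
  qed
  moreover have "closedin \<Theta> {x \<in> topspace \<Theta>. c x i \<in> {\<zero>}}" for i
    by (rule closedin_continuous_map_preimage[OF coeff_continuous assms])
  ultimately show ?thesis by (simp add: closedin_INT)
qed

text \<open>Every W U contains all series with coefficients only in high degrees, so x is a limit of
  its truncations; those are finite sums of monomials and are sent into the closed set S.\<close>

lemma dense_polynomials:
  assumes E: "continuous_map \<Theta> T E" and S: "closedin T S"
    "E \<zero>\<^bsub>L\<^esub> \<in> S" "\<And>x y. x \<in> carrier L \<Longrightarrow> y \<in> carrier L \<Longrightarrow> E x \<in> S \<Longrightarrow> E y \<in> S \<Longrightarrow> E (x \<oplus>\<^bsub>L\<^esub> y) \<in> S"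
    and mono: "\<And>a i. i \<ge> i0 \<Longrightarrow> a \<in> carrier A \<Longrightarrow> E (mono a i) \<in> S"
    and x: "x \<in> carrier L" "\<And>i. i < i0 \<Longrightarrow> c x i = \<zero>"
  shows "E x \<in> S"
proof (rule ccontr)
  interpret LC: cring L by (rule L_cring)
  assume "E x \<notin> S"
  let ?O = "{y \<in> topspace \<Theta>. E y \<in> topspace T - S}"
  have "openin \<Theta> ?O" using E S(1) unfolding continuous_map_def closedin_def by blast
  moreover have "x \<in> ?O" using x(1) \<open>E x \<notin> S\<close> E by (auto simp: theta(4) continuous_map_def)
  ultimately obtain U where U: "nbhd_family U" "\<forall>h\<in>W U. x \<oplus>\<^bsub>L\<^esub> h \<in> ?O" unfolding theta(1) by blast
  obtain N where N: "\<forall>i\<ge>N. U i = carrier A" using nbhd_familyD(3)[OF U(1)] by auto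
  \<comment> \<open>The truncation of x below N. It differs from x only where U is all of A, so it
    stays inside the chosen neighborhood of x.\<close>
  define y where "y = Series (\<lambda>i. if i < N then c x i else \<zero>)"
  have yc: "c y i = (if i < N then c x i else \<zero>)" for i by (simp add: y_def)
  have yL: "y \<in> carrier L" unfolding y_def by (rule Series_L[where N = i0]) (use x in auto)
  have "y \<ominus>\<^bsub>L\<^esub> x \<in> W U" using x(1) yL N sub_mem(1)[OF nbhd_familyD(2)[OF U(1)]]
      by (auto simp: W_def yc a_minus_def r_neg)
  then have "x \<oplus>\<^bsub>L\<^esub> (y \<ominus>\<^bsub>L\<^esub> x) \<in> ?O" using U(2) by blast
  moreover have "x \<oplus>\<^bsub>L\<^esub> (y \<ominus>\<^bsub>L\<^esub> x) = y"
  proof -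
    have "x \<oplus>\<^bsub>L\<^esub> (y \<ominus>\<^bsub>L\<^esub> x) = y \<oplus>\<^bsub>L\<^esub> (x \<oplus>\<^bsub>L\<^esub> \<ominus>\<^bsub>L\<^esub> x)" using x(1) yL by (simp add: LC.minus_eq LC.a_lcomm)
    then show ?thesis using x(1) yL LC.r_neg[OF x(1)] by simp
  qed
  ultimately have "E y \<notin> S" by auto
  moreover have "y \<in> {z \<in> carrier L. E z \<in> S}"
  proof (rule polynomial_mem[OF _ _ yL, where n = N])
    show "mono (c y i) i \<in> {z \<in> carrier L. E z \<in> S}" for i
    proof (cases "i < N \<and> i0 \<le> i")
      case True
      then show ?thesis using mono x(1) by (simp add: yc)
    next
      case False
      then have "c y i = \<zero>" using x(2) by (auto simp: yc)
      moreover have "mono \<zero> i = \<zero>\<^bsub>L\<^esub>" by (rule L_eqI) auto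
      ultimately show ?thesis using S(2) by simp
    qed
  qed (use S(2,3) yc in auto)
  ultimately show False by simp
qed

end

section \<open>Identification with the recursively defined fine topologies\<close>

context tlaurent
begin

definition truncated :: "nat \<Rightarrow> 'a laurent set" where
  "truncated i = {x \<in> carrier L. \<forall>j. j < 0 \<or> int i < j \<longrightarrow> c x j = \<zero>}"

text \<open>Scalars of k act as constants of A, and negation is multiplication by the constant
  -1.\<close>

lemma L_submoduleI:
  assumes "C \<subseteq> carrier L" "\<And>x y. x \<in> C \<Longrightarrow> y \<in> C \<Longrightarrow> x \<oplus>\<^bsub>L\<^esub> y \<in> C" "\<zero>\<^bsub>L\<^esub> \<in> C"
    "\<And>a x. a \<in> carrier A \<Longrightarrow> x \<in> C \<Longrightarrow> mono a 0 \<otimes>\<^bsub>L\<^esub> x \<in> C"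
  shows "submodule C k L"
proof -
  interpret M: Module.module k L by (rule mL)
  interpret LC: cring L by (rule L_cring)
  show ?thesis
  proof (rule M.submoduleI[OF assms(1,3) _ assms(2)])
    show "r \<odot>\<^bsub>L\<^esub> x \<in> C" if "r \<in> carrier k" "x \<in> C" for r x
      using smult_eq[of r x] assms(1,4) that A_smult(1) by auto
    show "\<ominus>\<^bsub>L\<^esub> x \<in> C" if "x \<in> C" for x
    proof -
      have xL: "x \<in> carrier L" using assms(1) that by auto
      have "\<ominus>\<^bsub>L\<^esub> x = mono (\<ominus> \<one>) 0 \<otimes>\<^bsub>L\<^esub> x" by (rule L_eqI) (use xL in \<open>auto simp: mono_mult_c l_minus\<close>)
      then show ?thesis using assms(4)[OF _ that, of "\<ominus> \<one>"] by simp
    qed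
  qed
qed

lemma truncated_submodule: "submodule (truncated i) k L"
  by (rule L_submoduleI) (auto simp: truncated_def mono_mult_c zero_L)

lemma PS_submodule: "submodule (power_series A) k L"
  by (rule L_submoduleI) (auto simp: power_series_def mono_mult_c zero_L)

lemma truncated_simps:
  "carrier (truncated_module A i) = truncated i" "add (truncated_module A i) = add L"
  "ring.zero (truncated_module A i) = \<zero>\<^bsub>L\<^esub>"
  "a \<in> carrier A \<Longrightarrow> x \<in> carrier L \<Longrightarrow> a \<odot>\<^bsub>truncated_module A i\<^esub> x = mono a 0 \<otimes>\<^bsub>L\<^esub> x"
proof -
  show "carrier (truncated_module A i) = truncated i" "add (truncated_module A i) = add L"
    "ring.zero (truncated_module A i) = \<zero>\<^bsub>L\<^esub>"
    by (auto simp: truncated_module_def truncated_def power_series_def)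
  assume a: "a \<in> carrier A" "x \<in> carrier L"
  have "a \<odot>\<^bsub>truncated_module A i\<^esub> x = Series (\<lambda>j. a \<otimes> c x j)" by (simp add: truncated_module_def)
  also have "\<dots> = Series (c (mono a 0 \<otimes>\<^bsub>L\<^esub> x))" using a by (simp add: mono_mult_c fun_eq_iff)
  finally show "a \<odot>\<^bsub>truncated_module A i\<^esub> x = mono a 0 \<otimes>\<^bsub>L\<^esub> x" by (simp add: mult_Series[symmetric])
qed

lemma mono_distr: "a \<in> carrier A \<Longrightarrow> b \<in> carrier A \<Longrightarrow> mono (a \<oplus> b) n = mono a n \<oplus>\<^bsub>L\<^esub> mono b n"
  by (rule L_eqI) auto

lemma truncated_mem: "x \<in> truncated i \<Longrightarrow> x \<in> carrier L" "a \<in> carrier A \<Longrightarrow> x \<in> truncated i \<Longrightarrow>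
    mono a 0 \<otimes>\<^bsub>L\<^esub> x \<in> truncated i"
  by (auto simp: truncated_def mono_mult_c)

lemma truncated_is_module: "Module.module A (truncated_module A i)"
proof -
  interpret LC: cring L by (rule L_cring)
  let ?M = "truncated_module A i"
  note s = truncated_simps
  note m = submodule_mem[OF mL truncated_submodule[of i]]
  have ag: "abelian_group ?M"
  proof (rule abelian_groupI)
    show "\<exists>y\<in>carrier ?M. y \<oplus>\<^bsub>?M\<^esub> x = \<zero>\<^bsub>?M\<^esub>" if "x \<in> carrier ?M" for x
      using that m(6)[of x] LC.l_neg[of x] m(2)[of x] unfolding s by blast
    show "x \<oplus>\<^bsub>?M\<^esub> y \<oplus>\<^bsub>?M\<^esub> z = x \<oplus>\<^bsub>?M\<^esub> (y \<oplus>\<^bsub>?M\<^esub> z)" if "x \<in> carrier ?M" "y \<in> carrier ?M" "z \<in> carrier ?M" for x y z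
      using LC.a_assoc[of x y z] m(2) that by (simp add: s)
    show "x \<oplus>\<^bsub>?M\<^esub> y = y \<oplus>\<^bsub>?M\<^esub> x" if "x \<in> carrier ?M" "y \<in> carrier ?M" for x y
      using LC.a_comm[of x y] m(2) that by (simp add: s)
  qed (use m in \<open>simp_all add: s\<close>)
  show ?thesis
  proof (rule moduleI[OF is_cring ag])
    fix a b x assume h: "a \<in> carrier A" "b \<in> carrier A" "x \<in> carrier ?M"
    have xL: "x \<in> carrier L" using h m(2) by (simp add: s)
    show "a \<odot>\<^bsub>?M\<^esub> x \<in> carrier ?M" using h truncated_mem by (simp add: s)
    show "(a \<oplus> b) \<odot>\<^bsub>?M\<^esub> x = a \<odot>\<^bsub>?M\<^esub> x \<oplus>\<^bsub>?M\<^esub> b \<odot>\<^bsub>?M\<^esub> x"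
      using h xL by (simp add: s mono_distr LC.l_distr)
    show "(a \<otimes> b) \<odot>\<^bsub>?M\<^esub> x = a \<odot>\<^bsub>?M\<^esub> (b \<odot>\<^bsub>?M\<^esub> x)"
      using h xL mono_mono[of a b 0 0] by (simp add: s mult_assoc[symmetric])
  next
    fix a x y assume h: "a \<in> carrier A" "x \<in> carrier ?M" "y \<in> carrier ?M"
    then have "x \<in> carrier L" "y \<in> carrier L" using m(2) by (simp_all add: s)
    then show "a \<odot>\<^bsub>?M\<^esub> (x \<oplus>\<^bsub>?M\<^esub> y) = a \<odot>\<^bsub>?M\<^esub> x \<oplus>\<^bsub>?M\<^esub> a \<odot>\<^bsub>?M\<^esub> y"
      using h by (simp add: s LC.r_distr)
  next
    fix x assume h: "x \<in> carrier ?M"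
    then have "x \<in> carrier L" using m(2) by (simp add: s)
    then show "\<one> \<odot>\<^bsub>?M\<^esub> x = x" by (simp add: s one_L[symmetric])
  qed
qed

lemma mono_V_good:
  assumes "\<And>j. j < N \<Longrightarrow> openin TA (G j) \<and> submodule (G j) k A"
  shows "nbhd_family (\<lambda>j. if j < N then G j else carrier A)"
  unfolding nbhd_family_def using assms open_A sub_A by (intro conjI allI exI[of _ N]) auto

text \<open>For any ST topology on A[t]/(t^(i+1)) the maps a -> a t^j are continuous. An open
  submodule V therefore contains a t^j for a in some open submodule G j of A; as there are only i +
  1 monomials, sums of such terms already contain a neighborhood of the subspace topology.\<close>

lemma fine_truncated:
  "fine_topology k A TA (truncated_module A i) = subtopology \<Theta> (truncated i)"
proof (rule fine_topology_eqI)
  let ?M = "truncated_module A i" and ?S = "subtopology \<Theta> (truncated i)"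
  let ?N = "restrict_scalars (structure_map A) ?M"
  note s = truncated_simps
  have N: "carrier ?N = truncated i" "add ?N = add L" "ring.zero ?N = \<zero>\<^bsub>L\<^esub>"
    by (simp_all add: restrict_scalars_def s)
  have Nsm: "r \<odot>\<^bsub>L\<^esub> x = r \<odot>\<^bsub>?N\<^esub> x" if r: "r \<in> carrier k" "x \<in> truncated i" for r x
  proof -
    have "r \<odot>\<^bsub>?N\<^esub> x = (r \<odot>\<^bsub>A\<^esub> \<one>) \<odot>\<^bsub>?M\<^esub> x" by (simp add: restrict_scalars_def structure_map_def)
    then show ?thesis
        using smult_eq[OF r(1), of x] s(4)[of "r \<odot>\<^bsub>A\<^esub> \<one>" x] truncated_mem(1)[OF r(2)] A_smult(1)[OF r(1)] by simp
  qed
  have tsS: "topspace ?S = truncated i" using theta(4) by (auto simp: truncated_def)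
  have modC: "Module.module k (L\<lparr>carrier := truncated i\<rparr>)"
    using submodule.submodule_is_module[OF truncated_submodule mL] .
  have linC: "linear_topology k (L\<lparr>carrier := truncated i\<rparr>) ?S"
    by (rule linear_topology_subtopology[OF mL theta(2) truncated_submodule])
  have linN: "linear_topology k ?N ?S"
    by (rule linear_topology_cong[OF linC]) (use N Nsm in auto)
  show "ST_module k A TA ?M ?S"
    unfolding ST_module_def
  proof (intro conjI ballI truncated_is_module linN)
    fix a assume a: "a \<in> carrier A"
    have "continuous_map ?S \<Theta> (\<lambda>x. mono a 0 \<otimes>\<^bsub>L\<^esub> x)"
      by (rule continuous_map_from_subtopology[OF mult_continuous]) (use a in simp)
    then have "continuous_map ?S ?S (\<lambda>x. mono a 0 \<otimes>\<^bsub>L\<^esub> x)"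
      using truncated_mem(2)[OF a] by (auto simp: continuous_map_in_subtopology)
    then show "continuous_map ?S ?S (\<lambda>x. a \<odot>\<^bsub>?M\<^esub> x)"
      by (rule continuous_map_eq) (use a truncated_mem tsS s(4) in auto)
  next
    fix x assume x: "x \<in> carrier ?M"
    then have x': "x \<in> truncated i" "x \<in> carrier L" using truncated_mem by (simp_all add: s)
    have "continuous_map TA ?S (\<lambda>a. mono a 0 \<otimes>\<^bsub>L\<^esub> x)"
      using const_continuous[OF x'(2)] truncated_mem(2)[OF _ x'(1)]
          by (auto simp: continuous_map_in_subtopology topspace_TA)
    then show "continuous_map TA ?S (\<lambda>a. a \<odot>\<^bsub>?M\<^esub> x)"
      by (rule continuous_map_eq) (use x' s(4) topspace_TA in auto)
  qed
  fix T' U assume T': "ST_module k A TA ?M T'" and U: "openin T' U"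
  have linT': "linear_topology k (L\<lparr>carrier := truncated i\<rparr>) T'"
    by (rule linear_topology_cong[where M = ?N]) (use T' N Nsm in \<open>auto simp: ST_module_def\<close>)
  show "openin ?S U"
  proof (rule finer_topology[OF modC linC linT' _ U])
    fix V assume V: "openin T' V" "submodule V k (L\<lparr>carrier := truncated i\<rparr>)"
    note vm = submodule_mem[OF modC V(2)]
    \<comment> \<open>For negative exponents there is no monomial in \<open>truncated i\<close>, and
      A is a harmless default; above i the family ?U takes A as well.\<close>
    define G where "G j = (if j < 0 then carrier A else {a \<in> carrier A. mono a j \<in> V})" for j
    have G: "openin TA (G j) \<and> submodule (G j) k A" if j: "j < int i + 1" for j
    proof (cases "j < 0")
      case True
      then show ?thesis using open_A sub_A by (simp add: G_def)
    next
      case False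
      have mj: "mono a j \<in> truncated i" if "a \<in> carrier A" for a using that j False by (auto simp: truncated_def)
      have c1: "continuous_map TA T' (\<lambda>a. a \<odot>\<^bsub>?M\<^esub> mono \<one> j)"
        using T' mj[of \<one>] by (simp add: ST_module_def s)
      have eq: "a \<odot>\<^bsub>?M\<^esub> mono \<one> j = mono a j" if "a \<in> carrier A" for a
        using that by (simp add: s mono_mono)
      have "continuous_map TA T' (\<lambda>a. mono a j)"
        by (rule continuous_map_eq[OF c1]) (use eq topspace_TA in auto)
      then have "openin TA {a \<in> carrier A. mono a j \<in> V}" using V(1) by (simp add: continuous_map_def topspace_TA)
      moreover have "submodule {a \<in> carrier A. mono a j \<in> V} k A"
      proof -
        have "lin k A (L\<lparr>carrier := truncated i\<rparr>) (\<lambda>a. mono a j)"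
          unfolding lin_def
        proof (intro conjI ballI funcsetI)
          fix r a assume ra: "r \<in> carrier k" "a \<in> carrier A"
          have "mono (r \<odot>\<^bsub>A\<^esub> a) j = r \<odot>\<^bsub>L\<^esub> mono a j"
            by (rule L_eqI) (use ra A_smult smult_L in auto)
          then show "mono (r \<odot>\<^bsub>A\<^esub> a) j = r \<odot>\<^bsub>L\<lparr>carrier := truncated i\<rparr>\<^esub> mono a j" by simp
        qed (auto simp: mj mono_distr)
        from lin_vimage_submodule[OF mA modC this V(2)] show ?thesis .
      qed
      ultimately show ?thesis using False by (simp add: G_def)
    qed
    let ?U = "\<lambda>j. if j < int i + 1 then G j else carrier A"
    have g: "nbhd_family ?U" by (rule mono_V_good[OF G])
    have "W ?U \<inter> truncated i \<subseteq> V"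
    proof
      fix x assume x: "x \<in> W ?U \<inter> truncated i"
      then have xL: "x \<in> carrier L" by (auto simp: W_def)
      show "x \<in> V"
      proof (rule polynomial_mem[OF _ _ xL, where n = "int i"])
        have "\<zero>\<^bsub>L\<^esub> \<in> V" using vm(1) by simp
        then show "\<zero>\<^bsub>L\<^esub> \<in> V" .
        show "y \<oplus>\<^bsub>L\<^esub> z \<in> V" if "y \<in> V" "z \<in> V" for y z using vm(3)[OF that] by simp
        show "c x j = \<zero>" if "int i < j" for j using x that by (auto simp: truncated_def)
        show "mono (c x j) j \<in> V" for j
        proof (cases "0 \<le> j \<and> j \<le> int i")
          case True
          have "c x j \<in> ?U j" using x by (auto simp: W_def)
          then show ?thesis using True by (simp add: G_def)
        next
          case False
          then have "c x j = \<zero>" using x by (auto simp: truncated_def)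
          moreover have "mono \<zero> j = \<zero>\<^bsub>L\<^esub>" by (rule L_eqI) (auto simp: zero_L)
          ultimately show ?thesis using \<open>\<zero>\<^bsub>L\<^esub> \<in> V\<close> by simp
        qed
      qed
    qed
    moreover have "openin ?S (W ?U \<inter> truncated i)" using theta(3)[OF g] by (auto simp: openin_subtopology)
    moreover have "\<zero>\<^bsub>L\<^esub> \<in> W ?U \<inter> truncated i" using W_zero[OF g] submodule_mem(1)[OF mL truncated_submodule]
        by simp
    ultimately show "\<exists>W. openin ?S W \<and> \<zero>\<^bsub>L\<lparr>carrier := truncated i\<rparr>\<^esub> \<in> W \<and> W \<subseteq> V"
        by (intro exI[of _ "W ?U \<inter> truncated i"]) simp
  qed
qed

lemma c_trunc[simp]: "c (truncate_series A i x) j = (if j \<le> int i then c x j else \<zero>)"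
  by (simp add: truncate_series_def)

lemma PS_mem: "x \<in> power_series A \<Longrightarrow> x \<in> carrier L" "x \<in> power_series A \<Longrightarrow> i < 0 \<Longrightarrow> c x i = \<zero>"
  by (auto simp: power_series_def)

lemma trunc_Ctr: assumes "x \<in> power_series A" shows "truncate_series A i x \<in> truncated i"
proof -
  have "truncate_series A i x \<in> carrier L"
    unfolding truncate_series_def by (rule Series_L[where N = 0]) (use PS_mem[OF assms] in auto)
  then show ?thesis using PS_mem[OF assms] by (auto simp: truncated_def)
qed

lemma trunc_minus: 
  assumes "x \<in> power_series A" "y \<in> power_series A"
  shows "truncate_series A i (x \<oplus>\<^bsub>L\<^esub> y) = truncate_series A i x \<oplus>\<^bsub>L\<^esub> truncate_series A i y"
proof (rule L_eqI)
  have "x \<oplus>\<^bsub>L\<^esub> y \<in> power_series A" using submodule_mem(3)[OF mL PS_submodule assms] .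
  then show "truncate_series A i (x \<oplus>\<^bsub>L\<^esub> y) \<in> carrier L" using trunc_Ctr truncated_mem(1) by blast
  show "truncate_series A i x \<oplus>\<^bsub>L\<^esub> truncate_series A i y \<in> carrier L"
    using trunc_Ctr[OF assms(1)] trunc_Ctr[OF assms(2)] truncated_mem(1) by (intro add_L) blast+
qed auto

text \<open>The truncations are continuous for the subspace topology, because they replace
  coefficients by 0, which lies in every U i. Conversely a neighborhood W G restricts only finitely
  many coefficients of a power series and so is pulled back from a single truncation.\<close>

lemma power_series_topology_eq: "power_series_topology k A TA = subtopology \<Theta> (power_series A)"
proof -
  interpret LC: cring L by (rule L_cring)
  let ?P = "power_series A" and ?S = "subtopology \<Theta> (power_series A)"
  let ?f = "\<lambda>x i. truncate_series A i x"
  let ?prod = "product_topology (\<lambda>i. subtopology \<Theta> (truncated i)) UNIV"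
  have e: "power_series_topology k A TA = pullback_topology ?P ?f ?prod"
    unfolding power_series_topology_def fine_truncated ..
  have modP: "Module.module k (L\<lparr>carrier := ?P\<rparr>)" and modC: "Module.module k (L\<lparr>carrier := truncated i\<rparr>)" for i
    using submodule.submodule_is_module[OF PS_submodule mL] submodule.submodule_is_module[OF truncated_submodule
        mL] .
  have linP: "linear_topology k (L\<lparr>carrier := ?P\<rparr>) ?S"
      and linC: "linear_topology k (L\<lparr>carrier := truncated i\<rparr>) (subtopology \<Theta> (truncated i))" for i
    by (rule linear_topology_subtopology[OF mL theta(2)], rule PS_submodule truncated_submodule)+
  have tsS: "topspace ?S = ?P" using theta(4) PS_mem(1) by auto
  have tsC: "topspace (subtopology \<Theta> (truncated i)) = truncated i" for i using theta(4) truncated_mem(1) by auto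
  have cont: "continuous_map ?S (subtopology \<Theta> (truncated i)) (\<lambda>x. truncate_series A i x)" for i
  proof (rule linear_continuous[OF modP linP modC linC])
    fix V' assume "openin (subtopology \<Theta> (truncated i)) V'" "submodule V' k (L\<lparr>carrier := truncated i\<rparr>)"
    then obtain V0 where V0: "openin \<Theta> V0" "V' = V0 \<inter> truncated i" and z: "\<zero>\<^bsub>L\<^esub> \<in> V'"
      using submodule_mem(1)[OF modC] by (auto simp: openin_subtopology)
    then obtain U where U: "nbhd_family U" "\<forall>h\<in>W U. \<zero>\<^bsub>L\<^esub> \<oplus>\<^bsub>L\<^esub> h \<in> V0" unfolding theta(1) by blast
    have "truncate_series A i x \<in> V'" if x: "x \<in> W U \<inter> ?P" for x
    proof -
      have t: "truncate_series A i x \<in> truncated i" using trunc_Ctr x by auto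
      have "truncate_series A i x \<in> W U"
        using x truncated_mem(1)[OF t] sub_mem(1)[OF nbhd_familyD(2)[OF U(1)]] by (auto simp: W_def)
      then have "\<zero>\<^bsub>L\<^esub> \<oplus>\<^bsub>L\<^esub> truncate_series A i x \<in> V0" using U(2) by blast
      then show ?thesis using t truncated_mem(1)[OF t] V0(2) by simp
    qed
    moreover have "openin ?S (W U \<inter> ?P)" using theta(3)[OF U(1)] by (auto simp: openin_subtopology)
    moreover have "\<zero>\<^bsub>L\<^esub> \<in> W U \<inter> ?P" using W_zero[OF U(1)] submodule_mem(1)[OF mL PS_submodule] by simp
    ultimately show "\<exists>V. openin ?S V \<and> \<zero>\<^bsub>L\<lparr>carrier := ?P\<rparr>\<^esub> \<in> V \<and> (\<forall>h\<in>V. truncate_series A i h \<in> V')"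
      by (intro exI[of _ "W U \<inter> ?P"]) simp
  qed (use trunc_Ctr trunc_minus in auto)
  have contp: "continuous_map ?S ?prod ?f"
    by (simp add: continuous_map_componentwise_UNIV cont)
  show ?thesis unfolding topology_eq
  proof (intro allI iffI)
    fix U assume "openin (power_series_topology k A TA) U"
    then obtain Q where Q: "openin ?prod Q" "U = ?f -` Q \<inter> ?P" unfolding e openin_pullback_topology by auto
    have "U = {x \<in> topspace ?S. ?f x \<in> Q}" unfolding tsS using Q(2) by auto
    then show "openin ?S U" using contp Q(1) by (simp add: continuous_map_def)
  next
    fix U assume U: "openin ?S U"
    then obtain U0 where U0: "openin \<Theta> U0" "U = U0 \<inter> ?P" by (auto simp: openin_subtopology)
    show "openin (power_series_topology k A TA) U"
    proof (subst openin_subopen, intro ballI)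
      fix x assume "x \<in> U"
      then have x: "x \<in> U0" "x \<in> ?P" using U0 by auto
      obtain G where G: "nbhd_family G" "\<forall>h\<in>W G. x \<oplus>\<^bsub>L\<^esub> h \<in> U0" using U0(1) x(1) unfolding theta(1) by blast
      obtain N0 where N0: "\<forall>i\<ge>N0. G i = carrier A" using nbhd_familyD(3)[OF G(1)] by auto
      \<comment> \<open>The bound N0 may be negative; its \<open>nat\<close> is still at least N0,
        so coefficients beyond N are unrestricted.\<close>
      define N where "N = nat N0"
      have N: "\<forall>i>int N. G i = carrier A" using N0 by (auto simp: N_def)
      let ?z = "truncate_series A N x"
      \<comment> \<open>The condition on the N-th truncation alone that forces y - x into W
        G.\<close>
      define Q' where "Q' = {y \<in> truncated N. y \<ominus>\<^bsub>L\<^esub> ?z \<in> W G}"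
      have zC: "?z \<in> truncated N" by (rule trunc_Ctr[OF x(2)])
      have "openin \<Theta> {y \<in> carrier L. y \<ominus>\<^bsub>L\<^esub> ?z \<in> W G}"
        by (rule linear_topology_facts(3)[OF mL theta(2) theta(3)[OF G(1)] truncated_mem(1)[OF zC]])
      moreover have "Q' = {y \<in> carrier L. y \<ominus>\<^bsub>L\<^esub> ?z \<in> W G} \<inter> truncated N" using truncated_mem(1)
          by (auto simp: Q'_def)
      ultimately have Q': "openin (subtopology \<Theta> (truncated N)) Q'" by (auto simp: openin_subtopology)
      let ?Q = "{h \<in> topspace ?prod. h N \<in> Q'}"
      have "openin ?prod ?Q"
        using continuous_map_product_projection[of N UNIV "\<lambda>i. subtopology \<Theta> (truncated i)"] Q'
            by (simp add: continuous_map_def)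
      then have "openin (power_series_topology k A TA) (?f -` ?Q \<inter> ?P)" unfolding e openin_pullback_topology
          by blast
      moreover have "x \<in> ?f -` ?Q \<inter> ?P"
      proof -
        have "?z \<ominus>\<^bsub>L\<^esub> ?z = \<zero>\<^bsub>L\<^esub>" using truncated_mem(1)[OF zC] by (simp add: LC.minus_eq LC.r_neg)
        then have "?z \<in> Q'" using zC W_zero[OF G(1)] by (simp add: Q'_def)
        moreover have "?f x \<in> topspace ?prod" using trunc_Ctr[OF x(2)] theta(4) truncated_mem(1)
            by (auto simp: PiE_iff)
        ultimately show ?thesis using x(2) by simp
      qed
      moreover have "?f -` ?Q \<inter> ?P \<subseteq> U"
      proof
        fix y assume "y \<in> ?f -` ?Q \<inter> ?P"
        then have y: "y \<in> ?P" "truncate_series A N y \<ominus>\<^bsub>L\<^esub> ?z \<in> W G" by (auto simp: Q'_def)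
        have yL: "y \<in> carrier L" "x \<in> carrier L" using y x PS_mem by auto
        have tL: "truncate_series A N y \<in> carrier L" "?z \<in> carrier L" using trunc_Ctr truncated_mem(1) y(1) x(2)
            by blast+
        have "c (y \<ominus>\<^bsub>L\<^esub> x) i \<in> G i" for i
        proof (cases "i \<le> int N")
          case True
          have "c (truncate_series A N y \<ominus>\<^bsub>L\<^esub> ?z) i \<in> G i" using y(2) by (auto simp: W_def)
          then show ?thesis using tL yL True by simp
        next
          case False
          then show ?thesis using N yL by simp
        qed
        then have "y \<ominus>\<^bsub>L\<^esub> x \<in> W G" using yL by (simp add: W_def)
        then have "x \<oplus>\<^bsub>L\<^esub> (y \<ominus>\<^bsub>L\<^esub> x) \<in> U0" using G(2) by blast
        moreover have "x \<oplus>\<^bsub>L\<^esub> (y \<ominus>\<^bsub>L\<^esub> x) = y"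
        proof -
          have "x \<oplus>\<^bsub>L\<^esub> (y \<ominus>\<^bsub>L\<^esub> x) = y \<oplus>\<^bsub>L\<^esub> (x \<oplus>\<^bsub>L\<^esub> \<ominus>\<^bsub>L\<^esub> x)" using yL by (simp add: LC.minus_eq LC.a_lcomm)
          then show ?thesis using yL LC.r_neg[OF yL(2)] by simp
        qed
        ultimately show "y \<in> U" using U0(2) y(1) by simp
      qed
      ultimately show "\<exists>T. openin (power_series_topology k A TA) T \<and> x \<in> T \<and> T \<subseteq> U" by blast
    qed
  qed
qed

lemma PS_subring: "subring (power_series A) L"
proof -
  interpret LC: cring L by (rule L_cring)
  show ?thesis
  proof (rule LC.subringI)
    show "x \<otimes>\<^bsub>L\<^esub> y \<in> power_series A" if xy: "x \<in> power_series A" "y \<in> power_series A" for x y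
    proof -
      have "c (x \<otimes>\<^bsub>L\<^esub> y) i = \<zero>" if "i < 0" for i
        by (rule mult_low[of 0 x 0 y]) (use PS_mem[OF xy(1)] PS_mem[OF xy(2)] that in auto)
      then show ?thesis using PS_mem(1)[OF xy(1)] PS_mem(1)[OF xy(2)] by (simp add: power_series_def)
    qed
  qed (auto simp: power_series_def one_L)
qed

lemma regular_L_module: "Module.module (power_series_algebra A) (regular_module L)"
proof -
  interpret LC: cring L by (rule L_cring)
  interpret P: cring "L\<lparr>carrier := power_series A\<rparr>"
    using LC.subcringI'[OF PS_subring] LC.subcring_iff[of "power_series A"] PS_mem(1) by blast
  interpret M: Module.module L "regular_module L" by (rule regular_module_module[OF L_cring])
  show ?thesis unfolding power_series_algebra_def
    by (rule moduleI[OF P.is_cring M.abelian_group_axioms])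
      (auto dest!: PS_mem(1) simp: LC.l_distr LC.r_distr LC.m_assoc)
qed

text \<open>Let V be an open submodule for some ST topology. Continuity of the action of A[[t]] on 1
  makes V open on power series, so V contains every series of order at least some n. Below n,
  continuity of a -> a t^j gives open submodules G j of A with G j t^j in V. Every series is such a
  tail plus a finite sum of lower monomials.\<close>

lemma laurent_topology_eq: "laurent_topology k A TA = \<Theta>"
  unfolding laurent_topology_def power_series_topology_eq
proof (rule fine_topology_eqI)
  interpret LC: cring L by (rule L_cring)
  let ?P = "power_series_algebra A" and ?S = "subtopology \<Theta> (power_series A)" and ?M = "regular_module L"
  let ?N = "restrict_scalars (structure_map ?P) ?M"
  have N: "carrier ?N = carrier L" "add ?N = add L" "ring.zero ?N = \<zero>\<^bsub>L\<^esub>" by (simp_all add: restrict_scalars_def)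
  have Nsm: "r \<odot>\<^bsub>L\<^esub> x = r \<odot>\<^bsub>?N\<^esub> x" if r: "r \<in> carrier k" "x \<in> carrier L" for r x
  proof -
    interpret LA: Module.algebra k L by (rule L_alg)
    show ?thesis using LA.smult_assoc2[OF r(1) LC.one_closed r(2)] r
      by (simp add: structure_map_def power_series_algebra_def restrict_scalars_def)
  qed
  have PC: "carrier ?P = power_series A" by (simp add: power_series_algebra_def)
  have tsS: "topspace ?S = power_series A" using theta(4) PS_mem(1) by auto
  show "ST_module k ?P ?S ?M \<Theta>"
    unfolding ST_module_def
  proof (intro conjI ballI regular_L_module)
    show "linear_topology k ?N \<Theta>" by (rule linear_topology_cong[OF theta(2)]) (use N Nsm in auto)
    show "continuous_map \<Theta> \<Theta> (\<lambda>x. a \<odot>\<^bsub>?M\<^esub> x)" if "a \<in> carrier ?P" for a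
      using mult_continuous[OF PS_mem(1)] that by (simp add: PC)
    fix x assume x: "x \<in> carrier ?M"
    then have xL: "x \<in> carrier L" by simp
    have "continuous_map ?S \<Theta> (\<lambda>a. x \<otimes>\<^bsub>L\<^esub> a)"
      by (rule continuous_map_from_subtopology[OF mult_continuous[OF xL]])
    then show "continuous_map ?S \<Theta> (\<lambda>a. a \<odot>\<^bsub>?M\<^esub> x)"
      by (rule continuous_map_eq) (use xL tsS PS_mem(1) in \<open>simp add: LC.m_comm\<close>)
  qed
  fix T' U assume T': "ST_module k ?P ?S ?M T'" and U: "openin T' U"
  have linT': "linear_topology k L T'"
    by (rule linear_topology_cong[where M = ?N]) (use T' N Nsm in \<open>auto simp: ST_module_def\<close>)
  have act: "continuous_map ?S T' (\<lambda>a. a \<otimes>\<^bsub>L\<^esub> x)" if "x \<in> carrier L" for x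
    using T' that by (simp add: ST_module_def)
  show "openin \<Theta> U"
  proof (rule finer_topology[OF mL theta(2) linT' _ U])
    fix V assume V: "openin T' V" "submodule V k L"
    note vm = submodule_mem[OF mL V(2)]
    have constP: "continuous_map TA ?S (\<lambda>a. mono a 0)"
      using mono_continuous[of 0] by (auto simp: continuous_map_in_subtopology topspace_TA power_series_def)
    have "openin ?S {a \<in> topspace ?S. a \<otimes>\<^bsub>L\<^esub> \<one>\<^bsub>L\<^esub> \<in> V}"
      using act[OF LC.one_closed] V(1) by (simp add: continuous_map_def)
    moreover have "{a \<in> topspace ?S. a \<otimes>\<^bsub>L\<^esub> \<one>\<^bsub>L\<^esub> \<in> V} = V \<inter> power_series A"
      using PS_mem(1) tsS by auto
    ultimately have "openin ?S (V \<inter> power_series A)" by simp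
    then obtain V0 where V0: "openin \<Theta> V0" "V \<inter> power_series A = V0 \<inter> power_series A"
        by (auto simp: openin_subtopology)
    have zP: "\<zero>\<^bsub>L\<^esub> \<in> power_series A" using submodule_mem(1)[OF mL PS_submodule] .
    then have "\<zero>\<^bsub>L\<^esub> \<in> V0" using V0(2) vm(1) by auto
    then obtain U' where U': "nbhd_family U'" "\<forall>h\<in>W U'. \<zero>\<^bsub>L\<^esub> \<oplus>\<^bsub>L\<^esub> h \<in> V0" using V0(1) unfolding theta(1) by blast
    obtain N0 where N0: "\<forall>i\<ge>N0. U' i = carrier A" using nbhd_familyD(3)[OF U'(1)] by auto
    \<comment> \<open>n is at least 0 so that series of order n are power series, where openness of
      V is known.\<close>
    define n where "n = max 0 N0"
    have n: "0 \<le> n" "\<forall>i\<ge>n. U' i = carrier A" using N0 by (auto simp: n_def)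
    have tail: "x \<in> V" if x: "x \<in> carrier L" "\<And>i. i < n \<Longrightarrow> c x i = \<zero>" for x
    proof -
      have "c x i \<in> U' i" for i using x n sub_mem(1)[OF nbhd_familyD(2)[OF U'(1)]] by (cases "i < n") auto
      then have "x \<in> W U'" using x by (simp add: W_def)
      then have "\<zero>\<^bsub>L\<^esub> \<oplus>\<^bsub>L\<^esub> x \<in> V0" using U'(2) by blast
      moreover have "x \<in> power_series A" using x n(1) by (simp add: power_series_def)
      ultimately show ?thesis using V0(2) x(1) by auto
    qed
    \<comment> \<open>The constants act through A[[t]], so a -> a t^j is the action on the monomial
      t^j, continuous also for negative j.\<close>
    define G where "G j = {a \<in> carrier A. mono a j \<in> V}" for j
    have G: "openin TA (G j) \<and> submodule (G j) k A" for j
    proof -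
      have "continuous_map TA T' (\<lambda>a. mono a 0 \<otimes>\<^bsub>L\<^esub> mono \<one> j)"
        using continuous_map_compose[OF constP act[of "mono \<one> j"]] by (simp add: o_def)
      then have "continuous_map TA T' (\<lambda>a. mono a j)"
        by (rule continuous_map_eq) (simp add: mono_mono topspace_TA)
      then have "openin TA (G j)" using V(1) by (simp add: continuous_map_def topspace_TA G_def)
      moreover have "submodule (G j) k A"
      proof -
        have "lin k A L (\<lambda>a. mono a j)"
          unfolding lin_def
        proof (intro conjI ballI funcsetI)
          fix r a assume ra: "r \<in> carrier k" "a \<in> carrier A"
          show "mono (r \<odot>\<^bsub>A\<^esub> a) j = r \<odot>\<^bsub>L\<^esub> mono a j"
            by (rule L_eqI) (use ra A_smult smult_L in auto)
        qed (auto simp: mono_distr)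
        from lin_vimage_submodule[OF mA mL this V(2)] show ?thesis by (simp add: G_def)
      qed
      ultimately show ?thesis by simp
    qed
    let ?U = "\<lambda>j. if j < n then G j else carrier A"
    have g: "nbhd_family ?U" by (rule mono_V_good[OF G])
    have "W ?U \<subseteq> V"
    proof
      fix x assume x: "x \<in> W ?U"
      then have xL: "x \<in> carrier L" by (auto simp: W_def)
      obtain B where B: "\<forall>i<B. c x i = \<zero>" using L_bound[OF xL] by auto
      \<comment> \<open>The part of x below n is a Laurent polynomial, handled monomial by monomial;
        the rest belongs to the tail.\<close>
      define lo where "lo = Series (\<lambda>j. if j < n then c x j else \<zero>)"
      have loc: "c lo j = (if j < n then c x j else \<zero>)" for j by (simp add: lo_def)
      have loL: "lo \<in> carrier L" unfolding lo_def by (rule Series_L[where N = B]) (use xL B in auto)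
      have hi: "x \<ominus>\<^bsub>L\<^esub> lo \<in> V"
        by (rule tail) (use xL loL in \<open>auto simp: loc a_minus_def r_neg\<close>)
      have "lo \<in> V"
      proof (rule polynomial_mem[OF vm(1) vm(3) loL, where n = n])
        show "c lo j = \<zero>" if "n < j" for j using that by (simp add: loc)
        show "mono (c lo j) j \<in> V" for j
        proof (cases "j < n")
          case True
          have "c x j \<in> ?U j" using x by (auto simp: W_def)
          then show ?thesis using True by (simp add: G_def loc)
        next
          case False
          moreover have "mono \<zero> j = \<zero>\<^bsub>L\<^esub>" by (rule L_eqI) (auto simp: zero_L)
          ultimately show ?thesis using vm(1) by (simp add: loc)
        qed
      qed
      then have "(x \<ominus>\<^bsub>L\<^esub> lo) \<oplus>\<^bsub>L\<^esub> lo \<in> V" using hi vm(3) by blast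
      moreover have "(x \<ominus>\<^bsub>L\<^esub> lo) \<oplus>\<^bsub>L\<^esub> lo = x" using xL loL by (simp add: LC.minus_eq LC.a_assoc LC.l_neg)
      ultimately show "x \<in> V" by simp
    qed
    then show "\<exists>W. openin \<Theta> W \<and> \<zero>\<^bsub>L\<^esub> \<in> W \<and> W \<subseteq> V" using theta(3)[OF g] W_zero[OF g] by blast
  qed
qed

end

section \<open>The iterated_laurent_tlaurent of iterated Laurent series\<close>

lemma const_algebra_alg:
  assumes "Module.algebra k k'" shows "cring (const_algebra k')" "Module.algebra k (const_algebra k')"
proof -
  interpret A: Module.algebra k k' by fact
  let ?C = "const_algebra k'"
  have ag: "abelian_group ?C"
  proof (rule abelian_groupI)
    show "\<exists>y\<in>carrier ?C. y \<oplus>\<^bsub>?C\<^esub> x = \<zero>\<^bsub>?C\<^esub>" if "x \<in> carrier ?C" for x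
      using that by (auto simp: const_algebra_def A.M.l_neg intro!: bexI[of _ "\<ominus>\<^bsub>k'\<^esub> y" for y])
  qed (auto simp: const_algebra_def A.M.a_ac)
  show cr: "cring ?C"
  proof (rule cringI[OF ag])
    show "comm_monoid ?C"
      by (rule comm_monoidI) (auto simp: const_algebra_def A.m_ac)
  qed (auto simp: const_algebra_def A.l_distr)
  show "Module.algebra k ?C"
    by (rule algebraI[OF A.R_cring cr])
      (auto simp: const_algebra_def A.smult_l_distr A.smult_r_distr A.smult_assoc1 A.smult_assoc2)
qed

lemma discrete_ST_ring:
  assumes "Module.algebra k A" shows "ST_ring k A (discrete_topology (carrier A))"
proof -
  interpret A: Module.algebra k A by fact
  have m: "Module.module k A" using assms by (simp add: Module.algebra_def)
  have z: "submodule {\<zero>\<^bsub>A\<^esub>} k A" by (rule module.submoduleI[OF m]) auto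
  have "linear_topology k A (discrete_topology (carrier A))"
    unfolding linear_topology_def prod_topology_discrete_topology[symmetric]
    using z by (auto intro!: exI[of _ "{\<zero>\<^bsub>A\<^esub>}"])
  then show ?thesis using assms by (auto simp: ST_ring_def)
qed

text \<open>Closedness of {0} is carried along the tower together with the ring structure, since it
  makes the filtration of K closed; it starts from the discrete topology on k'.\<close>

lemma iterated_laurent_tlaurent:
  assumes "Module.algebra k k'"
  shows "tlaurent (iterated_laurent k' m) k (iterated_laurent_topology k k' m) \<and>
    closedin (iterated_laurent_topology k k' m) {\<zero>\<^bsub>iterated_laurent k' m\<^esub>}"
proof (induction m)
  case 0
  interpret C: cring "const_algebra k'" by (rule const_algebra_alg[OF assms])
  show ?case using const_algebra_alg[OF assms] discrete_ST_ring
    by (auto simp: tlaurent_def tlaurent_axioms_def laurent_def laurent_axioms_def)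
next
  case (Suc m)
  then interpret tlaurent "iterated_laurent k' m" k "iterated_laurent_topology k k' m" by simp
  show ?case using L_cring L_alg L_ST_ring theta_closed_zero Suc laurent_topology_eq
    by (simp add: tlaurent_def tlaurent_axioms_def laurent_def laurent_axioms_def)
qed

text \<open>Serves for the residue field: its ST structure is brought over from the coefficient
  field along the induced isomorphism, rather than derived from the quotient topology.\<close>

lemma ST_ring_transport:
  assumes ST: "ST_ring k A TA" and F: "Module.algebra k F" and f: "f \<in> algebra_homs k A F"
    and bij: "bij_betw f (carrier A) (carrier F)" and homeo: "homeomorphic_map TA TF f"
  shows "ST_ring k F TF"
proof -
  interpret A: Module.algebra k A using ST by (simp add: ST_ring_def)
  interpret F: Module.algebra k F by fact
  have mA: "Module.module k A" and mF: "Module.module k F" using A.module_axioms F.module_axioms by auto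
  have lin: "linear_topology k A TA" using ST by (simp add: ST_ring_def)
  then have tA: "topspace TA = carrier A" by (simp add: linear_topology_def)
  have tF: "topspace TF = carrier F" using homeomorphic_imp_surjective_map[OF homeo] bij tA
      by (simp add: bij_betw_def)
  note f' = f[unfolded algebra_homs_def, simplified, THEN conjunct1] f[unfolded algebra_homs_def, simplified, THEN
      conjunct2, rule_format]
  note ff = ring_hom_memE[OF f'(1)] f'(2)
  have z: "f \<zero>\<^bsub>A\<^esub> = \<zero>\<^bsub>F\<^esub>" using ff(3)[of "\<zero>\<^bsub>A\<^esub>" "\<zero>\<^bsub>A\<^esub>"] ff(1)[of "\<zero>\<^bsub>A\<^esub>"] by simp
  obtain h where "homeomorphic_maps TA TF f h" using homeo homeomorphic_map_maps by blast
  then have h: "continuous_map TA TF f" "continuous_map TF TA h" "\<And>y. y \<in> carrier F \<Longrightarrow> f (h y) = y"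
    by (auto simp: homeomorphic_maps_def tF)
  have hA: "h y \<in> carrier A" if "y \<in> carrier F" for y using h(2) that by (auto simp: continuous_map_def tF tA)
  have p: "continuous_map (prod_topology TF TF) (prod_topology TA TA) (\<lambda>z. (h (fst z), h (snd z)))"
    "continuous_map (prod_topology D TF) (prod_topology D TA) (\<lambda>z. (fst z, h (snd z)))" for D :: "'x topology"
    using continuous_map_compose[OF continuous_map_fst h(2)] continuous_map_compose[OF continuous_map_snd h(2)]
    by (auto intro!: continuous_map_pairedI continuous_map_fst simp: o_def)
  have "continuous_map (prod_topology TA TA) TA (\<lambda>(x, y). x \<oplus>\<^bsub>A\<^esub> y)"
    "continuous_map (prod_topology (discrete_topology (carrier k)) TA) TA (\<lambda>(c, x). c \<odot>\<^bsub>A\<^esub> x)"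
    using lin by (auto simp: linear_topology_def)
  note q = continuous_map_compose[OF p(1) continuous_map_compose[OF this(1) h(1)]]
    continuous_map_compose[OF p(2) continuous_map_compose[OF this(2) h(1)]]
  have c1: "continuous_map (prod_topology TF TF) TF (\<lambda>(x, y). x \<oplus>\<^bsub>F\<^esub> y)"
    by (rule continuous_map_eq[OF q(1)]) (auto simp: tF ff(3) hA h(3))
  have c2: "continuous_map (prod_topology (discrete_topology (carrier k)) TF) TF (\<lambda>(c, x). c \<odot>\<^bsub>F\<^esub> x)"
    by (rule continuous_map_eq[OF q(2)]) (auto simp: tF ff(5) hA h(3))
  have c3: "continuous_map TF TF (\<lambda>b. a \<otimes>\<^bsub>F\<^esub> b)" if a: "a \<in> carrier F" for a
  proof -
    have "continuous_map TA TA (\<lambda>b. h a \<otimes>\<^bsub>A\<^esub> b)" using ST hA[OF a] by (simp add: ST_ring_def)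
    from continuous_map_compose[OF h(2) continuous_map_compose[OF this h(1)]] show ?thesis
      by (rule continuous_map_eq) (use a in \<open>auto simp: tF ff(2) hA h(3)\<close>)
  qed
  have nb: "\<exists>V. openin TF V \<and> submodule V k F \<and> V \<subseteq> U" if U: "openin TF U" "\<zero>\<^bsub>F\<^esub> \<in> U" for U
  proof -
    have "openin TA {x \<in> carrier A. f x \<in> U}" using h(1) U(1) by (auto simp: continuous_map_def tA)
    moreover have "\<zero>\<^bsub>A\<^esub> \<in> {x \<in> carrier A. f x \<in> U}" using U(2) z by simp
    ultimately obtain W where W: "openin TA W" "submodule W k A" "W \<subseteq> {x \<in> carrier A. f x \<in> U}"
      using lin unfolding linear_topology_def by meson
    note w = submodule_mem[OF mA W(2)]
    have WA: "x \<in> carrier A" if "x \<in> W" for x using W(3) that by auto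
    have "submodule (f ` W) k F"
    proof (rule module.submoduleI[OF mF])
      show "f ` W \<subseteq> carrier F" using WA ff(1) by auto
      show "\<zero>\<^bsub>F\<^esub> \<in> f ` W" using w z by (metis imageI)
      show "a \<oplus>\<^bsub>F\<^esub> b \<in> f ` W" if "a \<in> f ` W" "b \<in> f ` W" for a b
      proof -
        obtain x y where x: "x \<in> W" "a = f x" "y \<in> W" "b = f y" using \<open>a \<in> f ` W\<close> \<open>b \<in> f ` W\<close> by auto
        then have "a \<oplus>\<^bsub>F\<^esub> b = f (x \<oplus>\<^bsub>A\<^esub> y)" using ff(3) WA by simp
        moreover have "x \<oplus>\<^bsub>A\<^esub> y \<in> W" using w(3)[OF x(1,3)] .
        ultimately show ?thesis by simp
      qed
      show sm: "r \<odot>\<^bsub>F\<^esub> a \<in> f ` W" if "r \<in> carrier k" "a \<in> f ` W" for r a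
      proof -
        obtain x where x: "x \<in> W" "a = f x" using \<open>a \<in> f ` W\<close> by auto
        then have "r \<odot>\<^bsub>F\<^esub> a = f (r \<odot>\<^bsub>A\<^esub> x)" using ff(5)[OF that(1)] WA by simp
        moreover have "r \<odot>\<^bsub>A\<^esub> x \<in> W" using w(5)[OF that(1) x(1)] .
        ultimately show ?thesis by simp
      qed
      show "\<ominus>\<^bsub>F\<^esub> a \<in> f ` W" if a: "a \<in> f ` W" for a
      proof -
        have "a \<in> carrier F" using a WA ff(1) by auto
        then have "(\<ominus>\<^bsub>k\<^esub> \<one>\<^bsub>k\<^esub>) \<odot>\<^bsub>F\<^esub> a = \<ominus>\<^bsub>F\<^esub> a" by (simp add: F.smult_l_minus)
        then show ?thesis using sm[of "\<ominus>\<^bsub>k\<^esub> \<one>\<^bsub>k\<^esub>" a] a by simp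
      qed
    qed
    moreover have "openin TF (f ` W)" using homeomorphic_imp_open_map[OF homeo] W(1) by (auto simp: open_map_def)
    ultimately show ?thesis using W(3) by blast
  qed
  show ?thesis unfolding ST_ring_def linear_topology_def using tF c1 c2 c3 nb F by blast
qed

section \<open>Parametrized local fields and their residue fields\<close>

text \<open>One level of the structure: \<open>A\<close> stands for k'((t_2, ..., t_n)) and
  \<open>g\<close> for the isomorphism A((t_1)) -> K. The topology of A((t_1)) is taken in its
  explicit form \<open>\<Theta>\<close>.\<close>

locale parametrized = tlaurent A k TA for A :: "('k, 'a laurent) module" (structure)
    and k :: "('k, 'b) ring_scheme" and TA +
  fixes K :: "('k, 'a) module" and V :: "'a set" and T :: "'a topology" and g :: "'a laurent \<Rightarrow> 'a"
  assumes K_field: "field K" and K_ST: "ST_ring k K T"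
    and k_stable: "structure_map K ` carrier k \<subseteq> V"
    and g_hom: "g \<in> algebra_homs k (laurent_algebra A) K"
    and g_bij: "bij_betw g (carrier (laurent_algebra A)) (carrier K)"
    and g_homeo: "homeomorphic_map \<Theta> T g"
    and g_V: "g ` power_series A = V"
    and V_subring: "subring V K"
    and max_unique: "\<exists>!I. maximalideal I (K\<lparr>carrier := V\<rparr>)"
    and TA_zero: "closedin TA {\<zero>}"
begin

sublocale K: field K by (rule K_field)
interpretation LC: cring "laurent_algebra A" by (rule L_cring)

abbreviation (input) "F \<equiv> residue_field K V"
abbreviation (input) "res \<equiv> residue_map K V"
abbreviation (input) "R \<equiv> K\<lparr>carrier := V\<rparr>"

lemma K_alg: "Module.algebra k K" using K_ST by (simp add: ST_ring_def)
lemma K_lin: "linear_topology k K T" using K_ST by (simp add: ST_ring_def)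
lemma topspace_T: "topspace T = carrier K" using K_lin by (simp add: linear_topology_def)

lemma g_facts:
  "x \<in> carrier L \<Longrightarrow> g x \<in> carrier K" "x \<in> carrier L \<Longrightarrow> y \<in> carrier L \<Longrightarrow> g (x \<oplus>\<^bsub>L\<^esub> y) = g x \<oplus>\<^bsub>K\<^esub> g y"
  "x \<in> carrier L \<Longrightarrow> y \<in> carrier L \<Longrightarrow> g (x \<otimes>\<^bsub>L\<^esub> y) = g x \<otimes>\<^bsub>K\<^esub> g y" "g \<one>\<^bsub>L\<^esub> = \<one>\<^bsub>K\<^esub>"
  "r \<in> carrier k \<Longrightarrow> x \<in> carrier L \<Longrightarrow> g (r \<odot>\<^bsub>L\<^esub> x) = r \<odot>\<^bsub>K\<^esub> g x"
  "x \<in> carrier L \<Longrightarrow> y \<in> carrier L \<Longrightarrow> g x = g y \<Longrightarrow> x = y"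
  "z \<in> carrier K \<Longrightarrow> \<exists>x\<in>carrier L. z = g x"
  using g_hom ring_hom_memE[of g L K] g_bij by (auto simp: algebra_homs_def bij_betw_def inj_on_def)

lemma g_zero: "g \<zero>\<^bsub>L\<^esub> = \<zero>\<^bsub>K\<^esub>"
  using g_facts(2)[of "\<zero>\<^bsub>L\<^esub>" "\<zero>\<^bsub>L\<^esub>"] g_facts(1)[of "\<zero>\<^bsub>L\<^esub>"] by simp

lemma g_minus: assumes "x \<in> carrier L" "y \<in> carrier L" shows "g (x \<ominus>\<^bsub>L\<^esub> y) = g x \<ominus>\<^bsub>K\<^esub> g y"
proof -
  have "g (x \<ominus>\<^bsub>L\<^esub> y) \<oplus>\<^bsub>K\<^esub> g y = g x"
    using assms g_facts(2)[of "x \<ominus>\<^bsub>L\<^esub> y" y] by (simp add: LC.minus_eq LC.a_assoc LC.l_neg)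
  then show ?thesis using assms g_facts(1) K.minus_eq
    by (metis K.add.inv_solve_right LC.minus_closed)
qed

text \<open>This is t^n V for every integer n, described by coefficients so that negative exponents
  and closedness cause no trouble.\<close>

definition Fil :: "int \<Rightarrow> 'a set" where
  "Fil n = g ` {x \<in> carrier L. \<forall>i<n. c x i = \<zero>}"

lemma Fil_iff: "x \<in> carrier L \<Longrightarrow> g x \<in> Fil n \<longleftrightarrow> (\<forall>i<n. c x i = \<zero>)"
  unfolding Fil_def using g_facts(6) by blast

lemma Fil_V: "Fil 0 = V" unfolding Fil_def g_V[symmetric] power_series_def by simp

lemma Fil_sub: "Fil n \<subseteq> carrier K" unfolding Fil_def using g_facts(1) by auto

lemma Fil_mono: "m \<le> n \<Longrightarrow> Fil n \<subseteq> Fil m" unfolding Fil_def by auto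

lemma Fil_add: "x \<in> Fil n \<Longrightarrow> y \<in> Fil n \<Longrightarrow> x \<oplus>\<^bsub>K\<^esub> y \<in> Fil n"
proof -
  assume "x \<in> Fil n" "y \<in> Fil n"
  then obtain u v where u: "u \<in> carrier L" "x = g u" "\<forall>i<n. c u i = \<zero>" "v \<in> carrier L" "y = g v" "\<forall>i<n. c v i = \<zero>"
    by (auto simp: Fil_def)
  then have "x \<oplus>\<^bsub>K\<^esub> y = g (u \<oplus>\<^bsub>L\<^esub> v)" by (simp add: g_facts(2))
  then show ?thesis using Fil_iff[of "u \<oplus>\<^bsub>L\<^esub> v" n] u by simp
qed

lemma Fil_mult: "x \<in> Fil n \<Longrightarrow> y \<in> Fil p \<Longrightarrow> x \<otimes>\<^bsub>K\<^esub> y \<in> Fil (n + p)"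
proof -
  assume "x \<in> Fil n" "y \<in> Fil p"
  then obtain u v where u: "u \<in> carrier L" "x = g u" "\<forall>i<n. c u i = \<zero>" "v \<in> carrier L" "y = g v" "\<forall>i<p. c v i = \<zero>"
    by (auto simp: Fil_def)
  then have "x \<otimes>\<^bsub>K\<^esub> y = g (u \<otimes>\<^bsub>L\<^esub> v)" by (simp add: g_facts(3))
  moreover have "\<forall>i<n + p. c (u \<otimes>\<^bsub>L\<^esub> v) i = \<zero>" using mult_low[of n u p v] u(3,6) by blast
  ultimately show ?thesis using Fil_iff[of "u \<otimes>\<^bsub>L\<^esub> v" "n + p"] u by simp
qed

lemma Fil_zero: "\<zero>\<^bsub>K\<^esub> \<in> Fil n" using Fil_iff[of "\<zero>\<^bsub>L\<^esub>" n] by (simp add: g_zero)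

lemma Fil_mono_mem: "a \<in> carrier A \<Longrightarrow> n \<le> i \<Longrightarrow> g (mono a i) \<in> Fil n"
  by (subst Fil_iff) auto

lemma Fil_exhaust: assumes "x \<in> carrier K" obtains n where "x \<in> Fil n"
proof -
  obtain u where u: "u \<in> carrier L" "x = g u" using g_facts(7)[OF assms] by auto
  obtain N where "\<forall>i<N. c u i = \<zero>" using L_bound[OF u(1)] by auto
  then show ?thesis using Fil_iff[OF u(1)] u(2) that by blast
qed

text \<open>It corresponds to an intersection of kernels of coefficient maps, which are continuous,
  and {0} is closed in A.\<close>

lemma Fil_closed: "closedin T (Fil n)"
proof -
  have "{x \<in> carrier L. \<forall>i<n. c x i = \<zero>} = topspace \<Theta> \<inter> (\<Inter>i\<in>{..<n}. {x \<in> topspace \<Theta>. c x i \<in> {\<zero>}})"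
    by (auto simp: theta(4))
  moreover have "closedin \<Theta> \<dots>"
  proof (cases "{..<n} = {}")
    case False
    then show ?thesis
      by (intro closedin_Int closedin_topspace closedin_INT closedin_continuous_map_preimage[OF coeff_continuous
          TA_zero]) auto
  qed simp
  ultimately have "closedin \<Theta> {x \<in> carrier L. \<forall>i<n. c x i = \<zero>}" by simp
  then show ?thesis using homeomorphic_imp_closed_map[OF g_homeo] unfolding Fil_def closed_map_def by blast
qed

definition t :: 'a where "t = g (mono \<one> 1)"

lemma one_nz: "\<one> \<noteq> \<zero>"
proof
  assume "\<one> = \<zero>"
  then have "\<one>\<^bsub>L\<^esub> = \<zero>\<^bsub>L\<^esub>" by (simp add: one_L zero_L)
  then have "\<one>\<^bsub>K\<^esub> = \<zero>\<^bsub>K\<^esub>" using g_facts(4) g_zero by simp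
  then show False using K.one_not_zero by simp
qed

lemma mono_nz: "g (mono \<one> n) \<noteq> \<zero>\<^bsub>K\<^esub>"
proof
  assume "g (mono \<one> n) = \<zero>\<^bsub>K\<^esub>"
  then have "mono \<one> n = \<zero>\<^bsub>L\<^esub>" using g_facts(6)[of "mono \<one> n" "\<zero>\<^bsub>L\<^esub>"] g_zero by simp
  then have "c (mono \<one> n) n = \<zero>" by simp
  then show False using one_nz by simp
qed

lemma t_pow: "t [^]\<^bsub>K\<^esub> (n::nat) = g (mono \<one> (int n))"
proof (induction n)
  case 0 then show ?case using g_facts(4) by (simp add: one_L)
next
  case (Suc n)
  have "g (mono \<one> (int n)) \<otimes>\<^bsub>K\<^esub> g (mono \<one> 1) = g (mono \<one> (int n) \<otimes>\<^bsub>L\<^esub> mono \<one> 1)" by (simp add: g_facts(3))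
  then show ?case using Suc by (simp add: t_def mono_mono add.commute)
qed

lemma t_pow_mult: "mono \<one> n \<in> carrier L" "g (mono \<one> n) \<otimes>\<^bsub>K\<^esub> g (mono \<one> (- n)) = \<one>\<^bsub>K\<^esub>"
  using g_facts(3,4) by (simp_all flip: g_facts(3) add: mono_mono one_L)

lemma Fil_shift: "Fil (n + p) = (\<lambda>x. g (mono \<one> n) \<otimes>\<^bsub>K\<^esub> x) ` Fil p"
proof
  have m: "g (mono \<one> n) \<in> Fil n" for n by (rule Fil_mono_mem) auto
  show "(\<lambda>x. g (mono \<one> n) \<otimes>\<^bsub>K\<^esub> x) ` Fil p \<subseteq> Fil (n + p)" using Fil_mult[OF m] by blast
  show "Fil (n + p) \<subseteq> (\<lambda>x. g (mono \<one> n) \<otimes>\<^bsub>K\<^esub> x) ` Fil p"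
  proof
    fix x assume x: "x \<in> Fil (n + p)"
    then have xK: "x \<in> carrier K" using Fil_sub by auto
    have "g (mono \<one> (- n)) \<otimes>\<^bsub>K\<^esub> x \<in> Fil p" using Fil_mult[OF m[of "- n"] x] by simp
    moreover have "x = g (mono \<one> n) \<otimes>\<^bsub>K\<^esub> (g (mono \<one> (- n)) \<otimes>\<^bsub>K\<^esub> x)"
      using t_pow_mult(2)[of n] xK g_facts(1)[OF t_pow_mult(1)] by (simp add: K.m_assoc[symmetric])
    ultimately show "x \<in> (\<lambda>x. g (mono \<one> n) \<otimes>\<^bsub>K\<^esub> x) ` Fil p" by blast
  qed
qed

lemma valued: "valued K V t"
proof (intro valued.intro K_field valued_axioms.intro V_subring)
  show "t \<in> V" unfolding Fil_V[symmetric] t_def by (rule Fil_mono_mem) auto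
  show "t \<noteq> \<zero>\<^bsub>K\<^esub>" unfolding t_def by (rule mono_nz)
  fix x assume x: "x \<in> carrier K"
  obtain n where n: "x \<in> Fil n" using Fil_exhaust[OF x] .
  have "t [^]\<^bsub>K\<^esub> (nat (- n)) \<otimes>\<^bsub>K\<^esub> x \<in> Fil (int (nat (- n)) + n)"
    unfolding t_pow by (rule Fil_mult[OF Fil_mono_mem n]) auto
  also have "Fil (int (nat (- n)) + n) \<subseteq> Fil 0" by (rule Fil_mono) auto
  finally show "\<exists>n::nat. t [^]\<^bsub>K\<^esub> n \<otimes>\<^bsub>K\<^esub> x \<in> V" unfolding Fil_V by blast
qed

interpretation vd: valued K V t by (rule valued)

lemma tV: "(\<lambda>v. t \<otimes>\<^bsub>K\<^esub> v) ` V = Fil 1"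
  using Fil_shift[of 1 0] by (simp add: Fil_V t_def)

text \<open>The inverse in K of the constant a is a series; its coefficient at 0 inverts a in
  A.\<close>

lemma A_inverse: assumes a: "a \<in> carrier A" "a \<noteq> \<zero>" obtains b where "b \<in> carrier A" "a \<otimes> b = \<one>"
proof -
  have "g (mono a 0) \<noteq> \<zero>\<^bsub>K\<^esub>"
  proof
    assume "g (mono a 0) = \<zero>\<^bsub>K\<^esub>"
    then have "mono a 0 = \<zero>\<^bsub>L\<^esub>" using g_facts(6)[of "mono a 0" "\<zero>\<^bsub>L\<^esub>"] g_zero a by simp
    then have "c (mono a 0) 0 = \<zero>" by simp
    then show False using a by simp
  qed
  then have u: "g (mono a 0) \<in> Units K" using K.field_Units g_facts(1)[of "mono a 0"] a by simp
  obtain z where z: "z \<in> carrier L" "inv\<^bsub>K\<^esub> (g (mono a 0)) = g z" using g_facts(7) K.Units_inv_closed[OF u]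
      by blast
  have "g (mono a 0 \<otimes>\<^bsub>L\<^esub> z) = \<one>\<^bsub>K\<^esub>" using z a K.Units_r_inv[OF u] by (simp add: g_facts(3))
  then have "mono a 0 \<otimes>\<^bsub>L\<^esub> z = \<one>\<^bsub>L\<^esub>" using g_facts(4) g_facts(6)[of "mono a 0 \<otimes>\<^bsub>L\<^esub> z" "\<one>\<^bsub>L\<^esub>"] z a by simp
  then have "c (mono a 0 \<otimes>\<^bsub>L\<^esub> z) 0 = \<one>" by simp
  then show ?thesis using that[of "c z 0"] z a by (simp add: mono_mult_c)
qed

text \<open>An ideal J beyond \<open>Fil 1\<close> contains a series with nonzero constant term.
  Scaled to constant term 1, it differs from 1 by an element of \<open>Fil 1\<close>, hence of J, so
  1 lies in J.\<close>

lemma Fil1_maximal: "maximalideal (Fil 1) R"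
proof -
  interpret RC: cring R by (rule vd.R_cring)
  have V0: "V = Fil 0" by (rule Fil_V[symmetric])
  have neg: "\<ominus>\<^bsub>K\<^esub> x \<in> Fil n" if "x \<in> Fil n" for x n
  proof -
    obtain u where u: "u \<in> carrier L" "x = g u" "\<forall>i<n. c u i = \<zero>" using \<open>x \<in> Fil n\<close> by (auto simp: Fil_def)
    have "\<ominus>\<^bsub>K\<^esub> x = g (\<zero>\<^bsub>L\<^esub> \<ominus>\<^bsub>L\<^esub> u)" unfolding g_minus[OF LC.zero_closed u(1)] u(2) g_zero using g_facts(1)[OF u(1)]
        by (simp add: K.minus_eq)
    moreover have "\<forall>i<n. c (\<zero>\<^bsub>L\<^esub> \<ominus>\<^bsub>L\<^esub> u) i = \<zero>" using u by (simp add: a_minus_def)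
    ultimately show ?thesis using Fil_iff[OF LC.minus_closed[OF LC.zero_closed u(1)], of n] by simp
  qed
  have F1V: "Fil 1 \<subseteq> V" unfolding V0 by (rule Fil_mono) simp
  have id: "ideal (Fil 1) R"
  proof (rule idealI[OF RC.ring_axioms])
    show "subgroup (Fil 1) (add_monoid R)"
    proof (rule RC.add.subgroupI)
      show "\<ominus>\<^bsub>R\<^esub> a \<in> Fil 1" if "a \<in> Fil 1" for a
      proof -
        have aV: "a \<in> V" using that F1V by auto
        have "\<ominus>\<^bsub>R\<^esub> a = \<ominus>\<^bsub>K\<^esub> a"
          using RC.minus_equality[of "\<ominus>\<^bsub>K\<^esub> a" a] aV vd.V_closed(5)[OF aV] K.l_neg[OF vd.V_in[OF aV]] by simp
        then show ?thesis using neg[OF that] by simp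
      qed
    qed (use F1V Fil_zero[of 1] Fil_add in auto)
    show "x \<otimes>\<^bsub>R\<^esub> a \<in> Fil 1" if "a \<in> Fil 1" "x \<in> carrier R" for a x
      using Fil_mult[of x 0 a 1] that by (simp add: V0)
    show "a \<otimes>\<^bsub>R\<^esub> x \<in> Fil 1" if "a \<in> Fil 1" "x \<in> carrier R" for a x
      using Fil_mult[of a 1 x 0] that by (simp add: V0)
  qed
  have one: "\<one>\<^bsub>K\<^esub> \<notin> Fil 1" using Fil_iff[of "\<one>\<^bsub>L\<^esub>" 1] g_facts(4) one_nz by auto
  show ?thesis
  proof (rule maximalidealI[OF id])
    show "carrier R \<noteq> Fil 1" using one vd.V_closed(2) by auto
    fix J assume J: "ideal J R" "Fil 1 \<subseteq> J" "J \<subseteq> carrier R"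
    interpret J: ideal J R by (rule J(1))
    show "J = Fil 1 \<or> J = carrier R"
    proof (cases "J \<subseteq> Fil 1")
      case False
      then obtain x where x: "x \<in> J" "x \<notin> Fil 1" by auto
      then have "x \<in> Fil 0" using J(3) V0 by auto
      then obtain u where u: "u \<in> carrier L" "x = g u" "\<forall>i<0. c u i = \<zero>" by (auto simp: Fil_def)
      have "c u 0 \<noteq> \<zero>"
      proof
        assume "c u 0 = \<zero>"
        then have "c u i = \<zero>" if "i < 1" for i using u(3) that by (cases "i = 0") auto
        then show False using Fil_iff[OF u(1), of 1] u(2) x(2) by simp
      qed
      then obtain b where b: "b \<in> carrier A" "c u 0 \<otimes> b = \<one>" using A_inverse[of "c u 0"] u(1) by auto
      let ?w = "mono b 0 \<otimes>\<^bsub>L\<^esub> u"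
      have w: "?w \<in> carrier L" using b u by simp
      have bV: "g (mono b 0) \<in> V" unfolding V0 by (rule Fil_mono_mem) (use b in auto)
      have gw: "g ?w \<in> J" using J.I_l_closed[OF x(1), of "g (mono b 0)"] bV b u by (simp add: g_facts(3))
      have "g (\<one>\<^bsub>L\<^esub> \<ominus>\<^bsub>L\<^esub> ?w) \<in> Fil 1"
        unfolding Fil_iff[OF LC.minus_closed[OF LC.one_closed w]]
      proof (intro allI impI)
        fix i :: int assume i: "i < 1"
        show "c (\<one>\<^bsub>L\<^esub> \<ominus>\<^bsub>L\<^esub> ?w) i = \<zero>"
          using i b u w by (cases "i = 0") (simp_all add: mono_mult_c m_comm a_minus_def r_neg)
      qed
      then have "g \<one>\<^bsub>L\<^esub> \<ominus>\<^bsub>K\<^esub> g ?w \<in> J" using J(2) g_minus[OF LC.one_closed w] by auto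
      then have "(\<one>\<^bsub>K\<^esub> \<ominus>\<^bsub>K\<^esub> g ?w) \<oplus>\<^bsub>K\<^esub> g ?w \<in> J" using J.a_closed[OF _ gw] g_facts(4) by simp
      moreover have "(\<one>\<^bsub>K\<^esub> \<ominus>\<^bsub>K\<^esub> g ?w) \<oplus>\<^bsub>K\<^esub> g ?w = \<one>\<^bsub>K\<^esub>"
        using g_facts(1)[OF w] by (simp add: K.minus_eq K.a_assoc K.l_neg)
      ultimately have "\<one>\<^bsub>R\<^esub> \<in> J" by simp
      then show ?thesis using J.one_imp_carrier by simp
    qed (use J(2) in auto)
  qed
qed

text \<open>Uniqueness of the maximal ideal turns t V = Fil 1 into the ideal used to form the
  residue field.\<close>

lemma max_eq: "maximal_ideal_of R = (\<lambda>v. t \<otimes>\<^bsub>K\<^esub> v) ` V"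
  unfolding maximal_ideal_of_def tV by (rule the1_equality[OF max_unique Fil1_maximal])

lemma resid: "resid k K V t"
  using valued K_alg k_stable max_eq unfolding resid_def resid_axioms_def by auto

section \<open>The induced parametrization of the residue field\<close>

interpretation rs: resid k K V t by (rule resid)

text \<open>The isomorphism A -> k_1(K) induced by \<open>g\<close>; it has precisely the form in
  which \<open>respects_valuations\<close> passes to the next level.\<close>

definition g' :: "'a laurent \<Rightarrow> 'a" where
  "g' a = res (g (const_series A a))"

lemma res_g: assumes "x \<in> power_series A" shows "res (g x) = g' (c x 0)"
proof -
  note x = PS_mem[OF assms]
  have m: "mono (c x 0) 0 \<in> carrier L" using x by simp
  have "g (x \<ominus>\<^bsub>L\<^esub> mono (c x 0) 0) \<in> Fil 1"
    unfolding Fil_iff[OF LC.minus_closed[OF x(1) m]]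
  proof (intro allI impI)
    fix i :: int assume "i < 1"
    then show "c (x \<ominus>\<^bsub>L\<^esub> mono (c x 0) 0) i = \<zero>" using x m by (cases "i = 0") (simp_all add: a_minus_def r_neg)
  qed
  then have "g x \<ominus>\<^bsub>K\<^esub> g (mono (c x 0) 0) \<in> maximal_ideal_of R" unfolding max_eq tV g_minus[OF x(1) m] .
  then show ?thesis unfolding g'_def const_mono
    using rs.res_eq_iff[of "g x" "g (mono (c x 0) 0)"] g_facts(1) x m by simp
qed

lemma const_V: "a \<in> carrier A \<Longrightarrow> g (const_series A a) \<in> V"
  unfolding Fil_V[symmetric] const_mono by (rule Fil_mono_mem) auto

lemma g'_bij: "bij_betw g' (carrier A) (carrier F)"
  unfolding bij_betw_def
proof
  show "inj_on g' (carrier A)"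
  proof (rule inj_onI)
    fix a b assume ab: "a \<in> carrier A" "b \<in> carrier A" "g' a = g' b"
    have m: "mono a 0 \<in> carrier L" "mono b 0 \<in> carrier L" using ab by auto
    have "g (mono a 0) \<ominus>\<^bsub>K\<^esub> g (mono b 0) \<in> Fil 1"
      using rs.res_eq_iff[of "g (mono a 0)" "g (mono b 0)"] ab g_facts(1)[OF m(1)] g_facts(1)[OF m(2)]
      unfolding g'_def const_mono max_eq tV by simp
    then have "\<forall>i<1. c (mono a 0 \<ominus>\<^bsub>L\<^esub> mono b 0) i = \<zero>"
      unfolding g_minus[OF m, symmetric] Fil_iff[OF LC.minus_closed[OF m]] .
    then have "c (mono a 0 \<ominus>\<^bsub>L\<^esub> mono b 0) 0 = \<zero>" by (rule allE[of _ 0]) simp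
    then show "a = b" using m ab minus_eq_zeroD[of a b] by simp
  qed
  show "g' ` carrier A = carrier F"
  proof
    show "g' ` carrier A \<subseteq> carrier F" using rs.F_mem(1)[OF const_V] by (auto simp: g'_def)
    show "carrier F \<subseteq> g' ` carrier A"
    proof
      fix q assume "q \<in> carrier F"
      then obtain v where "v \<in> V" "q = res v" using rs.F_carrier by auto
      then obtain x where x: "x \<in> power_series A" "q = res (g x)" using g_V by auto
      then show "q \<in> g' ` carrier A" using res_g[OF x(1)] PS_mem(1)[OF x(1)] by auto
    qed
  qed
qed

lemma g'_hom: "g' \<in> algebra_homs k A F"
  unfolding algebra_homs_def
proof (intro CollectI conjI ballI ring_hom_memI)
  have m: "mono a 0 \<in> carrier L" if "a \<in> carrier A" for a using that by simp
  note cV = const_V[unfolded const_mono]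
  show "g' x \<in> carrier F" if "x \<in> carrier A" for x using rs.F_mem(1)[OF const_V[OF that]] by (simp add: g'_def)
  show "g' (x \<otimes> y) = g' x \<otimes>\<^bsub>F\<^esub> g' y" if h: "x \<in> carrier A" "y \<in> carrier A" for x y
    unfolding g'_def const_mono rs.res_mult[OF cV[OF h(1)] cV[OF h(2)]] g_facts(3)[OF m[OF h(1)] m[OF h(2)],
        symmetric]
    using h by (simp add: mono_mono)
  show "g' (x \<oplus> y) = g' x \<oplus>\<^bsub>F\<^esub> g' y" if h: "x \<in> carrier A" "y \<in> carrier A" for x y
    unfolding g'_def const_mono rs.res_add[OF cV[OF h(1)] cV[OF h(2)]] g_facts(2)[OF m[OF h(1)] m[OF h(2)],
        symmetric]
    using h by (simp add: mono_distr)
  show "g' \<one> = \<one>\<^bsub>F\<^esub>" unfolding g'_def const_mono one_L[symmetric] g_facts(4) rs.res_zero_one(2) ..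
  show "g' (r \<odot>\<^bsub>A\<^esub> x) = r \<odot>\<^bsub>F\<^esub> g' x" if h: "r \<in> carrier k" "x \<in> carrier A" for r x
  proof -
    interpret AK: Module.algebra k K by (rule K_alg)
    have sV: "structure_map K r \<in> V" using k_stable h(1) by auto
    have e: "r \<odot>\<^bsub>K\<^esub> w = structure_map K r \<otimes>\<^bsub>K\<^esub> w" if "w \<in> V" for w
      using AK.smult_assoc2[OF h(1) K.one_closed, of w] that h(1) by (simp add: structure_map_def)
    have "mono (r \<odot>\<^bsub>A\<^esub> x) 0 = r \<odot>\<^bsub>L\<^esub> mono x 0"
      using module.smult_r_null[OF mA h(1)] by (auto simp: laurent_algebra_def mono_def fun_eq_iff)
    then have "g' (r \<odot>\<^bsub>A\<^esub> x) = res (structure_map K r \<otimes>\<^bsub>K\<^esub> g (mono x 0))"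
      unfolding g'_def const_mono using g_facts(5)[OF h(1) m[OF h(2)]] e[OF cV[OF h(2)]] by simp
    also have "\<dots> = res (structure_map K r \<otimes>\<^bsub>K\<^esub> res (g (mono x 0)))"
      using rs.res_mult[OF sV cV[OF h(2)]] rs.res_mult[OF sV rs.res_V[OF cV[OF h(2)]]] rs.res_res[of
          "g (mono x 0)"] cV[OF h(2)] by simp
    also have "\<dots> = res (r \<odot>\<^bsub>K\<^esub> res (g (mono x 0)))" unfolding e[OF rs.res_V[OF cV[OF h(2)]]] ..
    finally show ?thesis unfolding g'_def const_mono rs.res_smult[OF h(1)] .
  qed
qed

text \<open>For openness, the preimage of g' U in V consists of the g x with constant coefficient in
  U. This is an open condition as coefficients are continuous, and the quotient topology then makes
  g' U open.\<close>

lemma g'_homeo: "homeomorphic_map TA (residue_topology K T V) g'"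
proof (rule bijective_open_imp_homeomorphic_map)
  have tV': "topspace (subtopology T V) = V" using V_subring subringE(1)
      by (auto simp: topspace_subtopology topspace_T)
  have q: "quotient_map (subtopology T V) (residue_topology K T V) res"
    unfolding residue_topology_def by (rule quotient_map_quotient_topology)
  have tF: "topspace (residue_topology K T V) = carrier F"
    using q tV' by (simp add: quotient_map_def rs.F_carrier)
  have "continuous_map TA T (\<lambda>a. g (mono a 0))"
    using continuous_map_compose[OF mono_continuous[of 0] homeomorphic_imp_continuous_map[OF g_homeo]]
        by (simp add: o_def)
  then have "continuous_map TA (subtopology T V) (\<lambda>a. g (mono a 0))"
    using const_V by (auto simp: continuous_map_in_subtopology topspace_TA const_mono)
  from continuous_map_compose[OF this quotient_imp_continuous_map[OF q]]
  show "continuous_map TA (residue_topology K T V) g'" by (simp add: o_def g'_def[abs_def] const_mono)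
  show "g' ` topspace TA = topspace (residue_topology K T V)" "inj_on g' (topspace TA)"
    using g'_bij by (auto simp: topspace_TA tF bij_betw_def)
  show "open_map TA (residue_topology K T V) g'" unfolding open_map_def
  proof (intro allI impI)
    fix U assume U: "openin TA U"
    then have UA: "U \<subseteq> carrier A" using openin_subset topspace_TA by metis
    let ?P = "{v \<in> topspace (subtopology T V). res v \<in> g' ` U}"
    have "openin \<Theta> {x \<in> topspace \<Theta>. c x 0 \<in> U}" using coeff_continuous[of 0] U by (auto simp: continuous_map_def)
    then have o: "openin T (g ` {x \<in> topspace \<Theta>. c x 0 \<in> U})"
      using homeomorphic_imp_open_map[OF g_homeo] by (auto simp: open_map_def)
    have "?P = V \<inter> g ` {x \<in> topspace \<Theta>. c x 0 \<in> U}"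
    proof (intro subset_antisym subsetI)
      fix v assume "v \<in> ?P"
      then have v: "v \<in> V" "res v \<in> g' ` U" unfolding tV' by auto
      then obtain x where x: "x \<in> power_series A" "v = g x" using g_V by auto
      then have "g' (c x 0) \<in> g' ` U" using v(2) res_g by simp
      then have "c x 0 \<in> U" using g'_bij UA PS_mem(1)[OF x(1)] unfolding bij_betw_def
        by (metis L_c inj_on_image_mem_iff)
      then show "v \<in> V \<inter> g ` {x \<in> topspace \<Theta>. c x 0 \<in> U}" using v x PS_mem(1)[OF x(1)] by (auto simp: theta(4))
    next
      fix v assume v: "v \<in> V \<inter> g ` {x \<in> topspace \<Theta>. c x 0 \<in> U}"
      then obtain x y where x: "x \<in> power_series A" "v = g x" "y \<in> carrier L" "v = g y" "c y 0 \<in> U"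
        using g_V by (auto simp: theta(4))
      then have "x = y" using g_facts(6)[of x y] PS_mem(1)[OF x(1)] by simp
      then have "res v \<in> g' ` U" using x res_g[OF x(1)] by simp
      then show "v \<in> ?P" unfolding tV' using v by simp
    qed
    then have "openin (subtopology T V) ?P" using o by (auto simp: openin_subtopology)
    moreover have "g' ` U \<subseteq> topspace (residue_topology K T V)" using UA g'_bij by (auto simp: tF bij_betw_def)
    ultimately show "openin (residue_topology K T V) (g' ` U)" using q unfolding quotient_map_def by blast
  qed
qed

end

section \<open>Boundedness of continuous differential operators\<close>

context parametrized
begin

text \<open>The source B runs through the rings of the Laurent tower while the target stays K, so
  these maps are not endomorphisms.\<close>

definition cont_linear :: "('k, 'x) module \<Rightarrow> 'x topology \<Rightarrow> ('x \<Rightarrow> 'a) \<Rightarrow> bool" where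
  "cont_linear B TB E \<longleftrightarrow> (\<forall>x\<in>carrier B. E x \<in> carrier K) \<and> (\<forall>x\<in>carrier B. \<forall>y\<in>carrier B.
      E (x \<oplus>\<^bsub>B\<^esub> y) = E x \<oplus>\<^bsub>K\<^esub> E y) \<and>
    (\<forall>r\<in>carrier k. \<forall>x\<in>carrier B. E (r \<odot>\<^bsub>B\<^esub> x) = r \<odot>\<^bsub>K\<^esub> E x) \<and> continuous_map TB T E"

text \<open>Commutators stay continuous and k-linear, which is what an induction on the order
  needs.\<close>

lemma cont_linear_commutator:
  assumes B: "ST_ring k B TB" and E: "cont_linear B TB E" and a: "a \<in> carrier B" "u \<in> carrier K"
  shows "cont_linear B TB (\<lambda>x. E (a \<otimes>\<^bsub>B\<^esub> x) \<ominus>\<^bsub>K\<^esub> u \<otimes>\<^bsub>K\<^esub> E x)"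
proof -
  interpret B: Module.algebra k B using B by (simp add: ST_ring_def)
  interpret AK: Module.algebra k K by (rule K_alg)
  note e = E[unfolded cont_linear_def, THEN conjunct1, rule_format] E[unfolded cont_linear_def, THEN conjunct2,
      THEN conjunct1, rule_format]
    E[unfolded cont_linear_def, THEN conjunct2, THEN conjunct2, THEN conjunct1, rule_format]
    E[unfolded cont_linear_def, THEN conjunct2, THEN conjunct2, THEN conjunct2]
  have "continuous_map TB TB (\<lambda>x. a \<otimes>\<^bsub>B\<^esub> x)" "continuous_map T T (\<lambda>x. u \<otimes>\<^bsub>K\<^esub> x)"
    using B K_ST a by (auto simp: ST_ring_def)
  then have "continuous_map TB T (\<lambda>x. E (a \<otimes>\<^bsub>B\<^esub> x))" "continuous_map TB T (\<lambda>x. u \<otimes>\<^bsub>K\<^esub> E x)"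
    using continuous_map_compose[OF _ e(4)] continuous_map_compose[OF e(4)] by (auto simp: o_def)
  note c = ST_ring_continuous_diff[OF K_ST K.is_cring this]
  have sm: "r \<odot>\<^bsub>K\<^esub> (x \<ominus>\<^bsub>K\<^esub> u \<otimes>\<^bsub>K\<^esub> y) = r \<odot>\<^bsub>K\<^esub> x \<ominus>\<^bsub>K\<^esub> u \<otimes>\<^bsub>K\<^esub> (r \<odot>\<^bsub>K\<^esub> y)"
    if h: "r \<in> carrier k" "x \<in> carrier K" "y \<in> carrier K" for r x y
  proof -
    have "r \<odot>\<^bsub>K\<^esub> (u \<otimes>\<^bsub>K\<^esub> y) = u \<otimes>\<^bsub>K\<^esub> (r \<odot>\<^bsub>K\<^esub> y)"
      using AK.smult_assoc2[OF h(1,3) a(2)] h a(2) by (simp add: K.m_comm)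
    then show ?thesis using h a by (simp add: K.minus_eq AK.smult_r_distr AK.smult_r_minus)
  qed
  have sB: "a \<otimes>\<^bsub>B\<^esub> (r \<odot>\<^bsub>B\<^esub> x) = r \<odot>\<^bsub>B\<^esub> (a \<otimes>\<^bsub>B\<^esub> x)" if h: "r \<in> carrier k" "x \<in> carrier B" for r x
    using B.smult_assoc2[OF h a(1)] h a(1) by (simp add: B.m_comm)
  have ad: "(p \<oplus>\<^bsub>K\<^esub> q) \<ominus>\<^bsub>K\<^esub> u \<otimes>\<^bsub>K\<^esub> (x \<oplus>\<^bsub>K\<^esub> y) = (p \<ominus>\<^bsub>K\<^esub> u \<otimes>\<^bsub>K\<^esub> x) \<oplus>\<^bsub>K\<^esub> (q \<ominus>\<^bsub>K\<^esub> u \<otimes>\<^bsub>K\<^esub> y)"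
    if "p \<in> carrier K" "q \<in> carrier K" "x \<in> carrier K" "y \<in> carrier K" for p q x y
    using that a(2) by (simp add: K.minus_eq K.r_distr K.minus_add K.a_ac)
  show ?thesis unfolding cont_linear_def
    using c a e(1) by (auto simp: B.r_distr e(2,3) sB sm ad)
qed

lemma Fil_smult: "r \<in> carrier k \<Longrightarrow> x \<in> Fil n \<Longrightarrow> r \<odot>\<^bsub>K\<^esub> x \<in> Fil n"
proof -
  interpret AK: Module.algebra k K by (rule K_alg)
  assume h: "r \<in> carrier k" "x \<in> Fil n"
  then have "structure_map K r \<in> Fil 0" "x \<in> carrier K" using k_stable Fil_sub by (auto simp: Fil_V)
  then show ?thesis using Fil_mult[of "structure_map K r" 0 x n] AK.smult_assoc2[OF h(1) K.one_closed, of x] h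
    by (simp add: structure_map_def)
qed

text \<open>
  The commutators with \<open>s\<close> and \<open>s\<inverse>\<close>, where \<open>B((s))\<close> is the source, are bounded by induction on the order.
  Hence so is \<open>E\<close> on the monomials \<open>a s\<^sup>i\<close>, going up and down from \<open>i = 0\<close>, and the density of the Laurent
  polynomials gives the rest.  The bound has slope \<open>e = 1\<close> if \<open>B((s))\<close> is \<open>K\<close> itself, and slope \<open>e = 0\<close> if it
  lies in the coefficients of \<open>K\<close>.
\<close>

lemma bounded_diff_op:
  assumes B: "tlaurent B k TB"
      and const: "\<And>E' d'. cont_linear B TB E' \<Longrightarrow> diff_op B K (\<lambda>a. h (const_series B a)) {\<zero>\<^bsub>K\<^esub>} d' E' \<Longrightarrow>
      \<exists>n. E' ` carrier B \<subseteq> Fil n"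
    and h: "h (laurent.mono B \<one>\<^bsub>B\<^esub> 1) \<in> Fil e" "h (laurent.mono B \<one>\<^bsub>B\<^esub> (-1)) \<in> Fil (- e)" "0 \<le> e"
    and E: "cont_linear (laurent_algebra B) (laurent_topology k B TB) E"
        "diff_op (laurent_algebra B) K h {\<zero>\<^bsub>K\<^esub>} d E"
  shows "\<exists>c. \<forall>i0. \<forall>x\<in>carrier (laurent_algebra B). (\<forall>i<i0. coeff_of x i = \<zero>\<^bsub>B\<^esub>) \<longrightarrow> E x \<in> Fil (e * i0 - c)"
  using E
proof (induction d arbitrary: E)
  case 0
  then show ?case using Fil_zero by auto
next
  case (Suc d)
  interpret B: tlaurent B k TB by (rule B)
  interpret LB: cring "laurent_algebra B" by (rule B.L_cring)
  note [simp] = LB.m_closed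
  let ?L = "laurent_algebra B"
  note E = Suc.prems(1)[unfolded B.laurent_topology_eq, unfolded cont_linear_def, THEN conjunct1, rule_format]
    Suc.prems(1)[unfolded B.laurent_topology_eq, unfolded cont_linear_def, THEN conjunct2, THEN conjunct1,
        rule_format]
    Suc.prems(1)[unfolded B.laurent_topology_eq, unfolded cont_linear_def, THEN conjunct2, THEN conjunct2, THEN
        conjunct1, rule_format]
    Suc.prems(1)[unfolded B.laurent_topology_eq, unfolded cont_linear_def, THEN conjunct2, THEN conjunct2, THEN
        conjunct2]
  \<comment> \<open>The commutator with s has smaller order, so the induction hypothesis bounds it;
    below, only its values on monomials are used.\<close>
  have comm: "\<exists>c. \<forall>i. \<forall>a\<in>carrier B. E (s \<otimes>\<^bsub>?L\<^esub> B.mono a i) \<ominus>\<^bsub>K\<^esub> h s \<otimes>\<^bsub>K\<^esub> E (B.mono a i) \<in> Fil (e * i - c)"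
    if s: "s \<in> carrier ?L" "h s \<in> carrier K" for s
  proof -
    have "\<exists>c. \<forall>i0. \<forall>x\<in>carrier ?L. (\<forall>i<i0. coeff_of x i = \<zero>\<^bsub>B\<^esub>) \<longrightarrow> E (s \<otimes>\<^bsub>?L\<^esub> x) \<ominus>\<^bsub>K\<^esub> h s \<otimes>\<^bsub>K\<^esub> E x \<in> Fil (e * i0 -
        c)"
      by (rule Suc.IH)
        (use cont_linear_commutator[OF B.L_ST_ring Suc.prems(1)[unfolded B.laurent_topology_eq] s] Suc.prems(2)
            s(1)
          in \<open>simp_all add: B.laurent_topology_eq\<close>)
    then obtain c where c: "\<And>i0 x. x \<in> carrier ?L \<Longrightarrow> \<forall>i<i0. coeff_of x i = \<zero>\<^bsub>B\<^esub> \<Longrightarrow>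
        E (s \<otimes>\<^bsub>?L\<^esub> x) \<ominus>\<^bsub>K\<^esub> h s \<otimes>\<^bsub>K\<^esub> E x \<in> Fil (e * i0 - c)" by blast
    show ?thesis
      by (intro exI[of _ c] allI ballI c) auto
  qed
  have s: "B.mono \<one>\<^bsub>B\<^esub> 1 \<in> carrier ?L" "B.mono \<one>\<^bsub>B\<^esub> (-1) \<in> carrier ?L" by auto
  have hs: "h (B.mono \<one>\<^bsub>B\<^esub> 1) \<in> carrier K" "h (B.mono \<one>\<^bsub>B\<^esub> (-1)) \<in> carrier K" using h(1,2) Fil_sub by auto
  obtain c1 where c1: "\<And>i a. a \<in> carrier B \<Longrightarrow>
      E (B.mono \<one>\<^bsub>B\<^esub> 1 \<otimes>\<^bsub>?L\<^esub> B.mono a i) \<ominus>\<^bsub>K\<^esub> h (B.mono \<one>\<^bsub>B\<^esub> 1) \<otimes>\<^bsub>K\<^esub> E (B.mono a i) \<in> Fil (e * i - c1)"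
    using comm[OF s(1) hs(1)] by blast
  obtain c2 where c2: "\<And>i a. a \<in> carrier B \<Longrightarrow>
      E (B.mono \<one>\<^bsub>B\<^esub> (-1) \<otimes>\<^bsub>?L\<^esub> B.mono a i) \<ominus>\<^bsub>K\<^esub> h (B.mono \<one>\<^bsub>B\<^esub> (-1)) \<otimes>\<^bsub>K\<^esub> E (B.mono a i) \<in> Fil (e * i - c2)"
    using comm[OF s(2) hs(2)] by blast
  have rec: "u = (u \<ominus>\<^bsub>K\<^esub> v) \<oplus>\<^bsub>K\<^esub> v" if "u \<in> carrier K" "v \<in> carrier K" for u v
    using that by (simp add: K.minus_eq K.a_assoc K.l_neg)
  have EB: "cont_linear B TB (\<lambda>a. E (B.mono a 0))"
    unfolding cont_linear_def
  proof (intro conjI ballI)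
    fix x y assume xy: "x \<in> carrier B" "y \<in> carrier B"
    show "E (B.mono x 0) \<in> carrier K" using E(1) xy by simp
    show "E (B.mono (x \<oplus>\<^bsub>B\<^esub> y) 0) = E (B.mono x 0) \<oplus>\<^bsub>K\<^esub> E (B.mono y 0)"
      using E(2)[of "B.mono x 0" "B.mono y 0"] xy by (simp add: B.mono_distr)
    fix r assume r: "r \<in> carrier k"
    have "B.mono (r \<odot>\<^bsub>B\<^esub> x) 0 = r \<odot>\<^bsub>?L\<^esub> B.mono x 0"
      using module.smult_r_null[OF B.mA r] by (auto simp: laurent_algebra_def B.mono_def fun_eq_iff)
    then show "E (B.mono (r \<odot>\<^bsub>B\<^esub> x) 0) = r \<odot>\<^bsub>K\<^esub> E (B.mono x 0)" using E(3)[OF r, of "B.mono x 0"] xy by simp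
  next
    show "continuous_map TB T (\<lambda>a. E (B.mono a 0))"
      using continuous_map_compose[OF B.mono_continuous[of 0] E(4)] by (simp add: o_def)
  qed
  \<comment> \<open>Restriction to constants is precomposition with a -> a s^0. The order remains d
    + 1, which \<open>const\<close> admits because it covers all orders.\<close>
  have "diff_op B K (\<lambda>a. h (B.mono a 0)) {\<zero>\<^bsub>K\<^esub>} (Suc d) (\<lambda>a. E (B.mono a 0 \<otimes>\<^bsub>?L\<^esub> \<one>\<^bsub>?L\<^esub>))"
    by (rule diff_op_precompose[OF B.is_cring LB.is_cring _ _ LB.one_closed Suc.prems(2)]) (auto simp: B.mono_mono)
  then have "diff_op B K (\<lambda>a. h (const_series B a)) {\<zero>\<^bsub>K\<^esub>} (Suc d) (\<lambda>a. E (B.mono a 0))"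
    unfolding B.const_mono by (rule diff_op_transfer[OF _ B.is_cring]) simp
  then obtain n where n: "\<And>a. a \<in> carrier B \<Longrightarrow> E (B.mono a 0) \<in> Fil n" using const[OF EB] by blast
  \<comment> \<open>Three inequalities are needed: -n <= c at i = 0, c1 + e <= c for going up, and
    c2 - e <= c for going down; c2 + e suffices for the last because e is not negative.\<close>
  define c where "c = max (- n) (max (c1 + e) (c2 + e))"
  have c: "- n \<le> c" "c1 + e \<le> c" "c2 \<le> c + e" using h(3) by (auto simp: c_def)
  \<comment> \<open>From i to i + 1 the value is multiplied by h s, which shifts the filtration by
    e, and a bounded commutator is added; the inverse of s serves likewise for i - 1.\<close>
  have m: "E (B.mono a i) \<in> Fil (e * i - c)" if a: "a \<in> carrier B" for a i
  proof (induction i rule: int_induct[of _ 0])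
    case base
    show ?case using n[OF a] Fil_mono[of "- c" n] c by auto
  next
    case (step1 i)
    have "E (B.mono a (i + 1)) = E (B.mono \<one>\<^bsub>B\<^esub> 1 \<otimes>\<^bsub>?L\<^esub> B.mono a i)" using a by (simp add: B.mono_mono add.commute)
    also have "\<dots> = (E (B.mono \<one>\<^bsub>B\<^esub> 1 \<otimes>\<^bsub>?L\<^esub> B.mono a i) \<ominus>\<^bsub>K\<^esub> h (B.mono \<one>\<^bsub>B\<^esub> 1) \<otimes>\<^bsub>K\<^esub> E (B.mono a i)) \<oplus>\<^bsub>K\<^esub>
        h (B.mono \<one>\<^bsub>B\<^esub> 1) \<otimes>\<^bsub>K\<^esub> E (B.mono a i)"
      by (rule rec[OF E(1)[OF LB.m_closed[OF s(1) B.mono_L[OF a]]] K.m_closed[OF hs(1) E(1)[OF B.mono_L[OF a]]]])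
    also have "\<dots> \<in> Fil (e * (i + 1) - c)"
    proof (rule Fil_add)
      show "E (B.mono \<one>\<^bsub>B\<^esub> 1 \<otimes>\<^bsub>?L\<^esub> B.mono a i) \<ominus>\<^bsub>K\<^esub> h (B.mono \<one>\<^bsub>B\<^esub> 1) \<otimes>\<^bsub>K\<^esub> E (B.mono a i) \<in> Fil (e * (i + 1) - c)"
        using c1[OF a, of i] Fil_mono[of "e * (i + 1) - c" "e * i - c1"] c by (auto simp: algebra_simps)
      show "h (B.mono \<one>\<^bsub>B\<^esub> 1) \<otimes>\<^bsub>K\<^esub> E (B.mono a i) \<in> Fil (e * (i + 1) - c)"
        using Fil_mult[OF h(1) step1(2)] by (simp add: algebra_simps)
    qed
    finally show ?case .
  next
    case (step2 i)
    have "E (B.mono a (i - 1)) = E (B.mono \<one>\<^bsub>B\<^esub> (-1) \<otimes>\<^bsub>?L\<^esub> B.mono a i)" using a by (simp add: B.mono_mono)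
    also have "\<dots> = (E (B.mono \<one>\<^bsub>B\<^esub> (-1) \<otimes>\<^bsub>?L\<^esub> B.mono a i) \<ominus>\<^bsub>K\<^esub> h (B.mono \<one>\<^bsub>B\<^esub> (-1)) \<otimes>\<^bsub>K\<^esub> E (B.mono a i)) \<oplus>\<^bsub>K\<^esub>
        h (B.mono \<one>\<^bsub>B\<^esub> (-1)) \<otimes>\<^bsub>K\<^esub> E (B.mono a i)"
      by (rule rec[OF E(1)[OF LB.m_closed[OF s(2) B.mono_L[OF a]]] K.m_closed[OF hs(2) E(1)[OF B.mono_L[OF a]]]])
    also have "\<dots> \<in> Fil (e * (i - 1) - c)"
    proof (rule Fil_add)
      show "E (B.mono \<one>\<^bsub>B\<^esub> (-1) \<otimes>\<^bsub>?L\<^esub> B.mono a i) \<ominus>\<^bsub>K\<^esub> h (B.mono \<one>\<^bsub>B\<^esub> (-1)) \<otimes>\<^bsub>K\<^esub> E (B.mono a i) \<in> Fil (e * (i - 1)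
          - c)"
        using c2[OF a, of i] Fil_mono[of "e * (i - 1) - c" "e * i - c2"] c by (auto simp: algebra_simps)
      show "h (B.mono \<one>\<^bsub>B\<^esub> (-1)) \<otimes>\<^bsub>K\<^esub> E (B.mono a i) \<in> Fil (e * (i - 1) - c)"
        using Fil_mult[OF h(2) step2(2)] by (simp add: algebra_simps)
    qed
    finally show ?case .
  qed
  show ?case
  proof (intro exI[of _ c] allI ballI impI)
    fix i0 x assume x: "x \<in> carrier ?L" "\<forall>i<i0. coeff_of x i = \<zero>\<^bsub>B\<^esub>"
    show "E x \<in> Fil (e * i0 - c)"
    \<comment> \<open>For i >= i0 the index e i - c is at least e i0 - c, so all monomials of x land
      in one closed set.\<close>
    proof (rule B.dense_polynomials[OF E(4) Fil_closed _ _ _ x(1)])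
      have "E (\<zero>\<^bsub>?L\<^esub> \<oplus>\<^bsub>?L\<^esub> \<zero>\<^bsub>?L\<^esub>) = E \<zero>\<^bsub>?L\<^esub> \<oplus>\<^bsub>K\<^esub> E \<zero>\<^bsub>?L\<^esub>" by (rule E(2)) auto
      then have "E \<zero>\<^bsub>?L\<^esub> = \<zero>\<^bsub>K\<^esub>" using E(1)[of "\<zero>\<^bsub>?L\<^esub>"] by simp
      then show "E \<zero>\<^bsub>?L\<^esub> \<in> Fil (e * i0 - c)" using Fil_zero by simp
      show "E (x \<oplus>\<^bsub>?L\<^esub> y) \<in> Fil (e * i0 - c)" if "x \<in> carrier ?L" "y \<in> carrier ?L" "E x \<in> Fil (e * i0 - c)"
          "E y \<in> Fil (e * i0 - c)" for x y
        using E(2)[OF that(1,2)] Fil_add[OF that(3,4)] by simp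
      show "E (B.mono a i) \<in> Fil (e * i0 - c)" if "i0 \<le> i" "a \<in> carrier B" for a i
        using m[OF that(2), of i] Fil_mono[of "e * i0 - c" "e * i - c"] mult_left_mono[OF that(1) h(3)] by auto
    qed (use x in auto)
  qed
qed

text \<open>Here the ring acts through V, so the variable s and its inverse both go to
  \<open>Fil 0\<close> and the slope is 0; the bound then does not depend on where the support
  begins. At the bottom, k' is spanned over k by finitely many elements, whose images lie in a
  common \<open>Fil n\<close>.\<close>

lemma tower_bounded:
  assumes k': "Module.algebra k k'" "finite_submodule k k' (carrier k')"
    and h: "\<And>x. x \<in> carrier (iterated_laurent k' j) \<Longrightarrow> h x \<in> V"
    and E: "cont_linear (iterated_laurent k' j) (iterated_laurent_topology k k' j) E"
        "diff_op (iterated_laurent k' j) K h {\<zero>\<^bsub>K\<^esub>} d E"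
  shows "\<exists>n. E ` carrier (iterated_laurent k' j) \<subseteq> Fil n"
  using h E
proof (induction j arbitrary: h E d)
  case 0
  interpret k': Module.algebra k k' by (rule k'(1))
  have mk: "Module.module k k'" by (rule k'.module_axioms)
  note E = 0(2)[unfolded cont_linear_def, THEN conjunct1, rule_format] 0(2)[unfolded cont_linear_def, THEN
      conjunct2, THEN conjunct1, rule_format]
    0(2)[unfolded cont_linear_def, THEN conjunct2, THEN conjunct2, THEN conjunct1, rule_format]
  have cc: "carrier (iterated_laurent k' 0) = Const ` carrier k'" by (simp add: const_algebra_def)
  have cm: "Const x \<in> carrier (iterated_laurent k' 0)" if "x \<in> carrier k'" for x using that unfolding cc by blast
  have ops: "Const x \<oplus>\<^bsub>iterated_laurent k' 0\<^esub> Const y = Const (x \<oplus>\<^bsub>k'\<^esub> y)"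
    "r \<odot>\<^bsub>iterated_laurent k' 0\<^esub> Const x = Const (r \<odot>\<^bsub>k'\<^esub> x)" for x y r by (auto simp: const_algebra_def)
  obtain S where S: "finite S" "S \<subseteq> carrier k'" "carrier k' = span_module k k' S"
    using k'(2) by (auto simp: finite_submodule_def)
  have "\<exists>n. \<forall>s\<in>S. E (Const s) \<in> Fil n" using S(1,2)
  proof (induction S)
    case (insert s S)
    then obtain n where n: "\<forall>s\<in>S. E (Const s) \<in> Fil n" by auto
    obtain p where "E (Const s) \<in> Fil p" using Fil_exhaust[OF E(1)[OF cm]] insert.prems by blast
    then show ?case using n Fil_mono[of "min n p" n] Fil_mono[of "min n p" p]
      by (intro exI[of _ "min n p"]) auto
  qed auto
  then obtain n where n: "\<forall>s\<in>S. E (Const s) \<in> Fil n" by blast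
  \<comment> \<open>The elements with image in \<open>Fil n\<close> form a k-submodule, so it
    suffices that it contains the generators.\<close>
  let ?N = "{x \<in> carrier k'. E (Const x) \<in> Fil n}"
  have a: "E (Const (x \<oplus>\<^bsub>k'\<^esub> y)) = E (Const x) \<oplus>\<^bsub>K\<^esub> E (Const y)" if "x \<in> carrier k'" "y \<in> carrier k'" for x y
    using E(2)[OF cm cm] that unfolding ops by blast
  have sm: "E (Const (r \<odot>\<^bsub>k'\<^esub> x)) = r \<odot>\<^bsub>K\<^esub> E (Const x)" if "r \<in> carrier k" "x \<in> carrier k'" for r x
    using E(3)[OF that(1) cm[OF that(2)]] unfolding ops .
  have z: "E (Const \<zero>\<^bsub>k'\<^esub>) = \<zero>\<^bsub>K\<^esub>" using a[of "\<zero>\<^bsub>k'\<^esub>" "\<zero>\<^bsub>k'\<^esub>"] E(1)[OF cm[of "\<zero>\<^bsub>k'\<^esub>"]] by simp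
  have "submodule ?N k k'"
  proof (rule module.submoduleI[OF mk])
    show "\<zero>\<^bsub>k'\<^esub> \<in> ?N" using z Fil_zero by simp
    show "x \<oplus>\<^bsub>k'\<^esub> y \<in> ?N" if "x \<in> ?N" "y \<in> ?N" for x y using that a Fil_add by simp
    show s: "r \<odot>\<^bsub>k'\<^esub> x \<in> ?N" if "r \<in> carrier k" "x \<in> ?N" for r x using that sm Fil_smult by simp
    show "\<ominus>\<^bsub>k'\<^esub> x \<in> ?N" if x: "x \<in> ?N" for x
      using s[of "\<ominus>\<^bsub>k\<^esub> \<one>\<^bsub>k\<^esub>" x] x by (simp add: k'.smult_l_minus)
  qed auto
  then have "span_module k k' S \<subseteq> ?N" by (rule span_least) (use S(2) n in auto)
  then show ?case using S(3) unfolding cc by blast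
next
  case (Suc j)
  interpret B: tlaurent "iterated_laurent k' j" k "iterated_laurent_topology k k' j"
      using iterated_laurent_tlaurent[OF k'(1)] by blast
  let ?L = "laurent_algebra (iterated_laurent k' j)"
  have hV: "x \<in> carrier ?L \<Longrightarrow> h x \<in> V" for x using Suc.prems(1) by simp
  have "\<exists>c. \<forall>i0. \<forall>x\<in>carrier ?L. (\<forall>i<i0. coeff_of x i = \<zero>\<^bsub>iterated_laurent k' j\<^esub>) \<longrightarrow> E x \<in> Fil (0 * i0 - c)"
  proof (rule bounded_diff_op[OF B.tlaurent_axioms _ _ _ _ Suc.prems(2,3)[simplified]])
    show "\<exists>n. E' ` carrier (iterated_laurent k' j) \<subseteq> Fil n"
      if "cont_linear (iterated_laurent k' j) (iterated_laurent_topology k k' j) E'"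
        "diff_op (iterated_laurent k' j) K (\<lambda>a. h (const_series (iterated_laurent k' j) a)) {\<zero>\<^bsub>K\<^esub>} d' E'" for E' d'
      by (rule Suc.IH[OF _ that]) (auto intro!: hV simp: B.const_mono)
  qed (use hV in \<open>auto simp: Fil_V\<close>)
  then obtain c where c: "\<And>i0 x. x \<in> carrier ?L \<Longrightarrow> \<forall>i<i0. coeff_of x i = \<zero>\<^bsub>iterated_laurent k' j\<^esub> \<Longrightarrow> E x \<in> Fil (- c)"
    by auto
  \<comment> \<open>With slope 0 every lower bound of the support gives the same filtration
    index.\<close>
  have "E x \<in> Fil (- c)" if "x \<in> carrier ?L" for x using B.L_bound[OF that] c[OF that] by blast
  then show ?case by auto
qed

text \<open>D is pulled back along \<open>g\<close> to a map from A((t)) to K on which A((t)) acts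
  through \<open>g\<close>. There t itself shifts the filtration by 1, so the slope is 1, and the
  restriction to coefficients is bounded by the tower.\<close>

lemma bounded:
  assumes k': "Module.algebra k k'" "finite_submodule k k' (carrier k')" "A = iterated_laurent k' j"
      "TA = iterated_laurent_topology k k' j"
    and D: "D \<in> Hom_base k K (regular_module K) (regular_module K)" "continuous_map T T D"
        "diff_op K K id {\<zero>\<^bsub>K\<^esub>} d D"
  shows "\<exists>c::nat. \<forall>n. \<forall>x\<in>Fil n. D x \<in> Fil (n - int c)"
proof -
  interpret AK: Module.algebra k K by (rule K_alg)
  interpret LC: cring L by (rule L_cring)
  have kh: "khom k K (regular_module K) (regular_module K) D" using D(1) by (simp add: Hom_base_iff)
  have sm: "r \<odot>\<^bsub>K\<^esub> x = structure_map K r \<otimes>\<^bsub>K\<^esub> x" if "r \<in> carrier k" "x \<in> carrier K" for r x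
    using AK.smult_assoc2[OF that(1) K.one_closed that(2)] that by (simp add: structure_map_def)
  have Dl: "cont_linear L \<Theta> (\<lambda>x. D (g x))"
    using kh g_facts(1,2,5) sm continuous_map_compose[OF homeomorphic_imp_continuous_map[OF g_homeo] D(2)]
    by (auto simp: cont_linear_def khom_def o_def Pi_iff)
  have "diff_op L K (\<lambda>x. id (g x)) {\<zero>\<^bsub>K\<^esub>} d (\<lambda>x. D (g x \<otimes>\<^bsub>K\<^esub> \<one>\<^bsub>K\<^esub>))"
    by (rule diff_op_precompose[OF L_cring K.is_cring _ _ K.one_closed D(3)]) (auto simp: g_facts)
  then have "diff_op L K g {\<zero>\<^bsub>K\<^esub>} d (\<lambda>x. D (g x \<otimes>\<^bsub>K\<^esub> \<one>\<^bsub>K\<^esub>))" by simp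
  then have dp: "diff_op L K g {\<zero>\<^bsub>K\<^esub>} d (\<lambda>x. D (g x))"
    by (rule diff_op_transfer[OF _ L_cring]) (simp add: g_facts)
  have "\<exists>c. \<forall>i0. \<forall>x\<in>carrier L. (\<forall>i<i0. coeff_of x i = \<zero>) \<longrightarrow> D (g x) \<in> Fil (1 * i0 - c)"
  proof (rule bounded_diff_op[OF tlaurent_axioms _ _ _ _ Dl[folded laurent_topology_eq] dp])
    show "\<exists>n. E' ` carrier A \<subseteq> Fil n"
      if "cont_linear A TA E'" "diff_op A K (\<lambda>a. g (const_series A a)) {\<zero>\<^bsub>K\<^esub>} d' E'" for E' d'
    proof -
      have kd: "cont_linear (iterated_laurent k' j) (iterated_laurent_topology k k' j) E'"
        "diff_op (iterated_laurent k' j) K (\<lambda>a. g (const_series A a)) {\<zero>\<^bsub>K\<^esub>} d' E'"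
        using that by (simp_all only: k'(3,4))
      have "g (const_series A x) \<in> V" if "x \<in> carrier (iterated_laurent k' j)" for x using const_V that k'(3)
          by simp
      from tower_bounded[OF k'(1,2) this kd] show ?thesis by (simp only: k'(3))
    qed
    show "g (mono \<one> 1) \<in> Fil 1" "g (mono \<one> (- 1)) \<in> Fil (- 1)" by (auto intro: Fil_mono_mem)
  qed simp
  then obtain c where c: "\<And>i0 x. x \<in> carrier L \<Longrightarrow> \<forall>i<i0. coeff_of x i = \<zero> \<Longrightarrow> D (g x) \<in> Fil (i0 - c)" by auto
  \<comment> \<open>The constant may be negative; rounding it up to a natural number only weakens
    the bound.\<close>
  have "D x \<in> Fil (n - int (nat c))" if x: "x \<in> Fil n" for n x
  proof -
    obtain u where u: "u \<in> carrier L" "x = g u" "\<forall>i<n. coeff_of u i = \<zero>" using x by (auto simp: Fil_def)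
    then have "D x \<in> Fil (n - c)" using c by simp
    then show ?thesis using Fil_mono[of "n - int (nat c)" "n - c"] by auto
  qed
  then show ?thesis by blast
qed

text \<open>With t^n V = Fil n, the two clauses are the cases n = i and n = -i of the
  hypothesis.\<close>

lemma bounded_op:
  assumes tl: "tlifted k K V t s T" and b: "\<And>n x. x \<in> Fil n \<Longrightarrow> D x \<in> Fil (n - int b)"
  shows "tlifted.bounded_op K V t D"
proof -
  interpret tl: tlifted k K V t s T by (rule tl)
  have "(\<exists>v\<in>V. t [^]\<^bsub>K\<^esub> b \<otimes>\<^bsub>K\<^esub> D (t [^]\<^bsub>K\<^esub> i \<otimes>\<^bsub>K\<^esub> x) = t [^]\<^bsub>K\<^esub> i \<otimes>\<^bsub>K\<^esub> v) \<and>
     t [^]\<^bsub>K\<^esub> (b + i) \<otimes>\<^bsub>K\<^esub> D (inv\<^bsub>K\<^esub> (t [^]\<^bsub>K\<^esub> i) \<otimes>\<^bsub>K\<^esub> x) \<in> V" if x: "x \<in> V" for i :: nat and x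
  proof
    have x0: "x \<in> Fil 0" using x by (simp add: Fil_V)
    have tF: "t [^]\<^bsub>K\<^esub> (n::nat) \<in> Fil (int n)" for n unfolding t_pow by (rule Fil_mono_mem) auto
    have ti: "inv\<^bsub>K\<^esub> (t [^]\<^bsub>K\<^esub> i) = g (mono \<one> (- int i))"
      unfolding t_pow by (rule K.comm_inv_char) (auto simp: t_pow_mult g_facts(1))
    have 1: "t [^]\<^bsub>K\<^esub> i \<otimes>\<^bsub>K\<^esub> x \<in> Fil (int i)" using Fil_mult[OF tF x0] by simp
    have "t [^]\<^bsub>K\<^esub> b \<otimes>\<^bsub>K\<^esub> D (t [^]\<^bsub>K\<^esub> i \<otimes>\<^bsub>K\<^esub> x) \<in> Fil (int i + 0)" using Fil_mult[OF tF[of b] b[OF 1]] by simp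
    then show "\<exists>v\<in>V. t [^]\<^bsub>K\<^esub> b \<otimes>\<^bsub>K\<^esub> D (t [^]\<^bsub>K\<^esub> i \<otimes>\<^bsub>K\<^esub> x) = t [^]\<^bsub>K\<^esub> i \<otimes>\<^bsub>K\<^esub> v"
      unfolding Fil_shift[of "int i" 0] Fil_V t_pow by auto
    have "inv\<^bsub>K\<^esub> (t [^]\<^bsub>K\<^esub> i) \<in> Fil (- int i)" unfolding ti by (rule Fil_mono_mem) auto
    then have "inv\<^bsub>K\<^esub> (t [^]\<^bsub>K\<^esub> i) \<otimes>\<^bsub>K\<^esub> x \<in> Fil (- int i)" using Fil_mult[OF _ x0, of _ "- int i"] by simp
    from Fil_mult[OF tF[of "b + i"] b[OF this]]
    show "t [^]\<^bsub>K\<^esub> (b + i) \<otimes>\<^bsub>K\<^esub> D (inv\<^bsub>K\<^esub> (t [^]\<^bsub>K\<^esub> i) \<otimes>\<^bsub>K\<^esub> x) \<in> V" by (simp add: Fil_V)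
  qed
  then show ?thesis unfolding tl.bounded_op_def by blast
qed

end

section \<open>Independence of the system of liftings\<close>

text \<open>A scalar of k acts on K as multiplication by its image in V, so it preserves V and its
  maximal ideal and descends to the quotient.\<close>

lemma residue_algebra:
  assumes K: "Module.algebra k K" and V: "subring V K" "structure_map K ` carrier k \<subseteq> V"
    and max: "\<exists>!I. maximalideal I (K\<lparr>carrier := V\<rparr>)" and F: "cring (residue_field K V)"
  shows "Module.algebra k (residue_field K V)"
    and "c \<in> carrier k \<Longrightarrow> structure_map (residue_field K V) c = residue_map K V (structure_map K c)"
proof -
  interpret K: Module.algebra k K by (rule K)
  let ?R = "K\<lparr>carrier := V\<rparr>"
  define m where "m = maximal_ideal_of ?R"
  have "maximalideal m ?R" unfolding m_def maximal_ideal_of_def by (rule theI'[OF max])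
  then interpret m: ideal m ?R by (simp add: maximalideal_def)
  have VK: "V \<subseteq> carrier K" by (rule subringE(1)[OF V(1)])
  have sm: "r \<odot>\<^bsub>K\<^esub> x = structure_map K r \<otimes>\<^bsub>K\<^esub> x" "structure_map K r \<in> V" if "r \<in> carrier k" "x \<in> V" for r x
    using K.smult_assoc2[OF that(1) K.one_closed, of x] that VK V(2) by (auto simp: structure_map_def)
  have mod: "Module.module k K" by (rule K.module_axioms)
  have VS: "submodule V k K"
    by (rule module.submoduleI[OF mod]) (use VK subringE[OF V(1)] sm in auto)
  have mV: "m \<subseteq> V" using m.a_subset by simp
  have MS: "submodule m k K"
  proof (rule module.submoduleI[OF mod])
    show "m \<subseteq> carrier K" using mV VK by auto
    show "\<zero>\<^bsub>K\<^esub> \<in> m" using additive_subgroup.zero_closed[OF m.is_additive_subgroup] by simp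
    show "a \<oplus>\<^bsub>K\<^esub> b \<in> m" if "a \<in> m" "b \<in> m" for a b using additive_subgroup.a_closed[OF m.is_additive_subgroup that]
        by simp
    show s: "r \<odot>\<^bsub>K\<^esub> x \<in> m" if "r \<in> carrier k" "x \<in> m" for r x
      using m.I_l_closed[OF that(2), of "structure_map K r"] sm[OF that(1)] that(2) mV by auto
    show "\<ominus>\<^bsub>K\<^esub> a \<in> m" if a: "a \<in> m" for a
    proof -
      have "a \<in> carrier K" using a mV VK by auto
      then show ?thesis using s[of "\<ominus>\<^bsub>k\<^esub> \<one>\<^bsub>k\<^esub>" a] a by (simp add: K.smult_l_minus)
    qed
  qed
  note S = submodule_restrict[OF mod MS VS mV]
  note cf = coset_rep_facts[OF S(2,1)] and cs = coset_rep_smult[OF S(2,1)]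
  let ?\<rho> = "coset_rep ?R m"
  interpret FM: Module.module k "residue_field K V"
    unfolding residue_field_def m_def[symmetric] by (rule quotient_module[OF S(2,1)])
  \<comment> \<open>Replacing z by its representative changes the product by a multiple of an
    element of the ideal m, so the residue of the product is unchanged.\<close>
  have mult: "?\<rho> (?\<rho> z \<otimes>\<^bsub>K\<^esub> y) = ?\<rho> (z \<otimes>\<^bsub>K\<^esub> y)" if zy: "z \<in> V" "y \<in> V" for z y
  proof -
    have c: "?\<rho> z \<in> V" "?\<rho> z \<ominus>\<^bsub>?R\<^esub> z \<in> m" using cf(1,2)[of z] zy by auto
    have neg: "\<ominus>\<^bsub>?R\<^esub> v = \<ominus>\<^bsub>K\<^esub> v" if "v \<in> V" for v
      using m.minus_equality[of "\<ominus>\<^bsub>K\<^esub> v" v] that VK subringE(5)[OF V(1)] by (auto simp: K.M.l_neg)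
    have e: "u \<ominus>\<^bsub>?R\<^esub> v = u \<ominus>\<^bsub>K\<^esub> v" if "u \<in> V" "v \<in> V" for u v
      using neg[OF that(2)] by (simp add: a_minus_def)
    have v: "?\<rho> z \<otimes>\<^bsub>K\<^esub> y \<in> V" "z \<otimes>\<^bsub>K\<^esub> y \<in> V" using subringE(6)[OF V(1)] c zy by auto
    have k: "?\<rho> z \<in> carrier K" "z \<in> carrier K" "y \<in> carrier K" using c zy VK by auto
    have "(?\<rho> z \<ominus>\<^bsub>K\<^esub> z) \<otimes>\<^bsub>K\<^esub> y \<in> m" using m.I_r_closed[OF c(2), of y] zy e[OF c(1) zy(1)] by simp
    moreover have "(?\<rho> z \<ominus>\<^bsub>K\<^esub> z) \<otimes>\<^bsub>K\<^esub> y = ?\<rho> z \<otimes>\<^bsub>K\<^esub> y \<ominus>\<^bsub>K\<^esub> z \<otimes>\<^bsub>K\<^esub> y"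
      using k by (simp add: K.M.minus_eq K.l_distr K.l_minus)
    ultimately have "?\<rho> z \<otimes>\<^bsub>K\<^esub> y \<ominus>\<^bsub>?R\<^esub> z \<otimes>\<^bsub>K\<^esub> y \<in> m" using e[OF v] by simp
    then show ?thesis using coset_rep_eq[OF S(2,1)] v by simp
  qed
  have FR: "carrier (residue_field K V) = ?\<rho> ` V" by (simp add: residue_field_def m_def)
  have "(r \<odot>\<^bsub>residue_field K V\<^esub> x) \<otimes>\<^bsub>residue_field K V\<^esub> y = r \<odot>\<^bsub>residue_field K V\<^esub> (x \<otimes>\<^bsub>residue_field K V\<^esub> y)"
    if h: "r \<in> carrier k" "x \<in> carrier (residue_field K V)" "y \<in> carrier (residue_field K V)" for r x y
  proof -
    have v: "x \<in> V" "y \<in> V" using h(2,3) cf(1) by (auto simp: FR)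
    have rx: "r \<odot>\<^bsub>K\<^esub> x \<in> V" using submodule_mem(5)[OF mod VS h(1) v(1)] .
    have xy: "x \<otimes>\<^bsub>K\<^esub> y \<in> V" using subringE(6)[OF V(1) v] .
    have "?\<rho> (?\<rho> (r \<odot>\<^bsub>K\<^esub> x) \<otimes>\<^bsub>K\<^esub> y) = ?\<rho> (r \<odot>\<^bsub>K\<^esub> ?\<rho> (x \<otimes>\<^bsub>K\<^esub> y))"
      unfolding mult[OF rx v(2)] using cs[OF h(1), of "x \<otimes>\<^bsub>K\<^esub> y"] xy
        K.smult_assoc2[OF h(1) subsetD[OF VK v(1)] subsetD[OF VK v(2)]] by simp
    then show ?thesis by (simp add: residue_field_def m_def)
  qed
  then show "Module.algebra k (residue_field K V)"
      using K.R_cring F FM.smult_closed FM.smult_l_distr FM.smult_r_distr FM.smult_assoc1 FM.smult_one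
    by (intro algebraI) simp_all
  show "structure_map (residue_field K V) c = residue_map K V (structure_map K c)" if "c \<in> carrier k"
    using cs[OF that, of "\<one>\<^bsub>K\<^esub>"] subringE(3)[OF V(1)]
    by (simp add: structure_map_def residue_field_def residue_map_def m_def)
qed

lemma local_field_field: "local_field K Os \<Longrightarrow> field K" by (cases Os) auto

lemma local_field_residue:
  assumes "local_field K (V # Os)" "Module.algebra k K" "structure_map K ` carrier k \<subseteq> V"
  shows "Module.algebra k (residue_field K V)" "field (residue_field K V)"
    "c \<in> carrier k \<Longrightarrow> structure_map (residue_field K V) c = residue_map K V (structure_map K c)"
proof -
  show "field (residue_field K V)" using assms(1) local_field_field[of "residue_field K V" Os] by simp
  then interpret F: field "residue_field K V" .
  have "subring V K" "\<exists>!I. maximalideal I (K\<lparr>carrier := V\<rparr>)" using assms(1)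
      by (auto simp: discrete_valuation_ring_def)
  note r = residue_algebra[OF assms(2) this(1) assms(3) this(2) F.is_cring]
  show "Module.algebra k (residue_field K V)" by (rule r(1))
  show "c \<in> carrier k \<Longrightarrow> structure_map (residue_field K V) c = residue_map K V (structure_map K c)" by (rule r(2))
qed

lemma ring_of_integers_residue:
  assumes "local_field K (V # Os)" "Module.algebra k K" "structure_map K ` carrier k \<subseteq> ring_of_integers K (V # Os)"
  shows "structure_map (residue_field K V) ` carrier k \<subseteq> ring_of_integers (residue_field K V) Os"
proof -
  have "structure_map K ` carrier k \<subseteq> V" using assms(3) by auto
  note r = local_field_residue(3)[OF assms(1,2) this]
  show ?thesis using assms(3) r by auto
qed

text \<open>That k lands in \<open>ring_of_integers\<close> means that it lands in the valuation
  ring at every level, which lets its action descend through all residue fields.\<close>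

lemma last_residue_field_algebra:
  assumes "local_field K Os" "Module.algebra k K" "structure_map K ` carrier k \<subseteq> ring_of_integers K Os"
  shows "Module.algebra k (last_residue_field K Os)"
  using assms
proof (induction Os arbitrary: K)
  case (Cons V Os)
  have "structure_map K ` carrier k \<subseteq> V" using Cons.prems(3) by auto
  from local_field_residue(1)[OF Cons.prems(1,2) this] ring_of_integers_residue[OF Cons.prems]
  show ?case using Cons.IH Cons.prems(1) by simp
qed simp

section \<open>Induction on the dimension for fields with a chosen parametrization\<close>

definition tlf ::
  "('k, 'b) ring_scheme \<Rightarrow> ('k, 'a) module \<Rightarrow> ('k, 'a) module \<Rightarrow> 'a set list \<Rightarrow> 'a topology \<Rightarrow> ('a laurent \<Rightarrow> 'a) \<Rightarrow> bool"
      where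
  "tlf k k' K Os T g \<longleftrightarrow> local_field K Os \<and> ST_ring k K T \<and> structure_map K ` carrier k \<subseteq> ring_of_integers K Os \<and>
     g \<in> algebra_homs k (iterated_laurent k' (length Os)) K \<and>
     bij_betw g (carrier (iterated_laurent k' (length Os))) (carrier K) \<and>
     homeomorphic_map (iterated_laurent_topology k k' (length Os)) T g \<and> respects_valuations k' K Os g"

lemma tlf_param:
  assumes k': "Module.algebra k k'" and t: "tlf k k' K (V # Os) T g"
  shows "parametrized (iterated_laurent k' (length Os)) k (iterated_laurent_topology k k' (length Os)) K V T g"
proof -
  note tw = iterated_laurent_tlaurent[OF k', of "length Os"]
  interpret tlaurent "iterated_laurent k' (length Os)" k "iterated_laurent_topology k k' (length Os)" using tw
      by blast
  show ?thesis
    using t tw laurent_topology_eq tlaurent_axioms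
    by (auto simp: tlf_def parametrized_def parametrized_axioms_def discrete_valuation_ring_def)
qed

text \<open>The constant field k' stays fixed and only the parametrization changes, to the induced
  one; this is why \<open>tlf\<close> carries both as parameters.\<close>

lemma tlf_residue:
  assumes k': "Module.algebra k k'" and t: "tlf k k' K (V # Os) T g"
  shows "tlf k k' (residue_field K V) Os (residue_topology K T V)
    (\<lambda>a. residue_map K V (g (const_series (iterated_laurent k' (length Os)) a)))"
proof -
  interpret p: parametrized "iterated_laurent k' (length Os)" k "iterated_laurent_topology k k' (length Os)" K V T
      g
    by (rule tlf_param[OF assms])
  have K: "Module.algebra k K" "structure_map K ` carrier k \<subseteq> V" by (rule p.K_alg) (rule p.k_stable)
  have lf: "local_field K (V # Os)" using t by (simp add: tlf_def)
  have e: "(\<lambda>a. residue_map K V (g (const_series (iterated_laurent k' (length Os)) a))) = p.g'"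
    by (simp add: fun_eq_iff p.g'_def)
  have "ST_ring k (residue_field K V) (residue_topology K T V)"
    by (rule ST_ring_transport[OF p.ST local_field_residue(1)[OF lf K] p.g'_hom p.g'_bij p.g'_homeo])
  then show ?thesis unfolding e tlf_def
    using t e p.g'_hom p.g'_bij p.g'_homeo ring_of_integers_residue[OF lf K(1)] by (simp add: tlf_def)
qed

text \<open>The uniformizer is read off from \<open>g\<close> alone, so it is the same for every
  system of liftings; \<open>identity_BT\<close> compares two liftings over one and the same
  \<open>t\<close>.\<close>

lemma tlf_tlifted:
  assumes k': "Module.algebra k k'" and t: "tlf k k' K (V # Os) T g" and s: "system_of_liftings k K (V # Os) T \<rho>"
  obtains u where "unif K V u" "tlifted k K V u (hd \<rho>) T"
    "u = parametrized.t (iterated_laurent k' (length Os)) g"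
proof
  let ?u = "parametrized.t (iterated_laurent k' (length Os)) g"
  interpret p: parametrized "iterated_laurent k' (length Os)" k "iterated_laurent_topology k k' (length Os)" K V T
      g
    by (rule tlf_param[OF k' t])
  have lf: "local_field K (V # Os)" using t by (simp add: tlf_def)
  show "unif K V ?u" unfolding unif_def using p.valued p.max_eq by simp
  have "lifted k K V ?u (hd \<rho>)"
    unfolding lifted_def lifted_axioms_def
    using p.resid s local_field_residue(1,2)[OF lf p.K_alg p.k_stable] by simp
  then show "tlifted k K V ?u (hd \<rho>) T"
    unfolding tlifted_def tlifted_axioms_def using s p.K_ST by simp
qed simp

text \<open>In dimension 0 every k-linear map is a BT operator. In the step, the statement for the
  residue field feeds \<open>expand\<close>, and the parametrization of K supplies
  boundedness.\<close>

lemma tlf_diff_ops_BT: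
  assumes k': "Module.algebra k k'" "finite_submodule k k' (carrier k')"
    and t: "tlf k k' K Os T g" and s: "system_of_liftings k K Os T \<rho>"
  shows "lifted_local_field k K Os \<rho> \<and> diff_ops_BT k K Os T \<rho>"
  using t s
proof (induction Os arbitrary: K T g \<rho>)
  case Nil
  then show ?case by (auto simp: tlf_def diff_ops_BT_def ST_ring_def)
next
  case (Cons V Os)
  let ?u = "parametrized.t (iterated_laurent k' (length Os)) g"
  interpret p: parametrized "iterated_laurent k' (length Os)" k "iterated_laurent_topology k k' (length Os)" K V T
      g
    by (rule tlf_param[OF k'(1) Cons.prems(1)])
  have u: "unif K V ?u" and tl: "tlifted k K V ?u (hd \<rho>) T"
    using tlf_tlifted[OF k'(1) Cons.prems] by blast+
  have IH: "lifted_local_field k (residue_field K V) Os (tl \<rho>)"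
      "diff_ops_BT k (residue_field K V) Os (residue_topology K T V) (tl \<rho>)"
    using Cons.IH[OF tlf_residue[OF k'(1) Cons.prems(1)], of "tl \<rho>"] Cons.prems(2) by auto
  have "lifted_local_field k K (V # Os) \<rho>" using IH(1) u Cons.prems(2) p.K_alg p.k_stable by auto
  moreover have "diff_ops_BT k K (V # Os) T \<rho>"
  proof (rule tlifted.diff_ops_BT_step[OF tl refl IH])
    fix D d assume D: "D \<in> Hom_base k K (regular_module K) (regular_module K)" "continuous_map T T D"
        "diff_op K K id {\<zero>\<^bsub>K\<^esub>} d D"
    obtain b where b: "\<And>n x. x \<in> p.Fil n \<Longrightarrow> D x \<in> p.Fil (n - int b)"
      using p.bounded[OF k' refl refl D] by blast
    show "tlifted.bounded_op K V ?u D" by (rule p.bounded_op[OF tl b])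
  qed
  ultimately show ?case by simp
qed

text \<open>Inclusions suffice, as the two systems may be exchanged. The index i is quantified
  because the recursion of \<open>BT_ideal\<close> lowers it, while j stays fixed.\<close>

lemma BT_independent:
  fixes M1 M2 :: "('a, 'a) module"
  assumes k': "Module.algebra k k'" "finite_submodule k k' (carrier k')"
    and t: "tlf k k' K Os T g" and s: "system_of_liftings k K Os T \<rho>" "system_of_liftings k K Os T \<tau>"
    and M: "fgmod K M1" "fgmod K M2"
  shows "BT k K Os \<rho> M1 M2 \<subseteq> BT k K Os \<tau> M1 M2 \<and> (\<forall>i. BT_ideal k K Os \<rho> M1 M2 i j \<subseteq> BT_ideal k K Os \<tau> M1 M2 i j)"
  using t s M
proof (induction Os arbitrary: K T g \<rho> \<tau> M1 M2)
  case Nil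
  then show ?case by simp
next
  case (Cons V Os)
  let ?u = "parametrized.t (iterated_laurent k' (length Os)) g"
  have tl: "tlifted k K V ?u (hd \<rho>) T" "tlifted k K V ?u (hd \<tau>) T"
    using tlf_tlifted[OF k'(1) Cons.prems(1,2)] tlf_tlifted[OF k'(1) Cons.prems(1,3)] by blast+
  note tr = tlf_residue[OF k'(1) Cons.prems(1)]
  have sl: "system_of_liftings k (residue_field K V) Os (residue_topology K T V) (tl \<rho>)"
    "system_of_liftings k (residue_field K V) Os (residue_topology K T V) (tl \<tau>)" using Cons.prems(2,3) by auto
  note c = tlf_diff_ops_BT[OF k' tr sl(2)]
  note IH = Cons.IH[OF tr sl]
  show ?case
    using tlifted.BT_step[OF tl(1) refl tl(2) c[THEN conjunct1] c[THEN conjunct2] fgmod_module[OF Cons.prems(4)]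
      fgmod_module[OF Cons.prems(5)], of j] IH by blast
qed

theorem theorem0p1:
  fixes k :: "'k ring" and K :: "('k, 'a) module" and Os :: "'a set list" and T :: "'a topology"
    and n :: nat and \<sigma> \<sigma>' :: "('a \<Rightarrow> 'a) list"
  assumes "perfect_field k"
    and "topological_local_field k n K Os T"
    and "system_of_liftings k K Os T \<sigma>"
    and "system_of_liftings k K Os T \<sigma>'"
  shows "BT_field k K Os \<sigma> = BT_field k K Os \<sigma>' \<and>
    (\<forall>i \<in> {1..n}. \<forall>j \<in> {1, 2}. BT_field_ideal k K Os \<sigma> i j = BT_field_ideal k K Os \<sigma>' i j)"
proof -
  define k' where "k' = last_residue_field K Os"
  have K: "length Os = n" "local_field K Os" "ST_ring k K T" "structure_map K ` carrier k \<subseteq> ring_of_integers K Os"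
    "finite_submodule k k' (carrier k')"
    using assms(2) by (auto simp: topological_local_field_def k'_def Let_def)
  obtain g where t: "tlf k k' K Os T g"
    using assms(2) by (auto simp: topological_local_field_def tlf_def k'_def Let_def)
  have k': "Module.algebra k k'" unfolding k'_def
    by (rule last_residue_field_algebra) (use K in \<open>auto simp: ST_ring_def\<close>)
  interpret K: field K by (rule local_field_field[OF K(2)])
  have M: "fgmod K (regular_module K)" by (rule fgmod_regular[OF K.is_cring])
  \<comment> \<open>The same statement with the two systems in either order; for M1 = M2 = K it
    gives both inclusions.\<close>
  note b = BT_independent[OF k' K(5) t assms(3,4) M M] BT_independent[OF k' K(5) t assms(4,3) M M]
  show ?thesis unfolding BT_field_def BT_field_ideal_def using b by (intro conjI ballI subset_antisym) blast+
qed

end
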